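(* Let $G$ be a finitely generated group and $\mathcal{m}$ a probability measure on $G$ whose support generates $G$, and let $\rho:G\to\mathrm{SL}(2,\mathbb{M})$ be a homomorphism such that $\rho_{\mathsf{na}}(G)\le\mathrm{SL}(2,\mathbb{L})$ is non-elementary. Then in $\mathbb{P}^1_{\mathrm{hyb}}$, $(\psi_t)_*\nu_t\to(\psi_{\mathsf{na}})_*\nu_{\mathsf{na}}$ weakly as $t\to 0$, where $\psi_t=\psi(t,\cdot)$.
   Context: $\mathbb{M}$ is the ring of holomorphic functions on $\mathbb{D}^*$ meromorphic at $0$, $\rho$ gives $\rho_t:G\to\mathrm{SL}(2,\mathbb{C})$, $\mathbb{L}=\mathbb{C}((t))$ with $|f|=\exp(-\mathrm{ord}_0f)$, $\rho_{\mathsf{na}}$ the induced representation into $\mathrm{SL}(2,\mathbb{L})$. Non-elementary: image in $\mathrm{PGL}(2,\mathbb{L})$ contains an element whose $\mathrm{SL}_2$-lift (over an at most quadratic extension) has trace of absolute value $>1$, and has no finite orbit on $\mathbb{P}^1(\mathbb{L})$. For small $t\ne0$, $\nu_t$ is the unique $(\rho_t)_*\mathcal{m}$-stationary probability measure on $\mathbb{P}^1(\mathbb{C})$; $\nu_{\mathsf{na}}$ is the unique $(\rho_{\mathsf{na}})_*\mathcal{m}$-stationary probability measure on the Berkovich line $\mathbb{P}^{1,an}_{\mathbb{L}}$. Hybrid space: let $\mathcal{A}$ be the ring of $f=\sum a_nt^n\in\mathbb{L}$ with $\|f\|_{hyb}=\sum_n|a_n|_{hyb}e^{-n}<\infty$,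 where $|a|_{hyb}=\max(|a|,1)$ for $a\ne0$ and $|0|_{hyb}=0$. For $B=\mathcal{A}[Z]$ (resp. $\mathcal{A}[Z,Z^{-1}]$) let $M(B)$ be the set of multiplicative seminorms on $B$ bounded by $\|\cdot\|_{hyb}$ on $\mathcal{A}$, with the topology of pointwise convergence. $\mathbb{P}^1_{\mathrm{hyb}}$ is obtained by gluing $U_1=M(\mathcal{A}[z_1])$ and $U_2=M(\mathcal{A}[z_2])$ along $M(\mathcal{A}[Z,Z^{-1}])$ via $z_1\mapsto Z$, $z_2\mapsto Z^{-1}$; it is compact. Restriction to $\mathcal{A}$ gives $p_{hyb}:\mathbb{P}^1_{\mathrm{hyb}}\to M(\mathcal{A})$, and $M(\mathcal{A})$ is identified with $\overline{\mathbb{D}}_{1/e}$ via $\tau$: $|f(\tau(0))|=e^{-\mathrm{ord}_0f}$, $|f(\tau(t))|=|f(t)|^{-1/\log|t|}$. There is a homeomorphism $\psi:\overline{\mathbb{D}}^*_{1/e}\times\mathbb{P}^1\to p_{hyb}^{-1}(\tau(\overline{\mathbb{D}}^*_{1/e}))$ given on $\overline{\mathbb{D}}^*_{1/e}\times\mathbb{C}$ by $|g(\psi(t,z))|=|g(t,z)|^{-1/\log|t|}$ for $g\in\mathcal{A}[Z]$, and a homeomorphism $\psi_{\mathsf{na}}:\mathbb{P}^{1,an}_{\mathbb{L}}\to p_{hyb}^{-1}(\tau(0))$ given by restricting seminorms on $\mathbb{L}[Z]$ to $\mathcal{A}[Z]$. *)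

theory Defs
  imports "HOL-Analysis.Analysis" "HOL-Probability.Probability"
    "HOL-Complex_Analysis.Complex_Analysis"
    "HOL-Computational_Algebra.Polynomial"
    "HOL-Computational_Algebra.Formal_Laurent_Series"
    "HOL-Algebra.Generated_Groups"
begin

definition borel_of :: "'a topology \<Rightarrow> 'a measure" where
  "borel_of T = sigma (topspace T) {U. openin T U}"

definition prob_on :: "'a topology \<Rightarrow> 'a measure \<Rightarrow> bool" where
  "prob_on T \<mu> \<longleftrightarrow> prob_space \<mu> \<and> sets \<mu> = sets (borel_of T) \<and> space \<mu> = topspace T"

definition stationary_on ::
  "'a topology \<Rightarrow> 'g pmf \<Rightarrow> ('g \<Rightarrow> 'a \<Rightarrow> 'a) \<Rightarrow> 'a measure \<Rightarrow> bool" where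
  "stationary_on T m act \<mu> \<longleftrightarrow> prob_on T \<mu> \<and>
     (\<forall>A\<in>sets \<mu>. emeasure \<mu> A =
        (\<integral>\<^sup>+ g. emeasure \<mu> (act g -` A \<inter> space \<mu>) \<partial>measure_pmf m))"

text \<open>The unique stationary probability measure (well defined when it is unique).\<close>
definition stationary_measure ::
  "'a topology \<Rightarrow> 'g pmf \<Rightarrow> ('g \<Rightarrow> 'a \<Rightarrow> 'a) \<Rightarrow> 'a measure" where
  "stationary_measure T m act = (THE \<mu>. stationary_on T m act \<mu>)"

text \<open>Weak convergence of probability measures on a compact space (tested
  against all continuous real functions), along a filter.\<close>
definition weak_conv_on ::
  "'a topology \<Rightarrow> ('b \<Rightarrow> 'a measure) \<Rightarrow> 'a measure \<Rightarrow> 'b filter \<Rightarrow> bool" where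
  "weak_conv_on T \<mu>s \<mu> F \<longleftrightarrow>
     (\<forall>f. continuous_map T euclideanreal f \<longrightarrow>
        ((\<lambda>s. \<integral>x. f x \<partial>(\<mu>s s)) \<longlongrightarrow> (\<integral>x. f x \<partial>\<mu>)) F)"

text \<open>\<open>None\<close> is the point at infinity.\<close>
definition P1C_top :: "complex option topology" where
  "P1C_top = topology_generated_by
     {W. open {z. Some z \<in> W} \<and> (None \<in> W \<longrightarrow> (\<exists>R. \<forall>z. R < norm z \<longrightarrow> Some z \<in> W))}"

definition mobius :: "'k::field ^2^2 \<Rightarrow> 'k option \<Rightarrow> 'k option" where
  "mobius g p = (let a = g$1$1; b = g$1$2; c = g$2$1; d = g$2$2 in
     case p of
       None \<Rightarrow> (if c = 0 then None else Some (a / c))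
     | Some z \<Rightarrow> (if c * z + d = 0 then None else Some ((a * z + b) / (c * z + d))))"

definition na_abs :: "complex fls \<Rightarrow> real" where
  "na_abs f = (if f = 0 then 0 else exp (- real_of_int (fls_subdegree f)))"

definition fls_eval :: "complex fls \<Rightarrow> complex \<Rightarrow> complex" where
  "fls_eval f t = infsum (\<lambda>n::int. fls_nth f n * t powi n) UNIV"

definition hyb_abs :: "complex \<Rightarrow> real" where
  "hyb_abs a = (if a = 0 then 0 else max (cmod a) 1)"

definition hyb_norm :: "complex fls \<Rightarrow> real" where
  "hyb_norm f = infsum (\<lambda>n::int. hyb_abs (fls_nth f n) * exp (- real_of_int n)) UNIV"

definition hybA :: "complex fls set" where
  "hybA = {f. (\<lambda>n::int. hyb_abs (fls_nth f n) * exp (- real_of_int n)) summable_on UNIV}"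

definition hybAZ :: "complex fls poly set" where
  "hybAZ = {p. \<forall>i. coeff p i \<in> hybA}"

definition mult_seminorm_on :: "'r::comm_ring_1 set \<Rightarrow> ('r \<Rightarrow> real) \<Rightarrow> bool" where
  "mult_seminorm_on S x \<longleftrightarrow> x 0 = 0 \<and> x 1 = 1 \<and>
     (\<forall>p\<in>S. 0 \<le> x p) \<and>
     (\<forall>p\<in>S. \<forall>q\<in>S. x (p * q) = x p * x q \<and> x (p + q) \<le> x p + x q)"

text \<open>Chart of the hybrid space: \<open>M(A[Z])\<close> (seminorms are extended by 0 outside \<open>A[Z]\<close>).\<close>
definition hyb_chart :: "(complex fls poly \<Rightarrow> real) set" where
  "hyb_chart = {x. mult_seminorm_on hybAZ x \<and> (\<forall>p. p \<notin> hybAZ \<longrightarrow> x p = 0) \<and>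
                   (\<forall>a\<in>hybA. x [:a:] \<le> hyb_norm a)}"

definition berk_chart :: "(complex fls poly \<Rightarrow> real) set" where
  "berk_chart = {x. mult_seminorm_on UNIV x \<and> (\<forall>a. x [:a:] = na_abs a)}"

text \<open>Gluing of two copies of a chart \<open>C\<close> of seminorms on \<open>R[z1]\<close>, \<open>R[z2]\<close>
  along seminorms with \<open>|Z| \<noteq> 0\<close> (= seminorms on \<open>R[Z,Z^-1]\<close>) via \<open>z2 = 1/z1\<close>.
  A point is \<open>(x, True)\<close> with \<open>x\<close> in the first chart, or \<open>(y, False)\<close> with
  \<open>y\<close> in the second chart and \<open>|z2|_y = 0\<close> (points not in the first chart).\<close>
definition glue_pts :: "('p poly \<Rightarrow> real) set \<Rightarrow> (('p::comm_ring_1 poly \<Rightarrow> real) \<times> bool) set" where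
  "glue_pts C = {(x, True) | x. x \<in> C} \<union> {(y, False) | y. y \<in> C \<and> y [:0, 1:] = 0}"

text \<open>Transition from the second chart to the first one: \<open>|P(z1)| = |z2^deg P P(1/z2)| / |z2|^deg P\<close>.\<close>
definition glue_trans :: "('p::comm_ring_1 poly \<Rightarrow> real) \<Rightarrow> 'p poly \<Rightarrow> real" where
  "glue_trans y P = y (reflect_poly P) / (y [:0, 1:]) ^ degree P"

definition glue_chart2 :: "('p::comm_ring_1 poly \<Rightarrow> real) \<Rightarrow> ('p poly \<Rightarrow> real) \<times> bool" where
  "glue_chart2 y = (if y [:0, 1:] = 0 then (y, False) else (glue_trans y, True))"

definition chart_top :: "('p poly \<Rightarrow> real) set \<Rightarrow> ('p poly \<Rightarrow> real) topology" where
  "chart_top C = subtopology (powertop_real UNIV) C"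

definition glue_top :: "('p::comm_ring_1 poly \<Rightarrow> real) set \<Rightarrow> (('p poly \<Rightarrow> real) \<times> bool) topology" where
  "glue_top C = topology_generated_by
     {W. W \<subseteq> glue_pts C \<and>
         openin (chart_top C) {x \<in> C. (x, True) \<in> W} \<and>
         openin (chart_top C) {y \<in> C. glue_chart2 y \<in> W}}"

definition P1hyb_top where "P1hyb_top = glue_top hyb_chart"
definition P1berk_top where "P1berk_top = glue_top berk_chart"

text \<open>\<open>P^g(Z) = (cZ+d)^n P((aZ+b)/(cZ+d))\<close>, \<open>n = deg P\<close>.\<close>
definition poly_subst_mob :: "complex fls ^2^2 \<Rightarrow> complex fls poly \<Rightarrow> complex fls poly" where
  "poly_subst_mob g P = (\<Sum>i\<le>degree P. smult (coeff P i)
       ([:g$1$2, g$1$1:] ^ i * [:g$2$2, g$2$1:] ^ (degree P - i)))"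

definition berk_infty :: "(complex fls poly \<Rightarrow> real) \<times> bool" where
  "berk_infty = ((\<lambda>P. na_abs (coeff P 0)), False)"

definition berk_act :: "complex fls ^2^2 \<Rightarrow> (complex fls poly \<Rightarrow> real) \<times> bool
                         \<Rightarrow> (complex fls poly \<Rightarrow> real) \<times> bool" where
  "berk_act g p = (case p of
      (x, True) \<Rightarrow>
        (if x [:g$2$2, g$2$1:] = 0 then berk_infty
         else ((\<lambda>P. x (poly_subst_mob g P) / x [:g$2$2, g$2$1:] ^ degree P), True))
    | (y, False) \<Rightarrow>
        (if g$2$1 = 0 then berk_infty
         else ((\<lambda>P. na_abs (poly P (g$1$1 / g$2$1))), True)))"

definition hyb_eps :: "complex \<Rightarrow> real" where
  "hyb_eps t = - 1 / ln (cmod t)"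

text \<open>\<open>\<psi>(t,z)\<close>: \<open>|g(\<psi>(t,z))| = |g(t,z)|^{-1/log|t|}\<close>; at \<open>z = \<infinity>\<close> one uses the
  second chart, where \<open>z2 = 0\<close>.\<close>
definition psi :: "complex \<Rightarrow> complex option \<Rightarrow> (complex fls poly \<Rightarrow> real) \<times> bool" where
  "psi t p = (case p of
     Some z \<Rightarrow> ((\<lambda>P. if P \<in> hybAZ then
                  cmod (poly (map_poly (\<lambda>a. fls_eval a t) P) z) powr hyb_eps t else 0), True)
   | None \<Rightarrow> ((\<lambda>P. if P \<in> hybAZ then
                  cmod (fls_eval (coeff P 0) t) powr hyb_eps t else 0), False))"

definition psi_na :: "(complex fls poly \<Rightarrow> real) \<times> bool \<Rightarrow> (complex fls poly \<Rightarrow> real) \<times> bool" where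
  "psi_na p = ((\<lambda>P. if P \<in> hybAZ then fst p P else 0), snd p)"

text \<open>\<open>\<rho>\<close> as a map \<open>G \<rightarrow> SL(2,\<M>)\<close>: \<open>\<rho> g t\<close> is the matrix \<open>\<rho>_t(g)\<close>.\<close>
definition rep_M :: "('g, 'b) monoid_scheme \<Rightarrow> ('g \<Rightarrow> complex \<Rightarrow> complex ^2^2) \<Rightarrow> bool" where
  "rep_M G \<rho> \<longleftrightarrow>
     (\<forall>g\<in>carrier G. \<forall>i j. (\<lambda>t. \<rho> g t $ i $ j) holomorphic_on (ball 0 1 - {0}) \<and>
                         not_essential (\<lambda>t. \<rho> g t $ i $ j) 0) \<and>
     (\<forall>g\<in>carrier G. \<forall>t\<in>ball 0 1 - {0}. det (\<rho> g t) = 1) \<and>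
     (\<forall>g\<in>carrier G. \<forall>h\<in>carrier G. \<forall>t\<in>ball 0 1 - {0}.
         \<rho> (g \<otimes>\<^bsub>G\<^esub> h) t = \<rho> g t ** \<rho> h t)"

definition rho_na :: "('g \<Rightarrow> complex \<Rightarrow> complex ^2^2) \<Rightarrow> 'g \<Rightarrow> complex fls ^2^2" where
  "rho_na \<rho> g = (\<chi> i j. laurent_expansion (\<lambda>t. \<rho> g t $ i $ j) 0)"

definition non_elementary :: "('g, 'b) monoid_scheme \<Rightarrow> ('g \<Rightarrow> complex fls ^2^2) \<Rightarrow> bool" where
  "non_elementary G r \<longleftrightarrow>
     (\<exists>g\<in>carrier G. na_abs (r g $ 1 $ 1 + r g $ 2 $ 2) > 1) \<and>
     (\<forall>p. infinite {mobius (r g) p | g. g \<in> carrier G})"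

definition nu_t :: "'g pmf \<Rightarrow> ('g \<Rightarrow> complex \<Rightarrow> complex ^2^2) \<Rightarrow> complex \<Rightarrow> complex option measure" where
  "nu_t m \<rho> t = stationary_measure P1C_top m (\<lambda>g. mobius (\<rho> g t))"

definition nu_na :: "'g pmf \<Rightarrow> ('g \<Rightarrow> complex \<Rightarrow> complex ^2^2)
                      \<Rightarrow> ((complex fls poly \<Rightarrow> real) \<times> bool) measure" where
  "nu_na m \<rho> = stationary_measure P1berk_top m (\<lambda>g. berk_act (rho_na \<rho> g))"

end

theory Submission
  imports Defs
begin

text \<open>
  For small \<open>t\<close>, \<open>N_t = |.|^(-1/log|t|)\<close> is an absolute value on the complex numbers, and
  \<open>N_t(f(t))\<close> tends to \<open>exp(-ord_0 f)\<close>; so the matrices \<open>\<rho>_t(g)\<close> and \<open>\<rho>_na(g)\<close> are random matrices over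
  valued fields that satisfy the same bounds: the norms of the letters, the trace of one
  hyperbolic word \<open>f\<close> (at least 5/2), and the determinant of the commutator of \<open>f\<close> with a conjugate
  of \<open>f\<close> (bounded below). From these bounds alone, random products of \<open>n\<close> letters are large and
  contract the projective line to a small set with probability near 1, at a rate that is uniform over
  all valued fields. Hence the stationary measure is the law of the limit of \<open>g_1...g_n \<infinity>\<close>, and it is
  close to the law of \<open>g_1...g_n \<infinity>\<close> at a fixed time \<open>n\<close>, uniformly in \<open>t\<close>. At a fixed time the
  random points \<open>\<psi>_t(\<rho>_t(g_1...g_n) \<infinity>)\<close> converge in the hybrid space because their coordinates are
  meromorphic in \<open>t\<close>. Continuous functions on the hybrid space are uniformly continuous for the
  chordal distances of all the \<open>N_t\<close> at once, since the closed disc of radius 2 in a chart is compact.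
\<close>

text \<open>The usual proofs that stationary measures are unique rest on compactness, but the
  projective line over L is not even locally compact, and the constants must not move with t. One
  counting inequality replaces compactness. Suppose \<open>q\<close> words, each of probability at
  least \<beta>, scatter every configuration so widely that at most one of them can end badly. Then
  the probability \<kappa> of a bad end improves to (1 - q \<beta>) \<kappa> + \<beta>, whose fixed
  point is 1/q. Powers of \<open>f\<close> scatter in norm, as traces show; powers of
  \<open>f\<close>, possibly after \<open>h\<close>, scatter directions, as wedge products show. The
  threshold 5/2 makes the recursions for traces and Chebyshev polynomials expand by 3/2 over every
  field, and a Laurent series of absolute value above 1 passes it, because that value is at least e.
  On the Berkovich line the walk contracts towards classical points, which are complete but not
  compact for the chordal distance. The limit point therefore comes from Borel-Cantelli along sparse
  times, and uniqueness is proved by comparing measures on open sets.\<close>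

no_notation fps_nth (infixl \<open>$\<close> 75)

section \<open>Two by two matrices over valued fields\<close>

lemma mat2_vec_nth [simp]:
  fixes A :: "'k::comm_ring_1^2^2"
  shows "(A *v v) $ i = A $ i $ 1 * v $ 1 + A $ i $ 2 * v $ 2"
  by (simp add: matrix_vector_mult_def sum_2)

lemma vec_mat2_nth [simp]:
  fixes A :: "'k::comm_ring_1^2^2"
  shows "(y v* A) $ i = y $ 1 * A $ 1 $ i + y $ 2 * A $ 2 $ i"
  by (simp add: vector_matrix_mult_def sum_2 mult.commute)

lemma mat2_mult_nth [simp]:
  fixes A :: "'k::comm_ring_1^2^2"
  shows "(A ** B) $ i $ j = A $ i $ 1 * B $ 1 $ j + A $ i $ 2 * B $ 2 $ j"
  by (simp add: matrix_matrix_mult_def sum_2)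

lemma mat2_eqI:
  fixes A :: "'k^2^2"
  assumes "A$1$1 = B$1$1" "A$1$2 = B$1$2" "A$2$1 = B$2$1" "A$2$2 = B$2$2"
  shows "A = B"
  using assms by (simp add: vec_eq_iff forall_2)

lemma mat2_one_nth [simp]:
  "(mat 1 :: 'k::comm_ring_1^2^2) $ 1 $ 1 = 1" "(mat 1 :: 'k::comm_ring_1^2^2) $ 1 $ 2 = 0"
  "(mat 1 :: 'k::comm_ring_1^2^2) $ 2 $ 1 = 0" "(mat 1 :: 'k::comm_ring_1^2^2) $ 2 $ 2 = 1"
  by (simp_all add: mat_def)

text \<open>The determinant with columns \<open>v\<close> and \<open>w\<close>. Over a field it
  vanishes exactly on dependent vectors; divided by the norms it becomes the chordal
  distance.\<close>

definition wedge :: "'k::comm_ring_1^2 \<Rightarrow> 'k^2 \<Rightarrow> 'k" where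
  "wedge v w = v$1 * w$2 - v$2 * w$1"

definition tr2 :: "'k::comm_ring_1^2^2 \<Rightarrow> 'k" where
  "tr2 A = A$1$1 + A$2$2"

text \<open>The adjugate. It inverts matrices of determinant 1, reverses products without side
  conditions, and permutes the entries up to sign, so it has the same norm.\<close>

definition adj2 :: "'k::comm_ring_1^2^2 \<Rightarrow> 'k^2^2" where
  "adj2 A = vector [vector [A$2$2, - A$1$2], vector [- A$2$1, A$1$1]]"

lemma adj2_nth [simp]:
  "adj2 A $ 1 $ 1 = A$2$2" "adj2 A $ 1 $ 2 = - A$1$2"
  "adj2 A $ 2 $ 1 = - A$2$1" "adj2 A $ 2 $ 2 = A$1$1"
  by (simp_all add: adj2_def)

lemma adj2_mult: "adj2 (A ** B) = adj2 B ** adj2 A"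
  by (rule mat2_eqI) (simp_all add: algebra_simps)

lemma mult_adj2: "det A = 1 \<Longrightarrow> A ** adj2 A = mat 1" "det A = 1 \<Longrightarrow> adj2 A ** A = mat 1"
  by (rule mat2_eqI; simp add: det_2 algebra_simps)+

lemma tr2_mult_commute: "tr2 (A ** B) = tr2 (B ** A)"
  by (simp add: tr2_def algebra_simps)

lemma wedge_mat: "wedge (A *v v) (A *v w) = det A * wedge v w"
  by (simp add: wedge_def det_2 algebra_simps)

primrec word_mat :: "('a \<Rightarrow> 'k::comm_ring_1^2^2) \<Rightarrow> 'a list \<Rightarrow> 'k^2^2" where
  "word_mat \<rho> [] = mat 1"
| "word_mat \<rho> (g # w) = \<rho> g ** word_mat \<rho> w"

lemma word_mat_append: "word_mat \<rho> (u @ w) = word_mat \<rho> u ** word_mat \<rho> w"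
  by (induction u) (simp_all add: matrix_mul_assoc)

lemma det_word_mat: "(\<And>g. g \<in> set w \<Longrightarrow> det (\<rho> g) = 1) \<Longrightarrow> det (word_mat \<rho> w) = 1"
  by (induction w) (simp_all add: det_mul)

section \<open>Powers of a matrix of determinant 1\<close>

primrec mat_pow :: "'k::comm_ring_1^2^2 \<Rightarrow> nat \<Rightarrow> 'k^2^2" where
  "mat_pow A 0 = mat 1"
| "mat_pow A (Suc n) = A ** mat_pow A n"

lemma mat_pow_add: "mat_pow A (m + n) = mat_pow A m ** mat_pow A n"
  by (induction m) (simp_all add: matrix_mul_assoc)

lemma det_mat_pow: "det A = 1 \<Longrightarrow> det (mat_pow A n) = 1"
  by (induction n) (simp_all add: det_mul)

lemma word_mat_concat_replicate:
  "word_mat \<rho> (concat (replicate n w)) = mat_pow (word_mat \<rho> w) n"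
  by (induction n) (simp_all add: word_mat_append)

text \<open>Chebyshev polynomials of the second kind, indexed so that Cayley-Hamilton reads
  \<open>A^n = U n \<cdot> A - U (n - 1) \<cdot> 1\<close>.\<close>
fun chebU :: "'k::comm_ring_1 \<Rightarrow> nat \<Rightarrow> 'k" where
  "chebU \<tau> 0 = 0"
| "chebU \<tau> (Suc 0) = 1"
| "chebU \<tau> (Suc (Suc n)) = \<tau> * chebU \<tau> (Suc n) - chebU \<tau> n"

lemma mat_pow_chebU:
  assumes "det A = 1"
  shows "mat_pow A (Suc n) $ i $ j = chebU (tr2 A) (Suc n) * A $ i $ j - chebU (tr2 A) n * mat 1 $ i $ j"
proof -
  have d: "A$1$1 * A$2$2 = 1 + A$1$2 * A$2$1" using assms by (simp add: det_2 algebra_simps)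
  have "\<forall>i j. mat_pow A (Suc n) $ i $ j = chebU (tr2 A) (Suc n) * A $ i $ j - chebU (tr2 A) n * mat 1 $ i $ j"
  proof (induction n)
    case 0 then show ?case by (auto simp: forall_2)
  next
    case (Suc n)
    have *: "mat_pow A (Suc (Suc n)) $ i $ j = A$i$1 * mat_pow A (Suc n) $ 1 $ j + A$i$2 * mat_pow A (Suc n) $ 2 $ j" for i j
      by (simp del: mat_pow.simps add: mat_pow.simps(2)[of A "Suc n"])
    let ?u = "chebU (tr2 A) (Suc n)" and ?w = "chebU (tr2 A) n"
    have d2: "A$1$1 * (A$2$2 * x) = x + A$1$2 * (A$2$1 * x)" for x
    proof -
      have "A$1$1 * (A$2$2 * x) = (A$1$1 * A$2$2) * x" by (simp add: mult.assoc)
      also have "\<dots> = x + A$1$2 * (A$2$1 * x)" unfolding d by (simp add: algebra_simps)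
      finally show ?thesis .
    qed
    have IH: "mat_pow A (Suc n) $ i $ j = ?u * A $ i $ j - ?w * mat 1 $ i $ j" for i j
      using Suc by blast
    show ?case unfolding * IH
      by (auto simp: forall_2 tr2_def algebra_simps d2)
  qed
  then show ?thesis by blast
qed

text \<open>By Cayley-Hamilton the power is a combination of \<open>A\<close> and the identity, and
  the identity contributes \<open>wedge v v = 0\<close>.\<close>

lemma wedge_mat_pow:
  assumes "det A = 1"
  shows "wedge v (mat_pow A n *v v) = chebU (tr2 A) n * wedge v (A *v v)"
proof (cases n)
  case 0 then show ?thesis by (simp add: wedge_def)
next
  case (Suc k)
  then show ?thesis
    by (simp only: wedge_def mat2_vec_nth mat_pow_chebU[OF assms] mat2_one_nth) (simp add: algebra_simps)
qed

text \<open>The common factor \<open>mat_pow A i\<close> has determinant 1 and cancels in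
  \<open>wedge\<close>. So the separation of two iterates depends only on \<open>j - i\<close> and
  on how far \<open>A\<close> moves the line of \<open>v\<close>.\<close>

lemma wedge_mat_pow2:
  assumes "det A = 1" "i \<le> j"
  shows "wedge (mat_pow A i *v v) (mat_pow A j *v v) = chebU (tr2 A) (j - i) * wedge v (A *v v)"
proof -
  have "mat_pow A j = mat_pow A i ** mat_pow A (j - i)"
    using assms(2) by (metis mat_pow_add le_add_diff_inverse)
  then have "wedge (mat_pow A i *v v) (mat_pow A j *v v)
     = wedge (mat_pow A i *v v) (mat_pow A i *v (mat_pow A (j - i) *v v))"
    by (simp add: matrix_vector_mul_assoc)
  also have "\<dots> = wedge v (mat_pow A (j - i) *v v)"
    by (simp only: wedge_mat det_mat_pow[OF assms(1)] mult_1_left)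
  finally show ?thesis by (simp only: wedge_mat_pow[OF assms(1)])
qed

lemma tr2_mat_pow:
  assumes "det A = 1"
  shows "tr2 (mat_pow A (Suc (Suc n))) = tr2 A * tr2 (mat_pow A (Suc n)) - tr2 (mat_pow A n)"
proof (cases n)
  case 0
  have "tr2 (A ** A) = tr2 A * tr2 A - 2 * det A"
    by (simp add: tr2_def det_2 algebra_simps)
  with 0 assms show ?thesis by (simp add: tr2_def[of "mat 1"])
next
  case (Suc k)
  show ?thesis unfolding Suc tr2_def[of "mat_pow _ _"]
    by (simp only: mat_pow_chebU[OF assms] mat2_one_nth) (simp add: tr2_def algebra_simps)
qed

text \<open>The right factor \<open>G\<close> cancels against its inverse and \<open>U\<close> acts
  by conjugation, which the trace ignores. Hence two powers of \<open>A\<close> remain separated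
  inside arbitrary surrounding products.\<close>

lemma tr2_mat_pow_adj2:
  assumes "det A = 1" "det U = 1" "det G = 1" "i \<le> j"
  shows "tr2 ((U ** mat_pow A j ** G) ** adj2 (U ** mat_pow A i ** G)) = tr2 (mat_pow A (j - i))"
proof -
  have "mat_pow A j = mat_pow A (j - i) ** mat_pow A i"
    using assms(4) by (metis mat_pow_add le_add_diff_inverse2)
  then have "(U ** mat_pow A j ** G) ** adj2 (U ** mat_pow A i ** G)
      = U ** mat_pow A (j - i) ** (mat_pow A i ** (G ** adj2 G) ** adj2 (mat_pow A i)) ** adj2 U"
    by (simp add: adj2_mult matrix_mul_assoc)
  also have "\<dots> = (U ** mat_pow A (j - i)) ** adj2 U"
    by (simp add: mult_adj2 assms det_mat_pow)
  also have "tr2 \<dots> = tr2 (adj2 U ** (U ** mat_pow A (j - i)))" by (rule tr2_mult_commute)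
  also have "\<dots> = tr2 (mat_pow A (j - i))"
    by (simp add: matrix_mul_assoc mult_adj2 assms)
  finally show ?thesis .
qed

section \<open>Absolute values and maximum norms\<close>

locale absval =
  fixes N :: "'k::field \<Rightarrow> real"
  assumes N_nonneg [simp]: "0 \<le> N x"
    and N_eq_0 [simp]: "N x = 0 \<longleftrightarrow> x = 0"
    and N_mult: "N (x * y) = N x * N y"
    and N_add: "N (x + y) \<le> N x + N y"
begin

no_notation fps_nth (infixl \<open>$\<close> 75)

lemma N_1 [simp]: "N 1 = 1"
  using N_mult[of 1 1] N_eq_0[of 1] by simp

lemma N_0 [simp]: "N 0 = 0"
  by simp

lemma N_minus [simp]: "N (- x) = N x"
proof -
  have "N (-1) * N (-1) = 1" using N_mult[of "-1" "-1"] by simp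
  then have "N (-1) = 1" using N_nonneg[of "-1"] by (metis abs_of_nonneg real_sqrt_abs2 real_sqrt_one)
  then show ?thesis using N_mult[of "-1" x] by simp
qed

lemma N_diff: "N (x - y) \<le> N x + N y"
  using N_add[of x "-y"] by simp

lemma N_diff_ge: "N x - N y \<le> N (x - y)"
  using N_add[of "x - y" y] by simp

lemma N_diff_commute: "N (x - y) = N (y - x)"
  using N_minus[of "x - y"] by simp

lemma N_divide: "N (x / y) = N x / N y"
proof (cases "y = 0")
  case False
  then have "N (x / y) * N y = N x" by (simp flip: N_mult)
  then show ?thesis using False by (simp add: field_simps)
qed simp

lemma N_power: "N (x ^ n) = N x ^ n"
  by (induction n) (simp_all add: N_mult)

lemma N_sum: "N (sum f A) \<le> (\<Sum>x\<in>A. N (f x))"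
proof (induction A rule: infinite_finite_induct)
  case (insert x F)
  then show ?case using N_add[of "f x" "sum f F"] by simp
qed simp_all

lemma N_pos [simp]: "0 < N x \<longleftrightarrow> x \<noteq> 0"
  using N_nonneg[of x] N_eq_0[of x] by linarith

text \<open>The maximum norm is used for every absolute value, archimedean or not; the price is the
  factor 2 in the product bounds.\<close>

definition nrm :: "'k^2 \<Rightarrow> real" where "nrm v = max (N (v$1)) (N (v$2))"

definition mnrm :: "'k^2^2 \<Rightarrow> real" where "mnrm A = max (nrm (A$1)) (nrm (A$2))"

lemma N_le_nrm: "N (v$i) \<le> nrm v"
  using exhaust_2[of i] by (auto simp: nrm_def)

lemma nrm_nonneg [simp]: "0 \<le> nrm v"
  by (simp add: nrm_def le_max_iff_disj)

lemma nrm_eq_0: "nrm v = 0 \<longleftrightarrow> v = 0"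
proof -
  have "nrm v = 0 \<longleftrightarrow> N (v$1) = 0 \<and> N (v$2) = 0"
    unfolding nrm_def using N_nonneg[of "v$1"] N_nonneg[of "v$2"] by linarith
  then show ?thesis by (simp add: vec_eq_iff forall_2)
qed

lemma nrm_pos [simp]: "0 < nrm v \<longleftrightarrow> v \<noteq> 0"
  using nrm_nonneg[of v] nrm_eq_0[of v] by linarith

lemma N_le_mnrm: "N (A$i$j) \<le> mnrm A"
  using N_le_nrm[of "A$i" j] exhaust_2[of i] by (auto simp: mnrm_def)

lemma nrm_le_mnrm: "nrm (A$i) \<le> mnrm A"
  using exhaust_2[of i] by (auto simp: mnrm_def)

lemma mnrm_nonneg [simp]: "0 \<le> mnrm A"
  by (simp add: mnrm_def le_max_iff_disj)

lemma nrm_obtain: obtains i where "nrm v = N (v$i)"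
  by (metis max_def nrm_def)

lemma nrm_smult: "nrm (c *s v) = N c * nrm v"
  by (simp add: nrm_def N_mult max_mult_distrib_left)

lemma nrm_mat_vec: "nrm (A *v v) \<le> 2 * mnrm A * nrm v"
proof -
  have "N ((A *v v) $ i) \<le> 2 * mnrm A * nrm v" for i
  proof -
    have "N ((A *v v) $ i) \<le> N (A$i$1) * N (v$1) + N (A$i$2) * N (v$2)"
      using N_add[of "A$i$1 * v$1" "A$i$2 * v$2"] by (simp add: N_mult)
    also have "\<dots> \<le> mnrm A * nrm v + mnrm A * nrm v"
      by (intro add_mono mult_mono N_le_mnrm N_le_nrm) simp_all
    finally show ?thesis by simp
  qed
  then show ?thesis by (simp add: nrm_def[of "A *v v"])
qed

lemma nrm_vec_mat: "nrm (y v* A) \<le> 2 * mnrm A * nrm y"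
proof -
  have "N ((y v* A) $ i) \<le> 2 * mnrm A * nrm y" for i
  proof -
    have "N ((y v* A) $ i) \<le> N (y$1) * N (A$1$i) + N (y$2) * N (A$2$i)"
      using N_add[of "y$1 * A$1$i" "y$2 * A$2$i"] by (simp add: N_mult)
    also have "\<dots> \<le> nrm y * mnrm A + nrm y * mnrm A"
      by (intro add_mono mult_mono N_le_mnrm N_le_nrm) simp_all
    finally show ?thesis by simp
  qed
  then show ?thesis by (simp add: nrm_def[of "y v* A"])
qed

lemma mnrm_mult: "mnrm (A ** B) \<le> 2 * mnrm A * mnrm B"
proof -
  have "(A ** B) $ i = A $ i v* B" for i by (simp add: vec_eq_iff)
  then have "nrm ((A ** B) $ i) \<le> 2 * mnrm A * mnrm B" for i
    using nrm_vec_mat[of "A$i" B] mult_mono[OF order_refl nrm_le_mnrm[of A i], of "2 * mnrm B"]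
    by (simp add: algebra_simps)
  then show ?thesis by (simp add: mnrm_def[of "A ** B"])
qed

lemma mnrm_adj2: "mnrm (adj2 A) = mnrm A"
  by (auto simp: mnrm_def nrm_def)

lemma nrm_le_nrm_mat_vec:
  assumes "det A = 1"
  shows "nrm v \<le> 2 * mnrm A * nrm (A *v v)"
proof -
  have "v = adj2 A *v (A *v v)" using assms by (simp add: matrix_vector_mul_assoc mult_adj2)
  then show ?thesis by (metis nrm_mat_vec mnrm_adj2)
qed

lemma N_tr_adj2: "N (tr2 (B ** adj2 A)) \<le> 4 * mnrm A * mnrm B"
proof -
  have "tr2 (B ** adj2 A) = (B$1$1 * A$2$2 - B$1$2 * A$2$1) + (B$2$2 * A$1$1 - B$2$1 * A$1$2)"
    by (simp add: tr2_def)
  then have "N (tr2 (B ** adj2 A)) \<le> N (B$1$1) * N (A$2$2) + N (B$1$2) * N (A$2$1)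
      + (N (B$2$2) * N (A$1$1) + N (B$2$1) * N (A$1$2))"
    using N_add[of "B$1$1 * A$2$2 - B$1$2 * A$2$1" "B$2$2 * A$1$1 - B$2$1 * A$1$2"]
      N_diff[of "B$1$1 * A$2$2" "B$1$2 * A$2$1"] N_diff[of "B$2$2 * A$1$1" "B$2$1 * A$1$2"]
    by (simp add: N_mult)
  also have "\<dots> \<le> mnrm B * mnrm A + mnrm B * mnrm A + (mnrm B * mnrm A + mnrm B * mnrm A)"
    by (intro add_mono mult_mono N_le_mnrm) simp_all
  finally show ?thesis by simp
qed

lemma mnrm_word_mat:
  assumes "\<And>g. g \<in> set w \<Longrightarrow> mnrm (\<rho> g) \<le> B g"
  shows "mnrm (word_mat \<rho> w) \<le> (\<Prod>g\<leftarrow>w. 2 * B g)"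
  using assms
proof (induction w)
  case Nil
  then show ?case by (simp add: mnrm_def nrm_def)
next
  case (Cons g w)
  have "mnrm (word_mat \<rho> (g # w)) \<le> 2 * mnrm (\<rho> g) * mnrm (word_mat \<rho> w)"
    using mnrm_mult by simp
  also have "\<dots> \<le> 2 * B g * (\<Prod>g\<leftarrow>w. 2 * B g)"
    using Cons mnrm_nonneg[of "\<rho> g"] order_trans[OF mnrm_nonneg Cons.prems[of g]]
    by (intro mult_mono) auto
  finally show ?case by simp
qed

text \<open>Monotonicity of the sequence is carried through the induction: it absorbs the subtracted
  term of the recursion, because \<open>5/2 - 1 \<ge> 1\<close>.\<close>

lemma N_chebU:
  assumes "5/2 \<le> N \<tau>"
  shows "1 \<le> N (chebU \<tau> (Suc n))"
proof -
  have "1 \<le> N (chebU \<tau> (Suc n)) \<and> N (chebU \<tau> n) \<le> N (chebU \<tau> (Suc n))"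
  proof (induction n)
    case (Suc n)
    have "N (chebU \<tau> (Suc (Suc n))) \<ge> N \<tau> * N (chebU \<tau> (Suc n)) - N (chebU \<tau> n)"
      using N_diff_ge[of "\<tau> * chebU \<tau> (Suc n)" "chebU \<tau> n"] by (simp add: N_mult)
    moreover have "N \<tau> * N (chebU \<tau> (Suc n)) \<ge> 5/2 * N (chebU \<tau> (Suc n))"
      using assms by (intro mult_right_mono) simp_all
    ultimately show ?case using Suc by linarith
  qed simp
  then show ?thesis by simp
qed

text \<open>The same recursion started at the trace of the identity. The growth factor is
  \<open>5/2 - 1 = 3/2\<close>, and monotonicity starts because
  \<open>N 2 \<le> 2 \<le> 5/2\<close>.\<close>

lemma N_tr_mat_pow:
  assumes "det A = 1" "5/2 \<le> N (tr2 A)"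
  shows "(3/2) ^ Suc n \<le> N (tr2 (mat_pow A (Suc n)))"
proof -
  have two: "N 2 \<le> 2" using N_add[of 1 1] by simp
  have "(3/2) ^ Suc n \<le> N (tr2 (mat_pow A (Suc n))) \<and> N (tr2 (mat_pow A n)) \<le> N (tr2 (mat_pow A (Suc n)))"
  proof (induction n)
    case 0
    then show ?case using assms two by (simp add: tr2_def[of "mat 1"])
  next
    case (Suc n)
    have "N (tr2 (mat_pow A (Suc (Suc n)))) \<ge> N (tr2 A) * N (tr2 (mat_pow A (Suc n))) - N (tr2 (mat_pow A n))"
      unfolding tr2_mat_pow[OF assms(1)]
      using N_diff_ge[of "tr2 A * tr2 (mat_pow A (Suc n))" "tr2 (mat_pow A n)"] by (simp only: N_mult)
    moreover have "N (tr2 A) * N (tr2 (mat_pow A (Suc n))) \<ge> 5/2 * N (tr2 (mat_pow A (Suc n)))"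
      using assms by (intro mult_right_mono) simp_all
    moreover have "(3/2) ^ Suc (Suc n) = 3/2 * (3/2 :: real) ^ Suc n" by simp
    ultimately show ?case
      using Suc[THEN conjunct1] Suc[THEN conjunct2] N_nonneg[of "tr2 (mat_pow A (Suc n))"]
      by (intro conjI; linarith)
  qed
  then show ?thesis by simp
qed

text \<open>The approximate eigenvalue is read off at a coordinate where \<open>v\<close> is
  largest. There the error vanishes, and its other coordinate is, up to sign, the wedge product
  divided by that coordinate of \<open>v\<close>.\<close>

lemma approx_eigenvector:
  assumes "v \<noteq> 0"
  obtains l e where "A *v v = l *s v + e" "nrm e * nrm v = N (wedge v (A *v v))" "N l \<le> 2 * mnrm A"
proof -
  obtain i where i: "nrm v = N (v$i)" by (rule nrm_obtain)
  with assms have nz: "v$i \<noteq> 0" by (metis N_eq_0 nrm_eq_0)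
  define l where "l = (A *v v)$i / v$i"
  define e where "e = A *v v - l *s v"
  have "N l * nrm v = N ((A *v v)$i)" using nz by (simp add: l_def N_divide i)
  also have "\<dots> \<le> 2 * mnrm A * nrm v" using N_le_nrm nrm_mat_vec order_trans by blast
  finally have 1: "N l \<le> 2 * mnrm A" using assms by simp
  have "nrm e * N (v$i) = N (wedge v (A *v v))"
  proof -
    have "nrm e * N (v$i) = max (N (e$1 * v$i)) (N (e$2 * v$i))"
      by (simp add: nrm_def N_mult max_mult_distrib_right)
    also have "\<dots> = N (wedge v (A *v v))"
    proof (cases "i = 1")
      case True
      have "e$1 * v$i = 0" "e$2 * v$i = wedge v (A *v v)"
        using nz True by (simp_all add: e_def l_def wedge_def field_simps)
      then show ?thesis by (simp only: N_minus N_0 max_absorb1[OF N_nonneg] max_absorb2[OF N_nonneg])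
    next
      case False
      then have i2: "i = 2" using exhaust_2 by blast
      have "e$2 * v$i = 0" "e$1 * v$i = - wedge v (A *v v)"
        using nz i2 by (simp_all add: e_def l_def wedge_def field_simps)
      then show ?thesis by (simp only: N_minus N_0 max_absorb1[OF N_nonneg] max_absorb2[OF N_nonneg])
    qed
    finally show ?thesis .
  qed
  then show ?thesis using that[of l e] 1 i by (simp add: e_def)
qed

lemma nrm_add: "nrm (v + w) \<le> nrm v + nrm w"
proof -
  have "N ((v + w)$i) \<le> nrm v + nrm w" for i
    using N_add[of "v$i" "w$i"] N_le_nrm[of v i] N_le_nrm[of w i] by simp
  then show ?thesis by (simp add: nrm_def[of "v + w"])
qed

lemma nrm_uminus [simp]: "nrm (- v) = nrm v"
  by (simp add: nrm_def)

lemma nrm_diff: "nrm (v - w) \<le> nrm v + nrm w"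
  using nrm_add[of v "-w"] by simp

text \<open>On a common approximate eigenvector the two products \<open>k * l\<close> times
  \<open>v\<close> cancel, so the commutator maps \<open>v\<close> to something of norm at most
  \<open>8 * b * M\<close>, with \<open>M\<close> the larger error. But a commutator of norm at most
  \<open>4 * b^2\<close> and determinant at least \<open>c\<close> cannot shrink \<open>v\<close>
  that much; \<open>2 * 4 * 8 = 64\<close> gives the constant.\<close>

lemma no_common_eigenvector:
  assumes "mnrm A \<le> b" "mnrm B \<le> b" "v \<noteq> 0" "0 < c" "c \<le> N (det (A ** B - B ** A))"
  shows "c * (nrm v)\<^sup>2 \<le> 64 * b ^ 3 * max (N (wedge v (A *v v))) (N (wedge v (B *v v)))"
proof -
  obtain l e where A: "A *v v = l *s v + e" "nrm e * nrm v = N (wedge v (A *v v))" "N l \<le> 2 * mnrm A"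
    using approx_eigenvector[OF assms(3)] by blast
  obtain k d where B: "B *v v = k *s v + d" "nrm d * nrm v = N (wedge v (B *v v))" "N k \<le> 2 * mnrm B"
    using approx_eigenvector[OF assms(3)] by blast
  define K where "K = A ** B - B ** A"
  define M where "M = max (nrm e) (nrm d)"
  have b0: "0 \<le> b" using assms(1) mnrm_nonneg order_trans by blast
  have M: "nrm e \<le> M" "nrm d \<le> M" "0 \<le> M" by (auto simp: M_def le_max_iff_disj)
  have "K *v v = A *v (B *v v) - B *v (A *v v)"
    by (simp add: K_def vec_eq_iff algebra_simps)
  also have "\<dots> = (k *s e + A *v d) - (l *s d + B *v e)"
  proof -
    have "A *v (B *v v) = k *s (A *v v) + A *v d" unfolding B(1) by (simp add: vec_eq_iff algebra_simps)
    moreover have "B *v (A *v v) = l *s (B *v v) + B *v e" unfolding A(1) by (simp add: vec_eq_iff algebra_simps)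
    ultimately show ?thesis by (simp only: A(1) B(1)) (simp add: vec_eq_iff algebra_simps)
  qed
  finally have "nrm (K *v v) \<le> (nrm (k *s e) + nrm (A *v d)) + (nrm (l *s d) + nrm (B *v e))"
    using nrm_diff[of "k *s e + A *v d" "l *s d + B *v e"] nrm_add[of "k *s e" "A *v d"] nrm_add[of "l *s d" "B *v e"]
    by (smt (verit))
  also have "\<dots> \<le> (2 * b * M + 2 * b * M) + (2 * b * M + 2 * b * M)"
  proof (intro add_mono)
    show "nrm (k *s e) \<le> 2 * b * M"
      unfolding nrm_smult using B(3) assms(2) M b0 by (intro mult_mono) auto
    show "nrm (l *s d) \<le> 2 * b * M"
      unfolding nrm_smult using A(3) assms(1) M b0 by (intro mult_mono) auto
    show "nrm (A *v d) \<le> 2 * b * M"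
      using assms(1) M b0 by (intro order_trans[OF nrm_mat_vec] mult_mono) auto
    show "nrm (B *v e) \<le> 2 * b * M"
      using assms(2) M b0 by (intro order_trans[OF nrm_mat_vec] mult_mono) auto
  qed
  finally have Kv: "nrm (K *v v) \<le> 8 * b * M" by (simp add: mult.commute)
  have Kn: "mnrm K \<le> 4 * b\<^sup>2"
  proof -
    have "N (K$i$j) \<le> mnrm (A ** B) + mnrm (B ** A)" for i j
      unfolding K_def using N_diff[of "(A**B)$i$j" "(B**A)$i$j"] N_le_mnrm[of "A**B" i j] N_le_mnrm[of "B**A" i j] by simp
    moreover have "mnrm (A ** B) \<le> 2 * b * b" "mnrm (B ** A) \<le> 2 * b * b"
      using assms b0 by (intro order_trans[OF mnrm_mult] mult_mono; simp)+
    ultimately have "N (K$i$j) \<le> 2 * b * b + 2 * b * b" for i j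
      by (meson add_mono order_trans)
    then have "N (K$i$j) \<le> 4 * b\<^sup>2" for i j
      by (simp add: power2_eq_square)
    then show ?thesis by (simp add: mnrm_def nrm_def)
  qed
  have "det K *s v = adj2 K *v (K *v v)"
    by (simp add: vec_eq_iff forall_2 det_2 algebra_simps)
  then have "N (det K) * nrm v \<le> 2 * mnrm K * nrm (K *v v)"
    by (metis nrm_smult nrm_mat_vec mnrm_adj2)
  also have "\<dots> \<le> 2 * (4 * b\<^sup>2) * (8 * b * M)"
    using Kv Kn M b0 by (intro mult_mono) auto
  also have "\<dots> = 64 * b ^ 3 * M" by (simp add: power2_eq_square power3_eq_cube)
  finally have "c * nrm v \<le> 64 * b ^ 3 * M"
    using assms(5) mult_right_mono[OF assms(5), of "nrm v"] by (simp add: K_def)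
  then have "c * nrm v * nrm v \<le> 64 * b ^ 3 * M * nrm v" by (rule mult_right_mono) simp
  also have "\<dots> = 64 * b ^ 3 * max (N (wedge v (A *v v))) (N (wedge v (B *v v)))"
    by (simp add: M_def max_mult_distrib_right mult.assoc A(2) B(2))
  finally show ?thesis by (simp add: power2_eq_square mult.assoc)
qed

end

section \<open>Random words\<close>

lemma measure_bind_pmf:
  "measure_pmf.prob (bind_pmf p f) S = measure_pmf.expectation p (\<lambda>x. measure_pmf.prob (f x) S)"
  unfolding measure_pmf_bind
  by (rule measure_pmf.measure_bind[where N="count_space UNIV"])
    (auto simp: space_subprob_algebra prob_space_imp_subprob_space measure_pmf.prob_space_axioms)

lemma prob_append:
  "measure_pmf.prob (replicate_pmf (a + b) m) {w. Q w}
    = measure_pmf.expectation (replicate_pmf a m) (\<lambda>u. measure_pmf.prob (replicate_pmf b m) {w. Q (u @ w)})"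
proof -
  have "measure_pmf.prob (bind_pmf (replicate_pmf b m) (\<lambda>ys. return_pmf (u @ ys))) {w. Q w}
       = measure_pmf.prob (replicate_pmf b m) {w. Q (u @ w)}" for u
    by (simp add: map_pmf_def[symmetric] vimage_def)
  then show ?thesis
    by (simp add: replicate_pmf_distrib measure_bind_pmf[of "replicate_pmf a m"])
qed

text \<open>Conditions on the last letters instead of the first ones. The norm estimate peels words
  off the front, the direction estimate off the back.\<close>

lemma prob_append':
  "measure_pmf.prob (replicate_pmf (a + b) m) {w. Q w}
    = measure_pmf.expectation (replicate_pmf b m) (\<lambda>w. measure_pmf.prob (replicate_pmf a m) {u. Q (u @ w)})"
proof -
  have "measure_pmf.prob (bind_pmf (replicate_pmf a m) (\<lambda>ys. return_pmf (ys @ u))) {w. Q w}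
       = measure_pmf.prob (replicate_pmf a m) {w. Q (w @ u)}" for u
    by (simp add: map_pmf_def[symmetric] vimage_def)
  then show ?thesis
    unfolding replicate_pmf_distrib
    by (subst bind_commute_pmf) (simp add: measure_bind_pmf[of "replicate_pmf b m"])
qed

text \<open>The counting inequality. On \<open>H\<close> a mass \<beta> per point is charged with
  the true values of \<phi>, which sum to at most 1; the remaining mass of \<open>F\<close> is
  charged with \<kappa>, and the mass outside \<open>F\<close> costs at most \<epsilon>
  more.\<close>

lemma expectation_le_mix:
  fixes \<phi> :: "'a \<Rightarrow> real" and \<beta> \<kappa> \<epsilon> :: real
  assumes "finite H" "H \<subseteq> F" "\<And>h. h \<in> H \<Longrightarrow> \<beta> \<le> pmf p h" "0 \<le> \<beta>" "0 \<le> \<kappa>"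
    and "\<And>x. 0 \<le> \<phi> x" "\<And>x. \<phi> x \<le> 1" "\<And>x. x \<in> F \<Longrightarrow> \<phi> x \<le> \<kappa>"
    and "(\<Sum>h\<in>H. \<phi> h) \<le> 1" "1 - \<epsilon> \<le> measure_pmf.prob p F"
  shows "measure_pmf.expectation p \<phi> \<le> (1 - card H * \<beta>) * \<kappa> + \<beta> + \<epsilon>"
proof -
  \<comment> \<open>A majorant of \<phi>: equal to \<phi> on \<open>H\<close>, to \<kappa> on the
    rest of \<open>F\<close>, and to \<open>\<kappa> + 1\<close> outside \<open>F\<close>.\<close>
  define \<psi> where "\<psi> x = \<kappa> + indicator (- F) x - (\<Sum>h\<in>H. (\<kappa> - \<phi> h) * indicator {h} x)" for x
  have le: "\<phi> x \<le> \<psi> x" for x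
  proof (cases "x \<in> H")
    case True
    then have "(\<Sum>h\<in>H. (\<kappa> - \<phi> h) * indicator {h} x) = \<kappa> - \<phi> x"
      using assms(1) by (simp add: sum.delta' indicator_def if_distrib cong: if_cong)
    then show ?thesis using True by (simp add: \<psi>_def)
  next
    case False
    then have "(\<Sum>h\<in>H. (\<kappa> - \<phi> h) * indicator {h} x) = 0"
      by (intro sum.neutral) (auto simp: indicator_def)
    then show ?thesis using assms(5) assms(7)[of x] assms(8)[of x] by (auto simp: \<psi>_def indicator_def)
  qed
  have int: "integrable (measure_pmf p) (indicator S :: 'a \<Rightarrow> real)" for S
    by (rule measure_pmf.integrable_const_bound[where B=1]) auto
  have i1: "integrable (measure_pmf p) (\<lambda>x. \<kappa> + indicator (- F) x)"
    and i2: "integrable (measure_pmf p) (\<lambda>x. \<Sum>h\<in>H. (\<kappa> - \<phi> h) * indicator {h} x)"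
    by (intro Bochner_Integration.integrable_add Bochner_Integration.integrable_sum integrable_mult_right int; simp)+
  have "measure_pmf.expectation p \<phi> \<le> measure_pmf.expectation p \<psi>"
  proof (rule integral_mono)
    show "integrable (measure_pmf p) \<phi>"
      using assms(6,7) by (intro measure_pmf.integrable_const_bound[where B=1]) auto
    show "integrable (measure_pmf p) \<psi>"
      unfolding \<psi>_def by (intro Bochner_Integration.integrable_diff i1 i2)
  qed (use le in auto)
  also have "\<dots> = \<kappa> + measure_pmf.prob p (- F) - (\<Sum>h\<in>H. (\<kappa> - \<phi> h) * pmf p h)"
    unfolding \<psi>_def
    by (subst Bochner_Integration.integral_diff[OF i1 i2])
       (simp add: Bochner_Integration.integral_sum int measure_pmf_single)
  finally have "measure_pmf.expectation p \<phi> \<le> \<kappa> + measure_pmf.prob p (- F) - (\<Sum>h\<in>H. (\<kappa> - \<phi> h) * pmf p h)" .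
  moreover have "measure_pmf.prob p (- F) \<le> \<epsilon>"
    using assms(10) measure_pmf.prob_compl[of F p] by (simp add: Compl_eq_Diff_UNIV)
  moreover have "(\<Sum>h\<in>H. (\<kappa> - \<phi> h) * \<beta>) \<le> (\<Sum>h\<in>H. (\<kappa> - \<phi> h) * pmf p h)"
    using assms(2,3,8) by (intro sum_mono mult_left_mono) auto
  moreover have "(\<Sum>h\<in>H. (\<kappa> - \<phi> h) * \<beta>) = card H * \<beta> * \<kappa> - \<beta> * (\<Sum>h\<in>H. \<phi> h)"
    by (simp add: algebra_simps sum_subtractf sum_distrib_left)
  moreover have "\<beta> * (\<Sum>h\<in>H. \<phi> h) \<le> \<beta> * 1"
    using assms(4,9) by (intro mult_left_mono)
  ultimately show ?thesis by (simp add: algebra_simps)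
qed

lemma prob_set_pmf: "measure_pmf.prob p (set_pmf p) = 1"
  using measure_Int_set_pmf[of p UNIV] by simp

text \<open>The support is countable, so initial pieces of an enumeration exhaust the mass.\<close>

lemma finite_almost_full_pmf:
  assumes "\<epsilon> > 0"
  obtains F where "finite F" "F \<subseteq> set_pmf p" "1 - \<epsilon> \<le> measure_pmf.prob p F"
proof -
  define A where "A n = from_nat_into (set_pmf p) ` {..<n}" for n :: nat
  have sub: "A n \<subseteq> set_pmf p" for n
    unfolding A_def by (auto simp: from_nat_into set_pmf_not_empty)
  have "(\<Union>n. A n) = set_pmf p"
    using sub from_nat_into_surj[OF countable_set_pmf[of p]]
    by (auto simp: A_def) (metis lessI lessThan_iff imageI)
  moreover have "incseq A" by (auto simp: A_def incseq_def)
  ultimately have "(\<lambda>n. measure_pmf.prob p (A n)) \<longlonglongrightarrow> measure_pmf.prob p (set_pmf p)"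
    using measure_pmf.finite_Lim_measure_incseq[of A p] by simp
  then have "(\<lambda>n. measure_pmf.prob p (A n)) \<longlonglongrightarrow> 1" by (simp add: prob_set_pmf)
  then obtain n where "1 - \<epsilon> < measure_pmf.prob p (A n)"
    using order_tendstoD(1)[of _ 1 sequentially "1 - \<epsilon>"] assms eventually_happens'[OF sequentially_bot] by fastforce
  then show ?thesis using that[of "A n"] sub by (auto simp: A_def)
qed

lemma prob_le_if_supp:
  assumes "\<And>w. w \<in> set_pmf p \<Longrightarrow> P w \<Longrightarrow> Q w"
  shows "measure_pmf.prob p {w. P w} \<le> measure_pmf.prob p {w. Q w}"
  by (rule measure_pmf.finite_measure_mono_AE) (use assms in \<open>auto simp: AE_measure_pmf_iff\<close>)

lemma sum_prob_disjoint_le_1: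
  assumes "finite H" "\<And>u u' w. \<lbrakk>u \<in> H; u' \<in> H; u \<noteq> u'; w \<in> set_pmf p; E u w; E u' w\<rbrakk> \<Longrightarrow> False"
  shows "(\<Sum>u\<in>H. measure_pmf.prob p {w. E u w}) \<le> 1"
proof -
  have "(\<Sum>u\<in>H. measure_pmf.prob p {w. E u w}) = (\<Sum>u\<in>H. measure_pmf.prob p ({w. E u w} \<inter> set_pmf p))"
    by (simp add: measure_Int_set_pmf)
  also have "\<dots> = measure_pmf.prob p (\<Union>u\<in>H. {w. E u w} \<inter> set_pmf p)"
    using assms by (intro measure_pmf.finite_measure_finite_Union[symmetric]) (auto simp: disjoint_family_on_def)
  finally show ?thesis by simp
qed

section \<open>One step of the counting argument, for norms and for directions\<close>

definition dot2 :: "'k::comm_ring_1^2 \<Rightarrow> 'k^2 \<Rightarrow> 'k" where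
  "dot2 y v = y$1 * v$1 + y$2 * v$2"

lemma dot2_vec_mat: "dot2 (y v* A) v = dot2 y (A *v v)"
  by (simp add: dot2_def algebra_simps)

definition lettersdet :: "'a pmf \<Rightarrow> ('a \<Rightarrow> 'k::comm_ring_1^2^2) \<Rightarrow> bool" where
  "lettersdet m \<rho> \<longleftrightarrow> (\<forall>g\<in>set_pmf m. det (\<rho> g) = 1)"

lemma det_word_mat_rep:
  "lettersdet m \<rho> \<Longrightarrow> w \<in> set_pmf (replicate_pmf n m) \<Longrightarrow> det (word_mat \<rho> w) = 1"
  by (rule det_word_mat) (auto simp: lettersdet_def set_replicate_pmf)

lemma vec_mat_nonzero:
  fixes A :: "'k::comm_ring_1^2^2"
  assumes "det A = 1" "y \<noteq> 0" shows "y v* A \<noteq> 0"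
proof
  assume "y v* A = 0"
  then have "(y v* A) v* adj2 A = 0" by (simp add: vec_eq_iff)
  then have "y v* (A ** adj2 A) = 0" by (simp add: vec_eq_iff forall_2 algebra_simps)
  then show False using assms by (simp add: mult_adj2)
qed

lemma mat_vec_nonzero:
  fixes A :: "'k::comm_ring_1^2^2"
  assumes "det A = 1" "v \<noteq> 0" shows "A *v v \<noteq> 0"
proof
  assume "A *v v = 0"
  then have "adj2 A *v (A *v v) = 0" by (simp add: vec_eq_iff)
  then show False using assms by (simp add: matrix_vector_mul_assoc mult_adj2)
qed

context absval
begin

lemma nrm_mat_vec_le: "mnrm A \<le> b \<Longrightarrow> nrm (A *v v) \<le> 2 * b * nrm v"
  using nrm_mat_vec[of A v] mult_right_mono[of "2 * mnrm A" "2 * b" "nrm v"] by simp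

lemma nrm_vec_mat_le: "mnrm A \<le> b \<Longrightarrow> nrm (y v* A) \<le> 2 * b * nrm y"
  using nrm_vec_mat[of y A] mult_right_mono[of "2 * mnrm A" "2 * b" "nrm y"] by simp

lemma nrm_le_nrm_mat_vec_le: "det A = 1 \<Longrightarrow> mnrm A \<le> b \<Longrightarrow> nrm v \<le> 2 * b * nrm (A *v v)"
  using nrm_le_nrm_mat_vec[of A v] mult_right_mono[of "2 * mnrm A" "2 * b" "nrm (A *v v)"] by simp

text \<open>If the products \<open>A\<close>, \<open>B\<close> both have norm at most \<open>R\<close> then \<open>N (tr (A adj B)) \<le> 4 R\<^sup>2\<close>, so by \<open>sep\<close> at most one
  word of \<open>H\<close> keeps a given product small.\<close>
lemma prob_mnrm_step:
  fixes \<beta> \<kappa> R :: real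
  assumes det: "lettersdet m \<rho>"
    and H: "finite H" "H \<subseteq> set_pmf (replicate_pmf k m)" "\<And>h. h \<in> H \<Longrightarrow> \<beta> \<le> pmf (replicate_pmf k m) h" "0 \<le> \<beta>"
    and sep: "\<And>u u' U G. \<lbrakk>u \<in> H; u' \<in> H; u \<noteq> u'; det U = 1; det G = 1\<rbrakk> \<Longrightarrow>
       4 * R\<^sup>2 < N (tr2 ((U ** word_mat \<rho> u ** G) ** adj2 (U ** word_mat \<rho> u' ** G)))"
    and \<kappa>: "\<And>U. det U = 1 \<Longrightarrow> measure_pmf.prob (replicate_pmf l m) {w. mnrm (U ** word_mat \<rho> w) \<le> R} \<le> \<kappa>"
    and U: "det U = 1" and "0 \<le> R"
  shows "measure_pmf.prob (replicate_pmf (k + l) m) {w. mnrm (U ** word_mat \<rho> w) \<le> R}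
      \<le> (1 - card H * \<beta>) * \<kappa> + \<beta>"
proof -
  have k0: "0 \<le> \<kappa>" using \<kappa>[OF U] measure_nonneg order_trans by blast
  have "measure_pmf.expectation (replicate_pmf k m)
    (\<lambda>u. measure_pmf.prob (replicate_pmf l m) {w. mnrm (U ** word_mat \<rho> (u @ w)) \<le> R})
    \<le> (1 - card H * \<beta>) * \<kappa> + \<beta> + 0"
  \<comment> \<open>Here \<open>F\<close> is the whole support, so no mass is lost.\<close>
  proof (rule expectation_le_mix[where F="set_pmf (replicate_pmf k m)"])
    fix u assume "u \<in> set_pmf (replicate_pmf k m)"
    then have "det (U ** word_mat \<rho> u) = 1" using U det_word_mat_rep[OF det] by (simp add: det_mul)
    from \<kappa>[OF this] show "measure_pmf.prob (replicate_pmf l m) {w. mnrm (U ** word_mat \<rho> (u @ w)) \<le> R} \<le> \<kappa>"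
      by (simp add: word_mat_append matrix_mul_assoc)
  next
    show "(\<Sum>h\<in>H. measure_pmf.prob (replicate_pmf l m) {w. mnrm (U ** word_mat \<rho> (h @ w)) \<le> R}) \<le> 1"
    proof (rule sum_prob_disjoint_le_1[OF H(1)])
      fix u u' w assume h: "u \<in> H" "u' \<in> H" "u \<noteq> u'" "w \<in> set_pmf (replicate_pmf l m)"
        "mnrm (U ** word_mat \<rho> (u @ w)) \<le> R" "mnrm (U ** word_mat \<rho> (u' @ w)) \<le> R"
      have "4 * R\<^sup>2 < N (tr2 ((U ** word_mat \<rho> u ** word_mat \<rho> w) ** adj2 (U ** word_mat \<rho> u' ** word_mat \<rho> w)))"
        using h det_word_mat_rep[OF det] U by (intro sep) auto
      also have "\<dots> \<le> 4 * mnrm (U ** word_mat \<rho> u' ** word_mat \<rho> w) * mnrm (U ** word_mat \<rho> u ** word_mat \<rho> w)"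
        by (rule N_tr_adj2)
      also have "\<dots> \<le> 4 * R * R"
        using h \<open>0 \<le> R\<close> by (intro mult_mono) (auto simp: word_mat_append matrix_mul_assoc)
      finally show False by (simp add: power2_eq_square)
    qed
  qed (use H k0 in \<open>auto simp: prob_set_pmf\<close>)
  then show ?thesis by (subst prob_append) simp
qed

text \<open>Cramer's rule: multiplied by a coordinate of \<open>y\<close>, the wedge product is a
  combination of the two pairings. So two vectors that one row nearly annihilates are nearly
  proportional.\<close>

lemma N_wedge_dot:
  "N (wedge a b) * nrm y \<le> N (dot2 y a) * nrm b + N (dot2 y b) * nrm a"
proof -
  have "N (wedge a b) * N (y$i) \<le> N (dot2 y a) * nrm b + N (dot2 y b) * nrm a" for i
  proof -
    have 1: "wedge a b * y$1 = dot2 y a * b$2 - dot2 y b * a$2"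
      by (simp add: wedge_def dot2_def algebra_simps)
    have 2: "wedge a b * y$2 = dot2 y b * a$1 - dot2 y a * b$1"
      by (simp add: wedge_def dot2_def algebra_simps)
    have "N (wedge a b * y$1) \<le> N (dot2 y a) * N (b$2) + N (dot2 y b) * N (a$2)"
      unfolding 1 using N_diff[of "dot2 y a * b$2" "dot2 y b * a$2"] by (simp add: N_mult)
    moreover have "N (wedge a b * y$2) \<le> N (dot2 y a) * N (b$1) + N (dot2 y b) * N (a$1)"
      unfolding 2 using N_diff[of "dot2 y b * a$1" "dot2 y a * b$1"] by (simp add: N_mult)
    moreover have "N (dot2 y a) * N (b$j) + N (dot2 y b) * N (a$j) \<le> N (dot2 y a) * nrm b + N (dot2 y b) * nrm a" for j
      by (intro add_mono mult_left_mono N_le_nrm) auto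
    ultimately have "N (wedge a b * y$i) \<le> N (dot2 y a) * nrm b + N (dot2 y b) * nrm a"
      using exhaust_2[of i] order_trans by blast
    then show ?thesis by (simp add: N_mult)
  qed
  moreover obtain i where "nrm y = N (y$i)" by (rule nrm_obtain)
  ultimately show ?thesis by simp
qed

text \<open>By \<open>sep\<close> the images of \<open>v\<close> under the words of \<open>H\<close> are far apart in the projective line, so at
  most one of them is close to the kernel of a given row.\<close>
lemma prob_nonconc_step:
  fixes \<beta> \<kappa> r s b \<epsilon> :: real
  assumes det: "lettersdet m \<rho>"
    and H: "finite H" "H \<subseteq> F" "\<And>h. h \<in> H \<Longrightarrow> \<beta> \<le> pmf (replicate_pmf k m) h" "0 \<le> \<beta>"
    and F: "F \<subseteq> set_pmf (replicate_pmf k m)" "\<And>u. u \<in> F \<Longrightarrow> mnrm (word_mat \<rho> u) \<le> b" "0 \<le> b"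
       "1 - \<epsilon> \<le> measure_pmf.prob (replicate_pmf k m) F"
    and sep: "\<And>u u'. \<lbrakk>u \<in> H; u' \<in> H; u \<noteq> u'\<rbrakk> \<Longrightarrow>
       s * (nrm v)\<^sup>2 \<le> N (wedge (word_mat \<rho> u *v v) (word_mat \<rho> u' *v v))"
    and r: "0 < r" "32 * b ^ 4 * r < s"
    and \<kappa>: "\<And>v. v \<noteq> 0 \<Longrightarrow> measure_pmf.prob (replicate_pmf l m)
         {w. N (dot2 (y v* word_mat \<rho> w) v) \<le> 4 * b\<^sup>2 * r * nrm (y v* word_mat \<rho> w) * nrm v} \<le> \<kappa>"
    and yv: "y \<noteq> 0" "v \<noteq> 0"
  shows "measure_pmf.prob (replicate_pmf (l + k) m)
         {w. N (dot2 (y v* word_mat \<rho> w) v) \<le> r * nrm (y v* word_mat \<rho> w) * nrm v}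
      \<le> (1 - card H * \<beta>) * \<kappa> + \<beta> + \<epsilon>"
proof -
  have k0: "0 \<le> \<kappa>" using \<kappa>[OF yv(2)] measure_nonneg order_trans by blast
  let ?P = "\<lambda>u w. N (dot2 (y v* word_mat \<rho> (w @ u)) v) \<le> r * nrm (y v* word_mat \<rho> (w @ u)) * nrm v"
  \<comment> \<open>\<open>?Q\<close> is \<open>?P\<close> with the suffix \<open>u\<close> moved
    from the row to the vector. Each of the two norms changes by a factor of at most
    \<open>2 * b\<close>, so the radius grows by \<open>4 * b^2\<close>.\<close>
  let ?Q = "\<lambda>u w. N (dot2 (y v* word_mat \<rho> w) (word_mat \<rho> u *v v))
       \<le> 4 * b\<^sup>2 * r * nrm (y v* word_mat \<rho> w) * nrm (word_mat \<rho> u *v v)"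
  have PQ: "?Q u w" if "u \<in> F" "?P u w" for u w
  proof -
    let ?W = "word_mat \<rho> u" and ?y = "y v* word_mat \<rho> w"
    have b: "mnrm ?W \<le> b" and d: "det ?W = 1" using that F det_word_mat_rep[OF det] by auto
    have eq: "y v* word_mat \<rho> (w @ u) = ?y v* ?W"
      by (simp add: word_mat_append vec_eq_iff algebra_simps)
    have "nrm (?y v* ?W) \<le> 2 * b * nrm ?y"
      by (rule nrm_vec_mat_le[OF b])
    moreover have "nrm v \<le> 2 * b * nrm (?W *v v)"
      by (rule nrm_le_nrm_mat_vec_le[OF d b])
    ultimately have "r * nrm (?y v* ?W) * nrm v \<le> r * (2 * b * nrm ?y) * (2 * b * nrm (?W *v v))"
      using r F(3) by (intro mult_mono) auto
    then show ?thesis using that(2) unfolding eq dot2_vec_mat by (simp add: power2_eq_square algebra_simps)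
  qed
  have "measure_pmf.expectation (replicate_pmf k m)
    (\<lambda>u. measure_pmf.prob (replicate_pmf l m) {w. ?P u w})
    \<le> (1 - card H * \<beta>) * \<kappa> + \<beta> + \<epsilon>"
  proof (rule expectation_le_mix[where F=F])
    fix u assume u: "u \<in> F"
    then have "word_mat \<rho> u *v v \<noteq> 0" using yv F(1) det_word_mat_rep[OF det] mat_vec_nonzero by blast
    from \<kappa>[OF this] show "measure_pmf.prob (replicate_pmf l m) {w. ?P u w} \<le> \<kappa>"
      using prob_le_if_supp[of "replicate_pmf l m" "?P u" "?Q u", OF PQ[OF u]] by linarith
  next
    have "(\<Sum>h\<in>H. measure_pmf.prob (replicate_pmf l m) {w. ?Q h w}) \<le> 1"
    proof (rule sum_prob_disjoint_le_1[OF H(1)])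
      fix u u' w assume h: "u \<in> H" "u' \<in> H" "u \<noteq> u'" "w \<in> set_pmf (replicate_pmf l m)" "?Q u w" "?Q u' w"
      let ?W = "word_mat \<rho> u" and ?W' = "word_mat \<rho> u'" and ?y = "y v* word_mat \<rho> w"
      have y0: "?y \<noteq> 0" using vec_mat_nonzero yv(1) det_word_mat_rep[OF det h(4)] by blast
      have "N (wedge (?W *v v) (?W' *v v)) * nrm ?y \<le> N (dot2 ?y (?W *v v)) * nrm (?W' *v v) + N (dot2 ?y (?W' *v v)) * nrm (?W *v v)"
        by (rule N_wedge_dot)
      also have "\<dots> \<le> (4 * b\<^sup>2 * r * nrm ?y * nrm (?W *v v)) * nrm (?W' *v v) + (4 * b\<^sup>2 * r * nrm ?y * nrm (?W' *v v)) * nrm (?W *v v)"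
        using h by (intro add_mono mult_right_mono) auto
      also have "\<dots> = (8 * b\<^sup>2 * r * (nrm (?W *v v) * nrm (?W' *v v))) * nrm ?y" by (simp add: algebra_simps)
      finally have "N (wedge (?W *v v) (?W' *v v)) \<le> 8 * b\<^sup>2 * r * (nrm (?W *v v) * nrm (?W' *v v))"
        using y0 by simp
      \<comment> \<open>With both images bounded by \<open>2 * b * nrm v\<close> the constant
        becomes \<open>8 * 4 * b^4\<close>; this is the origin of the condition
        \<open>32 * b ^ 4 * r < s\<close>.\<close>
      also have "\<dots> \<le> 8 * b\<^sup>2 * r * ((2 * b * nrm v) * (2 * b * nrm v))"
      proof (intro mult_left_mono mult_mono)
        show "nrm (?W *v v) \<le> 2 * b * nrm v" "nrm (?W' *v v) \<le> 2 * b * nrm v"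
          using h H(2) F(2) by (auto intro!: nrm_mat_vec_le)
      qed (use r F in auto)
      also have "\<dots> = 32 * b ^ 4 * r * (nrm v)\<^sup>2" by (simp add: power2_eq_square power4_eq_xxxx)
      also have "\<dots> < s * (nrm v)\<^sup>2" using r yv by (intro mult_strict_right_mono) (auto simp: nrm_eq_0)
      finally show False using sep[OF h(1-3)] by simp
    qed
    moreover have "(\<Sum>h\<in>H. measure_pmf.prob (replicate_pmf l m) {w. ?P h w}) \<le> (\<Sum>h\<in>H. measure_pmf.prob (replicate_pmf l m) {w. ?Q h w})"
      using H(2) by (intro sum_mono prob_le_if_supp PQ) auto
    ultimately show "(\<Sum>h\<in>H. measure_pmf.prob (replicate_pmf l m) {w. ?P h w}) \<le> 1" by linarith
  qed (use H F(4) k0 in simp_all)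
  then show ?thesis by (simp only: prob_append')
qed

end

section \<open>Growth of random products\<close>

text \<open>For \<open>det h = 1\<close> this is the conjugate of \<open>f\<close> by the inverse of
  \<open>h\<close>; it fixes the points that \<open>h\<close> sends to fixed points of
  \<open>f\<close>.\<close>

definition conj2 :: "'k::comm_ring_1^2^2 \<Rightarrow> 'k^2^2 \<Rightarrow> 'k^2^2" where
  "conj2 h f = adj2 h ** f ** h"

text \<open>All constants in the estimates on random products depend on the representation only
  through \<open>B\<close>, \<open>c\<close> and the words \<open>f\<close>, \<open>h\<close>; this is what makes them uniform in the parameter
  \<open>t\<close> and valid for the non-archimedean limit.  The letter \<open>e\<close> is the identity, by which words
  are padded to a common length.\<close>
definition sl2_data :: "'a pmf \<Rightarrow> ('a \<Rightarrow> real) \<Rightarrow> real \<Rightarrow> 'a \<Rightarrow> 'a list \<Rightarrow> 'a list \<Rightarrow>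
    ('k::field \<Rightarrow> real) \<Rightarrow> ('a \<Rightarrow> 'k^2^2) \<Rightarrow> bool" where
  "sl2_data m B c e f h N \<rho> \<longleftrightarrow> absval N \<and> lettersdet m \<rho> \<and>
     (\<forall>g\<in>set_pmf m. absval.mnrm N (\<rho> g) \<le> B g) \<and> \<rho> e = mat 1 \<and>
     5/2 \<le> N (tr2 (word_mat \<rho> f)) \<and>
     c \<le> N (det (word_mat \<rho> f ** conj2 (word_mat \<rho> h) (word_mat \<rho> f)
               - conj2 (word_mat \<rho> h) (word_mat \<rho> f) ** word_mat \<rho> f))"

definition pad :: "'a \<Rightarrow> nat \<Rightarrow> 'a list \<Rightarrow> 'a list" where
  "pad e k w = w @ replicate (k - length w) e"

lemma word_mat_pad: "\<rho> e = mat 1 \<Longrightarrow> word_mat \<rho> (pad e k w) = word_mat \<rho> w"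
proof -
  assume "\<rho> e = mat 1"
  then have "word_mat \<rho> (replicate n e) = mat 1" for n by (induction n) simp_all
  then show ?thesis by (simp add: pad_def word_mat_append)
qed

lemma pad_in_replicate_pmf:
  "\<lbrakk>set w \<subseteq> set_pmf m; e \<in> set_pmf m; length w \<le> k\<rbrakk> \<Longrightarrow> pad e k w \<in> set_pmf (replicate_pmf k m)"
  by (auto simp: pad_def set_replicate_pmf)

abbreviation wpow :: "'a list \<Rightarrow> nat \<Rightarrow> 'a list" where
  "wpow f n \<equiv> concat (replicate n f)"

lemma length_wpow: "length (wpow f n) = n * length f"
  by (induction n) simp_all

lemma set_wpow: "set f \<subseteq> S \<Longrightarrow> set (wpow f n) \<subseteq> S"
  by auto

lemma power_tendsto_0_obtain:
  fixes x :: real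
  assumes "0 \<le> x" "x < 1" "0 < \<epsilon>"
  obtains j where "x ^ j < \<epsilon>"
  using assms real_arch_pow_inv by blast

text \<open>Ensures that the factor \<open>1 - q * \<beta>\<close> of the recursion is
  nonnegative.\<close>

lemma prob_pmf_card_le:
  assumes "finite H" "\<And>h. h \<in> H \<Longrightarrow> \<beta> \<le> pmf p h"
  shows "real (card H) * \<beta> \<le> 1"
proof -
  have "real (card H) * \<beta> = (\<Sum>h\<in>H. \<beta>)" by simp
  also have "\<dots> \<le> (\<Sum>h\<in>H. pmf p h)" by (intro sum_mono assms)
  also have "\<dots> = measure_pmf.prob p H" by (simp add: measure_measure_pmf_finite assms)
  finally show ?thesis using measure_pmf.prob_le_1 order_trans by blast
qed

context
  fixes m :: "'a pmf" and B :: "'a \<Rightarrow> real" and c :: real and e :: 'a and f h :: "'a list"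
  assumes e: "e \<in> set_pmf m" and f: "set f \<subseteq> set_pmf m" and h: "set h \<subseteq> set_pmf m" and c: "0 < c"
begin

text \<open>The scattering words are the powers of \<open>f\<close> with exponents in multiples of
  \<open>a\<close>. The quotient of two of them is a power with exponent at least \<open>a\<close>,
  whose trace is too large for both products to have norm at most \<open>R\<close>.\<close>

lemma prob_mnrm_small:
  fixes R \<epsilon> :: real
  assumes "0 \<le> R" "0 < \<epsilon>"
  shows "\<exists>n0. \<forall>n\<ge>n0. \<forall>(N :: 'k::field \<Rightarrow> real) \<rho>. sl2_data m B c e f h N \<rho> \<longrightarrow>
     measure_pmf.prob (replicate_pmf n m) {w. absval.mnrm N (word_mat \<rho> w) \<le> R} \<le> \<epsilon>"
proof -
  \<comment> \<open>The fixed point 1/q of the recursion has to lie below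
    \<open>\<epsilon> / 2\<close>.\<close>
  obtain q :: nat where q: "2 / \<epsilon> < q" using reals_Archimedean2 by blast
  have q0: "0 < q" using q assms(2) by (metis divide_pos_pos of_nat_0_less_iff order_less_trans zero_less_numeral)
  obtain a0 :: nat where a0: "4 * R\<^sup>2 < (3/2) ^ a0" using real_arch_pow[of "3/2" "4 * R\<^sup>2"] by auto
  \<comment> \<open>Makes \<open>(3/2)^a\<close> exceed \<open>4 * R^2\<close>, for the separation,
    and 2, the bound for the trace of the identity, so that the words are distinct.\<close>
  define a where "a = Suc a0 + 2"
  have a: "4 * R\<^sup>2 < (3/2) ^ a" "2 < (3/2::real) ^ a"
  proof -
    have "(3/2::real) ^ a0 \<le> (3/2) ^ a" unfolding a_def by (intro power_increasing) auto
    with a0 show "4 * R\<^sup>2 < (3/2) ^ a" by (rule less_le_trans)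
    have "2 < (3/2::real) ^ 3" by (simp add: power3_eq_cube)
    also have "\<dots> \<le> (3/2) ^ a" unfolding a_def by (intro power_increasing) auto
    finally show "2 < (3/2::real) ^ a" .
  qed
  define k where "k = a * q * length f + 1"
  define u where "u i = pad e k (wpow f (a * i))" for i
  have u: "u i \<in> set_pmf (replicate_pmf k m)" if "i < q" for i
    unfolding u_def using that set_wpow[OF f]
    by (intro pad_in_replicate_pmf e) (auto simp: length_wpow k_def intro!: le_SucI)
  define \<beta> where "\<beta> = Min ((\<lambda>i. pmf (replicate_pmf k m) (u i)) ` {..<q})"
  have ne: "{..<q} \<noteq> {}" using q0 by auto
  have \<beta>: "0 < \<beta>" "\<And>i. i < q \<Longrightarrow> \<beta> \<le> pmf (replicate_pmf k m) (u i)"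
    using pmf_positive[OF u] ne by (auto simp: \<beta>_def)
  \<comment> \<open>That \<open>q * \<beta> \<le> 1\<close> requires the \<open>q\<close> words to
    be distinct, which is known only once a representation is given; \<open>j\<close> must be chosen
    before that, hence the \<open>max\<close>.\<close>
  have "0 \<le> max 0 (1 - q * \<beta>)" "max 0 (1 - q * \<beta>) < 1" using \<beta>(1) q0 by auto
  then obtain j where j: "max 0 (1 - q * \<beta>) ^ j < \<epsilon> / 2"
    using power_tendsto_0_obtain[of "max 0 (1 - q * \<beta>)" "\<epsilon> / 2"] assms(2) by auto
  show ?thesis
  proof (intro exI[of _ "j * k"] allI impI)
    fix n and N :: "'k \<Rightarrow> real" and \<rho> assume n: "j * k \<le> n" and D: "sl2_data m B c e f h N \<rho>"
    interpret absval N using D by (simp add: sl2_data_def)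
    let ?f = "word_mat \<rho> f"
    have det: "lettersdet m \<rho>" and eq: "\<rho> e = mat 1" and tr: "5/2 \<le> N (tr2 ?f)"
      using D by (auto simp: sl2_data_def)
    have df: "det ?f = 1" using det f by (intro det_word_mat) (auto simp: lettersdet_def)
    have wu: "word_mat \<rho> (u i) = mat_pow ?f (a * i)" for i
      by (simp add: u_def word_mat_pad[of \<rho> e, OF eq] word_mat_concat_replicate)
    have big: "max 2 (4 * R\<^sup>2) < N (tr2 ((U ** word_mat \<rho> (u i) ** G) ** adj2 (U ** word_mat \<rho> (u i') ** G)))"
      if "i \<noteq> i'" "det U = 1" "det G = 1" for i i' U G
    proof -
      have *: "max 2 (4 * R\<^sup>2) < N (tr2 (mat_pow ?f (a * i - a * i')))" if "i' < i" for i i'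
      proof -
        have "a * 1 \<le> a * (i - i')" using that by (intro mult_le_mono) auto
        then have "a \<le> a * i - a * i'" by (simp add: diff_mult_distrib2)
        then obtain p where p: "a * i - a * i' = Suc p" "a \<le> Suc p"
          by (cases "a * i - a * i'") (auto simp: a_def)
        have "(3/2::real) ^ a \<le> (3/2) ^ Suc p" using p by (intro power_increasing) auto
        then show ?thesis using N_tr_mat_pow[OF df tr, of p] a unfolding p by linarith
      qed
      show ?thesis
      proof (cases "i' < i")
        case True
        then show ?thesis using *[OF True] tr2_mat_pow_adj2[OF df that(2,3), of "a * i'" "a * i"]
          by (simp add: wu)
      next
        case False
        then have lt: "i < i'" using that by simp
        have "tr2 (A ** adj2 C) = tr2 (C ** adj2 A)" for A C :: "'k^2^2"
          by (simp add: tr2_def algebra_simps)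
        then show ?thesis using *[OF lt] tr2_mat_pow_adj2[OF df that(2,3), of "a * i" "a * i'"] lt
          by (simp add: wu)
      qed
    qed
    \<comment> \<open>Two equal words would have the identity as quotient, and its trace has
      absolute value at most 2.\<close>
    have inj: "inj_on u {..<q}"
    proof (rule inj_onI, rule ccontr)
      fix i i' assume "u i = u i'" "i \<noteq> i'"
      then have "max 2 (4 * R\<^sup>2) < N (tr2 (mat 1 :: 'k^2^2))"
        using big[of i i' "mat 1" "mat 1"] mult_adj2(1)[OF det_mat_pow[OF df, of "a * i'"]]
        by (simp add: wu[symmetric])
      moreover have "N (tr2 (mat 1 :: 'k^2^2)) \<le> 2" using N_add[of 1 1] by (simp add: tr2_def)
      ultimately show False by simp
    qed
    define H where "H = u ` {..<q}"
    have cH: "card H = q" using inj by (simp add: H_def card_image)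
    have q\<beta>: "q * \<beta> \<le> 1" using prob_pmf_card_le[of H \<beta>] \<beta>(2) cH by (auto simp: H_def)
    define \<kappa> where "\<kappa> j' = (1 - q * \<beta>) ^ j' + 1 / q" for j'
    \<comment> \<open>The \<open>n - j * k\<close> surplus letters are harmless: the induction
      starts from the trivial bound 1, which holds for words of any length.\<close>
    have main: "measure_pmf.prob (replicate_pmf (j' * k + (n - j * k)) m) {w. mnrm (U ** word_mat \<rho> w) \<le> R} \<le> \<kappa> j'"
      if "det U = 1" for U j'
      using that
    proof (induction j' arbitrary: U)
      case 0
      then show ?case using q0 by (auto simp: \<kappa>_def intro: order_trans[OF measure_pmf.prob_le_1])
    next
      case (Suc j')
      have "measure_pmf.prob (replicate_pmf (k + (j' * k + (n - j * k))) m) {w. mnrm (U ** word_mat \<rho> w) \<le> R}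
         \<le> (1 - card H * \<beta>) * \<kappa> j' + \<beta>"
      proof (rule prob_mnrm_step[OF det])
        fix x x' and U G :: "'k^2^2" assume "x \<in> H" "x' \<in> H" "x \<noteq> x'" "det U = 1" "det G = 1"
        then obtain i i' where ii: "x = u i" "x' = u i'" "i \<noteq> i'" and d: "det U = 1" "det G = 1"
          unfolding H_def by (elim imageE) (metis (no_types))
        show "4 * R\<^sup>2 < N (tr2 ((U ** word_mat \<rho> x ** G) ** adj2 (U ** word_mat \<rho> x' ** G)))"
          using big[OF ii(3) d] unfolding ii max_less_iff_conj by (rule conjunct2)
        next
        show "finite H" "H \<subseteq> set_pmf (replicate_pmf k m)" using u by (auto simp: H_def)
        show "\<beta> \<le> pmf (replicate_pmf k m) x" if "x \<in> H" for x using that \<beta>(2) by (auto simp: H_def)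
        show "0 \<le> \<beta>" using \<beta>(1) by simp
      qed (fact Suc assms)+
      also have "\<dots> = \<kappa> (Suc j')" using q0 by (simp add: cH \<kappa>_def field_simps)
      finally show ?case by (simp add: add.assoc)
    qed
    have "measure_pmf.prob (replicate_pmf n m) {w. mnrm (word_mat \<rho> w) \<le> R} \<le> \<kappa> j"
      using main[of "mat 1" j] n by simp
    also have "\<kappa> j \<le> \<epsilon>"
    proof -
      have "1 / q \<le> \<epsilon> / 2" using q q0 assms(2) by (simp add: field_simps)
      then show ?thesis using j q\<beta> by (simp add: \<kappa>_def)
    qed
    finally show "measure_pmf.prob (replicate_pmf n m) {w. mnrm (word_mat \<rho> w) \<le> R} \<le> \<epsilon>" .
  qed
qed

text \<open>No \<open>v\<close> is an approximate eigenvector both of \<open>f\<close> and of its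
  conjugate by \<open>h\<close>. Since the conjugate acts on \<open>v\<close> as \<open>f\<close>
  acts on its image under \<open>h\<close>, either the words \<open>f^i\<close> or the words
  \<open>f^i h\<close> move \<open>v\<close> to well separated directions.\<close>

lemma prob_nonconcentration:
  fixes \<eta> :: real
  assumes "0 < \<eta>"
  shows "\<exists>n0. \<exists>r>0. \<forall>n\<ge>n0. \<forall>(N :: 'k::field \<Rightarrow> real) \<rho> y v. sl2_data m B c e f h N \<rho> \<longrightarrow> y \<noteq> 0 \<longrightarrow> v \<noteq> 0 \<longrightarrow>
     measure_pmf.prob (replicate_pmf n m) {w. N (dot2 (y v* word_mat \<rho> w) v)
        \<le> r * absval.nrm N (y v* word_mat \<rho> w) * absval.nrm N v} \<le> \<eta>"
proof -
  obtain q :: nat where q: "4 / \<eta> < q" using reals_Archimedean2 by blast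
  have q0: "0 < q" using q assms by (metis divide_pos_pos of_nat_0_less_iff order_less_trans zero_less_numeral)
  define k where "k = q * length f + length h + 1"
  define u where "u x i = pad e k (wpow f i @ x)" for x i
  \<comment> \<open>Both families together: which one scatters depends on \<open>v\<close> and on
    the representation, while \<beta>, \<open>F\<close> and \<open>b\<close> must not.\<close>
  define X where "X = (\<lambda>(x, i). u x i) ` ({[], h} \<times> {..<q})"
  have u: "u x i \<in> set_pmf (replicate_pmf k m)" if "i < q" "x \<in> {[], h}" for x i
  proof -
    have "i * length f \<le> q * length f" using that by (intro mult_le_mono) auto
    then have "i * length f \<le> q * length f + j" for j by (rule trans_le_add1)
    then show ?thesis unfolding u_def using that set_wpow[OF f] h
      by (intro pad_in_replicate_pmf e) (auto simp: length_wpow k_def intro!: le_SucI)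
  qed
  have X: "finite X" "X \<noteq> {}" "X \<subseteq> set_pmf (replicate_pmf k m)"
    using u q0 by (auto simp: X_def)
  define \<beta> where "\<beta> = Min (pmf (replicate_pmf k m) ` X)"
  have \<beta>: "0 < \<beta>" "\<And>x. x \<in> X \<Longrightarrow> \<beta> \<le> pmf (replicate_pmf k m) x"
    using X by (auto simp: \<beta>_def pmf_positive)
  \<comment> \<open>The letters of an infinite support have no common norm bound. Dropping mass
    \<beta> leaves finitely many words; this costs one more \<beta> per step and moves the fixed
    point to 2/q, hence \<open>4 / \<eta> < q\<close> above.\<close>
  obtain F0 where F0: "finite F0" "F0 \<subseteq> set_pmf (replicate_pmf k m)" "1 - \<beta> \<le> measure_pmf.prob (replicate_pmf k m) F0"
    using finite_almost_full_pmf[OF \<beta>(1)] by blast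
  define F where "F = F0 \<union> X"
  have F: "finite F" "F \<subseteq> set_pmf (replicate_pmf k m)" "1 - \<beta> \<le> measure_pmf.prob (replicate_pmf k m) F"
    using F0 X measure_pmf.finite_measure_mono[of F0 F "replicate_pmf k m"] by (auto simp: F_def)
  define Bw where "Bw w = (\<Prod>g\<leftarrow>w. 2 * B g)" for w
  define b where "b = Max (insert 1 (Bw ` F))"
  have b: "1 \<le> b" "\<And>w. w \<in> F \<Longrightarrow> Bw w \<le> b" using F(1) by (auto simp: b_def)
  define b0 where "b0 = max (Bw f) (max 1 (4 * Bw h * Bw f * Bw h))"
  have b0: "1 \<le> b0" "Bw f \<le> b0" "4 * Bw h * Bw f * Bw h \<le> b0" by (auto simp: b0_def)
  define s where "s = c / (64 * b0 ^ 3)"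
  have s: "0 < s" using c b0 by (simp add: s_def)
  \<comment> \<open>Half of the critical radius in \<open>prob_nonconc_step\<close>, so that the
    strict inequality there holds.\<close>
  define r0 where "r0 = s / (64 * b ^ 4)"
  have r0: "0 < r0" "32 * b ^ 4 * r0 < s" using s b(1) by (auto simp: r0_def)
  have "0 \<le> max 0 (1 - q * \<beta>)" "max 0 (1 - q * \<beta>) < 1" using \<beta>(1) q0 by auto
  then obtain j where j: "max 0 (1 - q * \<beta>) ^ j < \<eta> / 2"
    using power_tendsto_0_obtain[of "max 0 (1 - q * \<beta>)" "\<eta> / 2"] assms by auto
  \<comment> \<open>Each of the \<open>j\<close> steps enlarges the radius by
    \<open>4 * b^2\<close>, and the last one must still be at most \<open>r0\<close>.\<close>
  define r where "r = r0 / (4 * b\<^sup>2) ^ j"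
  have r: "0 < r" using r0 b by (simp add: r_def)
  show ?thesis
  proof (intro exI[of _ "j * k"] exI[of _ r] conjI r allI impI)
    fix n and N :: "'k \<Rightarrow> real" and \<rho> and y v :: "'k^2"
    assume n: "j * k \<le> n" and D: "sl2_data m B c e f h N \<rho>" and yv: "y \<noteq> 0" "v \<noteq> 0"
    interpret absval N using D by (simp add: sl2_data_def)
    let ?f = "word_mat \<rho> f" and ?h = "word_mat \<rho> h"
    have det: "lettersdet m \<rho>" and eq: "\<rho> e = mat 1" and tr: "5/2 \<le> N (tr2 ?f)"
      and cK: "c \<le> N (det (?f ** conj2 ?h ?f - conj2 ?h ?f ** ?f))"
      and Bg: "\<And>g. g \<in> set_pmf m \<Longrightarrow> mnrm (\<rho> g) \<le> B g"
      using D by (auto simp: sl2_data_def)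
    have df: "det ?f = 1" "det ?h = 1" using det f h by (auto intro!: det_word_mat simp: lettersdet_def)
    have Bw: "mnrm (word_mat \<rho> w) \<le> Bw w" if "set w \<subseteq> set_pmf m" for w
      unfolding Bw_def by (rule mnrm_word_mat) (use that Bg in auto)
    have mf: "mnrm ?f \<le> b0" using Bw[OF f] b0 by simp
    have mf': "mnrm (conj2 ?h ?f) \<le> b0"
    proof -
      have "mnrm (conj2 ?h ?f) \<le> 2 * mnrm (adj2 ?h ** ?f) * mnrm ?h" unfolding conj2_def by (rule mnrm_mult)
      also have "\<dots> \<le> 2 * (2 * mnrm ?h * mnrm ?f) * mnrm ?h"
        using mnrm_mult[of "adj2 ?h" ?f] by (intro mult_mono) (auto simp: mnrm_adj2)
      also have "\<dots> \<le> 2 * (2 * Bw h * Bw f) * Bw h"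
        using Bw[OF f] Bw[OF h] order_trans[OF mnrm_nonneg Bw[OF f]] order_trans[OF mnrm_nonneg Bw[OF h]]
        by (intro mult_mono) auto
      finally show ?thesis using b0 by simp
    qed
    have wu: "word_mat \<rho> (u x i) = mat_pow ?f i ** word_mat \<rho> x" for x i
      by (simp add: u_def word_mat_pad[of \<rho> e, OF eq] word_mat_append word_mat_concat_replicate)
    have sep: "\<exists>x\<in>{[], h}. \<forall>i j. i \<noteq> j \<longrightarrow> s * (nrm v)\<^sup>2 \<le> N (wedge (word_mat \<rho> (u x i) *v v) (word_mat \<rho> (u x j) *v v))"
      if "v \<noteq> 0" for v
    proof -
      have "c * (nrm v)\<^sup>2 \<le> 64 * b0 ^ 3 * max (N (wedge v (?f *v v))) (N (wedge v (conj2 ?h ?f *v v)))"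
        by (rule no_common_eigenvector[OF mf mf' that c cK])
      then have mx: "s * (nrm v)\<^sup>2 \<le> max (N (wedge v (?f *v v))) (N (wedge v (conj2 ?h ?f *v v)))"
        using b0(1) unfolding s_def times_divide_eq_left
        by (subst pos_divide_le_eq) (auto simp: mult.commute)
      have "wedge v (conj2 ?h ?f *v v) = wedge (?h *v v) (?h *v (conj2 ?h ?f *v v))"
        using df by (simp only: wedge_mat mult_1_left)
      also have "?h *v (conj2 ?h ?f *v v) = ?f *v (?h *v v)"
        using mult_adj2(1)[OF df(2)] by (simp add: conj2_def matrix_vector_mul_assoc matrix_mul_assoc)
      finally have w: "wedge v (conj2 ?h ?f *v v) = wedge (?h *v v) (?f *v (?h *v v))" .
      obtain x where x: "x \<in> {[], h}" "s * (nrm v)\<^sup>2 \<le> N (wedge (word_mat \<rho> x *v v) (?f *v (word_mat \<rho> x *v v)))"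
      proof (cases "N (wedge v (conj2 ?h ?f *v v)) \<le> N (wedge v (?f *v v))")
        case True
        show ?thesis using mx[unfolded max_absorb1[OF True]] by (intro that[of "[]"]) simp_all
      next
        case False
        then have "N (wedge v (?f *v v)) \<le> N (wedge v (conj2 ?h ?f *v v))" by simp
        from mx[unfolded max_absorb2[OF this], unfolded w] show ?thesis by (intro that[of h]) simp_all
      qed
      let ?v = "word_mat \<rho> x *v v"
      have *: "s * (nrm v)\<^sup>2 \<le> N (wedge (mat_pow ?f i *v ?v) (mat_pow ?f j *v ?v))" if ij: "i < j" for i j
      proof -
        obtain p where p: "j - i = Suc p" using ij by (cases "j - i") auto
        have "s * (nrm v)\<^sup>2 \<le> 1 * N (wedge ?v (?f *v ?v))" using x(2) by (simp only: mult_1_left)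
        also have "\<dots> \<le> N (chebU (tr2 ?f) (j - i)) * N (wedge ?v (?f *v ?v))"
          unfolding p using N_chebU[OF tr] by (intro mult_right_mono) auto
        also have "\<dots> = N (wedge (mat_pow ?f i *v ?v) (mat_pow ?f j *v ?v))"
          unfolding wedge_mat_pow2[OF df(1) less_imp_le[OF that]] N_mult ..
        finally show ?thesis .
      qed
      have sym: "N (wedge a b) = N (wedge b a)" for a b
        unfolding wedge_def using N_diff_commute[of "a$1 * b$2" "a$2 * b$1"] by (simp add: mult.commute)
      have "s * (nrm v)\<^sup>2 \<le> N (wedge (mat_pow ?f i *v ?v) (mat_pow ?f j *v ?v))" if "i \<noteq> j" for i j
      proof (cases "i < j")
        case False
        then have "j < i" using that by simp
        from *[OF this] show ?thesis by (subst sym)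
      qed (rule *)
      then show ?thesis using x(1)
        by (intro bexI[of _ x] allI impI) (simp_all only: wu matrix_vector_mul_assoc[symmetric])
    qed
    have q\<beta>: "q * \<beta> \<le> 1 \<and> (\<forall>v. v \<noteq> 0 \<longrightarrow> (\<exists>H. H \<subseteq> X \<and> card H = q \<and>
      (\<forall>x\<in>H. \<forall>x'\<in>H. x \<noteq> x' \<longrightarrow> s * (nrm v)\<^sup>2 \<le> N (wedge (word_mat \<rho> x *v v) (word_mat \<rho> x' *v v)))))"
    proof -
      have ex: "\<exists>H. H \<subseteq> X \<and> card H = q \<and>
         (\<forall>x\<in>H. \<forall>x'\<in>H. x \<noteq> x' \<longrightarrow> s * (nrm v)\<^sup>2 \<le> N (wedge (word_mat \<rho> x *v v) (word_mat \<rho> x' *v v)))"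
        if v: "v \<noteq> 0" for v
      proof -
        obtain x where x: "x \<in> {[], h}" and
          sx: "\<And>i j. i \<noteq> j \<Longrightarrow> s * (nrm v)\<^sup>2 \<le> N (wedge (word_mat \<rho> (u x i) *v v) (word_mat \<rho> (u x j) *v v))"
          using sep[OF v] by blast
        have "inj_on (u x) {..<q}"
        proof (rule inj_onI, rule ccontr)
          fix i i' assume "u x i = u x i'" "i \<noteq> i'"
          then have "s * (nrm v)\<^sup>2 \<le> N 0" using sx[of i i'] by (simp add: wedge_def)
          moreover have "0 < s * (nrm v)\<^sup>2" using s v by (simp add: nrm_eq_0)
          ultimately show False by simp
        qed
        then have "card (u x ` {..<q}) = q" by (simp add: card_image)
        moreover have "u x ` {..<q} \<subseteq> X" using x by (auto simp: X_def)
        moreover have "\<forall>z\<in>u x ` {..<q}. \<forall>z'\<in>u x ` {..<q}. z \<noteq> z' \<longrightarrow> s * (nrm v)\<^sup>2 \<le> N (wedge (word_mat \<rho> z *v v) (word_mat \<rho> z' *v v))"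
        proof (intro ballI impI)
          fix z z' assume z: "z \<in> u x ` {..<q}" "z' \<in> u x ` {..<q}" "z \<noteq> z'"
          then obtain i i' where "z = u x i" "z' = u x i'" by blast
          with z(3) sx[of i i'] show "s * (nrm v)\<^sup>2 \<le> N (wedge (word_mat \<rho> z *v v) (word_mat \<rho> z' *v v))" by blast
        qed
        ultimately show ?thesis by blast
      qed
      obtain H where HX: "H \<subseteq> X" "card H = q" using ex[OF yv(2)] by blast
      have "real (card H) * \<beta> \<le> 1"
        by (rule prob_pmf_card_le[where p="replicate_pmf k m"]) (use HX \<beta>(2) X(1) finite_subset in auto)
      with ex HX(2) show ?thesis by simp
    qed
    define \<kappa> where "\<kappa> j' = (1 - q * \<beta>) ^ j' + 2 / q" for j'
    have main: "measure_pmf.prob (replicate_pmf ((n - j * k) + j' * k) m)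
         {w. N (dot2 (y v* word_mat \<rho> w) v) \<le> r' * nrm (y v* word_mat \<rho> w) * nrm v} \<le> \<kappa> j'"
      if "v \<noteq> 0" "0 < r'" "r' \<le> r0 / (4 * b\<^sup>2) ^ j'" for v r' j'
      using that
    proof (induction j' arbitrary: v r')
      case 0
      then show ?case using q0 by (auto simp: \<kappa>_def intro: order_trans[OF measure_pmf.prob_le_1])
    next
      case (Suc j')
      have bb: "1 \<le> 4 * b\<^sup>2" using one_le_power[OF b(1), of 2] by linarith
      obtain H where H: "H \<subseteq> X" "card H = q"
        "\<And>x x'. \<lbrakk>x\<in>H; x'\<in>H; x \<noteq> x'\<rbrakk> \<Longrightarrow> s * (nrm v)\<^sup>2 \<le> N (wedge (word_mat \<rho> x *v v) (word_mat \<rho> x' *v v))"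
        using q\<beta>[THEN conjunct2, rule_format, OF Suc.prems(1)] by blast
      have r'r0: "r' \<le> r0"
      proof -
        have "r0 / (4 * b\<^sup>2) ^ Suc j' \<le> r0 / 1"
          using bb r0 one_le_power[OF bb, of "Suc j'"] by (intro divide_left_mono) auto
        then show ?thesis using Suc.prems by simp
      qed
      have "measure_pmf.prob (replicate_pmf (((n - j * k) + j' * k) + k) m)
         {w. N (dot2 (y v* word_mat \<rho> w) v) \<le> r' * nrm (y v* word_mat \<rho> w) * nrm v}
         \<le> (1 - card H * \<beta>) * \<kappa> j' + \<beta> + \<beta>"
      proof (rule prob_nonconc_step[OF det, where F=F and b=b and s=s])
        show "finite H" by (rule finite_subset[OF H(1) X(1)])
        show "H \<subseteq> F" using H(1) by (auto simp: F_def)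
        show "\<beta> \<le> pmf (replicate_pmf k m) x" if "x \<in> H" for x
          by (rule \<beta>(2)[OF subsetD[OF H(1) that]])
        show "mnrm (word_mat \<rho> x) \<le> b" if "x \<in> F" for x
        proof -
          have "set x \<subseteq> set_pmf m" using F(2) that by (auto simp: set_replicate_pmf)
          from Bw[OF this] b(2)[OF that] show ?thesis by linarith
        qed
        show "32 * b ^ 4 * r' < s"
          using r0(2) mult_left_mono[OF r'r0, of "32 * b ^ 4"] b(1) zero_le_power[of b 4] by linarith
        show "measure_pmf.prob (replicate_pmf (n - j * k + j' * k) m)
          {w. N (dot2 (y v* word_mat \<rho> w) v) \<le> 4 * b\<^sup>2 * r' * nrm (y v* word_mat \<rho> w) * nrm v} \<le> \<kappa> j'"
          if "v \<noteq> 0" for v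
        proof (rule Suc.IH[OF that])
          show "0 < 4 * b\<^sup>2 * r'" using b Suc.prems by simp
          have "4 * b\<^sup>2 * r' \<le> 4 * b\<^sup>2 * (r0 / (4 * b\<^sup>2) ^ Suc j')"
            using Suc.prems bb by (intro mult_left_mono) auto
          also have "\<dots> = r0 / (4 * b\<^sup>2) ^ j'" using b(1) by simp
          finally show "4 * b\<^sup>2 * r' \<le> r0 / (4 * b\<^sup>2) ^ j'" .
        qed
        show "0 \<le> \<beta>" "0 \<le> b" using \<beta>(1) b(1) by auto
      qed (fact F H(3) Suc.prems yv)+
      also have "\<dots> = \<kappa> (Suc j')" using q0 by (simp add: H(2) \<kappa>_def field_simps)
      finally show ?case by (simp add: add_ac)
    qed
    have "measure_pmf.prob (replicate_pmf n m) {w. N (dot2 (y v* word_mat \<rho> w) v)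
        \<le> r * nrm (y v* word_mat \<rho> w) * nrm v} \<le> \<kappa> j"
      using main[OF yv(2) r, of j] n by (simp add: r_def)
    also have "\<kappa> j \<le> \<eta>"
    proof -
      have "2 / q \<le> \<eta> / 2" using q q0 assms by (simp add: field_simps)
      then show ?thesis using j q\<beta>[THEN conjunct1] by (simp add: \<kappa>_def)
    qed
    finally show "measure_pmf.prob (replicate_pmf n m) {w. N (dot2 (y v* word_mat \<rho> w) v)
        \<le> r * nrm (y v* word_mat \<rho> w) * nrm v} \<le> \<eta>" .
  qed
qed

end

text \<open>A point of the line seen as a seminorm on linear forms: the absolute value of the
  pairing with \<open>v\<close> for a classical point, the values on linear polynomials for a
  Berkovich point. One estimate then covers every starting point.\<close>

definition row_seminorm :: "('k::field \<Rightarrow> real) \<Rightarrow> ('k^2 \<Rightarrow> real) \<Rightarrow> bool" where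
  "row_seminorm N H \<longleftrightarrow> (\<forall>y. 0 \<le> H y) \<and> (\<forall>y z. H (y + z) \<le> H y + H z) \<and> (\<forall>c y. H (c *s y) = N c * H y)
     \<and> (H (axis 1 1) \<noteq> 0 \<or> H (axis 2 1) \<noteq> 0)"

definition row_size :: "('k::field^2 \<Rightarrow> real) \<Rightarrow> real" where
  "row_size H = max (H (axis 1 1)) (H (axis 2 1))"

lemma row_size_pos: "row_seminorm N H \<Longrightarrow> 0 < row_size H"
  unfolding row_seminorm_def row_size_def less_max_iff_disj by (metis order_less_le)

lemma axis_vec_mat: "axis i 1 v* W = (W::'k::comm_ring_1^2^2) $ i"
  using exhaust_2[of i] by (auto simp: vec_eq_iff axis_def)

text \<open>Cramer's rule again: both unit rows, multiplied by \<open>wedge y z\<close>, are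
  combinations of \<open>y\<close> and \<open>z\<close>. So two independent rows cannot both be
  small for \<open>H\<close>.\<close>

lemma (in absval) row_seminorm_wedge:
  assumes "row_seminorm N H"
  shows "N (wedge y z) * row_size H \<le> nrm z * H y + nrm y * H z"
proof -
  have h: "\<And>y. 0 \<le> H y" "\<And>y z. H (y + z) \<le> H y + H z" "\<And>c y. H (c *s y) = N c * H y"
    using assms by (auto simp: row_seminorm_def)
  have 1: "wedge y z *s axis 1 1 = z$2 *s y + (- y$2) *s z"
    by (simp add: vec_eq_iff forall_2 axis_def wedge_def algebra_simps)
  have 2: "wedge y z *s axis 2 1 = (- z$1) *s y + y$1 *s z"
    by (simp add: vec_eq_iff forall_2 axis_def wedge_def algebra_simps)
  have "N (wedge y z) * H (axis 1 1) \<le> N (z$2) * H y + N (y$2) * H z"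
    using h(2)[of "z$2 *s y" "(- y$2) *s z"] unfolding 1[symmetric] h(3) by simp
  moreover have "N (wedge y z) * H (axis 2 1) \<le> N (z$1) * H y + N (y$1) * H z"
    using h(2)[of "(- z$1) *s y" "y$1 *s z"] unfolding 2[symmetric] h(3) by simp
  moreover have "N (z$i) * H y + N (y$i) * H z \<le> nrm z * H y + nrm y * H z" for i
    by (intro add_mono mult_right_mono N_le_nrm h)
  ultimately have "N (wedge y z) * H (axis 1 1) \<le> nrm z * H y + nrm y * H z"
    "N (wedge y z) * H (axis 2 1) \<le> nrm z * H y + nrm y * H z" by (blast intro: order_trans)+
  then show ?thesis by (simp add: row_size_def max_def)
qed

text \<open>If no word makes row \<open>i\<close> too small for \<open>H\<close>, that row causes no
  loss. Otherwise fix one such row \<open>z\<close>: every other bad row is nearly proportional to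
  \<open>z\<close>, so its pairing with the vector orthogonal to \<open>z\<close> is small, which is
  unlikely by \<open>prob_nonconcentration\<close>. Thus \<open>H\<close> is comparable with the
  norm on both rows, and the norm is large.\<close>

lemma random_product_growth:
  fixes R \<epsilon> :: real
  assumes "e \<in> set_pmf m" "set f \<subseteq> set_pmf m" "set h \<subseteq> set_pmf m" "0 < c" "0 < R" "0 < \<epsilon>"
  shows "\<exists>n0. \<forall>n\<ge>n0. \<forall>(N :: 'k::field \<Rightarrow> real) \<rho> H. sl2_data m B c e f h N \<rho> \<longrightarrow> row_seminorm N H \<longrightarrow>
     measure_pmf.prob (replicate_pmf n m)
       {w. max (H (word_mat \<rho> w $ 1)) (H (word_mat \<rho> w $ 2)) \<le> R * row_size H} \<le> \<epsilon>"
proof -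
  define \<eta> where "\<eta> = \<epsilon> / 3"
  have \<eta>: "0 < \<eta>" using assms by (simp add: \<eta>_def)
  obtain n1 r where r: "0 < r" and n1: "\<And>n (N :: 'k \<Rightarrow> real) \<rho> y v. \<lbrakk>n1 \<le> n; sl2_data m B c e f h N \<rho>; y \<noteq> 0; v \<noteq> 0\<rbrakk> \<Longrightarrow>
     measure_pmf.prob (replicate_pmf n m) {w. N (dot2 (y v* word_mat \<rho> w) v)
        \<le> r * absval.nrm N (y v* word_mat \<rho> w) * absval.nrm N v} \<le> \<eta>"
    using prob_nonconcentration[OF assms(1-4) \<eta>, of B, where 'k='k] by blast
  \<comment> \<open>The comparison of a bad row with the reference row adds two terms of this
    size.\<close>
  define r' where "r' = r / 2"
  have r': "0 < r'" using r by (simp add: r'_def)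
  have R': "0 \<le> R / r'" using assms r' by simp
  obtain n2 where n2: "\<And>n (N :: 'k \<Rightarrow> real) \<rho>. \<lbrakk>n2 \<le> n; sl2_data m B c e f h N \<rho>\<rbrakk> \<Longrightarrow>
     measure_pmf.prob (replicate_pmf n m) {w. absval.mnrm N (word_mat \<rho> w) \<le> R / r'} \<le> \<eta>"
    using prob_mnrm_small[OF assms(1-4) R' \<eta>, of B, where 'k='k] by blast
  show ?thesis
  proof (intro exI[of _ "max n1 n2"] allI impI)
    fix n and N :: "'k \<Rightarrow> real" and \<rho> H
    assume n: "max n1 n2 \<le> n" and D: "sl2_data m B c e f h N \<rho>" and H: "row_seminorm N H"
    interpret absval N using D by (simp add: sl2_data_def)
    have det: "lettersdet m \<rho>" using D by (simp add: sl2_data_def)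
    let ?P = "measure_pmf.prob (replicate_pmf n m)"
    have dir: "?P {w. H (word_mat \<rho> w $ i) \<le> r' * nrm (word_mat \<rho> w $ i) * row_size H} \<le> \<eta>" (is "?P {w. ?E w} \<le> \<eta>") for i
    proof (cases "\<exists>w\<in>set_pmf (replicate_pmf n m). ?E w")
      case False
      then have "?P {w. ?E w} \<le> ?P {w. False}" by (intro prob_le_if_supp) blast
      then show ?thesis using \<eta> by simp
    next
      case True
      then obtain w0 where w0: "w0 \<in> set_pmf (replicate_pmf n m)" "?E w0" by blast
      define z where "z = word_mat \<rho> w0 $ i"
      define v :: "'k^2" where "v = vector [z$2, - z$1]"
      have ax: "axis i (1::'k) \<noteq> 0" by simp
      have z: "z \<noteq> 0" using vec_mat_nonzero[OF det_word_mat_rep[OF det w0(1)] ax] by (simp add: axis_vec_mat z_def)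
      have vz: "nrm v = nrm z" by (simp add: nrm_def v_def max.commute)
      have v: "v \<noteq> 0" using z vz by (metis nrm_eq_0)
      have dw: "dot2 y v = wedge y z" for y by (simp add: dot2_def wedge_def v_def)
      have "?P {w. ?E w} \<le> ?P {w. N (dot2 (axis i 1 v* word_mat \<rho> w) v) \<le> r * nrm (axis i 1 v* word_mat \<rho> w) * nrm v}"
      proof (rule prob_le_if_supp)
        fix w assume E: "?E w"
        let ?y = "word_mat \<rho> w $ i"
        have "N (wedge ?y z) * row_size H \<le> nrm z * H ?y + nrm ?y * H z"
          by (rule row_seminorm_wedge[OF H])
        also have "\<dots> \<le> nrm z * (r' * nrm ?y * row_size H) + nrm ?y * (r' * nrm z * row_size H)"
          using E w0(2) by (intro add_mono mult_left_mono) (auto simp: z_def)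
        also have "\<dots> = (r * nrm ?y * nrm z) * row_size H" by (simp add: r'_def algebra_simps)
        finally show "N (dot2 (axis i 1 v* word_mat \<rho> w) v) \<le> r * nrm (axis i 1 v* word_mat \<rho> w) * nrm v"
          using row_size_pos[OF H] by (simp add: dw vz axis_vec_mat)
      qed
      also have "\<dots> \<le> \<eta>" using n by (intro n1 D v ax) simp
      finally show ?thesis .
    qed
    have "?P {w. max (H (word_mat \<rho> w $ 1)) (H (word_mat \<rho> w $ 2)) \<le> R * row_size H}
      \<le> ?P (({w. H (word_mat \<rho> w $ 1) \<le> r' * nrm (word_mat \<rho> w $ 1) * row_size H}
          \<union> {w. H (word_mat \<rho> w $ 2) \<le> r' * nrm (word_mat \<rho> w $ 2) * row_size H})
          \<union> {w. mnrm (word_mat \<rho> w) \<le> R / r'})" (is "_ \<le> ?P ((?A \<union> ?B) \<union> ?C)")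
    proof (rule measure_pmf.finite_measure_mono, rule subsetI)
      fix w assume "w \<in> {w. max (H (word_mat \<rho> w $ 1)) (H (word_mat \<rho> w $ 2)) \<le> R * row_size H}"
      then have w: "H (word_mat \<rho> w $ i) \<le> R * row_size H" for i using exhaust_2[of i] by auto
      show "w \<in> (?A \<union> ?B) \<union> ?C"
      proof (rule ccontr)
        assume a: "w \<notin> (?A \<union> ?B) \<union> ?C"
        obtain i where i: "mnrm (word_mat \<rho> w) = nrm (word_mat \<rho> w $ i)" by (metis max_def mnrm_def)
        have "r' * nrm (word_mat \<rho> w $ i) * row_size H < H (word_mat \<rho> w $ i)"
          using a exhaust_2[of i] by auto
        also have "\<dots> \<le> R * row_size H" by (rule w)
        finally have "r' * nrm (word_mat \<rho> w $ i) < R" using row_size_pos[OF H] by simp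
        moreover have "R / r' < nrm (word_mat \<rho> w $ i)" using a i by auto
        ultimately show False using r' by (simp add: field_simps)
      qed
    qed simp
    also have "\<dots> \<le> (?P ?A + ?P ?B) + ?P ?C"
      by (rule order_trans[OF measure_Un_le]) (auto intro: measure_Un_le)
    also have "\<dots> \<le> (\<eta> + \<eta>) + \<eta>" using n by (intro add_mono dir n2 D) auto
    finally show "?P {w. max (H (word_mat \<rho> w $ 1)) (H (word_mat \<rho> w $ 2)) \<le> R * row_size H} \<le> \<epsilon>"
      by (simp add: \<eta>_def)
  qed
qed

section \<open>Limit points of contracting walks\<close>

lemma space_borel_of [simp]: "space (borel_of T) = topspace T"
  by (simp add: borel_of_def space_measure_of_conv)

lemma sets_borel_of: "sets (borel_of T) = sigma_sets (topspace T) {U. openin T U}"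
  unfolding borel_of_def by (rule sets_measure_of) (auto dest: openin_subset)

lemma borel_of_open: "openin T U \<Longrightarrow> U \<in> sets (borel_of T)"
  by (simp add: sets_borel_of)

lemma measurable_borel_ofI:
  assumes "\<And>x. x \<in> space M \<Longrightarrow> f x \<in> topspace T"
    and "\<And>U. openin T U \<Longrightarrow> f -` U \<inter> space M \<in> sets M"
  shows "f \<in> measurable M (borel_of T)"
  unfolding borel_of_def
  by (rule measurable_measure_of) (use assms in \<open>auto dest: openin_subset\<close>)

lemma continuous_map_measurable:
  assumes "continuous_map X Y f"
  shows "f \<in> measurable (borel_of X) (borel_of Y)"
proof (rule measurable_borel_ofI)
  show "f x \<in> topspace Y" if "x \<in> space (borel_of X)" for x
    using that assms by (auto simp: continuous_map_def)
  show "f -` U \<inter> space (borel_of X) \<in> sets (borel_of X)" if "openin Y U" for U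
  proof -
    have "f -` U \<inter> space (borel_of X) = {x \<in> topspace X. f x \<in> U}" by auto
    then show ?thesis using openin_continuous_map_preimage[OF assms that] borel_of_open by metis
  qed
qed

lemma borel_of_euclidean: "sets (borel_of (euclidean :: 'a::topological_space topology)) = sets borel"
  by (simp add: sets_borel_of borel_def open_openin[symmetric])

text \<open>The first letter acts last. Appending letters therefore changes the starting point and
  leaves the outer maps alone, and this is the order in which the points converge.\<close>

definition word_act :: "('a \<Rightarrow> 'x \<Rightarrow> 'x) \<Rightarrow> 'a list \<Rightarrow> 'x \<Rightarrow> 'x" where
  "word_act act w x = foldr act w x"

lemma word_act_simps [simp]:
  "word_act act [] x = x" "word_act act (g # w) x = act g (word_act act w x)"
  "word_act act (u @ w) x = word_act act u (word_act act w x)"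
  by (simp_all add: word_act_def)

text \<open>Finite words are the prefixes of an infinite i.i.d. stream. Any condition on a prefix is
  measurable because the letters are countable.\<close>

lemma emeasure_stake:
  fixes m :: "'a::countable pmf"
  shows "emeasure (stream_space (measure_pmf m)) {\<omega>. P (stake n \<omega>)} = emeasure (replicate_pmf n m) {w. P w}"
    and "{\<omega>. P (stake n \<omega>)} \<in> sets (stream_space (measure_pmf m))"
proof -
  have sp: "space (stream_space (measure_pmf m)) = UNIV"
    by (simp add: space_stream_space)
  have "stake n \<in> measurable (stream_space (measure_pmf m)) (count_space UNIV)" for n
    using measurable_stake[of n, where 'a='a]
    by (subst measurable_cong_sets[OF sets_stream_space_cong[OF sets_measure_pmf_count_space] refl])
  then have meas: "{\<omega>. P (stake n \<omega>)} \<in> sets (stream_space (measure_pmf m))" for n P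
    using measurable_sets[of "stake n" "stream_space (measure_pmf m)" "count_space UNIV" "{w. P w}"]
    by (simp add: sp vimage_def)
  then show "{\<omega>. P (stake n \<omega>)} \<in> sets (stream_space (measure_pmf m))" .
  show "emeasure (stream_space (measure_pmf m)) {\<omega>. P (stake n \<omega>)} = emeasure (replicate_pmf n m) {w. P w}"
  proof (induction n arbitrary: P)
    case 0
    interpret prob_space "stream_space (measure_pmf m)"
      by (rule prob_space.prob_space_stream_space[OF prob_space_measure_pmf])
    show ?case using emeasure_space_1 by (auto simp: sp indicator_def)
  next
    case (Suc n)
    have "emeasure (stream_space (measure_pmf m)) {\<omega>. P (stake (Suc n) \<omega>)}
       = (\<integral>\<^sup>+g. emeasure (stream_space (measure_pmf m)) {\<omega>. P (g # stake n \<omega>)} \<partial>measure_pmf m)"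
      by (subst prob_space.emeasure_stream_space[OF prob_space_measure_pmf meas]) (simp add: sp)
    also have "\<dots> = (\<integral>\<^sup>+g. emeasure (replicate_pmf n m) {w. P (g # w)} \<partial>measure_pmf m)"
      by (rule nn_integral_cong) (rule Suc.IH[of "\<lambda>w. P (_ # w)"])
    also have "\<dots> = emeasure (replicate_pmf (Suc n) m) {w. P w}"
      by (simp add: map_pmf_def[symmetric] vimage_def)
    finally show ?case .
  qed
qed

text \<open>The type \<open>'x\<close> holds the classical points, with the chordal distance \<open>d\<close>; \<open>T\<close> is the space that
  carries the stationary measures, into which they embed by \<open>\<iota>\<close>, and \<open>D\<close> extends \<open>d\<close> to it. The two
  spaces differ only for the Berkovich line.\<close>
locale boundary_walk =
  fixes m :: "'a::countable pmf"
    and act :: "'a \<Rightarrow> 'x \<Rightarrow> 'x" and d :: "'x \<Rightarrow> 'x \<Rightarrow> real" and x0 :: 'x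
    and T :: "'y topology" and act' :: "'a \<Rightarrow> 'y \<Rightarrow> 'y" and \<iota> :: "'x \<Rightarrow> 'y"
    and D :: "'y \<Rightarrow> 'x \<Rightarrow> real"
  assumes d_nonneg [simp]: "0 \<le> d x z"
    and d_refl [simp]: "d x x = 0"
    and d_sym: "d x z = d z x"
    and d_triangle: "d x z \<le> d x u + d u z"
    and d_complete: "(\<And>\<epsilon>::real. 0 < \<epsilon> \<Longrightarrow> \<exists>K. \<forall>i\<ge>K. \<forall>j\<ge>K. d (s i) (s j) < \<epsilon>) \<Longrightarrow> \<exists>l. (\<lambda>n. d (s n) l) \<longlonglongrightarrow> 0"
    and act_Lipschitz: "\<exists>L. \<forall>x y. d (act g x) (act g y) \<le> L * d x y"
    and \<iota>_in: "\<iota> x \<in> topspace T"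
    and \<iota>_act: "\<iota> (act g x) = act' g (\<iota> x)"
    and act'_measurable: "act' g \<in> measurable (borel_of T) (borel_of T)"
    and D_\<iota>: "D (\<iota> x) z = d x z"
    and D_nonneg: "y \<in> topspace T \<Longrightarrow> 0 \<le> D y z"
    and D_triangle: "y \<in> topspace T \<Longrightarrow> D y z \<le> D y x + d x z"
    and D_triangle2: "y \<in> topspace T \<Longrightarrow> d x z \<le> D y x + D y z"
    and D_eq_0: "y \<in> topspace T \<Longrightarrow> D y z = 0 \<Longrightarrow> y = \<iota> z"
    and D_ball_open: "openin T {y \<in> topspace T. D y z < r}"
    and D_ball_basis: "openin T U \<Longrightarrow> \<iota> z \<in> U \<Longrightarrow> \<exists>r>0. {y \<in> topspace T. D y z < r} \<subseteq> U"
    and contraction: "0 < \<eta> \<Longrightarrow> \<exists>n0. \<forall>n\<ge>n0. \<forall>y\<in>topspace T.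
       measure_pmf.prob (replicate_pmf n m) {w. \<eta> < D (word_act act' w y) (word_act act w x0)} \<le> \<eta>"
begin

abbreviation \<Omega> :: "'a stream measure" where "\<Omega> \<equiv> stream_space (measure_pmf m)"

sublocale \<Omega>: prob_space \<Omega>
  by (rule prob_space.prob_space_stream_space[OF prob_space_measure_pmf])

lemma space_\<Omega> [simp]: "space \<Omega> = UNIV"
  by (simp add: space_stream_space)

lemma sets_stake: "{\<omega>. P (stake n \<omega>)} \<in> sets \<Omega>"
  by (rule emeasure_stake)

lemma prob_stake: "\<Omega>.prob {\<omega>. P (stake n \<omega>)} = measure_pmf.prob (replicate_pmf n m) {w. P w}"
  by (simp add: measure_def emeasure_stake)

lemma sets_finite_dep:
  assumes "\<And>\<omega> \<omega>'. stake n \<omega> = stake n \<omega>' \<Longrightarrow> P \<omega> = P \<omega>'"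
  shows "{\<omega>. P \<omega>} \<in> sets \<Omega>"
proof -
  have "{\<omega>. P \<omega>} = {\<omega>. \<exists>\<omega>'. stake n \<omega>' = stake n \<omega> \<and> P \<omega>'}" using assms by blast
  also have "\<dots> \<in> sets \<Omega>" by (rule sets_stake[of "\<lambda>w. \<exists>\<omega>'. stake n \<omega>' = w \<and> P \<omega>'"])
  finally show ?thesis .
qed

section \<open>Almost sure convergence along sparse times\<close>

lemma word_act'_in: "y \<in> topspace T \<Longrightarrow> word_act act' w y \<in> topspace T"
  by (induction w) (use measurable_space[OF act'_measurable] in auto)

lemma word_act_\<iota>: "\<iota> (word_act act w x) = word_act act' w (\<iota> x)"
  by (induction w) (simp_all add: \<iota>_act)

text \<open>The letters after position \<open>n\<close> merely replace the starting point
  \<open>x0\<close> by another one, and the contraction bound is the same for all starting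
  points.\<close>

lemma increment_prob_le:
  assumes "\<And>y. y \<in> topspace T \<Longrightarrow>
       measure_pmf.prob (replicate_pmf n m) {w. \<delta> < D (word_act act' w y) (word_act act w x0)} \<le> \<eta>"
  shows "measure_pmf.prob (replicate_pmf (n + b) m)
     {w. \<delta> < d (word_act act w x0) (word_act act (take n w) x0)} \<le> \<eta>"
proof -
  let ?E = "\<lambda>w. \<delta> < d (word_act act w x0) (word_act act (take n w) x0)"
  have "measure_pmf.prob (replicate_pmf n m) {u. ?E (u @ w)} \<le> \<eta>" for w
  proof -
    have "measure_pmf.prob (replicate_pmf n m) {u. ?E (u @ w)} \<le> measure_pmf.prob (replicate_pmf n m)
        {u. \<delta> < D (word_act act' u (\<iota> (word_act act w x0))) (word_act act u x0)}"
      by (rule prob_le_if_supp) (auto simp: set_replicate_pmf word_act_\<iota>[symmetric] D_\<iota>)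
    also have "\<dots> \<le> \<eta>" by (rule assms[OF \<iota>_in])
    finally show ?thesis .
  qed
  then have "measure_pmf.expectation (replicate_pmf b m) (\<lambda>w. measure_pmf.prob (replicate_pmf n m) {u. ?E (u @ w)}) \<le> \<eta>"
    by (intro measure_pmf.integral_le_const measure_pmf.integrable_const_bound[where B=1]) auto
  then show ?thesis by (simp only: prob_append')
qed

lemma contraction_increment:
  assumes "0 < \<eta>"
  shows "\<exists>n0. \<forall>n\<ge>n0. \<forall>b. measure_pmf.prob (replicate_pmf (n + b) m)
     {w. \<eta> < d (word_act act w x0) (word_act act (take n w) x0)} \<le> \<eta>"
proof -
  obtain n0 where n0: "\<And>n y. n0 \<le> n \<Longrightarrow> y \<in> topspace T \<Longrightarrow>
       measure_pmf.prob (replicate_pmf n m) {w. \<eta> < D (word_act act' w y) (word_act act w x0)} \<le> \<eta>"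
    using contraction[OF assms] by blast
  show ?thesis by (intro exI[of _ n0] allI impI increment_prob_le n0)
qed

definition thr :: "nat \<Rightarrow> nat" where
  "thr k = (SOME n0. (\<forall>n\<ge>n0. \<forall>b. measure_pmf.prob (replicate_pmf (n + b) m)
     {w. (1/2)^k < d (word_act act w x0) (word_act act (take n w) x0)} \<le> (1/2)^k) \<and>
     (\<forall>n\<ge>n0. \<forall>y\<in>topspace T. measure_pmf.prob (replicate_pmf n m)
        {w. (1/2)^k < D (word_act act' w y) (word_act act w x0)} \<le> (1/2)^k))"

lemma thr:
  assumes "thr k \<le> n"
  shows "measure_pmf.prob (replicate_pmf (n + b) m)
     {w. (1/2)^k < d (word_act act w x0) (word_act act (take n w) x0)} \<le> (1/2)^k"
    and "y \<in> topspace T \<Longrightarrow> measure_pmf.prob (replicate_pmf n m)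
        {w. (1/2)^k < D (word_act act' w y) (word_act act w x0)} \<le> (1/2)^k"
proof -
  have p: "0 < (1/2::real)^k" by simp
  obtain a where a: "\<forall>n\<ge>a. \<forall>b. measure_pmf.prob (replicate_pmf (n + b) m)
     {w. (1/2)^k < d (word_act act w x0) (word_act act (take n w) x0)} \<le> (1/2)^k"
    using contraction_increment[OF p] by blast
  obtain c where c: "\<forall>n\<ge>c. \<forall>y\<in>topspace T. measure_pmf.prob (replicate_pmf n m)
        {w. (1/2)^k < D (word_act act' w y) (word_act act w x0)} \<le> (1/2)^k"
    using contraction[OF p] by blast
  have "\<exists>n0. (\<forall>n\<ge>n0. \<forall>b. measure_pmf.prob (replicate_pmf (n + b) m)
     {w. (1/2)^k < d (word_act act w x0) (word_act act (take n w) x0)} \<le> (1/2)^k) \<and>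
     (\<forall>n\<ge>n0. \<forall>y\<in>topspace T. measure_pmf.prob (replicate_pmf n m)
        {w. (1/2)^k < D (word_act act' w y) (word_act act w x0)} \<le> (1/2)^k)"
    using a c by (intro exI[of _ "max a c"]) simp
  from someI_ex[OF this, folded thr_def] assms
  show "measure_pmf.prob (replicate_pmf (n + b) m)
     {w. (1/2)^k < d (word_act act w x0) (word_act act (take n w) x0)} \<le> (1/2)^k"
    and "y \<in> topspace T \<Longrightarrow> measure_pmf.prob (replicate_pmf n m)
        {w. (1/2)^k < D (word_act act' w y) (word_act act w x0)} \<le> (1/2)^k" by blast+
qed

text \<open>Sums of thresholds: the times increase strictly and \<open>tm k\<close> passes
  \<open>thr k\<close>, so the failure probabilities \<open>(1/2)^k\<close> along them are
  summable.\<close>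

definition tm :: "nat \<Rightarrow> nat" where "tm k = (\<Sum>i\<le>k. Suc (thr i))"

lemma tm_Suc: "tm (Suc k) = tm k + Suc (thr (Suc k))"
  by (simp add: tm_def)

lemma thr_le_tm: "thr k \<le> tm k"
  by (cases k) (simp_all add: tm_def)

lemma le_tm: "k \<le> tm k"
  by (induction k) (simp_all add: tm_Suc)

definition Y :: "nat \<Rightarrow> 'a stream \<Rightarrow> 'x" where
  "Y k \<omega> = word_act act (stake (tm k) \<omega>) x0"

text \<open>One letter more than \<open>Y\<close>: this is the first letter applied to
  \<open>Y k\<close> of the shifted stream, which later makes the limit point equivariant.\<close>

definition Y' :: "nat \<Rightarrow> 'a stream \<Rightarrow> 'x" where
  "Y' k \<omega> = word_act act (stake (Suc (tm k)) \<omega>) x0"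

lemma AE_eventually_if_small:
  assumes "\<And>k. {\<omega>. P k \<omega>} \<in> sets \<Omega>" "\<And>k. \<Omega>.prob {\<omega>. P k \<omega>} \<le> (1/2)^k"
  shows "AE \<omega> in \<Omega>. eventually (\<lambda>k. \<not> P k \<omega>) sequentially"
proof -
  have "summable (\<lambda>k. \<Omega>.prob {\<omega>. P k \<omega>})"
    by (rule summable_comparison_test'[where g="\<lambda>k. (1/2)^k" and N=0]) (use assms in \<open>auto intro: summable_geometric\<close>)
  moreover have "emeasure \<Omega> {\<omega>. P k \<omega>} < \<infinity>" for k
    by (simp add: \<Omega>.emeasure_eq_measure)
  ultimately show ?thesis using borel_cantelli_AE1[OF assms(1)] by simp
qed

lemma AE_increment: "AE \<omega> in \<Omega>. eventually (\<lambda>k. d (Y (Suc k) \<omega>) (Y k \<omega>) \<le> (1/2)^k) sequentially"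
  and AE_increment': "AE \<omega> in \<Omega>. eventually (\<lambda>k. d (Y' k \<omega>) (Y k \<omega>) \<le> (1/2)^k) sequentially"
proof -
  have *: "AE \<omega> in \<Omega>. eventually (\<lambda>k. d (word_act act (stake (tm k + b k) \<omega>) x0) (Y k \<omega>) \<le> (1/2)^k) sequentially" for b
  proof -
    have eq: "{\<omega>. (1/2)^k < d (word_act act (stake (tm k + b k) \<omega>) x0) (Y k \<omega>)}
      = {\<omega>. (1/2)^k < d (word_act act (stake (tm k + b k) \<omega>) x0) (word_act act (take (tm k) (stake (tm k + b k) \<omega>)) x0)}" for k
      by (simp add: Y_def take_stake min_def)
    have "AE \<omega> in \<Omega>. eventually (\<lambda>k. \<not> (1/2)^k < d (word_act act (stake (tm k + b k) \<omega>) x0) (Y k \<omega>)) sequentially"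
    proof (rule AE_eventually_if_small)
      show "{\<omega>. (1/2)^k < d (word_act act (stake (tm k + b k) \<omega>) x0) (Y k \<omega>)} \<in> sets \<Omega>" for k
        unfolding eq by (rule sets_stake[of "\<lambda>w. (1/2)^k < d (word_act act w x0) (word_act act (take (tm k) w) x0)"])
      show "\<Omega>.prob {\<omega>. (1/2)^k < d (word_act act (stake (tm k + b k) \<omega>) x0) (Y k \<omega>)} \<le> (1/2)^k" for k
        unfolding eq prob_stake[of "\<lambda>w. (1/2)^k < d (word_act act w x0) (word_act act (take (tm k) w) x0)"]
        by (rule thr(1)[OF thr_le_tm])
    qed
    then show ?thesis by (simp add: not_less)
  qed
  show "AE \<omega> in \<Omega>. eventually (\<lambda>k. d (Y (Suc k) \<omega>) (Y k \<omega>) \<le> (1/2)^k) sequentially"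
    using *[of "\<lambda>k. Suc (thr (Suc k))"] by (simp add: Y_def tm_Suc)
  show "AE \<omega> in \<Omega>. eventually (\<lambda>k. d (Y' k \<omega>) (Y k \<omega>) \<le> (1/2)^k) sequentially"
    using *[of "\<lambda>k. 1"] by (simp add: Y'_def)
qed

lemma AE_near:
  assumes "y \<in> topspace T"
  shows "AE \<omega> in \<Omega>. eventually (\<lambda>k. D (word_act act' (stake (tm k) \<omega>) y) (Y k \<omega>) \<le> (1/2)^k) sequentially"
proof -
  have "AE \<omega> in \<Omega>. eventually (\<lambda>k. \<not> (1/2)^k < D (word_act act' (stake (tm k) \<omega>) y) (Y k \<omega>)) sequentially"
  proof (rule AE_eventually_if_small)
    show "{\<omega>. (1/2)^k < D (word_act act' (stake (tm k) \<omega>) y) (Y k \<omega>)} \<in> sets \<Omega>" for k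
      unfolding Y_def by (rule sets_stake)
    show "\<Omega>.prob {\<omega>. (1/2)^k < D (word_act act' (stake (tm k) \<omega>) y) (Y k \<omega>)} \<le> (1/2)^k" for k
      unfolding Y_def prob_stake[of "\<lambda>w. (1/2)^k < D (word_act act' w y) (word_act act w x0)"]
      by (rule thr(2)[OF thr_le_tm assms])
  qed
  then show ?thesis by (simp add: not_less)
qed

text \<open>Eventual geometric decay instead of mere convergence: it is a countable combination of
  conditions on finitely many letters, hence measurable.\<close>

definition good :: "'a stream \<Rightarrow> bool" where
  "good \<omega> \<longleftrightarrow> (\<exists>K. \<forall>k\<ge>K. d (Y (Suc k) \<omega>) (Y k \<omega>) \<le> (1/2)^k)"

text \<open>The value \<open>x0\<close> on the null set of other streams lets measurability be
  proved for the total function.\<close>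

definition \<xi> :: "'a stream \<Rightarrow> 'x" where
  "\<xi> \<omega> = (if good \<omega> then SOME l. (\<lambda>k. d (Y k \<omega>) l) \<longlonglongrightarrow> 0 else x0)"

lemma good_convergent:
  assumes "good \<omega>"
  shows "(\<lambda>k. d (Y k \<omega>) (\<xi> \<omega>)) \<longlonglongrightarrow> 0"
proof -
  obtain K where K: "\<And>k. K \<le> k \<Longrightarrow> d (Y (Suc k) \<omega>) (Y k \<omega>) \<le> (1/2)^k"
    using assms by (auto simp: good_def)
  \<comment> \<open>The right side is the exact sum of the geometric series from \<open>k\<close> to
    \<open>k + i - 1\<close>.\<close>
  have step: "d (Y (k + i) \<omega>) (Y k \<omega>) \<le> 2 * (1/2)^k - 2 * (1/2)^(k + i)" if "K \<le> k" for k i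
  proof (induction i)
    case (Suc i)
    have "d (Y (k + Suc i) \<omega>) (Y k \<omega>) \<le> d (Y (Suc (k + i)) \<omega>) (Y (k + i) \<omega>) + d (Y (k + i) \<omega>) (Y k \<omega>)"
      using d_triangle by simp
    also have "\<dots> \<le> (1/2)^(k + i) + (2 * (1/2)^k - 2 * (1/2)^(k + i))"
      using K[of "k + i"] Suc that by (intro add_mono) auto
    finally show ?case by simp
  qed simp
  have "\<exists>l. (\<lambda>k. d (Y k \<omega>) l) \<longlonglongrightarrow> 0"
  proof (rule d_complete)
    fix \<epsilon> :: real assume "0 < \<epsilon>"
    then obtain k0 where k0: "(1/2::real)^k0 < \<epsilon> / 4"
      using power_tendsto_0_obtain[of "1/2" "\<epsilon>/4"] by auto
    define k where "k = max K k0"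
    have "(1/2::real)^k \<le> (1/2)^k0" unfolding k_def by (intro power_decreasing) auto
    with k0 have ke: "(1/2::real)^k < \<epsilon> / 4" by linarith
    have near: "d (Y i \<omega>) (Y k \<omega>) \<le> 2 * (1/2)^k" if ki: "k \<le> i" for i
    proof -
      obtain j where i: "i = k + j" using le_Suc_ex[OF ki] by blast
      have "d (Y (k + j) \<omega>) (Y k \<omega>) \<le> 2 * (1/2)^k - 2 * (1/2)^(k + j)" by (rule step) (simp add: k_def)
      moreover have "0 \<le> 2 * (1/2::real)^(k + j)" by simp
      ultimately show ?thesis unfolding i by linarith
    qed
    show "\<exists>K. \<forall>i\<ge>K. \<forall>j\<ge>K. d (Y i \<omega>) (Y j \<omega>) < \<epsilon>"
    proof (intro exI[of _ k] allI impI)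
      fix i j assume "k \<le> i" "k \<le> j"
      have "d (Y i \<omega>) (Y j \<omega>) \<le> d (Y i \<omega>) (Y k \<omega>) + d (Y k \<omega>) (Y j \<omega>)" by (rule d_triangle)
      also have "d (Y k \<omega>) (Y j \<omega>) = d (Y j \<omega>) (Y k \<omega>)" by (rule d_sym)
      finally show "d (Y i \<omega>) (Y j \<omega>) < \<epsilon>" using near[OF \<open>k \<le> i\<close>] near[OF \<open>k \<le> j\<close>] ke by linarith
    qed
  qed
  from someI_ex[OF this] show ?thesis unfolding \<xi>_def using assms by simp
qed

lemma AE_good: "AE \<omega> in \<Omega>. good \<omega>"
  using AE_increment unfolding good_def eventually_sequentially .

lemma sets_good: "{\<omega>. good \<omega>} \<in> sets \<Omega>"
proof -
  have "{\<omega>. d (Y (Suc k) \<omega>) (Y k \<omega>) \<le> (1/2)^k} \<in> sets \<Omega>" for k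
  proof (rule sets_finite_dep[of "tm (Suc k)"])
    fix \<omega> \<omega>' :: "'a stream" assume e: "stake (tm (Suc k)) \<omega> = stake (tm (Suc k)) \<omega>'"
    have "stake (tm k) s = take (tm k) (stake (tm (Suc k)) s)" for s :: "'a stream"
      unfolding take_stake by (simp add: tm_Suc min_def)
    with e have "stake (tm k) \<omega> = stake (tm k) \<omega>'" by metis
    with e show "(d (Y (Suc k) \<omega>) (Y k \<omega>) \<le> (1/2)^k) = (d (Y (Suc k) \<omega>') (Y k \<omega>') \<le> (1/2)^k)"
      by (simp add: Y_def)
  qed
  then have "(\<Union>K. \<Inter>k\<in>{K..}. {\<omega>. d (Y (Suc k) \<omega>) (Y k \<omega>) \<le> (1/2)^k}) \<in> sets \<Omega>"
    by (intro sets.countable_UN sets.countable_INT) auto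
  also have "(\<Union>K. \<Inter>k\<in>{K..}. {\<omega>. d (Y (Suc k) \<omega>) (Y k \<omega>) \<le> (1/2)^k}) = {\<omega>. good \<omega>}"
    by (auto simp: good_def)
  finally show ?thesis .
qed

lemma limit_unique:
  assumes "(\<lambda>k. d (s k) x) \<longlonglongrightarrow> 0" "(\<lambda>k. d (s k) y) \<longlonglongrightarrow> 0"
  shows "\<iota> x = \<iota> y"
proof -
  have "(\<lambda>k. d (s k) x + d (s k) y) \<longlonglongrightarrow> 0" using tendsto_add[OF assms] by simp
  moreover have "d x y \<le> d (s k) x + d (s k) y" for k
    using d_triangle[of x y "s k"] d_sym[of x "s k"] by simp
  ultimately have "d x y \<le> 0" by (intro LIMSEQ_le_const) auto
  then have "D (\<iota> x) y = 0" using d_nonneg[of x y] by (simp add: D_\<iota>)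
  then show ?thesis by (rule D_eq_0[OF \<iota>_in])
qed

text \<open>\<open>T\<close> has no assumed countable basis. Instead, the limit lies in the open set
  \<open>U\<close> exactly when, for some radius 1/(j+1), the balls around all late
  \<open>Y k\<close> lie in \<open>U\<close>; each such condition depends on finitely many
  letters.\<close>

lemma \<iota>_\<xi>_measurable: "(\<lambda>\<omega>. \<iota> (\<xi> \<omega>)) \<in> measurable \<Omega> (borel_of T)"
proof (rule measurable_borel_ofI)
  fix U assume U: "openin T U"
  let ?G = "\<lambda>j k \<omega>. \<forall>y\<in>topspace T. D y (Y k \<omega>) < 1 / real (Suc j) \<longrightarrow> y \<in> U"
  have G: "{\<omega>. ?G j k \<omega>} \<in> sets \<Omega>" for j k unfolding Y_def by (rule sets_stake)
  have iff: "\<iota> (\<xi> \<omega>) \<in> U \<longleftrightarrow> (\<exists>j K. \<forall>k\<ge>K. ?G j k \<omega>)" if "good \<omega>" for \<omega>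
  proof
    note lim = good_convergent[OF that]
    assume "\<iota> (\<xi> \<omega>) \<in> U"
    then obtain r where r: "0 < r" "{y \<in> topspace T. D y (\<xi> \<omega>) < r} \<subseteq> U" using D_ball_basis[OF U] by blast
    obtain j where j: "1 / real (Suc j) < r / 2" using r(1) nat_approx_posE[of "r/2"] by auto
    obtain K where K: "\<And>k. K \<le> k \<Longrightarrow> d (Y k \<omega>) (\<xi> \<omega>) < r / 2"
      using order_tendstoD(2)[OF lim, of "r/2"] r(1) by (auto simp: eventually_sequentially)
    have "?G j k \<omega>" if "K \<le> k" for k
    proof (intro ballI impI)
      fix y assume y: "y \<in> topspace T" "D y (Y k \<omega>) < 1 / real (Suc j)"
      have "D y (\<xi> \<omega>) \<le> D y (Y k \<omega>) + d (Y k \<omega>) (\<xi> \<omega>)" by (rule D_triangle[OF y(1)])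
      then have "D y (\<xi> \<omega>) < r" using y(2) K[OF that] j by linarith
      then show "y \<in> U" using r(2) y(1) by blast
    qed
    then show "\<exists>j K. \<forall>k\<ge>K. ?G j k \<omega>" by blast
  next
    note lim = good_convergent[OF that]
    assume "\<exists>j K. \<forall>k\<ge>K. ?G j k \<omega>"
    then obtain j K where jK: "\<And>k. K \<le> k \<Longrightarrow> ?G j k \<omega>" by blast
    obtain K' where K': "\<And>k. K' \<le> k \<Longrightarrow> d (Y k \<omega>) (\<xi> \<omega>) < 1 / real (Suc j)"
      using order_tendstoD(2)[OF lim, of "1 / real (Suc j)"] by (auto simp: eventually_sequentially)
    have "D (\<iota> (\<xi> \<omega>)) (Y (max K K') \<omega>) < 1 / real (Suc j)"
      using K'[of "max K K'"] by (simp add: D_\<iota> d_sym)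
    then show "\<iota> (\<xi> \<omega>) \<in> U" using jK[of "max K K'"] \<iota>_in by auto
  qed
  have "(\<lambda>\<omega>. \<iota> (\<xi> \<omega>)) -` U \<inter> space \<Omega> = ({\<omega>. good \<omega>} \<inter> (\<Union>j. \<Union>K. \<Inter>k\<in>{K..}. {\<omega>. ?G j k \<omega>}))
       \<union> (if \<iota> x0 \<in> U then UNIV - {\<omega>. good \<omega>} else {})" (is "?L = ?R")
  proof (rule Set.set_eqI)
    fix \<omega> show "\<omega> \<in> ?L \<longleftrightarrow> \<omega> \<in> ?R"
    proof (cases "good \<omega>")
      case True
      have "\<omega> \<in> ?R \<longleftrightarrow> (\<exists>j K. \<forall>k\<ge>K. ?G j k \<omega>)" using True by auto
      then show ?thesis using iff[OF True] by simp
    next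
      case False
      then show ?thesis by (simp add: \<xi>_def)
    qed
  qed
  also have "\<dots> \<in> sets \<Omega>"
    using sets.compl_sets[OF sets_good] G
    by (intro sets.Un sets.Int sets_good sets.countable_UN sets.countable_INT) auto
  finally show "(\<lambda>\<omega>. \<iota> (\<xi> \<omega>)) -` U \<inter> space \<Omega> \<in> sets \<Omega>" .
qed (rule \<iota>_in)

text \<open>\<open>Y'\<close> has two limits: that of \<open>Y\<close>, because they differ by at
  most \<open>(1/2)^k\<close>, and the image of the shifted limit, because the first letter acts by
  a Lipschitz map.\<close>

lemma AE_\<xi>_shift: "AE \<omega> in \<Omega>. \<iota> (\<xi> \<omega>) = act' (shd \<omega>) (\<iota> (\<xi> (stl \<omega>)))"
proof -
  have "AE \<omega> in \<Omega>. good (stl \<omega>)"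
  proof (subst prob_space.AE_stream_space[OF prob_space_measure_pmf])
    have "{\<omega>. good (stl \<omega>)} = stl -` {\<omega>. good \<omega>} \<inter> space \<Omega>" by auto
    also have "\<dots> \<in> sets \<Omega>" by (rule measurable_sets[OF measurable_stl sets_good])
    finally show "Measurable.pred \<Omega> (\<lambda>\<omega>. good (stl \<omega>))" by (simp add: pred_def)
  qed (use AE_good in simp)
  with AE_good AE_increment' show ?thesis
  proof eventually_elim
    case (elim \<omega>)
    have lim: "(\<lambda>k. d (Y k \<omega>) (\<xi> \<omega>)) \<longlonglongrightarrow> 0" "(\<lambda>k. d (Y k (stl \<omega>)) (\<xi> (stl \<omega>))) \<longlonglongrightarrow> 0"
      by (intro good_convergent elim)+
    obtain L where L: "\<And>x y. d (act (shd \<omega>) x) (act (shd \<omega>) y) \<le> L * d x y" using act_Lipschitz by blast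
    have Y': "Y' k \<omega> = act (shd \<omega>) (Y k (stl \<omega>))" for k by (simp add: Y'_def Y_def)
    have half: "(\<lambda>k. (1/2::real)^k) \<longlonglongrightarrow> 0" by (intro LIMSEQ_realpow_zero) auto
    have "(\<lambda>k. d (Y' k \<omega>) (\<xi> \<omega>)) \<longlonglongrightarrow> 0"
    proof (rule tendsto_sandwich[of "\<lambda>_. 0" _ _ "\<lambda>k. (1/2)^k + d (Y k \<omega>) (\<xi> \<omega>)"])
      show "eventually (\<lambda>k. d (Y' k \<omega>) (\<xi> \<omega>) \<le> (1/2)^k + d (Y k \<omega>) (\<xi> \<omega>)) sequentially"
        using elim(2)
      proof eventually_elim
        case (elim k)
        then show ?case using d_triangle[of "Y' k \<omega>" "\<xi> \<omega>" "Y k \<omega>"] by linarith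
      qed
      show "(\<lambda>k. (1/2)^k + d (Y k \<omega>) (\<xi> \<omega>)) \<longlonglongrightarrow> 0" using tendsto_add[OF half lim(1)] by simp
    qed simp_all
    moreover have "(\<lambda>k. d (Y' k \<omega>) (act (shd \<omega>) (\<xi> (stl \<omega>)))) \<longlonglongrightarrow> 0"
    proof (rule tendsto_sandwich[of "\<lambda>_. 0" _ _ "\<lambda>k. L * d (Y k (stl \<omega>)) (\<xi> (stl \<omega>))"])
      show "(\<lambda>k. L * d (Y k (stl \<omega>)) (\<xi> (stl \<omega>))) \<longlonglongrightarrow> 0" using tendsto_mult_left[OF lim(2), of L] by simp
    qed (simp_all add: Y' L)
    ultimately have "\<iota> (\<xi> \<omega>) = \<iota> (act (shd \<omega>) (\<xi> (stl \<omega>)))" by (rule limit_unique)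
    then show ?case by (simp add: \<iota>_act)
  qed
qed

section \<open>The law of the limit point as the only stationary measure\<close>

definition \<nu> :: "'y measure" where "\<nu> = distr \<Omega> (borel_of T) (\<lambda>\<omega>. \<iota> (\<xi> \<omega>))"

lemma prob_on_\<nu>: "prob_on T \<nu>"
  unfolding prob_on_def \<nu>_def using \<Omega>.prob_space_distr[OF \<iota>_\<xi>_measurable] by simp

text \<open>A stream is an independent first letter followed by a stream of the same law, so the
  equivariance of the limit point is the stationarity equation.\<close>

lemma stationary_\<nu>: "stationary_on T m act' \<nu>"
  unfolding stationary_on_def
proof (intro conjI prob_on_\<nu> ballI)
  fix A assume "A \<in> sets \<nu>"
  then have A: "A \<in> sets (borel_of T)" by (simp add: \<nu>_def)
  let ?\<xi> = "\<lambda>\<omega>. \<iota> (\<xi> \<omega>)"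
  have pre: "act' g -` A \<inter> topspace T \<in> sets (borel_of T)" for g
    using measurable_sets[OF act'_measurable A] by simp
  let ?S = "{\<omega>. act' (shd \<omega>) (?\<xi> (stl \<omega>)) \<in> A}"
  have S: "?S \<in> sets \<Omega>"
  proof -
    have "?S = (\<Union>g. (shd -` {g} \<inter> space \<Omega>) \<inter> ((\<lambda>\<omega>. ?\<xi> (stl \<omega>)) -` (act' g -` A \<inter> topspace T) \<inter> space \<Omega>))"
      using \<iota>_in by auto
    also have "\<dots> \<in> sets \<Omega>"
    proof -
      have s1: "shd -` {g} \<inter> space \<Omega> \<in> sets \<Omega>" for g by (rule measurable_sets[OF measurable_shd]) simp
      have s2: "(\<lambda>\<omega>. ?\<xi> (stl \<omega>)) -` (act' g -` A \<inter> topspace T) \<inter> space \<Omega> \<in> sets \<Omega>" for g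
        by (rule measurable_sets[OF measurable_compose[OF measurable_stl \<iota>_\<xi>_measurable] pre])
      show ?thesis by (intro sets.countable_UN image_subsetI sets.Int[OF s1 s2])
    qed
    finally show ?thesis .
  qed
  have "emeasure \<nu> A = emeasure \<Omega> (?\<xi> -` A \<inter> space \<Omega>)"
    unfolding \<nu>_def by (rule emeasure_distr[OF \<iota>_\<xi>_measurable A])
  also have "\<dots> = emeasure \<Omega> ?S"
    by (rule emeasure_eq_AE) (use AE_\<xi>_shift S measurable_sets[OF \<iota>_\<xi>_measurable A] in auto)
  also have "\<dots> = (\<integral>\<^sup>+g. emeasure \<Omega> {x \<in> space \<Omega>. g ## x \<in> ?S} \<partial>measure_pmf m)"
    by (rule prob_space.emeasure_stream_space[OF prob_space_measure_pmf S])
  also have "\<dots> = (\<integral>\<^sup>+g. emeasure \<nu> (act' g -` A \<inter> space \<nu>) \<partial>measure_pmf m)"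
  proof (rule nn_integral_cong)
    fix g
    have "{x \<in> space \<Omega>. g ## x \<in> ?S} = ?\<xi> -` (act' g -` A \<inter> topspace T) \<inter> space \<Omega>" using \<iota>_in by auto
    then show "emeasure \<Omega> {x \<in> space \<Omega>. g ## x \<in> ?S} = emeasure \<nu> (act' g -` A \<inter> space \<nu>)"
      using emeasure_distr[OF \<iota>_\<xi>_measurable pre[of g]] by (simp add: \<nu>_def)
  qed
  finally show "emeasure \<nu> A = (\<integral>\<^sup>+g. emeasure \<nu> (act' g -` A \<inter> space \<nu>) \<partial>measure_pmf m)" .
qed

lemma word_act'_measurable: "word_act act' w \<in> measurable (borel_of T) (borel_of T)"
proof (induction w)
  case Nil
  then show ?case by (simp add: word_act_def)
next
  case (Cons g w)
  have "word_act act' (g # w) = (\<lambda>x. act' g (word_act act' w x))" by (rule ext) simp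
  then show ?case using measurable_compose[OF Cons act'_measurable] by simp
qed

lemma stationary_words:
  assumes st: "stationary_on T m act' \<mu>" and A: "A \<in> sets (borel_of T)"
  shows "emeasure \<mu> A = (\<integral>\<^sup>+w. emeasure \<mu> (word_act act' w -` A \<inter> topspace T) \<partial>replicate_pmf n m)"
  using A
proof (induction n arbitrary: A)
  case 0
  have "A \<subseteq> topspace T" using sets.sets_into_space[OF 0] by simp
  then have "word_act act' [] -` A \<inter> topspace T = A" by auto
  then show ?case by simp
next
  case (Suc n)
  have sp: "space \<mu> = topspace T" "sets \<mu> = sets (borel_of T)"
    using st by (auto simp: stationary_on_def prob_on_def)
  have pre: "act' g -` A \<inter> topspace T \<in> sets (borel_of T)" for g
    using measurable_sets[OF act'_measurable Suc.prems] by simp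
  have vim: "word_act act' w -` (act' g -` A \<inter> topspace T) \<inter> topspace T = word_act act' (g # w) -` A \<inter> topspace T" for g w
    using word_act'_in by auto
  have "emeasure \<mu> A = (\<integral>\<^sup>+g. emeasure \<mu> (act' g -` A \<inter> topspace T) \<partial>measure_pmf m)"
    using st Suc.prems unfolding stationary_on_def sp by blast
  also have "\<dots> = (\<integral>\<^sup>+g. (\<integral>\<^sup>+w. emeasure \<mu> (word_act act' (g # w) -` A \<inter> topspace T) \<partial>replicate_pmf n m) \<partial>measure_pmf m)"
    by (rule nn_integral_cong) (simp only: Suc.IH[OF pre] vim)
  also have "\<dots> = (\<integral>\<^sup>+w. emeasure \<mu> (word_act act' w -` A \<inter> topspace T) \<partial>replicate_pmf (Suc n) m)"
    by simp
  finally show ?case .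
qed

text \<open>The walk from \<open>y\<close> has the same limit as the walk from \<open>x0\<close>
  along \<open>tm\<close>. If that limit lies in the open set \<open>U\<close>, the walk is
  eventually in \<open>U\<close>, and Fatou's lemma applies.\<close>

lemma \<nu>_le_liminf:
  assumes y: "y \<in> topspace T" and U: "openin T U"
  shows "emeasure \<nu> U \<le> liminf (\<lambda>k. emeasure (replicate_pmf (tm k) m) {w. word_act act' w y \<in> U})"
proof -
  let ?y = "\<lambda>k \<omega>. word_act act' (stake (tm k) \<omega>) y"
  have Us: "U \<in> sets (borel_of T)" by (rule borel_of_open[OF U])
  have S: "{\<omega>. ?y k \<omega> \<in> U} \<in> sets \<Omega>" for k by (rule sets_stake)
  have "emeasure \<nu> U = emeasure \<Omega> {\<omega>. \<iota> (\<xi> \<omega>) \<in> U}"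
    unfolding \<nu>_def using emeasure_distr[OF \<iota>_\<xi>_measurable Us] by (simp add: vimage_def)
  also have "\<dots> = (\<integral>\<^sup>+\<omega>. indicator {\<omega>. \<iota> (\<xi> \<omega>) \<in> U} \<omega> \<partial>\<Omega>)"
    using measurable_sets[OF \<iota>_\<xi>_measurable Us] by (simp add: vimage_def)
  also have "\<dots> \<le> (\<integral>\<^sup>+\<omega>. liminf (\<lambda>k. indicator {\<omega>. ?y k \<omega> \<in> U} \<omega>) \<partial>\<Omega>)"
  proof (rule nn_integral_mono_AE)
    show "AE \<omega> in \<Omega>. indicator {\<omega>. \<iota> (\<xi> \<omega>) \<in> U} \<omega> \<le> liminf (\<lambda>k. indicator {\<omega>. ?y k \<omega> \<in> U} \<omega> :: ennreal)"
      using AE_good AE_near[OF y]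
    proof eventually_elim
      case (elim \<omega>)
      show ?case
      proof (cases "\<iota> (\<xi> \<omega>) \<in> U")
        case True
        then obtain r where r: "0 < r" "{y \<in> topspace T. D y (\<xi> \<omega>) < r} \<subseteq> U" using D_ball_basis[OF U] by blast
        have "(\<lambda>k. (1/2::real)^k + d (Y k \<omega>) (\<xi> \<omega>)) \<longlonglongrightarrow> 0 + 0"
          by (intro tendsto_add LIMSEQ_realpow_zero good_convergent elim) auto
        then have "eventually (\<lambda>k. (1/2::real)^k + d (Y k \<omega>) (\<xi> \<omega>) < r) sequentially"
          using r(1) by (intro order_tendstoD(2)) auto
        with elim(2) have "eventually (\<lambda>k. ?y k \<omega> \<in> U) sequentially"
        proof eventually_elim
          case (elim k)
          have "D (?y k \<omega>) (\<xi> \<omega>) \<le> D (?y k \<omega>) (Y k \<omega>) + d (Y k \<omega>) (\<xi> \<omega>)"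
            by (rule D_triangle[OF word_act'_in[OF y]])
          then have "D (?y k \<omega>) (\<xi> \<omega>) < r" using elim by linarith
          then show ?case using r(2) word_act'_in[OF y] by blast
        qed
        then have "eventually (\<lambda>k. (1::ennreal) \<le> indicator {\<omega>. ?y k \<omega> \<in> U} \<omega>) sequentially"
          by (rule eventually_mono) simp
        then have "(1::ennreal) \<le> liminf (\<lambda>k. indicator {\<omega>. ?y k \<omega> \<in> U} \<omega>)"
          by (rule Liminf_bounded)
        then show ?thesis using True by simp
      qed simp
    qed
  qed
  also have "\<dots> \<le> liminf (\<lambda>k. \<integral>\<^sup>+\<omega>. indicator {\<omega>. ?y k \<omega> \<in> U} \<omega> \<partial>\<Omega>)"
    using S by (intro nn_integral_liminf) simp
  also have "\<dots> = liminf (\<lambda>k. emeasure (replicate_pmf (tm k) m) {w. word_act act' w y \<in> U})"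
    using S emeasure_stake(1)[where P="\<lambda>w. word_act act' w y \<in> U" and m=m] by simp
  finally show ?thesis .
qed

text \<open>With starting point distributed by \<mu>, the walk is in \<open>U\<close> with
  probability \<open>emeasure \<mu> U\<close> at every time. Averaging
  \<open>\<nu>_le_liminf\<close> over \<mu> and a second use of Fatou give the bound.\<close>

lemma \<nu>_le_stationary:
  assumes st: "stationary_on T m act' \<mu>" and U: "openin T U"
  shows "emeasure \<nu> U \<le> emeasure \<mu> U"
proof -
  have sp: "space \<mu> = topspace T" "sets \<mu> = sets (borel_of T)" and pr: "prob_space \<mu>"
    using st by (auto simp: stationary_on_def prob_on_def)
  interpret \<mu>: prob_space \<mu> by (rule pr)
  interpret \<nu>: prob_space \<nu> using prob_on_\<nu> by (simp add: prob_on_def)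
  have Us: "U \<in> sets (borel_of T)" by (rule borel_of_open[OF U])
  define h where "h k y = emeasure (replicate_pmf (tm k) m) {w. word_act act' w y \<in> U}" for k y
  have pre: "word_act act' w -` U \<inter> topspace T \<in> sets \<mu>" for w
    using measurable_sets[OF word_act'_measurable Us] by (simp add: sp)
  define S where "S w = word_act act' w -` U \<inter> topspace T" for w
  have hS: "h k y = (\<integral>\<^sup>+w. indicator (S w) y \<partial>replicate_pmf (tm k) m)" if "y \<in> topspace T" for k y
  proof -
    have "(\<integral>\<^sup>+w. indicator (S w) y \<partial>replicate_pmf (tm k) m) = (\<integral>\<^sup>+w. indicator {w. word_act act' w y \<in> U} w \<partial>replicate_pmf (tm k) m)"
      using that by (intro nn_integral_cong) (auto simp: S_def indicator_def)
    then show ?thesis by (simp add: h_def)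
  qed
  have pm: "(\<lambda>(w, y). indicator (S w) y :: ennreal) \<in> borel_measurable (measure_pmf (replicate_pmf (tm k) m) \<Otimes>\<^sub>M \<mu>)" for k
  proof -
    have "(\<lambda>(w, y). indicator (S w) y :: ennreal) \<in> borel_measurable (count_space UNIV \<Otimes>\<^sub>M \<mu>)"
      by (rule measurable_pair_measure_countable1) (use pre in \<open>auto simp: S_def\<close>)
    then show ?thesis
      by (subst measurable_cong_sets[OF sets_pair_measure_cong[OF sets_measure_pmf_count_space refl] refl])
  qed
  interpret P: pair_sigma_finite "measure_pmf (replicate_pmf (tm k) m)" \<mu> for k ..
  have hm: "h k \<in> borel_measurable \<mu>" for k
  proof -
    have "(\<lambda>y. \<integral>\<^sup>+w. indicator (S w) y \<partial>replicate_pmf (tm k) m) \<in> borel_measurable \<mu>"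
      using measurable_pair_swap[OF pm[of k]]
      by (intro measure_pmf.borel_measurable_nn_integral) (simp add: case_prod_beta')
    then show ?thesis by (rule measurable_cong[THEN iffD2, rotated]) (simp add: hS sp)
  qed
  have int: "(\<integral>\<^sup>+y. h k y \<partial>\<mu>) = emeasure \<mu> U" for k
  proof -
    have "(\<integral>\<^sup>+y. h k y \<partial>\<mu>) = (\<integral>\<^sup>+y. (\<integral>\<^sup>+w. indicator (S w) y \<partial>replicate_pmf (tm k) m) \<partial>\<mu>)"
      by (rule nn_integral_cong) (simp add: hS sp)
    also have "\<dots> = (\<integral>\<^sup>+w. (\<integral>\<^sup>+y. indicator (S w) y \<partial>\<mu>) \<partial>replicate_pmf (tm k) m)"
      using P.Fubini'[OF pm[of k]] .
    also have "\<dots> = (\<integral>\<^sup>+w. emeasure \<mu> (S w) \<partial>replicate_pmf (tm k) m)"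
      using pre by (simp add: S_def)
    also have "\<dots> = emeasure \<mu> U" unfolding S_def by (rule stationary_words[OF st Us, symmetric])
    finally show ?thesis .
  qed
  have "emeasure \<nu> U = (\<integral>\<^sup>+y. emeasure \<nu> U \<partial>\<mu>)" by (simp add: \<mu>.emeasure_space_1)
  also have "\<dots> \<le> (\<integral>\<^sup>+y. liminf (\<lambda>k. h k y) \<partial>\<mu>)"
    unfolding h_def by (rule nn_integral_mono) (use \<nu>_le_liminf[OF _ U] sp in auto)
  also have "\<dots> \<le> liminf (\<lambda>k. \<integral>\<^sup>+y. h k y \<partial>\<mu>)" by (rule nn_integral_liminf[OF hm])
  also have "\<dots> = emeasure \<mu> U" by (simp add: int Liminf_const)
  finally show ?thesis .
qed

text \<open>The previous bound is one-sided. The reverse one needs open neighbourhoods of the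
  complement of \<open>U\<close> whose intersection misses \<open>U\<close>; balls around classical
  points provide them although \<open>T\<close> is not assumed metrizable.\<close>

lemma stationary_unique:
  assumes st: "stationary_on T m act' \<mu>"
  shows "\<mu> = \<nu>"
proof -
  have sp: "space \<mu> = topspace T" "sets \<mu> = sets (borel_of T)" and pr: "prob_space \<mu>"
    using st by (auto simp: stationary_on_def prob_on_def)
  have spn: "space \<nu> = topspace T" "sets \<nu> = sets (borel_of T)" and prn: "prob_space \<nu>"
    using prob_on_\<nu> by (auto simp: prob_on_def)
  interpret \<mu>: prob_space \<mu> by (rule pr)
  interpret \<nu>: prob_space \<nu> by (rule prn)
  have le: "\<nu>.prob U \<le> \<mu>.prob U" if "openin T U" for U
    using \<nu>_le_stationary[OF st that] by (simp add: \<mu>.emeasure_eq_measure \<nu>.emeasure_eq_measure)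
  have ge: "\<mu>.prob U \<le> \<nu>.prob U" if U: "openin T U" for U
  proof -
    have Us: "U \<in> sets \<mu>" "U \<in> sets \<nu>" using borel_of_open[OF U] sp spn by auto
    \<comment> \<open>\<open>\<nu>\<close> is carried by the image of \<open>\<iota>\<close>; apply \<open>le\<close> to shrinking neighbourhoods of the part outside \<open>U\<close>.\<close>
    define F where "F k = (\<Union>z\<in>{z. \<iota> z \<notin> U}. {y \<in> topspace T. D y z < 1 / real (Suc k)})" for k
    define V where "V k = (\<Inter>i\<le>k. F i)" for k
    have Vo: "openin T (V k)" for k
      unfolding V_def F_def by (intro openin_INT2 openin_Union ballI) (auto intro: D_ball_open)
    have Vs: "V k \<in> sets \<mu>" "V k \<in> sets \<nu>" for k using borel_of_open[OF Vo] sp spn by auto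
    have "1 - \<nu>.prob U \<le> \<mu>.prob (V k)" for k
    proof -
      have "(\<lambda>\<omega>. \<iota> (\<xi> \<omega>)) -` (topspace T - U) \<inter> space \<Omega> \<subseteq> (\<lambda>\<omega>. \<iota> (\<xi> \<omega>)) -` V k \<inter> space \<Omega>"
        using \<iota>_in by (auto simp: V_def F_def D_\<iota> intro!: exI[of _ "\<xi> _"])
      moreover have "topspace T - U \<in> sets (borel_of T)" using sets.compl_sets[OF borel_of_open[OF U]] by simp
      moreover have "V k \<in> sets (borel_of T)" by (rule borel_of_open[OF Vo])
      moreover have "\<nu>.prob A = \<Omega>.prob ((\<lambda>\<omega>. \<iota> (\<xi> \<omega>)) -` A \<inter> space \<Omega>)" if "A \<in> sets (borel_of T)" for A
        unfolding \<nu>_def by (rule measure_distr[OF \<iota>_\<xi>_measurable that])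
      ultimately have "\<nu>.prob (topspace T - U) \<le> \<nu>.prob (V k)"
        using \<Omega>.finite_measure_mono[OF _ measurable_sets[OF \<iota>_\<xi>_measurable]] by simp
      moreover have "\<nu>.prob (topspace T - U) = 1 - \<nu>.prob U" using \<nu>.prob_compl[OF Us(2)] by (simp add: spn)
      ultimately show ?thesis using le[OF Vo[of k]] by linarith
    qed
    moreover have "(\<lambda>k. \<mu>.prob (V k)) \<longlonglongrightarrow> \<mu>.prob (\<Inter>k. V k)"
      by (rule \<mu>.finite_Lim_measure_decseq) (use Vs in \<open>auto simp: decseq_def V_def\<close>)
    ultimately have "1 - \<nu>.prob U \<le> \<mu>.prob (\<Inter>k. V k)" by (intro LIMSEQ_le_const) auto
    \<comment> \<open>A point of \<open>U\<close> in every \<open>V k\<close> is approached by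
      classical points outside \<open>U\<close>. By completeness it is classical itself, and then a
      ball around it inside \<open>U\<close> contains some of them.\<close>
    moreover have "U \<inter> (\<Inter>k. V k) = {}"
    proof (rule ccontr)
      assume "U \<inter> (\<Inter>k. V k) \<noteq> {}"
      then obtain y where y: "y \<in> U" "\<And>k. y \<in> F k" by (auto simp: V_def)
      then have "\<forall>k. \<exists>z. \<iota> z \<notin> U \<and> D y z < 1 / real (Suc k)" by (fastforce simp: F_def)
      then obtain s where s: "\<And>k. \<iota> (s k) \<notin> U" "\<And>k. D y (s k) < 1 / real (Suc k)" by metis
      have yT: "y \<in> topspace T" using y(1) openin_subset[OF U] by blast
      have D0: "(\<lambda>k. D y (s k)) \<longlonglongrightarrow> 0"
        by (rule tendsto_sandwich[OF _ _ tendsto_const LIMSEQ_inverse_real_of_nat])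
          (use s(2) D_nonneg[OF yT] in \<open>auto simp: inverse_eq_divide less_imp_le\<close>)
      have "\<exists>l. (\<lambda>k. d (s k) l) \<longlonglongrightarrow> 0"
      proof (rule d_complete)
        fix \<epsilon> :: real assume "0 < \<epsilon>"
        then obtain K where K: "\<And>k. K \<le> k \<Longrightarrow> D y (s k) < \<epsilon> / 2"
          using order_tendstoD(2)[OF D0, of "\<epsilon>/2"] by (auto simp: eventually_sequentially)
        show "\<exists>K. \<forall>i\<ge>K. \<forall>j\<ge>K. d (s i) (s j) < \<epsilon>"
        proof (intro exI[of _ K] allI impI)
          fix i j assume "K \<le> i" "K \<le> j"
          from D_triangle2[OF yT, of "s i" "s j"] K[OF this(1)] K[OF this(2)]
          show "d (s i) (s j) < \<epsilon>" by linarith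
        qed
      qed
      then obtain l where l: "(\<lambda>k. d (s k) l) \<longlonglongrightarrow> 0" by blast
      have "(\<lambda>k. D y (s k) + d (s k) l) \<longlonglongrightarrow> 0" using tendsto_add[OF D0 l] by simp
      then have "D y l \<le> 0" by (rule LIMSEQ_le_const) (use D_triangle[OF yT] in auto)
      then have "y = \<iota> l" using D_nonneg[OF yT, of l] by (intro D_eq_0[OF yT]) simp
      then obtain r where r: "0 < r" "{y \<in> topspace T. D y l < r} \<subseteq> U" using D_ball_basis[OF U] y(1) by blast
      obtain k where "d (s k) l < r"
        using order_tendstoD(2)[OF l r(1)] by (auto simp: eventually_sequentially)
      then have "\<iota> (s k) \<in> U" using r(2) \<iota>_in by (auto simp: D_\<iota>)
      then show False using s(1) by blast
    qed
    moreover have "(\<Inter>k. V k) \<in> sets \<mu>" using Vs by auto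
    ultimately have "\<mu>.prob U + (1 - \<nu>.prob U) \<le> \<mu>.prob (U \<union> (\<Inter>k. V k))"
      using \<mu>.finite_measure_Union[OF Us(1), of "\<Inter>k. V k"] by simp
    then show ?thesis using \<mu>.prob_le_1[of "U \<union> (\<Inter>k. V k)"] by linarith
  qed
  show ?thesis
  proof (rule measure_eqI_generator_eq[where E="{U. openin T U}" and \<Omega>="topspace T" and A="\<lambda>_. topspace T"])
    show "Int_stable {U. openin T U}" by (auto simp: Int_stable_def)
    show "{U. openin T U} \<subseteq> Pow (topspace T)" by (auto dest: openin_subset)
    show "emeasure \<mu> X = emeasure \<nu> X" if "X \<in> {U. openin T U}" for X
      using le[of X] ge[of X] that by (simp add: \<mu>.emeasure_eq_measure \<nu>.emeasure_eq_measure)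
  qed (auto simp: sp spn sets_borel_of)
qed

lemma stationary_measure_eq: "stationary_measure T m act' = \<nu>"
  unfolding stationary_measure_def
  by (rule the_equality[where P="stationary_on T m act'"]) (rule stationary_\<nu>, rule stationary_unique)

text \<open>The error involves only the contraction bound at the fixed time \<open>n\<close> and the
  numbers \<delta>, \<epsilon>, \<open>C\<close>, not the rate of almost sure convergence. That
  makes the comparison uniform over a family of walks.\<close>

lemma expectation_\<xi>_approx:
  fixes F :: "'x \<Rightarrow> real"
  assumes Fm: "(\<lambda>\<omega>. F (\<xi> \<omega>)) \<in> borel_measurable \<Omega>"
    and Fc: "\<And>\<epsilon>. 0 < \<epsilon> \<Longrightarrow> \<exists>\<delta>>0. \<forall>x z. d x z \<le> \<delta> \<longrightarrow> \<bar>F x - F z\<bar> \<le> \<epsilon>"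
    and C: "\<And>x. \<bar>F x\<bar> \<le> C" and \<epsilon>pos: "0 \<le> \<epsilon>"
    and \<delta>: "\<And>x z. d x z \<le> \<delta> \<Longrightarrow> \<bar>F x - F z\<bar> \<le> \<epsilon>"
    and small: "\<And>y. y \<in> topspace T \<Longrightarrow>
        measure_pmf.prob (replicate_pmf n m) {w. \<delta> < D (word_act act' w y) (word_act act w x0)} \<le> \<eta>"
  shows "\<bar>(\<integral>\<omega>. F (\<xi> \<omega>) \<partial>\<Omega>) - measure_pmf.expectation (replicate_pmf n m) (\<lambda>w. F (word_act act w x0))\<bar> \<le> \<epsilon> + 2 * C * \<eta>"
proof -
  let ?Fw = "\<lambda>w. F (word_act act w x0)"
  have C0: "0 \<le> C" using C[of x0] by linarith
  have stm: "stake k \<in> measurable \<Omega> (count_space UNIV)" for k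
    unfolding measurable_def using sets_stake[of "\<lambda>w. w \<in> _" k] by (auto simp: vimage_def)
  have Ym: "(\<lambda>\<omega>. ?Fw (stake k \<omega>)) \<in> borel_measurable \<Omega>" for k
    by (rule measurable_compose[OF stm]) simp
  have int: "integrable \<Omega> (\<lambda>\<omega>. ?Fw (stake k \<omega>))" for k
    by (rule \<Omega>.integrable_const_bound[where B=C]) (use C Ym in auto)
  have dst: "distr \<Omega> (count_space UNIV) (stake k) = measure_pmf (replicate_pmf k m)" for k
  proof (rule measure_eqI)
    fix A :: "'a list set"
    show "emeasure (distr \<Omega> (count_space UNIV) (stake k)) A = emeasure (measure_pmf (replicate_pmf k m)) A"
      using emeasure_stake(1)[where P="\<lambda>w. w \<in> A" and n=k and m=m]
      by (simp add: emeasure_distr[OF stm] vimage_def)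
  qed simp
  have Ek: "(\<integral>\<omega>. ?Fw (stake k \<omega>) \<partial>\<Omega>) = measure_pmf.expectation (replicate_pmf k m) ?Fw" for k
    unfolding dst[symmetric] by (rule integral_distr[OF stm, symmetric]) simp
  have lim: "(\<lambda>k. \<integral>\<omega>. ?Fw (stake (tm k) \<omega>) \<partial>\<Omega>) \<longlonglongrightarrow> (\<integral>\<omega>. F (\<xi> \<omega>) \<partial>\<Omega>)"
  proof (rule integral_dominated_convergence[where w="\<lambda>_. C"])
    show "AE \<omega> in \<Omega>. (\<lambda>k. ?Fw (stake (tm k) \<omega>)) \<longlonglongrightarrow> F (\<xi> \<omega>)"
      using AE_good
    proof eventually_elim
      case (elim \<omega>)
      show ?case
      proof (rule LIMSEQ_I)
        fix e :: real assume "0 < e"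
        then obtain r where r: "0 < r" "\<And>x z. d x z \<le> r \<Longrightarrow> \<bar>F x - F z\<bar> \<le> e / 2" using Fc[of "e/2"] by auto
        obtain K where K: "\<And>k. K \<le> k \<Longrightarrow> d (Y k \<omega>) (\<xi> \<omega>) < r"
          using order_tendstoD(2)[OF good_convergent[OF elim] r(1)] by (auto simp: eventually_sequentially)
        have "norm (?Fw (stake (tm k) \<omega>) - F (\<xi> \<omega>)) < e" if "K \<le> k" for k
          using r(2)[of "Y k \<omega>" "\<xi> \<omega>"] K[OF that] \<open>0 < e\<close> by (simp add: Y_def)
        then show "\<exists>K. \<forall>k\<ge>K. norm (?Fw (stake (tm k) \<omega>) - F (\<xi> \<omega>)) < e" by blast
      qed
    qed
  qed (use Ym Fm C in auto)
  \<comment> \<open>The bound is independent of \<open>b\<close>, so it survives the passage to the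
    limit along \<open>tm\<close>.\<close>
  have diff: "\<bar>(\<integral>\<omega>. ?Fw (stake (n + b) \<omega>) \<partial>\<Omega>) - (\<integral>\<omega>. ?Fw (stake n \<omega>) \<partial>\<Omega>)\<bar> \<le> \<epsilon> + 2 * C * \<eta>" for b
  proof -
    let ?E = "{\<omega>. \<delta> < d (word_act act (stake (n + b) \<omega>) x0) (word_act act (take n (stake (n + b) \<omega>)) x0)}"
    have E: "?E \<in> sets \<Omega>"
      by (rule sets_stake[of "\<lambda>w. \<delta> < d (word_act act w x0) (word_act act (take n w) x0)"])
    have PE: "\<Omega>.prob ?E \<le> \<eta>"
      unfolding prob_stake[of "\<lambda>w. \<delta> < d (word_act act w x0) (word_act act (take n w) x0)"]
      by (rule increment_prob_le[OF small])
    have intE: "integrable \<Omega> (indicator ?E :: _ \<Rightarrow> real)"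
      by (rule \<Omega>.integrable_const_bound[where B=1]) (use E in auto)
    have pt: "\<bar>?Fw (stake (n + b) \<omega>) - ?Fw (stake n \<omega>)\<bar> \<le> \<epsilon> + 2 * C * indicator ?E \<omega>" for \<omega>
    proof (cases "\<omega> \<in> ?E")
      case True
      have "\<bar>?Fw (stake (n + b) \<omega>) - ?Fw (stake n \<omega>)\<bar> \<le> 2 * C"
        using C[of "word_act act (stake (n + b) \<omega>) x0"] C[of "word_act act (stake n \<omega>) x0"] by linarith
      then show ?thesis using True \<epsilon>pos by simp
    next
      case False
      then show ?thesis using \<delta>[of "word_act act (stake (n + b) \<omega>) x0" "word_act act (stake n \<omega>) x0"]
        by (simp add: take_stake min_def)
    qed
    have "\<bar>(\<integral>\<omega>. ?Fw (stake (n + b) \<omega>) \<partial>\<Omega>) - (\<integral>\<omega>. ?Fw (stake n \<omega>) \<partial>\<Omega>)\<bar>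
        = \<bar>\<integral>\<omega>. ?Fw (stake (n + b) \<omega>) - ?Fw (stake n \<omega>) \<partial>\<Omega>\<bar>"
      by (simp add: Bochner_Integration.integral_diff[OF int int])
    also have "\<dots> \<le> (\<integral>\<omega>. \<bar>?Fw (stake (n + b) \<omega>) - ?Fw (stake n \<omega>)\<bar> \<partial>\<Omega>)"
      by (rule integral_abs_bound)
    also have "\<dots> \<le> (\<integral>\<omega>. \<epsilon> + 2 * C * indicator ?E \<omega> \<partial>\<Omega>)"
    proof (rule integral_mono[OF _ _ pt])
      show "integrable \<Omega> (\<lambda>\<omega>. \<bar>?Fw (stake (n + b) \<omega>) - ?Fw (stake n \<omega>)\<bar>)"
        by (intro integrable_abs Bochner_Integration.integrable_diff int)
      show "integrable \<Omega> (\<lambda>\<omega>. \<epsilon> + 2 * C * indicator ?E \<omega>)"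
        using intE by (intro Bochner_Integration.integrable_add integrable_mult_right) auto
    qed
    also have "\<dots> = \<epsilon> + 2 * C * \<Omega>.prob ?E"
      using E intE \<Omega>.prob_space by (subst Bochner_Integration.integral_add) simp_all
    also have "\<dots> \<le> \<epsilon> + 2 * C * \<eta>" using PE C0 by (intro add_left_mono mult_left_mono) auto
    finally show ?thesis .
  qed
  have "\<bar>(\<integral>\<omega>. F (\<xi> \<omega>) \<partial>\<Omega>) - (\<integral>\<omega>. ?Fw (stake n \<omega>) \<partial>\<Omega>)\<bar> \<le> \<epsilon> + 2 * C * \<eta>"
  proof (rule LIMSEQ_le_const2)
    show "(\<lambda>k. \<bar>(\<integral>\<omega>. ?Fw (stake (tm k) \<omega>) \<partial>\<Omega>) - (\<integral>\<omega>. ?Fw (stake n \<omega>) \<partial>\<Omega>)\<bar>)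
       \<longlonglongrightarrow> \<bar>(\<integral>\<omega>. F (\<xi> \<omega>) \<partial>\<Omega>) - (\<integral>\<omega>. ?Fw (stake n \<omega>) \<partial>\<Omega>)\<bar>"
      by (intro tendsto_intros lim)
    have "\<bar>(\<integral>\<omega>. ?Fw (stake (tm k) \<omega>) \<partial>\<Omega>) - (\<integral>\<omega>. ?Fw (stake n \<omega>) \<partial>\<Omega>)\<bar> \<le> \<epsilon> + 2 * C * \<eta>" if "n \<le> k" for k
      using diff[of "tm k - n"] le_tm[of k] that by simp
    then show "\<exists>K. \<forall>k\<ge>K. \<bar>(\<integral>\<omega>. ?Fw (stake (tm k) \<omega>) \<partial>\<Omega>) - (\<integral>\<omega>. ?Fw (stake n \<omega>) \<partial>\<Omega>)\<bar> \<le> \<epsilon> + 2 * C * \<eta>" by blast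
  qed
  then show ?thesis by (simp only: Ek)
qed

end

section \<open>The projective line over a valued field\<close>

text \<open>Homogeneous coordinates, normalised so that proportional vectors come from equal
  points.\<close>

definition pv :: "'k::field option \<Rightarrow> 'k^2" where
  "pv p = (case p of None \<Rightarrow> vector [1, 0] | Some z \<Rightarrow> vector [z, 1])"

lemma pv_simps [simp]:
  "pv None $ 1 = 1" "pv None $ 2 = 0" "pv (Some z) $ 1 = z" "pv (Some z) $ 2 = 1"
  by (simp_all add: pv_def)

lemma pv_nonzero [simp]: "pv p \<noteq> 0"
  by (cases p) (auto simp: vec_eq_iff forall_2)

definition perp :: "'k::comm_ring_1^2 \<Rightarrow> 'k^2" where
  "perp v = vector [v$2, - v$1]"

lemma perp_nth [simp]: "perp v $ 1 = v$2" "perp v $ 2 = - v$1"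
  by (simp_all add: perp_def)

lemma dot2_perp: "dot2 (perp v) u = - wedge v u"
  by (simp add: dot2_def wedge_def)

lemma perp_smult: "perp (c *s v) = c *s perp v"
  by (simp add: vec_eq_iff forall_2)

lemma perp_mat: "perp (A *v v) v* A = det A *s perp v"
  by (simp add: vec_eq_iff forall_2 det_2 algebra_simps)

lemma pv_mobius:
  fixes g :: "'k::field^2^2"
  assumes "det g \<noteq> 0"
  obtains c where "c \<noteq> 0" "g *v pv p = c *s pv (mobius g p)"
proof (cases "(g *v pv p) $ 2 = 0")
  case True
  have "(g *v pv p) $ 1 \<noteq> 0"
  proof
    assume "(g *v pv p) $ 1 = 0"
    with True have "g *v pv p = 0" by (simp only: vec_eq_iff forall_2) simp
    then have "det g *s pv p = 0"
    proof -
      have "det g *s pv p = adj2 g *v (g *v pv p)" by (simp add: vec_eq_iff forall_2 det_2 algebra_simps)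
      then show ?thesis using \<open>g *v pv p = 0\<close> by (simp add: vec_eq_iff)
    qed
    then have "pv p = 0" using assms by (simp add: vec_eq_iff)
    then show False by simp
  qed
  moreover have "mobius g p = None" using True by (cases p) (auto simp: mobius_def Let_def)
  ultimately show ?thesis using True by (intro that[of "(g *v pv p) $ 1"]) (simp_all add: vec_eq_iff forall_2)
next
  case False
  then have "mobius g p = Some ((g *v pv p) $ 1 / (g *v pv p) $ 2)"
    by (cases p) (auto simp: mobius_def Let_def)
  with False show ?thesis by (intro that[of "(g *v pv p) $ 2"]) (simp_all add: vec_eq_iff forall_2 del: mat2_vec_nth)
qed

lemma pv_proportional:
  assumes "c *s pv p = pv q" shows "p = q"
  using assms by (cases p; cases q) (auto simp: vec_eq_iff forall_2)

lemma wedge_pv_eq_0: "wedge (pv p) (pv q) = 0 \<Longrightarrow> p = q"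
  by (cases p; cases q) (auto simp: wedge_def)

section \<open>The chordal distance and its extension to seminorms on rows\<close>

context absval
begin

definition ptH :: "'k option \<Rightarrow> 'k^2 \<Rightarrow> real" where "ptH p y = N (dot2 y (pv p))"

text \<open>The value of \<open>H\<close> on the linear form that vanishes at \<open>p\<close>,
  normalised to be independent of scale. For the seminorm of a classical point it is the chordal
  distance.\<close>

definition hdist :: "('k^2 \<Rightarrow> real) \<Rightarrow> 'k option \<Rightarrow> real" where
  "hdist H p = H (perp (pv p)) / (row_size H * nrm (pv p))"

definition cdist :: "'k option \<Rightarrow> 'k option \<Rightarrow> real" where
  "cdist p q = N (wedge (pv p) (pv q)) / (nrm (pv p) * nrm (pv q))"

lemma nrm_pv_neq_0 [simp]: "nrm (pv p) \<noteq> 0"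
  by (simp add: nrm_eq_0)

lemma row_seminorm_ptH: "row_seminorm N (ptH p)"
  unfolding row_seminorm_def
proof (intro conjI allI)
  show "ptH p (y + z) \<le> ptH p y + ptH p z" for y z
    using N_add[of "dot2 y (pv p)" "dot2 z (pv p)"] by (simp add: ptH_def dot2_def algebra_simps)
  show "ptH p (c *s y) = N c * ptH p y" for c y
    by (simp add: ptH_def dot2_def N_mult[symmetric] algebra_simps)
  show "ptH p (axis 1 1) \<noteq> 0 \<or> ptH p (axis 2 1) \<noteq> 0"
    by (cases p) (auto simp: ptH_def dot2_def axis_def)
qed (simp add: ptH_def)

lemma row_size_ptH: "row_size (ptH p) = nrm (pv p)"
  by (simp add: row_size_def nrm_def ptH_def dot2_def axis_def)

lemma wedge_sym: "N (wedge a b) = N (wedge b a)"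
  unfolding wedge_def using N_diff_commute[of "a$1 * b$2" "a$2 * b$1"] by (simp add: mult.commute)

lemma hdist_ptH: "hdist (ptH p) q = cdist p q"
  by (simp add: hdist_def cdist_def row_size_ptH) (simp add: ptH_def dot2_perp wedge_sym)

lemma hdist_scale: "0 < c \<Longrightarrow> hdist (\<lambda>y. c * H y) p = hdist H p"
proof -
  assume "0 < c"
  then have "row_size (\<lambda>y. c * H y) = c * row_size H" by (simp add: row_size_def max_mult_distrib_left)
  then show ?thesis using \<open>0 < c\<close> by (simp add: hdist_def)
qed

lemma nrm_perp: "nrm (perp v) = nrm v"
  by (simp add: nrm_def max.commute)

lemma wedge_perp: "wedge (perp v) (perp u) = wedge v u"
  by (simp add: wedge_def algebra_simps)

text \<open>The rows \<open>b$i *s a\<close> and \<open>a$i *s b\<close> differ by a multiple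
  \<open>wedge a b\<close> of a unit row. Subadditivity of \<open>H\<close> then gives the triangle
  inequality of \<open>hdist\<close>.\<close>

lemma row_seminorm_compare:
  assumes "row_seminorm N H"
  shows "nrm b * H a \<le> nrm a * H b + N (wedge a b) * row_size H"
proof -
  have h: "\<And>y. 0 \<le> H y" "\<And>y z. H (y + z) \<le> H y + H z" "\<And>c y. H (c *s y) = N c * H y"
    using assms by (auto simp: row_seminorm_def)
  have 1: "b$1 *s a = a$1 *s b + (- wedge a b) *s axis 2 1"
    by (simp add: vec_eq_iff forall_2 axis_def wedge_def algebra_simps)
  have 2: "b$2 *s a = a$2 *s b + wedge a b *s axis 1 1"
    by (simp add: vec_eq_iff forall_2 axis_def wedge_def algebra_simps)
  have "N (b$1) * H a \<le> N (a$1) * H b + N (wedge a b) * H (axis 2 1)"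
    using h(2)[of "a$1 *s b" "(- wedge a b) *s axis 2 1"] unfolding 1[symmetric] h(3) by simp
  moreover have "N (b$2) * H a \<le> N (a$2) * H b + N (wedge a b) * H (axis 1 1)"
    using h(2)[of "a$2 *s b" "wedge a b *s axis 1 1"] unfolding 2[symmetric] h(3) by simp
  moreover have "N (a$i) * H b + N (wedge a b) * H (axis j 1) \<le> nrm a * H b + N (wedge a b) * row_size H" for i j
    using h exhaust_2[of j] by (intro add_mono mult_mono N_le_nrm) (auto simp: row_size_def)
  ultimately have "N (b$1) * H a \<le> nrm a * H b + N (wedge a b) * row_size H"
     "N (b$2) * H a \<le> nrm a * H b + N (wedge a b) * row_size H" by (blast intro: order_trans)+
  then show ?thesis by (simp add: nrm_def[of b] max_def)
qed

lemma hdist_nonneg: "row_seminorm N H \<Longrightarrow> 0 \<le> hdist H p"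
  using row_size_pos[of N H] by (simp add: hdist_def row_seminorm_def)

lemma hdist_triangle:
  assumes H: "row_seminorm N H"
  shows "hdist H q \<le> hdist H p + cdist p q"
proof -
  let ?a = "nrm (pv p)" and ?b = "nrm (pv q)" and ?r = "row_size H"
  have pos: "0 < ?a" "0 < ?b" "0 < ?r" using row_size_pos[OF H] by auto
  have "?a * H (perp (pv q)) \<le> ?b * H (perp (pv p)) + N (wedge (pv p) (pv q)) * ?r"
    using row_seminorm_compare[OF H, of "perp (pv p)" "perp (pv q)"] wedge_sym[of "pv p" "pv q"]
    by (simp add: nrm_perp wedge_perp)
  then have "?a * H (perp (pv q)) / (?a * ?b * ?r) \<le> (?b * H (perp (pv p)) + N (wedge (pv p) (pv q)) * ?r) / (?a * ?b * ?r)"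
    using pos by (intro divide_right_mono) auto
  also have "\<dots> = hdist H p + cdist p q"
  proof -
    have "(b * x + w * r) / (a * b * r) = x / (r * a) + w / (a * b)" if "0 < a" "0 < b" "0 < r" for a b r x w :: real
      using that by (simp add: field_simps)
    from this[OF pos] show ?thesis unfolding hdist_def cdist_def .
  qed
  finally show ?thesis using pos by (simp add: hdist_def mult.commute)
qed

lemma hdist_triangle2:
  assumes H: "row_seminorm N H"
  shows "cdist p q \<le> hdist H p + hdist H q"
proof -
  let ?a = "nrm (pv p)" and ?b = "nrm (pv q)" and ?r = "row_size H"
  have pos: "0 < ?a" "0 < ?b" "0 < ?r" using row_size_pos[OF H] by auto
  have "N (wedge (pv p) (pv q)) * ?r \<le> ?b * H (perp (pv p)) + ?a * H (perp (pv q))"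
    using row_seminorm_wedge[OF H, of "perp (pv p)" "perp (pv q)"] by (simp add: nrm_perp wedge_perp)
  then have "N (wedge (pv p) (pv q)) * ?r / (?a * ?b * ?r) \<le> (?b * H (perp (pv p)) + ?a * H (perp (pv q))) / (?a * ?b * ?r)"
    using pos by (intro divide_right_mono) auto
  also have "\<dots> = hdist H p + hdist H q"
  proof -
    have "(b * x + a * y) / (a * b * r) = x / (r * a) + y / (r * b)" if "0 < a" "0 < b" "0 < r" for a b r x y :: real
      using that by (simp add: field_simps)
    from this[OF pos] show ?thesis unfolding hdist_def .
  qed
  finally show ?thesis using pos by (simp add: cdist_def)
qed

lemma cdist_nonneg [simp]: "0 \<le> cdist p q"
  by (simp add: cdist_def)

lemma cdist_refl [simp]: "cdist p p = 0"
  by (simp add: cdist_def wedge_def)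

lemma cdist_sym: "cdist p q = cdist q p"
  by (simp add: cdist_def wedge_sym[of "pv p"] mult.commute)

lemma cdist_triangle: "cdist p q \<le> cdist p r + cdist r q"
  using hdist_triangle[OF row_seminorm_ptH, of p q r] by (simp add: hdist_ptH)

lemma cdist_eq_0: "cdist p q = 0 \<Longrightarrow> p = q"
  using wedge_pv_eq_0[of p q] by (simp add: cdist_def nrm_eq_0)

lemma cdist_smult:
  assumes "c \<noteq> 0" "e \<noteq> 0" "v = c *s pv p" "u = e *s pv q"
  shows "cdist p q = N (wedge v u) / (nrm v * nrm u)"
proof -
  have "wedge v u = c * e * wedge (pv p) (pv q)" by (simp add: assms wedge_def algebra_simps)
  then show ?thesis using assms by (simp add: cdist_def nrm_smult N_mult)
qed

text \<open>The numerator is invariant under determinant 1, and each norm in the denominator shrinks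
  by a factor of at most \<open>2 * mnrm g\<close>.\<close>

lemma cdist_mobius_Lipschitz:
  assumes "det g = 1"
  shows "cdist (mobius g p) (mobius g q) \<le> 4 * (mnrm g)\<^sup>2 * cdist p q"
proof -
  have nz: "det g \<noteq> 0" using assms by simp
  obtain c where c: "c \<noteq> 0" "g *v pv p = c *s pv (mobius g p)" using pv_mobius[OF nz] by blast
  obtain e where e: "e \<noteq> 0" "g *v pv q = e *s pv (mobius g q)" using pv_mobius[OF nz] by blast
  let ?a = "nrm (pv p)" and ?b = "nrm (pv q)" and ?A = "nrm (g *v pv p)" and ?B = "nrm (g *v pv q)"
  have pos: "0 < ?A" "0 < ?B" "0 < ?a" "0 < ?b" using mat_vec_nonzero[OF assms] by auto
  have nz': "?A \<noteq> 0" "?B \<noteq> 0" using mat_vec_nonzero[OF assms] by (auto simp: nrm_eq_0)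
  have "cdist (mobius g p) (mobius g q) = N (wedge (pv p) (pv q)) / (?A * ?B)"
    using cdist_smult[OF c(1) e(1) c(2) e(2)] assms by (simp only: wedge_mat mult_1_left)
  also have "\<dots> = cdist p q * ((?a / ?A) * (?b / ?B))" using nz' by (simp add: cdist_def field_simps)
  also have "\<dots> \<le> cdist p q * ((2 * mnrm g) * (2 * mnrm g))"
    using pos nrm_le_nrm_mat_vec[OF assms, of "pv p"] nrm_le_nrm_mat_vec[OF assms, of "pv q"]
    by (intro mult_left_mono mult_mono) (simp_all add: divide_le_eq)
  finally show ?thesis by (simp add: power2_eq_square algebra_simps)
qed

lemma pv_word_act:
  assumes "\<And>g. g \<in> set w \<Longrightarrow> det (\<rho> g) = 1"
  shows "\<exists>c. c \<noteq> 0 \<and> word_mat \<rho> w *v pv p = c *s pv (word_act (\<lambda>g. mobius (\<rho> g)) w p)"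
  using assms
proof (induction w)
  case Nil
  show ?case by (rule exI[of _ 1]) simp
next
  case (Cons g w)
  have "\<exists>c. c \<noteq> 0 \<and> word_mat \<rho> w *v pv p = c *s pv (word_act (\<lambda>g. mobius (\<rho> g)) w p)"
    by (rule Cons.IH) (simp add: Cons.prems)
  then obtain c where c: "c \<noteq> 0" "word_mat \<rho> w *v pv p = c *s pv (word_act (\<lambda>g. mobius (\<rho> g)) w p)" by blast
  have "det (\<rho> g) \<noteq> 0" using Cons.prems[of g] by simp
  then obtain e where e: "e \<noteq> 0" "\<rho> g *v pv (word_act (\<lambda>g. mobius (\<rho> g)) w p) = e *s pv (mobius (\<rho> g) (word_act (\<lambda>g. mobius (\<rho> g)) w p))"
    by (rule pv_mobius)
  have "word_mat \<rho> (g # w) *v pv p = \<rho> g *v (word_mat \<rho> w *v pv p)" by (simp add: matrix_vector_mul_assoc)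
  also have "\<dots> = c *s (\<rho> g *v pv (word_act (\<lambda>g. mobius (\<rho> g)) w p))"
    unfolding c(2) by (simp add: vec_eq_iff algebra_simps)
  also have "\<dots> = (c * e) *s pv (word_act (\<lambda>g. mobius (\<rho> g)) (g # w) p)" by (simp add: e(2))
  finally show ?case using c(1) e(1) by (intro exI[of _ "c * e"]) simp
qed

text \<open>Pulling the form that vanishes at the image of \<open>None\<close> back by a matrix of
  determinant 1 gives a multiple of the form that vanishes at \<open>None\<close>; so the numerator
  stays bounded by \<open>row_size H\<close>. The denominator is a product of two quantities that
  each exceed \<open>R\<close> in their normalisation.\<close>

lemma hdist_word_bound:
  assumes det: "\<And>g. g \<in> set w \<Longrightarrow> det (\<rho> g) = 1" and H: "row_seminorm N H" and R: "0 < R"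
    and 1: "R * row_size H < max (H (word_mat \<rho> w $ 1)) (H (word_mat \<rho> w $ 2))"
    and 2: "R * row_size (ptH None) < max (ptH None (word_mat \<rho> w $ 1)) (ptH None (word_mat \<rho> w $ 2))"
  shows "hdist (\<lambda>y. H (y v* word_mat \<rho> w)) (word_act (\<lambda>g. mobius (\<rho> g)) w None) \<le> 1 / R\<^sup>2"
proof -
  let ?W = "word_mat \<rho> w" and ?q = "word_act (\<lambda>g. mobius (\<rho> g)) w None"
  have dW: "det ?W = 1" using det by (rule det_word_mat)
  obtain c where c: "c \<noteq> 0" "?W *v pv None = c *s pv ?q" using pv_word_act[of w \<rho> None, OF det] by blast
  have Hs: "\<And>y. 0 \<le> H y" "\<And>c y. H (c *s y) = N c * H y" using H by (auto simp: row_seminorm_def)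
  have rs: "row_size (\<lambda>y. H (y v* ?W)) = max (H (?W $ 1)) (H (?W $ 2))"
    by (simp add: row_size_def axis_vec_mat)
  have "nrm (?W *v pv None) = max (ptH None (?W $ 1)) (ptH None (?W $ 2))"
    by (simp add: nrm_def ptH_def dot2_def)
  moreover have "row_size (ptH None) = 1" by (simp add: row_size_ptH nrm_def)
  ultimately have big: "R < nrm (?W *v pv None)" using 2 by simp
  have "hdist (\<lambda>y. H (y v* ?W)) ?q = N c * H (perp (pv ?q) v* ?W) / (max (H (?W $ 1)) (H (?W $ 2)) * (N c * nrm (pv ?q)))"
    unfolding hdist_def rs using c(1) by simp
  also have "N c * nrm (pv ?q) = nrm (?W *v pv None)" by (simp only: c(2) nrm_smult)
  also have "N c * H (perp (pv ?q) v* ?W) = H (perp (c *s pv ?q) v* ?W)"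
    unfolding Hs(2)[symmetric] perp_smult by (rule arg_cong[of _ _ H]) (simp add: vec_eq_iff algebra_simps)
  also have "perp (c *s pv ?q) v* ?W = perp (pv None)" unfolding c(2)[symmetric] perp_mat dW by simp
  also have "perp (pv None) = (-1) *s (axis 2 1 :: 'k^2)"
    by (simp add: vec_eq_iff forall_2 axis_def)
  also have "H ((-1) *s (axis 2 1 :: 'k^2)) \<le> row_size H" unfolding Hs(2) by (simp add: row_size_def)
  finally have "hdist (\<lambda>y. H (y v* ?W)) ?q \<le> row_size H / (max (H (?W $ 1)) (H (?W $ 2)) * nrm (?W *v pv None))"
    using Hs(1)[of "?W $ 1"] by (simp add: divide_right_mono le_max_iff_disj)
  also have "\<dots> \<le> row_size H / ((R * row_size H) * R)"
  proof -
    have "r / (a * b) \<le> r / ((R * r) * R)" if "R * r < a" "R < b" "0 < r" for a b r :: real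
    proof -
      have "0 < R * r" using that R by simp
      then have "0 < a" "0 < b" using that R by linarith+
      show ?thesis
      proof (rule divide_left_mono)
        show "R * r * R \<le> a * b"
          by (rule mult_mono) (use that R \<open>0 < a\<close> in linarith)+
        show "0 < a * b * (R * r * R)" by (intro mult_pos_pos \<open>0 < a\<close> \<open>0 < b\<close> R that(3))
      qed (use that in simp)
    qed
    from this[OF 1 big row_size_pos[OF H]] show ?thesis .
  qed
  also have "\<dots> = 1 / R\<^sup>2" using row_size_pos[OF H] R by (simp add: power2_eq_square)
  finally show ?thesis .
qed

definition inv_pt :: "'k option \<Rightarrow> 'k option" where
  "inv_pt p = (case p of None \<Rightarrow> Some 0 | Some z \<Rightarrow> if z = 0 then None else Some (1 / z))"

lemma inv_pt_inv_pt [simp]: "inv_pt (inv_pt p) = p"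
  by (cases p) (auto simp: inv_pt_def)

lemma cdist_Some: "cdist (Some z) (Some w) = N (z - w) / (max (N z) 1 * max (N w) 1)"
  by (simp add: cdist_def nrm_def wedge_def)

lemma cdist_Some_None: "cdist (Some z) None = 1 / max (N z) 1"
  by (simp add: cdist_def nrm_def wedge_def)

lemma cdist_inv_pt: "cdist (inv_pt p) (inv_pt q) = cdist p q"
proof -
  have ex: "\<exists>c. c \<noteq> 0 \<and> vector [pv p $ 2, pv p $ 1] = c *s pv (inv_pt p)" for p :: "'k option"
  proof (cases p)
    case None
    then show ?thesis by (intro exI[of _ 1]) (simp add: inv_pt_def vec_eq_iff forall_2)
  next
    case (Some z)
    then show ?thesis by (intro exI[of _ "if z = 0 then 1 else z"]) (simp add: inv_pt_def vec_eq_iff forall_2)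
  qed
  obtain c where c: "c \<noteq> 0" "vector [pv p $ 2, pv p $ 1] = c *s pv (inv_pt p)" using ex by blast
  obtain e where e: "e \<noteq> 0" "vector [pv q $ 2, pv q $ 1] = e *s pv (inv_pt q)" using ex by blast
  from cdist_smult[OF c(1) e(1) c(2) e(2)] show ?thesis
    using N_diff_commute[of "pv p $ 2 * pv q $ 1" "pv p $ 1 * pv q $ 2"]
    by (simp add: cdist_def wedge_def nrm_def max.commute)
qed

text \<open>After an inversion if necessary, some term with a Cauchy tail within 1/4 has coordinate
  at most 1. The tail then stays in the disc of radius 2, where \<open>cdist\<close> and
  \<open>N (z - w)\<close> are comparable.\<close>

lemma cdist_complete:
  assumes compl: "\<And>s :: nat \<Rightarrow> 'k. (\<And>\<epsilon>::real. 0 < \<epsilon> \<Longrightarrow> \<exists>K. \<forall>i\<ge>K. \<forall>j\<ge>K. N (s i - s j) < \<epsilon>) \<Longrightarrow> \<exists>l. (\<lambda>n. N (s n - l)) \<longlonglongrightarrow> 0"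
    and s: "\<And>\<epsilon>::real. 0 < \<epsilon> \<Longrightarrow> \<exists>K. \<forall>i\<ge>K. \<forall>j\<ge>K. cdist (s i) (s j) < \<epsilon>"
  shows "\<exists>l. (\<lambda>n. cdist (s n) l) \<longlonglongrightarrow> 0"
proof -
  have main: "\<exists>l. (\<lambda>n. cdist (s n) l) \<longlonglongrightarrow> 0" if s: "\<And>\<epsilon>::real. 0 < \<epsilon> \<Longrightarrow> \<exists>K. \<forall>i\<ge>K. \<forall>j\<ge>K. cdist (s i) (s j) < \<epsilon>"
    and K: "\<And>i. K \<le> i \<Longrightarrow> cdist (s i) (s K) < 1/4" and a: "s K = Some a" "N a \<le> 1" for s K a
  proof -
    have z: "\<exists>z. s i = Some z \<and> N z \<le> 2" if i: "K \<le> i" for i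
    proof (cases "s i")
      case None
      then have "cdist (s i) (s K) = 1" using a by (simp add: cdist_sym[of None] cdist_Some_None)
      then show ?thesis using K[OF i] by simp
    next
      case (Some z)
      have "N (z - a) < 1/4 * max (N z) 1" using K[OF i] a Some by (simp add: cdist_Some max_def divide_less_eq split: if_splits)
      moreover have "N z - N a \<le> N (z - a)" by (rule N_diff_ge)
      ultimately have "N z \<le> 2" using a(2) by (auto simp: max_def split: if_splits)
      then show ?thesis using Some by blast
    qed
    define t where "t i = the (s (K + i))" for i
    have t: "s (K + i) = Some (t i)" "N (t i) \<le> 2" for i using z[of "K + i"] by (auto simp: t_def)
    have "\<exists>l. (\<lambda>n. N (t n - l)) \<longlonglongrightarrow> 0"
    proof (rule compl)
      fix \<epsilon> :: real assume "0 < \<epsilon>"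
      then obtain K' where K': "\<And>i j. \<lbrakk>K' \<le> i; K' \<le> j\<rbrakk> \<Longrightarrow> cdist (s i) (s j) < \<epsilon> / 4" using s[of "\<epsilon>/4"] by auto
      show "\<exists>K. \<forall>i\<ge>K. \<forall>j\<ge>K. N (t i - t j) < \<epsilon>"
      proof (intro exI[of _ K'] allI impI)
        fix i j assume "K' \<le> i" "K' \<le> j"
        then have "cdist (s (K + i)) (s (K + j)) < \<epsilon> / 4" by (intro K') auto
        then have "N (t i - t j) / (max (N (t i)) 1 * max (N (t j)) 1) < \<epsilon> / 4" by (simp add: t cdist_Some)
        moreover have "0 < max (N (t i)) 1 * max (N (t j)) 1" by (simp add: less_max_iff_disj)
        ultimately have "N (t i - t j) < \<epsilon> / 4 * (max (N (t i)) 1 * max (N (t j)) 1)" by (simp add: pos_divide_less_eq)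
        also have "\<dots> \<le> \<epsilon> / 4 * (2 * 2)" using t(2) \<open>0 < \<epsilon>\<close> by (intro mult_left_mono mult_mono) auto
        finally show "N (t i - t j) < \<epsilon>" by simp
      qed
    qed
    then obtain l where l: "(\<lambda>n. N (t n - l)) \<longlonglongrightarrow> 0" by blast
    have "(\<lambda>n. cdist (s (n + K)) (Some l)) \<longlonglongrightarrow> 0"
    proof (rule tendsto_sandwich[OF _ _ tendsto_const l])
      have "cdist (s (n + K)) (Some l) \<le> N (t n - l)" for n
      proof -
        have "1 * 1 \<le> max (N (t n)) 1 * max (N l) 1" by (intro mult_mono) auto
        then show ?thesis unfolding add.commute[of n] t cdist_Some
          using divide_left_mono[of 1 "max (N (t n)) 1 * max (N l) 1" "N (t n - l)"] by simp
      qed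
      then show "\<forall>\<^sub>F n in sequentially. cdist (s (n + K)) (Some l) \<le> N (t n - l)" by simp
    qed simp
    then show ?thesis using LIMSEQ_offset[of "\<lambda>n. cdist (s n) (Some l)" K] by blast
  qed
  obtain K where K: "\<And>i j. \<lbrakk>K \<le> i; K \<le> j\<rbrakk> \<Longrightarrow> cdist (s i) (s j) < 1/4" using s[of "1/4"] by auto
  show ?thesis
  proof (cases "\<exists>a. s K = Some a \<and> N a \<le> 1")
    case True
    then obtain a where "s K = Some a" "N a \<le> 1" by blast
    from main[OF s K this] show ?thesis by simp
  next
    case False
    have "\<exists>a. inv_pt (s K) = Some a \<and> N a \<le> 1"
    proof (cases "s K")
      case None
      then show ?thesis by (simp add: inv_pt_def)
    next
      case (Some z)
      then have "1 < N z" using False by auto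
      then have "z \<noteq> 0" "N (1 / z) \<le> 1" by (auto simp: N_divide divide_le_eq)
      then show ?thesis using Some by (simp add: inv_pt_def)
    qed
    then obtain a where a: "inv_pt (s K) = Some a" "N a \<le> 1" by blast
    have "\<exists>l. (\<lambda>n. cdist (inv_pt (s n)) l) \<longlonglongrightarrow> 0"
    proof (rule main[where K=K and a=a])
      show "cdist (inv_pt (s i)) (inv_pt (s K)) < 1/4" if "K \<le> i" for i
        unfolding cdist_inv_pt by (rule K[OF that order_refl])
    qed (use a s in \<open>simp_all only: cdist_inv_pt\<close>)
    then obtain l where "(\<lambda>n. cdist (inv_pt (s n)) l) \<longlonglongrightarrow> 0" by blast
    moreover have "cdist (inv_pt (s n)) l = cdist (s n) (inv_pt l)" for n
      using cdist_inv_pt[of "s n" "inv_pt l"] by simp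
    ultimately show ?thesis by auto
  qed
qed

end

text \<open>Growth is used twice, for \<open>H\<close> and for the seminorm of the point
  \<open>None\<close>, each failing with probability at most \<open>\<eta> / 2\<close>. The time
  \<open>n0\<close> is chosen before \<open>N\<close>, \<rho> and \<open>H\<close>: all uniformity
  in t comes from this order of quantifiers.\<close>

lemma contraction_uniform:
  fixes \<eta> :: real
  assumes "e \<in> set_pmf m" "set f \<subseteq> set_pmf m" "set h \<subseteq> set_pmf m" "0 < c" "0 < \<eta>" "0 < \<delta>"
  shows "\<exists>n0. \<forall>n\<ge>n0. \<forall>(N :: 'k::field \<Rightarrow> real) \<rho> H. sl2_data m B c e f h N \<rho> \<longrightarrow> row_seminorm N H \<longrightarrow>
     measure_pmf.prob (replicate_pmf n m)
       {w. \<delta> < absval.hdist N (\<lambda>y. H (y v* word_mat \<rho> w)) (word_act (\<lambda>g. mobius (\<rho> g)) w None)} \<le> \<eta>"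
proof -
  define R where "R = 1 / sqrt \<delta>"
  have R: "0 < R" "1 / R\<^sup>2 = \<delta>" using assms by (simp_all add: R_def power_divide)
  have "0 < \<eta> / 2" using assms by simp
  from random_product_growth[OF assms(1-4) R(1) this, of B, where 'k='k]
  obtain n0 where n0: "\<And>n (N :: 'k \<Rightarrow> real) \<rho> H. \<lbrakk>n0 \<le> n; sl2_data m B c e f h N \<rho>; row_seminorm N H\<rbrakk> \<Longrightarrow>
     measure_pmf.prob (replicate_pmf n m)
       {w. max (H (word_mat \<rho> w $ 1)) (H (word_mat \<rho> w $ 2)) \<le> R * row_size H} \<le> \<eta> / 2" by blast
  show ?thesis
  proof (intro exI[of _ n0] allI impI)
    fix n and N :: "'k \<Rightarrow> real" and \<rho> H
    assume n: "n0 \<le> n" and D: "sl2_data m B c e f h N \<rho>" and H: "row_seminorm N H"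
    interpret absval N using D by (simp add: sl2_data_def)
    let ?P = "measure_pmf.prob (replicate_pmf n m)"
    let ?A = "\<lambda>H w. max (H (word_mat \<rho> w $ 1)) (H (word_mat \<rho> w $ 2)) \<le> R * row_size H"
    have det: "lettersdet m \<rho>" using D by (simp add: sl2_data_def)
    have "?P {w. \<delta> < hdist (\<lambda>y. H (y v* word_mat \<rho> w)) (word_act (\<lambda>g. mobius (\<rho> g)) w None)}
        \<le> ?P {w. ?A H w \<or> ?A (ptH None) w}"
    proof (rule prob_le_if_supp, rule ccontr)
      fix w assume w: "w \<in> set_pmf (replicate_pmf n m)"
        "\<delta> < hdist (\<lambda>y. H (y v* word_mat \<rho> w)) (word_act (\<lambda>g. mobius (\<rho> g)) w None)"
        and "\<not> (?A H w \<or> ?A (ptH None) w)"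
      then have "hdist (\<lambda>y. H (y v* word_mat \<rho> w)) (word_act (\<lambda>g. mobius (\<rho> g)) w None) \<le> 1 / R\<^sup>2"
        using det by (intro hdist_word_bound H R(1)) (auto simp: set_replicate_pmf lettersdet_def)
      then show False using w(2) R by simp
    qed
    also have "\<dots> = ?P ({w. ?A H w} \<union> {w. ?A (ptH None) w})" by (rule arg_cong[of _ _ ?P]) auto
    also have "\<dots> \<le> ?P {w. ?A H w} + ?P {w. ?A (ptH None) w}" by (rule measure_Un_le) auto
    also have "\<dots> \<le> \<eta> / 2 + \<eta> / 2" by (intro add_mono n0[OF n D] H row_seminorm_ptH)
    finally show "?P {w. \<delta> < hdist (\<lambda>y. H (y v* word_mat \<rho> w)) (word_act (\<lambda>g. mobius (\<rho> g)) w None)} \<le> \<eta>" by simp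
  qed
qed

section \<open>The complex projective line\<close>

text \<open>After dividing by \<open>a + b\<close> both terms lie in the unit interval, where
  \<open>x \<le> x powr \<epsilon>\<close>.\<close>

lemma powr_subadditive:
  fixes a b \<epsilon> :: real
  assumes "0 \<le> a" "0 \<le> b" "0 < \<epsilon>" "\<epsilon> \<le> 1"
  shows "(a + b) powr \<epsilon> \<le> a powr \<epsilon> + b powr \<epsilon>"
proof (cases "a + b = 0")
  case True
  then show ?thesis by simp
next
  case False
  then have s: "0 < a + b" using assms by linarith
  have *: "x / (a + b) \<le> (x / (a + b)) powr \<epsilon>" if "0 \<le> x" "x \<le> a + b" for x
  proof (cases "x = 0")
    case False
    have "(x / (a + b)) powr 1 \<le> (x / (a + b)) powr \<epsilon>"
      using that s assms False by (intro powr_mono') auto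
    then show ?thesis using that s False by simp
  qed simp
  have "1 = a / (a + b) + b / (a + b)" using s by (simp add: add_divide_distrib[symmetric])
  also have "\<dots> \<le> (a / (a + b)) powr \<epsilon> + (b / (a + b)) powr \<epsilon>" using assms by (intro add_mono *) auto
  also have "\<dots> = (a powr \<epsilon> + b powr \<epsilon>) / (a + b) powr \<epsilon>"
    using assms s by (simp add: powr_divide add_divide_distrib)
  finally show ?thesis using s by (simp add: field_simps)
qed

lemma absval_cmod_powr:
  assumes "0 < \<epsilon>" "\<epsilon> \<le> 1"
  shows "absval (\<lambda>z::complex. cmod z powr \<epsilon>)"
proof
  fix x y :: complex
  show "cmod (x * y) powr \<epsilon> = cmod x powr \<epsilon> * cmod y powr \<epsilon>" by (simp add: norm_mult powr_mult)
  have "cmod (x + y) powr \<epsilon> \<le> (cmod x + cmod y) powr \<epsilon>"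
    using assms by (intro powr_mono2 norm_triangle_ineq) auto
  also have "\<dots> \<le> cmod x powr \<epsilon> + cmod y powr \<epsilon>" using assms by (intro powr_subadditive) auto
  finally show "cmod (x + y) powr \<epsilon> \<le> cmod x powr \<epsilon> + cmod y powr \<epsilon>" .
qed auto

lemma cmod_powr_less_iff:
  fixes z :: complex and r \<epsilon> :: real
  assumes "0 < \<epsilon>" "0 \<le> r"
  shows "cmod z powr \<epsilon> < r powr \<epsilon> \<longleftrightarrow> cmod z < r"
  using assms powr_less_mono2[of \<epsilon> "cmod z" r] powr_mono2[of \<epsilon> r "cmod z"] by force

lemma cmod_powr_complete:
  fixes s :: "nat \<Rightarrow> complex"
  assumes "0 < \<epsilon>" "\<And>r::real. 0 < r \<Longrightarrow> \<exists>K. \<forall>i\<ge>K. \<forall>j\<ge>K. cmod (s i - s j) powr \<epsilon> < r"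
  shows "\<exists>l. (\<lambda>n. cmod (s n - l) powr \<epsilon>) \<longlonglongrightarrow> 0"
proof -
  have "Cauchy s"
  proof (rule CauchyI)
    fix r :: real assume r: "0 < r"
    then obtain K where "\<forall>i\<ge>K. \<forall>j\<ge>K. cmod (s i - s j) powr \<epsilon> < r powr \<epsilon>" using assms(2)[of "r powr \<epsilon>"] by auto
    then show "\<exists>M. \<forall>m\<ge>M. \<forall>n\<ge>M. norm (s m - s n) < r" using cmod_powr_less_iff[OF assms(1), of r] r by auto
  qed
  then obtain l where "s \<longlonglongrightarrow> l" using Cauchy_convergent_iff convergent_def by blast
  then have "(\<lambda>n. cmod (s n - l)) \<longlonglongrightarrow> 0" by (simp add: LIM_zero_iff tendsto_norm_zero_iff)
  then have "(\<lambda>n. cmod (s n - l) powr \<epsilon>) \<longlonglongrightarrow> 0 powr \<epsilon>"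
    using assms(1) by (intro tendsto_powr'[where b=\<epsilon>]) auto
  then show ?thesis by auto
qed

abbreviation P1C_opens :: "complex option set set" where
  "P1C_opens \<equiv> {W. open {z. Some z \<in> W} \<and> (None \<in> W \<longrightarrow> (\<exists>R. \<forall>z. R < norm z \<longrightarrow> Some z \<in> W))}"

text \<open>The generating family is itself closed under finite intersections and arbitrary
  unions.\<close>

lemma openin_P1C_top: "openin P1C_top U \<longleftrightarrow> U \<in> P1C_opens"
proof
  assume "openin P1C_top U"
  then have "generate_topology_on P1C_opens U"
    unfolding P1C_top_def openin_topology_generated_by_iff .
  then show "U \<in> P1C_opens"
  proof induction
    case (Int a b)
    have "{z. Some z \<in> a \<inter> b} = {z. Some z \<in> a} \<inter> {z. Some z \<in> b}" by auto
    moreover have "\<exists>R. \<forall>z. R < cmod z \<longrightarrow> Some z \<in> a \<inter> b" if n: "None \<in> a \<inter> b"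
    proof -
      obtain R1 R2 where "\<forall>z. R1 < norm z \<longrightarrow> Some z \<in> a" "\<forall>z. R2 < norm z \<longrightarrow> Some z \<in> b" using Int.IH n by blast
      then show ?thesis by (intro exI[of _ "max R1 R2"]) auto
    qed
    ultimately show ?case using Int.IH by auto
  next
    case (UN K)
    have "{z. Some z \<in> \<Union>K} = (\<Union>k\<in>K. {z. Some z \<in> k})" by auto
    moreover have "open (\<Union>k\<in>K. {z. Some z \<in> k})" using UN by blast
    moreover have "\<exists>R. \<forall>z. R < cmod z \<longrightarrow> Some z \<in> \<Union>K" if n: "None \<in> \<Union>K"
    proof -
      obtain k where k: "k \<in> K" "None \<in> k" using n by blast
      then obtain R where "\<forall>z. R < cmod z \<longrightarrow> Some z \<in> k" using UN(2)[OF k(1)] by blast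
      then show ?thesis using k(1) by blast
    qed
    ultimately show ?case by auto
  qed auto
next
  assume "U \<in> P1C_opens"
  then show "openin P1C_top U" unfolding P1C_top_def by (intro topology_generated_by_Basis)
qed

lemma topspace_P1C_top [simp]: "topspace P1C_top = UNIV"
proof -
  have "openin P1C_top UNIV" unfolding openin_P1C_top by auto
  then show ?thesis using openin_subset by blast
qed

text \<open>The condition on \<open>r\<close> forces
  \<open>max (N w) 1 \<le> 2 * max (N z) 1\<close>; then the denominator of the chordal distance is
  bounded.\<close>

lemma (in absval) cdist_Some_ball:
  assumes "cdist (Some w) (Some z) < r" "r * max (N z) 1 \<le> 1/2"
  shows "N (w - z) < 2 * (max (N z) 1)\<^sup>2 * r"
proof -
  define M where "M = max (N z) 1"
  define W where "W = max (N w) 1"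
  have M: "1 \<le> M" "N z \<le> M" and W: "1 \<le> W" by (auto simp: M_def W_def)
  have less: "N (w - z) < r * (W * M)"
    using assms(1) M(1) W by (simp add: cdist_Some M_def[symmetric] W_def[symmetric] pos_divide_less_eq)
  have r: "r * M \<le> 1/2" using assms(2) by (simp add: M_def)
  have "r * (W * M) = W * (r * M)" by simp
  also have "\<dots> \<le> W * (1/2)" using r W by (intro mult_left_mono) auto
  finally have "N (w - z) < W / 2" using less by simp
  moreover have "N w \<le> N z + N (w - z)" using N_diff_ge[of w z] by simp
  ultimately have "W \<le> 2 * M" using M W_def by (auto simp: max_def split: if_splits)
  have r0: "0 < r" using assms(1) cdist_nonneg[of "Some w" "Some z"] by linarith
  have "r * (W * M) \<le> r * ((2 * M) * M)" using r0 M \<open>W \<le> 2 * M\<close> by (intro mult_left_mono mult_right_mono) auto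
  then show ?thesis using less by (simp add: M_def[symmetric] power2_eq_square algebra_simps)
qed

text \<open>Moving a starting point by a word pulls its seminorm back. Contraction for all seminorms
  is thus contraction from all starting points.\<close>

lemma (in absval) cdist_word_act:
  assumes "\<And>g. g \<in> set w \<Longrightarrow> det (\<rho> g) = 1"
  shows "cdist (word_act (\<lambda>g. mobius (\<rho> g)) w y) q = hdist (\<lambda>u. ptH y (u v* word_mat \<rho> w)) q"
proof -
  obtain c where c: "c \<noteq> 0" "word_mat \<rho> w *v pv y = c *s pv (word_act (\<lambda>g. mobius (\<rho> g)) w y)"
    using pv_word_act[of w \<rho> y, OF assms] by blast
  have dot: "dot2 (u v* word_mat \<rho> w) (pv y) = c * dot2 u (pv (word_act (\<lambda>g. mobius (\<rho> g)) w y))" for u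
    unfolding dot2_vec_mat c(2) by (simp add: dot2_def algebra_simps)
  have "(\<lambda>u. ptH y (u v* word_mat \<rho> w)) = (\<lambda>u. N c * ptH (word_act (\<lambda>g. mobius (\<rho> g)) w y) u)"
    unfolding ptH_def dot N_mult ..
  moreover have "0 < N c" using c(1) by simp
  ultimately show ?thesis by (simp only: hdist_scale hdist_ptH)
qed

context
  fixes \<epsilon> :: real
  assumes \<epsilon>: "0 < \<epsilon>" "\<epsilon> \<le> 1"
begin

interpretation absval "\<lambda>z::complex. cmod z powr \<epsilon>"
  by (rule absval_cmod_powr[OF \<epsilon>])

text \<open>Together with the next lemma: the chordal distances for all exponents \<epsilon> induce
  one topology, the fixed one of the complex line.\<close>

lemma P1C_ball_open: "openin P1C_top {y. cdist y p < r}"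
  unfolding openin_P1C_top
proof (intro CollectI conjI impI)
  have cont: "continuous_on UNIV (\<lambda>w::complex. cmod (f w) powr \<epsilon>)" if "continuous_on UNIV f" for f
    using \<epsilon> that by (intro continuous_on_powr' continuous_intros) auto
  have "continuous_on UNIV (\<lambda>w. cdist (Some w) p)"
    unfolding cdist_def wedge_def nrm_def pv_simps
  proof (intro continuous_on_divide continuous_on_mult continuous_on_max cont continuous_intros ballI)
    fix w :: complex
    show "max (cmod w powr \<epsilon>) (cmod 1 powr \<epsilon>) *
         max (cmod (pv p $ 1) powr \<epsilon>) (cmod (pv p $ 2) powr \<epsilon>) \<noteq> 0"
      using nrm_pv_neq_0[of "Some w"] nrm_pv_neq_0[of p] by (simp add: nrm_def)
  qed
  then have "open {w. cdist (Some w) p < r}"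
    by (intro open_Collect_less) auto
  then show "open {z. Some z \<in> {y. cdist y p < r}}" by simp
next
  assume "None \<in> {y. cdist y p < r}"
  then have d: "0 < r - cdist None p" by simp
  show "\<exists>R. \<forall>z. R < cmod z \<longrightarrow> Some z \<in> {y. cdist y p < r}"
  proof (intro exI[of _ "(1 / (r - cdist None p)) powr (1 / \<epsilon>)"] allI impI CollectI)
    fix z :: complex assume z: "(1 / (r - cdist None p)) powr (1 / \<epsilon>) < cmod z"
    have "((1 / (r - cdist None p)) powr (1 / \<epsilon>)) powr \<epsilon> < cmod z powr \<epsilon>"
      using z \<epsilon> by (intro powr_less_mono2) auto
    then have "1 / (r - cdist None p) < cmod z powr \<epsilon>" using \<epsilon> d by (simp add: powr_powr)
    then have "1 / (r - cdist None p) < max (cmod z powr \<epsilon>) 1" by simp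
    moreover have "1 / M < x" if "1 / x < M" "0 < x" for M x :: real
    proof -
      have "0 < M" using that by (meson divide_pos_pos zero_less_one order_less_trans)
      then show ?thesis using that by (simp add: field_simps)
    qed
    ultimately have "cdist (Some z) None < r - cdist None p"
      using d unfolding cdist_Some_None by blast
    then show "cdist (Some z) p < r" using cdist_triangle[of "Some z" p None] by simp
  qed
qed

lemma P1C_ball_basis:
  assumes "openin P1C_top U" "p \<in> U"
  shows "\<exists>r>0. {y. cdist y p < r} \<subseteq> U"
proof (cases p)
  case None
  then obtain R where R: "\<And>z. R < cmod z \<Longrightarrow> Some z \<in> U" using assms unfolding openin_P1C_top by blast
  define R' where "R' = max R 1"
  define r where "r = 1 / (R' powr \<epsilon>)"
  have R': "1 \<le> R'" "R \<le> R'" by (auto simp: R'_def)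
  have r: "0 < r" using R' by (simp add: r_def)
  have R1: "1 \<le> R' powr \<epsilon>" using R' \<epsilon> by (intro ge_one_powr_ge_zero) auto
  have "y \<in> U" if y: "cdist y p < r" for y
  proof (cases y)
    case None
    then show ?thesis using assms(2) \<open>p = None\<close> by simp
  next
    case (Some z)
    have "1 / max (cmod z powr \<epsilon>) 1 < 1 / R' powr \<epsilon>" using y unfolding Some \<open>p = None\<close> cdist_Some_None r_def .
    moreover have "b < a" if "1 / a < 1 / b" "1 \<le> a" "1 \<le> b" for a b :: real
      using that by (simp add: field_simps)
    ultimately have "R' powr \<epsilon> < max (cmod z powr \<epsilon>) 1" using R1 max.cobounded2 by blast
    then have "R' powr \<epsilon> < cmod z powr \<epsilon>" using R1 by auto
    then have "R' < cmod z" using cmod_powr_less_iff[OF \<epsilon>(1)] powr_mono2[of \<epsilon> "cmod z" R'] \<epsilon> by force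
    then show ?thesis using R R' Some by simp
  qed
  then show ?thesis using r by blast
next
  case (Some z)
  then have "open {z. Some z \<in> U}" "z \<in> {z. Some z \<in> U}" using assms unfolding openin_P1C_top by blast+
  then obtain e where e: "0 < e" "ball z e \<subseteq> {z. Some z \<in> U}" by (meson open_contains_ball)
  define M where "M = max (cmod z powr \<epsilon>) 1"
  have M: "1 \<le> M" by (simp add: M_def)
  \<comment> \<open>The first bound excludes infinity and allows \<open>cdist_Some_ball\<close>; the
    second turns its conclusion into membership in \<open>ball z e\<close>.\<close>
  define r where "r = min (1 / (2 * M)) (e powr \<epsilon> / (2 * M\<^sup>2))"
  have r: "0 < r" "r * M \<le> 1/2" "2 * M\<^sup>2 * r \<le> e powr \<epsilon>"
  proof -
    show "0 < r" using M e by (simp add: r_def)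
    have "r * M \<le> 1 / (2 * M) * M" unfolding r_def using M by (intro mult_right_mono) auto
    then show "r * M \<le> 1/2" using M by simp
    have "2 * M\<^sup>2 * r \<le> 2 * M\<^sup>2 * (e powr \<epsilon> / (2 * M\<^sup>2))" unfolding r_def using M by (intro mult_left_mono) auto
    then show "2 * M\<^sup>2 * r \<le> e powr \<epsilon>" using M by simp
  qed
  have "y \<in> U" if y: "cdist y p < r" for y
  proof (cases y)
    case None
    then have "1 / M < r" using y Some by (simp add: cdist_sym[of None] cdist_Some_None M_def)
    then have "1 < r * M" using M by (simp add: field_simps)
    then show ?thesis using r by simp
  next
    case (Some w)
    have "cmod (w - z) powr \<epsilon> < 2 * M\<^sup>2 * r"
      unfolding M_def using y r(2) Some \<open>p = Some z\<close> by (intro cdist_Some_ball) (auto simp: M_def)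
    then have "cmod (w - z) powr \<epsilon> < e powr \<epsilon>" using r by simp
    then have "cmod (w - z) < e" using cmod_powr_less_iff[OF \<epsilon>(1), of e] e by simp
    then have "w \<in> ball z e" by (simp add: dist_norm norm_minus_commute)
    then show ?thesis using e Some by auto
  qed
  then show ?thesis using r by blast
qed

lemma complex_mobius_measurable:
  assumes "det g = 1"
  shows "mobius g \<in> measurable (borel_of P1C_top) (borel_of P1C_top)"
proof (rule continuous_map_measurable)
  show "continuous_map P1C_top P1C_top (mobius g)"
    unfolding continuous_map_def
  proof (intro conjI allI impI)
    fix U assume U: "openin P1C_top U"
    have L: "0 < 4 * (mnrm g)\<^sup>2"
    proof -
      have "mnrm g \<noteq> 0"
      proof
        assume "mnrm g = 0"
        then have "g$i$j = 0" for i j using N_le_mnrm[of g i j] by simp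
        then show False using assms by (simp add: det_2)
      qed
      then show ?thesis by simp
    qed
    show "openin P1C_top {x \<in> topspace P1C_top. mobius g x \<in> U}"
    proof (subst openin_subopen, intro ballI)
      fix x assume x: "x \<in> {x \<in> topspace P1C_top. mobius g x \<in> U}"
      then obtain r where r: "0 < r" "{y. cdist y (mobius g x) < r} \<subseteq> U" using P1C_ball_basis[OF U] by blast
      show "\<exists>S. openin P1C_top S \<and> x \<in> S \<and> S \<subseteq> {x \<in> topspace P1C_top. mobius g x \<in> U}"
      proof (intro exI[of _ "{y. cdist y x < r / (4 * (mnrm g)\<^sup>2)}"] conjI P1C_ball_open subsetI)
        show "x \<in> {y. cdist y x < r / (4 * (mnrm g)\<^sup>2)}" using r L by simp
        fix y assume "y \<in> {y. cdist y x < r / (4 * (mnrm g)\<^sup>2)}"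
        then have "4 * (mnrm g)\<^sup>2 * cdist y x < r" using L by (simp add: pos_less_divide_eq mult.commute)
        then have "cdist (mobius g y) (mobius g x) < r" using cdist_mobius_Lipschitz[OF assms, of y x] by linarith
        then show "y \<in> {x \<in> topspace P1C_top. mobius g x \<in> U}" using r(2) by auto
      qed
    qed
  qed simp
qed

text \<open>Over the complex numbers all points are classical, so the two spaces of the locale
  coincide and the embedding is the identity.\<close>

lemma complex_boundary_walk:
  fixes m :: "'a::countable pmf"
  assumes "e \<in> set_pmf m" "set f \<subseteq> set_pmf m" "set h \<subseteq> set_pmf m" "0 < c"
    and data: "sl2_data m B c e f h (\<lambda>z::complex. cmod z powr \<epsilon>) \<rho>"
    and det: "\<And>g. det (\<rho> g) = 1"
  shows "boundary_walk m (\<lambda>g. mobius (\<rho> g)) cdist None P1C_top (\<lambda>g. mobius (\<rho> g)) (\<lambda>x. x) cdist"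
proof
  show "\<exists>L. \<forall>x y. cdist (mobius (\<rho> g) x) (mobius (\<rho> g) y) \<le> L * cdist x y" for g
    using cdist_mobius_Lipschitz[OF det] by blast
  show "\<exists>l. (\<lambda>n. cdist (s n) l) \<longlonglongrightarrow> 0" if "\<And>r::real. 0 < r \<Longrightarrow> \<exists>K. \<forall>i\<ge>K. \<forall>j\<ge>K. cdist (s i) (s j) < r" for s
    using cdist_complete[OF cmod_powr_complete[OF \<epsilon>(1)] that] by simp
  show "mobius (\<rho> g) \<in> measurable (borel_of P1C_top) (borel_of P1C_top)" for g
    by (rule complex_mobius_measurable[OF det])
  show "openin P1C_top {y \<in> topspace P1C_top. cdist y z < r}" for z r using P1C_ball_open by simp
  show "\<exists>r>0. {y \<in> topspace P1C_top. cdist y z < r} \<subseteq> U" if "openin P1C_top U" "z \<in> U" for U z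
    using P1C_ball_basis[OF that] by simp
  show "\<exists>n0. \<forall>n\<ge>n0. \<forall>y\<in>topspace P1C_top.
       measure_pmf.prob (replicate_pmf n m) {w. \<eta> < cdist (word_act (\<lambda>g. mobius (\<rho> g)) w y) (word_act (\<lambda>g. mobius (\<rho> g)) w None)} \<le> \<eta>"
    if \<eta>: "0 < \<eta>" for \<eta>
  proof -
    obtain n0 where n0: "\<And>n H. n0 \<le> n \<Longrightarrow> row_seminorm (\<lambda>z::complex. cmod z powr \<epsilon>) H \<Longrightarrow>
      measure_pmf.prob (replicate_pmf n m) {w. \<eta> < hdist (\<lambda>y. H (y v* word_mat \<rho> w)) (word_act (\<lambda>g. mobius (\<rho> g)) w None)} \<le> \<eta>"
      using contraction_uniform[OF assms(1-4) \<eta> \<eta>, of B, where 'k=complex] data by blast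
    have eq: "cdist (word_act (\<lambda>g. mobius (\<rho> g)) w y) q = hdist (\<lambda>u. ptH y (u v* word_mat \<rho> w)) q" for w y q
      by (rule cdist_word_act[OF det])
    show ?thesis using n0[OF _ row_seminorm_ptH] unfolding eq by blast
  qed
  show "cdist x z \<le> cdist x u + cdist u z" for x z u by (rule cdist_triangle)
  show "cdist x z = cdist z x" for x z by (rule cdist_sym)
  show "cdist y z \<le> cdist y x + cdist x z" for x y z by (rule cdist_triangle)
  show "cdist x z \<le> cdist y x + cdist y z" for x y z
    using cdist_triangle[of x z y] by (simp add: cdist_sym[of x y])
  show "y = z" if "cdist y z = 0" for y z using cdist_eq_0 that by blast
qed auto

end

section \<open>Gluing charts of seminorms\<close>

text \<open>\<open>hom_subst n A B P = B^n P(A/B)\<close>; both the gluing \<open>z \<mapsto> 1/z\<close> and the action of a matrix are of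
  this form.\<close>
definition hom_subst :: "nat \<Rightarrow> 'p::comm_ring_1 poly \<Rightarrow> 'p poly \<Rightarrow> 'p poly \<Rightarrow> 'p poly" where
  "hom_subst n A B P = (\<Sum>i\<le>n. smult (coeff P i) (A ^ i * B ^ (n - i)))"

lemma hom_subst_add: "hom_subst n A B (P + Q) = hom_subst n A B P + hom_subst n A B Q"
  by (simp add: hom_subst_def smult_add_left sum.distrib)

lemma hom_subst_smult: "hom_subst n A B (smult c P) = smult c (hom_subst n A B P)"
  by (simp add: hom_subst_def poly_eq_iff coeff_sum sum_distrib_left mult.assoc)

lemma hom_subst_zero [simp]: "hom_subst n A B 0 = 0"
  by (simp add: hom_subst_def)

lemma hom_subst_pCons: "hom_subst (Suc n) A B (pCons a P) = smult a (B ^ Suc n) + A * hom_subst n A B P"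
  by (simp add: hom_subst_def sum.atMost_Suc_shift sum_distrib_left mult.assoc del: sum.atMost_Suc)

lemma hom_subst_const: "hom_subst n A B [:a:] = smult a (B ^ n)"
proof -
  have "hom_subst n A B [:a:] = (\<Sum>i\<le>n. if i = 0 then smult a (B ^ n) else 0)"
    unfolding hom_subst_def by (rule sum.cong) (auto simp: coeff_pCons split: nat.split)
  then show ?thesis by simp
qed

text \<open>Homogenising in a higher degree only adds a power of \<open>B\<close>. This allows a
  common degree for \<open>P\<close>, \<open>Q\<close> and \<open>P + Q\<close>, although the last
  one may drop.\<close>

lemma hom_subst_raise:
  assumes "degree P \<le> n"
  shows "hom_subst n A B P = B ^ (n - degree P) * hom_subst (degree P) A B P"
proof -
  have "hom_subst n A B P = (\<Sum>i\<le>degree P. smult (coeff P i) (A ^ i * B ^ (n - i)))"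
    unfolding hom_subst_def using assms
    by (intro sum.mono_neutral_right) (auto simp: coeff_eq_0)
  also have "\<dots> = (\<Sum>i\<le>degree P. B ^ (n - degree P) * smult (coeff P i) (A ^ i * B ^ (degree P - i)))"
  proof (rule sum.cong)
    fix i assume "i \<in> {..degree P}"
    then have "n - i = (n - degree P) + (degree P - i)" using assms by simp
    then have "B ^ (n - i) = B ^ (n - degree P) * B ^ (degree P - i)" by (simp add: power_add)
    then show "smult (coeff P i) (A ^ i * B ^ (n - i)) = B ^ (n - degree P) * smult (coeff P i) (A ^ i * B ^ (degree P - i))"
      by (simp add: mult_ac)
  qed simp
  finally show ?thesis by (simp add: hom_subst_def sum_distrib_left)
qed

text \<open>The degrees are upper bounds rather than exact values, so the induction on the
  coefficients of \<open>P\<close> can lower \<open>n\<close> by one each time.\<close>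

lemma hom_subst_mult:
  assumes "degree P \<le> n" "degree Q \<le> k"
  shows "hom_subst (n + k) A B (P * Q) = hom_subst n A B P * hom_subst k A B Q"
  using assms(1)
proof (induction P arbitrary: n)
  case 0
  then show ?case by simp
next
  case (pCons a P)
  show ?case
  proof (cases n)
    case 0
    then have P: "P = 0" using pCons by (cases "P = 0") auto
    have "pCons a P * Q = smult a Q" by (simp add: P)
    then show ?thesis by (simp add: 0 P hom_subst_smult hom_subst_const)
  next
    case (Suc n')
    have d: "degree P \<le> n'" using pCons.prems Suc by (cases "P = 0") auto
    have eq: "pCons a P * Q = smult a Q + pCons 0 (P * Q)" by (rule mult_pCons_left)
    have "degree Q \<le> n + k" using assms(2) by simp
    then have Q: "hom_subst (n + k) A B Q = B ^ n * hom_subst k A B Q"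
      using hom_subst_raise[of Q "n + k" A B] hom_subst_raise[OF assms(2), of A B] assms(2)
      by (simp add: mult.assoc[symmetric] power_add[symmetric] add_diff_assoc)
    have "hom_subst (n + k) A B (pCons a P * Q) = smult a (B ^ n * hom_subst k A B Q) + A * hom_subst (n' + k) A B (P * Q)"
      unfolding eq hom_subst_add hom_subst_smult Q using hom_subst_pCons[of "n' + k" A B 0 "P * Q"] Suc by simp
    also have "\<dots> = hom_subst n A B (pCons a P) * hom_subst k A B Q"
      unfolding pCons.IH[OF d] Suc hom_subst_pCons by (simp add: algebra_simps)
    finally show ?thesis .
  qed
qed

lemma poly_hom_subst:
  fixes A B :: "'p::field poly"
  assumes "poly B z \<noteq> 0" "degree P \<le> n"
  shows "poly (hom_subst n A B P) z = poly B z ^ n * poly P (poly A z / poly B z)"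
proof -
  have 1: "poly P w = (\<Sum>i\<le>n. coeff P i * w ^ i)" for w
    unfolding poly_altdef using assms(2) by (intro sum.mono_neutral_left) (auto simp: coeff_eq_0)
  have 2: "poly (hom_subst n A B P) z = (\<Sum>i\<le>n. coeff P i * (poly A z ^ i * poly B z ^ (n - i)))"
    by (simp add: hom_subst_def poly_sum)
  have 3: "poly B z ^ n * (coeff P i * (poly A z / poly B z) ^ i) = coeff P i * (poly A z ^ i * poly B z ^ (n - i))"
    if "i \<le> n" for i
    using assms(1) that by (simp add: power_divide power_diff)
  show ?thesis unfolding 1[of "poly A z / poly B z"] 2 sum_distrib_left
    by (rule sum.cong[OF refl]) (simp only: 3 atMost_iff)
qed

lemma coeff_hom_subst_reflect: "coeff (hom_subst n 1 [:0, 1:] P) i = (if i \<le> n then coeff P (n - i) else 0)"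
proof -
  have Z: "[:0, 1:] ^ k = monom 1 k" for k by (simp add: monom_altdef)
  have "coeff (hom_subst n 1 [:0, 1:] P) i = (\<Sum>j\<le>n. coeff P j * (if n - j = i then 1 else 0))"
    unfolding hom_subst_def coeff_sum Z by simp
  also have "\<dots> = (\<Sum>j\<le>n. if i \<le> n \<and> j = n - i then coeff P j else 0)"
    by (rule sum.cong) auto
  also have "\<dots> = (if i \<le> n then coeff P (n - i) else 0)" by auto
  finally show ?thesis .
qed

lemma reflect_poly_hom_subst: "reflect_poly P = hom_subst (degree P) 1 [:0, 1:] P"
  by (rule poly_eqI) (simp add: coeff_hom_subst_reflect coeff_reflect_poly)

text \<open>The degree is that of \<open>P\<close>, not of its reflection, which is smaller when the
  constant coefficient vanishes.\<close>

lemma hom_subst_reflect_reflect: "hom_subst (degree P) 1 [:0, 1:] (reflect_poly P) = P"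
  by (rule poly_eqI) (auto simp: coeff_hom_subst_reflect coeff_reflect_poly coeff_eq_0)

text \<open>The seminorm of \<open>P(A/B)\<close> cleared of its denominator by multiplicativity;
  meaningful where \<open>x B \<noteq> 0\<close>.\<close>

definition subst_seminorm :: "'p::comm_ring_1 poly \<Rightarrow> 'p poly \<Rightarrow> ('p poly \<Rightarrow> real) \<Rightarrow> 'p poly \<Rightarrow> real" where
  "subst_seminorm A B x P = x (hom_subst (degree P) A B P) / x B ^ degree P"

lemma glue_trans_subst: "glue_trans y = subst_seminorm 1 [:0, 1:] y"
  by (rule ext) (simp add: glue_trans_def subst_seminorm_def reflect_poly_hom_subst)

text \<open>What \<open>UNIV\<close> and \<open>hybAZ\<close> have in common, so that the Berkovich
  and the hybrid charts are glued by the same lemmas.\<close>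

definition coeff_subring :: "'p::comm_ring_1 poly set \<Rightarrow> bool" where
  "coeff_subring S \<longleftrightarrow> 0 \<in> S \<and> 1 \<in> S \<and> [:0, 1:] \<in> S \<and> (\<forall>P\<in>S. \<forall>Q\<in>S. P + Q \<in> S \<and> P * Q \<in> S) \<and>
     (\<forall>P\<in>S. \<forall>i. [:coeff P i:] \<in> S)"

lemma coeff_subring_power: "coeff_subring S \<Longrightarrow> P \<in> S \<Longrightarrow> P ^ n \<in> S"
  by (induction n) (auto simp: coeff_subring_def)

lemma coeff_subring_smult: "coeff_subring S \<Longrightarrow> P \<in> S \<Longrightarrow> Q \<in> S \<Longrightarrow> smult (coeff P i) Q \<in> S"
proof -
  assume S: "coeff_subring S" "P \<in> S" "Q \<in> S"
  then have "[:coeff P i:] \<in> S" by (simp only: coeff_subring_def)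
  then have "[:coeff P i:] * Q \<in> S" using S by (simp only: coeff_subring_def)
  then show ?thesis by simp
qed

lemma coeff_subring_hom_subst:
  assumes S: "coeff_subring S" and "A \<in> S" "B \<in> S" "P \<in> S"
  shows "hom_subst n A B P \<in> S"
proof -
  have t: "smult (coeff P i) (A ^ i * B ^ (n - i)) \<in> S" for i
    using assms coeff_subring_power[OF S] by (intro coeff_subring_smult[OF S]) (auto simp: coeff_subring_def)
  have "(\<Sum>i\<in>I. smult (coeff P i) (A ^ i * B ^ (n - i))) \<in> S" if "finite I" for I
    using that by (induction I) (use S t in \<open>auto simp: coeff_subring_def\<close>)
  then show ?thesis by (simp add: hom_subst_def)
qed

lemma mult_seminorm_power:
  assumes "mult_seminorm_on S x" "coeff_subring S" "P \<in> S"
  shows "x (P ^ n) = x P ^ n"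
proof (induction n)
  case (Suc n)
  then show ?case using assms coeff_subring_power[OF assms(2,3)] by (simp add: mult_seminorm_on_def)
qed (use assms in \<open>simp add: mult_seminorm_on_def\<close>)

lemma subst_seminorm_raise:
  assumes x: "mult_seminorm_on S x" and S: "coeff_subring S" and "A \<in> S" "B \<in> S" "P \<in> S" "x B \<noteq> 0" "degree P \<le> n"
  shows "subst_seminorm A B x P = x (hom_subst n A B P) / x B ^ n"
proof -
  have "x (hom_subst n A B P) = x (B ^ (n - degree P)) * x (hom_subst (degree P) A B P)"
    unfolding hom_subst_raise[OF assms(7)]
    using x coeff_subring_hom_subst[OF S assms(3-5)] coeff_subring_power[OF S assms(4)]
    by (simp add: mult_seminorm_on_def)
  also have "\<dots> = x B ^ (n - degree P) * x (hom_subst (degree P) A B P)"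
    by (simp add: mult_seminorm_power[OF x S assms(4)])
  finally show ?thesis using assms(6,7) by (simp add: subst_seminorm_def power_diff)
qed

lemma mult_seminorm_subst:
  fixes x :: "'p::idom poly \<Rightarrow> real"
  assumes x: "mult_seminorm_on S x" and S: "coeff_subring S" and AB: "A \<in> S" "B \<in> S" and nz: "x B \<noteq> 0"
  shows "mult_seminorm_on S (subst_seminorm A B x)"
  unfolding mult_seminorm_on_def
proof (intro conjI ballI)
  note hs = coeff_subring_hom_subst[OF S AB]
  have xs: "x 0 = 0" "x 1 = 1" "\<And>P. P \<in> S \<Longrightarrow> 0 \<le> x P" "\<And>P Q. P \<in> S \<Longrightarrow> Q \<in> S \<Longrightarrow> x (P * Q) = x P * x Q"
    "\<And>P Q. P \<in> S \<Longrightarrow> Q \<in> S \<Longrightarrow> x (P + Q) \<le> x P + x Q" using x by (auto simp: mult_seminorm_on_def)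
  have pos: "0 < x B" using xs(3)[OF AB(2)] nz by simp
  show "subst_seminorm A B x 0 = 0" by (simp add: subst_seminorm_def xs)
  show "subst_seminorm A B x 1 = 1" using hom_subst_const[of 0 A B 1] xs by (simp add: subst_seminorm_def one_pCons)
  show "0 \<le> subst_seminorm A B x P" if "P \<in> S" for P using xs(3)[OF hs[OF that]] pos by (simp add: subst_seminorm_def)
  fix P Q assume PQ: "P \<in> S" "Q \<in> S"
  have in': "P * Q \<in> S" "P + Q \<in> S" using PQ S by (auto simp: coeff_subring_def)
  note r = subst_seminorm_raise[OF x S AB _ nz]
  have "subst_seminorm A B x (P * Q) = x (hom_subst (degree P + degree Q) A B (P * Q)) / x B ^ (degree P + degree Q)"
    by (rule r[OF in'(1) degree_mult_le])
  also have "\<dots> = subst_seminorm A B x P * subst_seminorm A B x Q"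
    unfolding hom_subst_mult[OF order_refl order_refl] by (simp add: xs(4) hs PQ subst_seminorm_def power_add)
  finally show "subst_seminorm A B x (P * Q) = subst_seminorm A B x P * subst_seminorm A B x Q" .
  define n where "n = max (degree P) (degree Q)"
  have n: "degree P \<le> n" "degree Q \<le> n" "degree (P + Q) \<le> n" by (auto simp: n_def intro: degree_add_le)
  have "subst_seminorm A B x (P + Q) = x (hom_subst n A B P + hom_subst n A B Q) / x B ^ n"
    using r[OF in'(2) n(3)] by (simp add: hom_subst_add)
  also have "\<dots> \<le> (x (hom_subst n A B P) + x (hom_subst n A B Q)) / x B ^ n"
    using pos by (intro divide_right_mono xs(5) hs PQ) auto
  also have "\<dots> = subst_seminorm A B x P + subst_seminorm A B x Q"
    by (simp add: r[OF PQ(1) n(1)] r[OF PQ(2) n(2)] add_divide_distrib)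
  finally show "subst_seminorm A B x (P + Q) \<le> subst_seminorm A B x P + subst_seminorm A B x Q" .
qed

lemma subst_seminorm_const: "subst_seminorm A B x [:a:] = x [:a:]"
  using hom_subst_const[of 0 A B a] by (simp add: subst_seminorm_def)

lemma glue_trans_Z: "x 1 = 1 \<Longrightarrow> glue_trans x [:0, 1:] = 1 / x [:0, 1:]"
  by (simp add: glue_trans_def reflect_poly_def one_pCons)

lemma glue_trans_glue_trans:
  assumes x: "mult_seminorm_on S x" and S: "coeff_subring S" and nz: "x [:0, 1:] \<noteq> 0" and P: "P \<in> S"
  shows "glue_trans (glue_trans x) P = x P"
proof -
  have Z: "[:0, 1:] \<in> S" "1 \<in> S" using S by (auto simp: coeff_subring_def)
  have "reflect_poly P \<in> S" unfolding reflect_poly_hom_subst by (rule coeff_subring_hom_subst[OF S Z(2,1) P])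
  moreover have "degree (reflect_poly P) \<le> degree P" by (rule degree_reflect_poly_le)
  ultimately have "glue_trans x (reflect_poly P) = x P / x [:0, 1:] ^ degree P"
    unfolding glue_trans_subst
    by (subst subst_seminorm_raise[OF x S Z(2,1) _ nz]) (auto simp: hom_subst_reflect_reflect)
  then show ?thesis using nz x
    by (simp add: glue_trans_def[of "glue_trans x"] glue_trans_Z mult_seminorm_on_def power_one_over)
qed

section \<open>The topology of a chart and of the glued space\<close>

lemma topspace_chart_top [simp]: "topspace (chart_top C) = C"
  by (simp add: chart_top_def)

lemma continuous_map_chart_coord: "continuous_map (chart_top C) euclideanreal (\<lambda>x. x P)"
  unfolding chart_top_def
  by (intro continuous_map_from_subtopology continuous_map_product_projection) simp

lemma continuous_map_into_chart:
  assumes "\<And>P. continuous_map X euclideanreal (\<lambda>x. f x P)" "\<And>x. x \<in> topspace X \<Longrightarrow> f x \<in> C"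
  shows "continuous_map X (chart_top C) f"
  unfolding chart_top_def
  using assms by (auto simp: continuous_map_in_subtopology continuous_map_componentwise_UNIV)

lemma openin_chart_top_nbhd:
  assumes "openin (chart_top C) U" "x \<in> U"
  shows "\<exists>F \<delta>. finite F \<and> 0 < \<delta> \<and> (\<forall>y\<in>C. (\<forall>P\<in>F. \<bar>y P - x P\<bar> < \<delta>) \<longrightarrow> y \<in> U)"
proof -
  obtain V where V: "openin (powertop_real UNIV) V" "U = V \<inter> C"
    using assms(1) unfolding chart_top_def openin_subtopology by blast
  then obtain X where X: "x \<in> (\<Pi>\<^sub>E i\<in>UNIV. X i)" "\<And>i. open (X i)" "finite {i. X i \<noteq> UNIV}" "(\<Pi>\<^sub>E i\<in>UNIV. X i) \<subseteq> V"
    using product_topology_open_contains_basis[of "\<lambda>_. euclideanreal" UNIV V x] assms(2) by auto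
  define F where "F = {i. X i \<noteq> UNIV}"
  have "\<forall>i. \<exists>e>0. ball (x i) e \<subseteq> X i" using X(1,2) by (metis PiE_mem UNIV_I open_contains_ball)
  then obtain e where e: "\<And>i. 0 < e i" "\<And>i. ball (x i) (e i) \<subseteq> X i" by metis
  define \<delta> where "\<delta> = Min (insert 1 (e ` F))"
  have fF: "finite F" using X(3) by (simp add: F_def)
  have \<delta>: "0 < \<delta>" "\<And>i. i \<in> F \<Longrightarrow> \<delta> \<le> e i" using fF e(1) by (auto simp: \<delta>_def)
  have "y \<in> U" if y: "y \<in> C" "\<forall>P\<in>F. \<bar>y P - x P\<bar> < \<delta>" for y
  proof -
    have "y i \<in> X i" for i
    proof (cases "i \<in> F")
      case True
      then have "y i \<in> ball (x i) (e i)" using y(2) \<delta>(2)[OF True] by (force simp: dist_real_def abs_minus_commute)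
      then show ?thesis using e(2) by blast
    qed (auto simp: F_def)
    then have "y \<in> V" using X(4) by (auto simp: PiE_def extensional_def)
    then show ?thesis using V y by simp
  qed
  then show ?thesis using fF \<delta>(1) by blast
qed

definition gluable :: "('p::idom poly \<Rightarrow> real) set \<Rightarrow> bool" where
  "gluable C \<longleftrightarrow> (\<forall>y\<in>C. y [:0, 1:] \<noteq> 0 \<longrightarrow> glue_trans y \<in> C \<and> glue_trans (glue_trans y) = y)"

lemma glue_chart2_in: "gluable C \<Longrightarrow> y \<in> C \<Longrightarrow> glue_chart2 y \<in> glue_pts C"
  by (auto simp: gluable_def glue_chart2_def glue_pts_def)

lemma openin_glue_topI:
  assumes "W \<subseteq> glue_pts C" "openin (chart_top C) {x \<in> C. (x, True) \<in> W}" "openin (chart_top C) {y \<in> C. glue_chart2 y \<in> W}"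
  shows "openin (glue_top C) W"
  unfolding glue_top_def by (rule topology_generated_by_Basis) (use assms in auto)

lemma topspace_glue_top:
  assumes "gluable C" shows "topspace (glue_top C) = glue_pts C"
proof
  have "{x \<in> C. (x, True) \<in> glue_pts C} = topspace (chart_top C)" by (auto simp: glue_pts_def)
  moreover have "{y \<in> C. glue_chart2 y \<in> glue_pts C} = topspace (chart_top C)" using glue_chart2_in[OF assms] by auto
  ultimately have "openin (glue_top C) (glue_pts C)" by (intro openin_glue_topI) (simp_all only: openin_topspace subset_refl)
  then show "glue_pts C \<subseteq> topspace (glue_top C)" by (rule openin_subset)
  show "topspace (glue_top C) \<subseteq> glue_pts C"
    unfolding glue_top_def topology_generated_by_topspace by blast
qed

text \<open>Converse to \<open>openin_glue_topI\<close>: the generating sets already form a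
  topology.\<close>

lemma openin_glue_top:
  "openin (glue_top C) W \<Longrightarrow> W \<subseteq> glue_pts C \<and> openin (chart_top C) {x \<in> C. (x, True) \<in> W} \<and> openin (chart_top C) {y \<in> C. glue_chart2 y \<in> W}"
proof -
  assume "openin (glue_top C) W"
  then have "generate_topology_on {W. W \<subseteq> glue_pts C \<and> openin (chart_top C) {x \<in> C. (x, True) \<in> W} \<and> openin (chart_top C) {y \<in> C. glue_chart2 y \<in> W}} W"
    unfolding glue_top_def openin_topology_generated_by_iff .
  then show ?thesis
  proof induction
    case (Int a b)
    have "{x \<in> C. (x, True) \<in> a \<inter> b} = {x \<in> C. (x, True) \<in> a} \<inter> {x \<in> C. (x, True) \<in> b}"
      "{y \<in> C. glue_chart2 y \<in> a \<inter> b} = {y \<in> C. glue_chart2 y \<in> a} \<inter> {y \<in> C. glue_chart2 y \<in> b}" by auto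
    then show ?case using Int.IH by auto
  next
    case (UN K)
    have e: "{x \<in> C. (x, True) \<in> \<Union>K} = (\<Union>k\<in>K. {x \<in> C. (x, True) \<in> k})"
      "{y \<in> C. glue_chart2 y \<in> \<Union>K} = (\<Union>k\<in>K. {y \<in> C. glue_chart2 y \<in> k})" by auto
    show ?case unfolding e using UN by (auto intro!: openin_Union)
  qed auto
qed

lemma continuous_map_chart1:
  assumes "gluable C" shows "continuous_map (chart_top C) (glue_top C) (\<lambda>x. (x, True))"
  unfolding continuous_map_def using openin_glue_top[of C] by (auto simp: topspace_glue_top[OF assms] glue_pts_def)

lemma continuous_map_chart2:
  assumes "gluable C" shows "continuous_map (chart_top C) (glue_top C) glue_chart2"
  unfolding continuous_map_def using openin_glue_top[of C] glue_chart2_in[OF assms] by (auto simp: topspace_glue_top[OF assms])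

lemma subst_seminorm_open:
  assumes "\<And>x. x \<in> C \<Longrightarrow> x B \<noteq> 0 \<Longrightarrow> subst_seminorm A B x \<in> C" "openin (chart_top C) U"
  shows "openin (chart_top C) {x \<in> C. x B \<noteq> 0 \<and> subst_seminorm A B x \<in> U}"
proof -
  let ?X = "subtopology (chart_top C) {x. x B \<noteq> 0}"
  have "{x \<in> C. x B \<noteq> 0} = {x \<in> topspace (chart_top C). x B \<in> - {0}}" by auto
  also have "openin (chart_top C) \<dots>"
    by (rule openin_continuous_map_preimage[OF continuous_map_chart_coord]) (simp add: open_openin[symmetric] open_Compl)
  finally have o: "openin (chart_top C) {x \<in> C. x B \<noteq> 0}" .
  have "continuous_map ?X (chart_top C) (subst_seminorm A B)"
  proof (rule continuous_map_into_chart)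
    show "continuous_map ?X euclideanreal (\<lambda>x. subst_seminorm A B x P)" for P
      unfolding subst_seminorm_def
      by (intro continuous_map_real_divide continuous_map_real_pow continuous_map_from_subtopology continuous_map_chart_coord) auto
  qed (use assms(1) in auto)
  from openin_continuous_map_preimage[OF this assms(2)]
  have "openin ?X {x \<in> topspace ?X. subst_seminorm A B x \<in> U}" .
  moreover have "?X = subtopology (chart_top C) {x \<in> C. x B \<noteq> 0}"
  proof -
    have "{x \<in> C. x B \<noteq> 0} = topspace (chart_top C) \<inter> {x. x B \<noteq> 0}" by auto
    then show ?thesis by (simp only: subtopology_restrict)
  qed
  ultimately have "openin (chart_top C) {x \<in> topspace ?X. subst_seminorm A B x \<in> U}"
    using openin_open_subtopology[OF o] by simp
  moreover have "{x \<in> topspace ?X. subst_seminorm A B x \<in> U} = {x \<in> C. x B \<noteq> 0 \<and> subst_seminorm A B x \<in> U}" by auto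
  ultimately show ?thesis by simp
qed

text \<open>Seen from the second chart, the set is the preimage of \<open>U\<close> under the
  transition map, which is continuous on the open locus where the coordinate has nonzero
  seminorm.\<close>

lemma chart1_open:
  assumes "gluable C" "openin (chart_top C) U"
  shows "openin (glue_top C) {(x, True) | x. x \<in> U}"
proof (rule openin_glue_topI)
  have UC: "U \<subseteq> C" using openin_subset[OF assms(2)] by simp
  then show "{(x, True) |x. x \<in> U} \<subseteq> glue_pts C" by (auto simp: glue_pts_def)
  have "{x \<in> C. (x, True) \<in> {(x, True) |x. x \<in> U}} = U" using UC by auto
  then show "openin (chart_top C) {x \<in> C. (x, True) \<in> {(x, True) |x. x \<in> U}}" using assms by simp
  have "{y \<in> C. glue_chart2 y \<in> {(x, True) |x. x \<in> U}} = {y \<in> C. y [:0, 1:] \<noteq> 0 \<and> subst_seminorm 1 [:0, 1:] y \<in> U}"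
    by (auto simp: glue_chart2_def glue_trans_subst)
  moreover have "openin (chart_top C) \<dots>"
    using assms by (intro subst_seminorm_open) (auto simp: gluable_def glue_trans_subst)
  ultimately show "openin (chart_top C) {y \<in> C. glue_chart2 y \<in> {(x, True) |x. x \<in> U}}" by simp
qed

section \<open>The t-adic absolute value on Laurent series\<close>

lemma na_abs_nonneg [simp]: "0 \<le> na_abs f"
  by (simp add: na_abs_def)

lemma absval_na_abs: "absval na_abs"
proof
  fix f g :: "complex fls"
  show "na_abs f = 0 \<longleftrightarrow> f = 0" by (simp add: na_abs_def)
  show "na_abs (f * g) = na_abs f * na_abs g" by (simp add: na_abs_def exp_add[symmetric])
  show "na_abs (f + g) \<le> na_abs f + na_abs g"
  proof (cases "f = 0 \<or> g = 0 \<or> f + g = 0")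
    case False
    then have "min (fls_subdegree f) (fls_subdegree g) \<le> fls_subdegree (f + g)" by (simp add: fls_plus_subdegree)
    then have "na_abs (f + g) \<le> na_abs f \<or> na_abs (f + g) \<le> na_abs g" using False by (auto simp: na_abs_def min_def split: if_splits)
    then show ?thesis using na_abs_nonneg[of f] na_abs_nonneg[of g] by linarith
  qed (auto simp: na_abs_def)
qed simp

interpretation na: absval na_abs by (rule absval_na_abs)

text \<open>Ultrametric balls are conditions on coefficients; completeness becomes a coefficientwise
  matter.\<close>

lemma na_abs_le_iff: "na_abs f \<le> exp (- real_of_int n) \<longleftrightarrow> (\<forall>k<n. fls_nth f k = 0)"
proof (cases "f = 0")
  case False
  have "na_abs f \<le> exp (- real_of_int n) \<longleftrightarrow> n \<le> fls_subdegree f" using False by (simp add: na_abs_def)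
  also have "\<dots> \<longleftrightarrow> (\<forall>k<n. fls_nth f k = 0)"
    using False fls_subdegree_geI[of f n] by auto
  finally show ?thesis .
qed (simp add: na_abs_def)

lemma na_abs_complete:
  fixes s :: "nat \<Rightarrow> complex fls"
  assumes "\<And>r::real. 0 < r \<Longrightarrow> \<exists>K. \<forall>i\<ge>K. \<forall>j\<ge>K. na_abs (s i - s j) < r"
  shows "\<exists>l. (\<lambda>n. na_abs (s n - l)) \<longlonglongrightarrow> 0"
proof -
  have "\<forall>n. \<exists>K. \<forall>i\<ge>K. \<forall>j\<ge>K. na_abs (s i - s j) \<le> exp (- real_of_int n)"
  proof
    fix n :: int
    have "0 < exp (- real_of_int n)" by simp
    from assms[OF this] show "\<exists>K. \<forall>i\<ge>K. \<forall>j\<ge>K. na_abs (s i - s j) \<le> exp (- real_of_int n)"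
      by (blast intro: less_imp_le)
  qed
  from choice[OF this] obtain K where
    "\<forall>n. \<forall>i\<ge>K n. \<forall>j\<ge>K n. na_abs (s i - s j) \<le> exp (- real_of_int n)" by blast
  then have K: "\<And>n i j. \<lbrakk>K n \<le> i; K n \<le> j\<rbrakk> \<Longrightarrow> na_abs (s i - s j) \<le> exp (- real_of_int n)" by blast
  \<comment> \<open>Precision \<open>n + 1\<close> controls the coefficients below
    \<open>n + 1\<close>, hence the one at \<open>n\<close>. Including \<open>K 0\<close> fixes all
    negative coefficients, which bounds the pole order of the limit.\<close>
  define K' where "K' n = max (K 0) (K (n + 1))" for n
  have K': "fls_nth (s i) n = fls_nth (s (K' n)) n" if i: "K' n \<le> i" for n i
    using K[of "n + 1" i "K' n"] i unfolding na_abs_le_iff by (simp add: K'_def)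
  define f where "f n = fls_nth (s (K' n)) n" for n
  have "f n = 0" if n: "n < min 0 (fls_subdegree (s (K 0)))" for n
  proof -
    have "fls_nth (s (K' n)) n = fls_nth (s (K 0)) n"
      using K[of 0 "K' n" "K 0"] n unfolding na_abs_le_iff by (simp add: K'_def)
    then show ?thesis using n by (simp add: f_def)
  qed
  then have f: "fls_nth (Abs_fls f) n = f n" for n by (intro nth_Abs_fls_ex_lower_bound) blast
  have near: "na_abs (s i - Abs_fls f) \<le> exp (- real_of_int n)" if i: "K n \<le> i" for i n
    unfolding na_abs_le_iff
  proof (intro allI impI)
    fix k assume k: "k < n"
    define j where "j = max i (K' k)"
    have "fls_nth (s i) k = fls_nth (s j) k"
      using K[of n i j] i k unfolding na_abs_le_iff by (simp add: j_def)
    also have "\<dots> = f k" using K'[of k j] by (simp add: j_def f_def)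
    finally show "fls_nth (s i - Abs_fls f) k = 0" by (simp add: f)
  qed
  have "(\<lambda>n. na_abs (s n - Abs_fls f)) \<longlonglongrightarrow> 0"
  proof (rule LIMSEQ_I)
    fix r :: real assume r: "0 < r"
    obtain n :: nat where n: "- ln r < real n" using reals_Archimedean2 by blast
    then have "exp (- real_of_int (int n)) < exp (ln r)" unfolding exp_less_cancel_iff by simp
    then have "exp (- real_of_int (int n)) < r" using r by simp
    then have "norm (na_abs (s i - Abs_fls f) - 0) < r" if "K (int n) \<le> i" for i
      using near[OF that] by simp
    then show "\<exists>no. \<forall>i\<ge>no. norm (na_abs (s i - Abs_fls f) - 0) < r" by blast
  qed
  then show ?thesis by blast
qed

section \<open>The Berkovich projective line\<close>

lemma coeff_subring_UNIV: "coeff_subring UNIV"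
  by (simp add: coeff_subring_def)

lemma berk_chartD:
  assumes "x \<in> berk_chart"
  shows "mult_seminorm_on UNIV x" "x 0 = 0" "x 1 = 1" "0 \<le> x P" "x (P * Q) = x P * x Q" "x (P + Q) \<le> x P + x Q"
    "x [:a:] = na_abs a"
  using assms by (auto simp: berk_chart_def mult_seminorm_on_def)

lemma berk_chart_smult: "x \<in> berk_chart \<Longrightarrow> x (smult a P) = na_abs a * x P"
  using berk_chartD(5)[of x "[:a:]" P] berk_chartD(7)[of x a] by simp

lemma berk_chart_diff:
  assumes "x \<in> berk_chart" shows "\<bar>x P - x Q\<bar> \<le> x (P - Q)"
proof -
  have "x P \<le> x Q + x (P - Q)" using berk_chartD(6)[OF assms, of Q "P - Q"] by simp
  moreover have "x (Q - P) = x (P - Q)" using berk_chart_smult[OF assms, of "-1" "P - Q"] by simp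
  then have "x Q \<le> x P + x (P - Q)" using berk_chartD(6)[OF assms, of P "Q - P"] by simp
  ultimately show ?thesis by linarith
qed

lemma berk_subst:
  assumes "x \<in> berk_chart" "x B \<noteq> 0"
  shows "subst_seminorm A B x \<in> berk_chart"
  using mult_seminorm_subst[OF berk_chartD(1)[OF assms(1)] coeff_subring_UNIV _ _ assms(2), of A] assms
  by (simp add: berk_chart_def subst_seminorm_const)

lemma gluable_berk: "gluable berk_chart"
  unfolding gluable_def
proof (intro ballI impI conjI)
  fix y assume y: "y \<in> berk_chart" "y [:0, 1:] \<noteq> 0"
  show "glue_trans y \<in> berk_chart" unfolding glue_trans_subst by (rule berk_subst[OF y])
  show "glue_trans (glue_trans y) = y"
    by (rule ext) (rule glue_trans_glue_trans[OF berk_chartD(1)[OF y(1)] coeff_subring_UNIV y(2) UNIV_I])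
qed

lemma topspace_P1berk: "topspace P1berk_top = glue_pts berk_chart"
  unfolding P1berk_top_def by (rule topspace_glue_top[OF gluable_berk])

definition eval_pt :: "complex fls \<Rightarrow> complex fls poly \<Rightarrow> real" where
  "eval_pt a P = na_abs (poly P a)"

lemma eval_pt_in: "eval_pt a \<in> berk_chart"
  by (auto simp: berk_chart_def mult_seminorm_on_def eval_pt_def na.N_mult na.N_add)

text \<open>\<open>P\<close> minus its value at \<open>a\<close> is a multiple of
  \<open>Z - a\<close>, so the seminorm cannot tell them apart.\<close>

lemma eval_pt_unique:
  assumes x: "x \<in> berk_chart" "x [:- a, 1:] = 0"
  shows "x = eval_pt a"
proof (rule ext)
  fix P
  have "P - [:poly P a:] = [:- a, 1:] * synthetic_div P a"
    using synthetic_div_correct'[of a P] by (simp add: algebra_simps)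
  then have "x (P - [:poly P a:]) = 0" using berk_chartD(5)[OF x(1), of "[:- a, 1:]" "synthetic_div P a"] x(2) by simp
  then have "x P = x [:poly P a:]" using berk_chart_diff[OF x(1), of P "[:poly P a:]"] by simp
  then show "x P = eval_pt a P" using berk_chartD(7)[OF x(1)] by (simp add: eval_pt_def)
qed

definition berk_\<iota> :: "complex fls option \<Rightarrow> (complex fls poly \<Rightarrow> real) \<times> bool" where
  "berk_\<iota> p = (case p of None \<Rightarrow> berk_infty | Some a \<Rightarrow> (eval_pt a, True))"

lemma berk_infty_eq: "berk_infty = (eval_pt 0, False)"
  by (simp add: berk_infty_def eval_pt_def[abs_def] poly_0_coeff_0)

lemma berk_\<iota>_in: "berk_\<iota> p \<in> glue_pts berk_chart"
proof (cases p)
  case None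
  have "eval_pt 0 [:0, 1:] = 0" by (simp add: eval_pt_def)
  then show ?thesis using None eval_pt_in[of 0] by (auto simp: berk_\<iota>_def berk_infty_eq glue_pts_def)
next
  case (Some a)
  then show ?thesis using eval_pt_in[of a] by (auto simp: berk_\<iota>_def glue_pts_def)
qed

text \<open>A point outside the first chart kills the second coordinate, hence is evaluation at 0
  there. Only infinity is left over.\<close>

lemma glue_pts_berk_cases:
  assumes "p \<in> glue_pts berk_chart"
  obtains x where "p = (x, True)" "x \<in> berk_chart" | "p = berk_infty"
proof -
  consider x where "p = (x, True)" "x \<in> berk_chart" | y where "p = (y, False)" "y \<in> berk_chart" "y [:0, 1:] = 0"
    using assms by (auto simp: glue_pts_def)
  then show thesis
  proof cases
    case 1
    then show ?thesis using that(1) by blast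
  next
    case 2
    have "y = eval_pt 0" by (rule eval_pt_unique[OF 2(2)]) (simp add: 2(3))
    then show ?thesis using 2(1) that(2) by (simp add: berk_infty_eq)
  qed
qed

text \<open>The row \<open>u\<close> stands for the polynomial \<open>u$1 * Z + u$2\<close>; at
  infinity only its leading coefficient counts.\<close>

definition berk_H :: "(complex fls poly \<Rightarrow> real) \<times> bool \<Rightarrow> complex fls^2 \<Rightarrow> real" where
  "berk_H p u = (if snd p then fst p [:u$2, u$1:] else na_abs (u$1))"

lemma lin_seminorm:
  assumes x: "x \<in> berk_chart"
  shows "row_seminorm na_abs (\<lambda>u. x [:u$2, u$1:])" "row_seminorm na_abs (\<lambda>u. x [:u$1, u$2:])"
proof -
  have "x [:1:] = 1" using berk_chartD(7)[OF x, of 1] by simp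
  moreover have "x [:a + b, c + d:] \<le> x [:a, c:] + x [:b, d:]" for a b c d using berk_chartD(6)[OF x, of "[:a, c:]" "[:b, d:]"] by simp
  moreover have "x [:c * a, c * b:] = na_abs c * x [:a, b:]" for a b c using berk_chart_smult[OF x, of c "[:a, b:]"] by simp
  ultimately show "row_seminorm na_abs (\<lambda>u. x [:u$2, u$1:])" "row_seminorm na_abs (\<lambda>u. x [:u$1, u$2:])"
    using berk_chartD(4)[OF x] by (simp_all add: row_seminorm_def axis_def)
qed

lemma row_seminorm_berk_H:
  assumes "p \<in> glue_pts berk_chart"
  shows "row_seminorm na_abs (berk_H p)"
  using assms
proof (cases rule: glue_pts_berk_cases)
  case (1 x)
  then show ?thesis using lin_seminorm(1)[OF 1(2)] by (simp add: berk_H_def[abs_def])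
next
  case 2
  then show ?thesis by (simp add: berk_H_def[abs_def] berk_infty_def row_seminorm_def na.N_add na.N_mult axis_def)
qed

lemma berk_H_\<iota>: "berk_H (berk_\<iota> p) = na.ptH p"
  by (rule ext, cases p) (simp_all add: berk_H_def berk_\<iota>_def na.ptH_def dot2_def berk_infty_def eval_pt_def algebra_simps)

definition berk_D :: "(complex fls poly \<Rightarrow> real) \<times> bool \<Rightarrow> complex fls option \<Rightarrow> real" where
  "berk_D p z = na.hdist (berk_H p) z"

lemma berk_D_\<iota>: "berk_D (berk_\<iota> p) z = na.cdist p z"
  by (simp add: berk_D_def berk_H_\<iota> na.hdist_ptH)

lemma berk_D_eq_0:
  assumes p: "p \<in> glue_pts berk_chart" and "berk_D p z = 0"
  shows "p = berk_\<iota> z"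
proof -
  have H0: "berk_H p (perp (pv z)) = 0"
    using assms(2) row_size_pos[OF row_seminorm_berk_H[OF p]] by (simp add: berk_D_def na.hdist_def)
  from p show ?thesis
  proof (cases rule: glue_pts_berk_cases)
    case (1 x)
    show ?thesis
    proof (cases z)
      case None
      then have "x [:-1:] = 0" using H0 1 by (simp add: berk_H_def)
      then show ?thesis using berk_chartD(7)[OF 1(2), of "-1"] by simp
    next
      case (Some a)
      then have "x [:- a, 1:] = 0" using H0 1 by (simp add: berk_H_def)
      then show ?thesis using eval_pt_unique[OF 1(2)] 1 Some by (simp add: berk_\<iota>_def)
    qed
  next
    case 2
    then show ?thesis using H0 by (cases z) (simp_all add: berk_H_def berk_\<iota>_def berk_infty_def)
  qed
qed

text \<open>In the second chart the coefficients of the linear form are exchanged. The factor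
  \<open>c\<close> disappears in \<open>hdist\<close>, so balls can be tested for openness in both
  charts.\<close>

lemma berk_H_chart2:
  assumes y: "y \<in> berk_chart"
  shows "\<exists>c>0. berk_H (glue_chart2 y) = (\<lambda>u. c * y [:u$1, u$2:])"
proof (cases "y [:0, 1:] = 0")
  case True
  then have "y [:- 0, 1:] = 0" by simp
  from eval_pt_unique[OF y this] have "y = eval_pt 0" .
  then show ?thesis using True by (intro exI[of _ 1]) (auto simp: glue_chart2_def berk_H_def eval_pt_def fun_eq_iff)
next
  case False
  then have q: "0 < y [:0, 1:]" using berk_chartD(4)[OF y, of "[:0, 1:]"] by simp
  have "glue_trans y [:b, a:] = (1 / y [:0, 1:]) * y [:a, b:]" for a b
  proof (cases "a = 0")
    case True
    have "y [:0, b:] = na_abs b * y [:0, 1:]" using berk_chart_smult[OF y, of b "[:0, 1:]"] by simp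
    then show ?thesis using True q berk_chartD(7)[OF y, of b] by (simp add: glue_trans_def)
  next
    case False
    have "degree [:b, a:] = 1" "reflect_poly [:b, a:] = [:a, b:]" using False by (simp_all add: reflect_poly_def)
    then show ?thesis by (simp add: glue_trans_def)
  qed
  then show ?thesis using q False by (intro exI[of _ "1 / y [:0, 1:]"]) (auto simp: glue_chart2_def berk_H_def fun_eq_iff)
qed

lemma hdist_lin_continuous:
  "continuous_map (chart_top berk_chart) euclideanreal (\<lambda>x. na.hdist (\<lambda>u. x [:u$2, u$1:]) z)"
  "continuous_map (chart_top berk_chart) euclideanreal (\<lambda>x. na.hdist (\<lambda>u. x [:u$1, u$2:]) z)"
proof -
  have "row_size (\<lambda>u. x [:u$2, u$1:]) * na.nrm (pv z) \<noteq> 0" "row_size (\<lambda>u. x [:u$1, u$2:]) * na.nrm (pv z) \<noteq> 0"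
    if "x \<in> berk_chart" for x
    using row_size_pos[OF lin_seminorm(1)[OF that]] row_size_pos[OF lin_seminorm(2)[OF that]] by auto
  then show "continuous_map (chart_top berk_chart) euclideanreal (\<lambda>x. na.hdist (\<lambda>u. x [:u$2, u$1:]) z)"
   "continuous_map (chart_top berk_chart) euclideanreal (\<lambda>x. na.hdist (\<lambda>u. x [:u$1, u$2:]) z)"
    unfolding na.hdist_def row_size_def
    by (intro continuous_map_real_divide continuous_map_real_mult continuous_map_real_max continuous_map_chart_coord; simp)+
qed

lemma berk_ball_open: "openin P1berk_top {p \<in> topspace P1berk_top. berk_D p z < r}"
  unfolding P1berk_top_def topspace_glue_top[OF gluable_berk]
proof (rule openin_glue_topI)
  have "{x \<in> berk_chart. (x, True) \<in> {p \<in> glue_pts berk_chart. berk_D p z < r}}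
      = {x \<in> topspace (chart_top berk_chart). na.hdist (\<lambda>u. x [:u$2, u$1:]) z \<in> {..<r}}"
    by (auto simp: glue_pts_def berk_D_def berk_H_def[abs_def])
  then show "openin (chart_top berk_chart) {x \<in> berk_chart. (x, True) \<in> {p \<in> glue_pts berk_chart. berk_D p z < r}}"
    using openin_continuous_map_preimage[OF hdist_lin_continuous(1)[of z], of "{..<r}"] by (simp add: open_openin[symmetric])
  have "berk_D (glue_chart2 y) z = na.hdist (\<lambda>u. y [:u$1, u$2:]) z" if y: "y \<in> berk_chart" for y
  proof -
    obtain c where "0 < c" "berk_H (glue_chart2 y) = (\<lambda>u. c * y [:u$1, u$2:])" using berk_H_chart2[OF y] by blast
    then show ?thesis unfolding berk_D_def by (simp add: na.hdist_scale)
  qed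
  then have "{y \<in> berk_chart. glue_chart2 y \<in> {p \<in> glue_pts berk_chart. berk_D p z < r}}
      = {y \<in> topspace (chart_top berk_chart). na.hdist (\<lambda>u. y [:u$1, u$2:]) z \<in> {..<r}}"
    using glue_chart2_in[OF gluable_berk] by auto
  then show "openin (chart_top berk_chart) {y \<in> berk_chart. glue_chart2 y \<in> {p \<in> glue_pts berk_chart. berk_D p z < r}}"
    using openin_continuous_map_preimage[OF hdist_lin_continuous(2)[of z], of "{..<r}"] by (simp add: open_openin[symmetric])
qed blast

lemma berk_poly_bound:
  assumes x: "x \<in> berk_chart" and "x [:0, 1:] \<le> M" "0 \<le> M"
  shows "x P \<le> (\<Sum>i\<le>degree P. na_abs (coeff P i) * M ^ i)"
proof -
  have "x P \<le> (\<Sum>i\<le>n. na_abs (coeff P i) * M ^ i)" if "degree P \<le> n" for n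
    using that
  proof (induction P arbitrary: n)
    case 0
    then show ?case using berk_chartD(2)[OF x] by simp
  next
    case (pCons a P)
    have eq: "pCons a P = [:a:] + [:0, 1:] * P" by simp
    have le: "x (pCons a P) \<le> na_abs a + x [:0, 1:] * x P"
      unfolding eq using berk_chartD(6)[OF x, of "[:a:]" "[:0, 1:] * P"] berk_chartD(5)[OF x, of "[:0, 1:]" P] berk_chartD(7)[OF x, of a] by linarith
    show ?case
    proof (cases n)
      case 0
      then have "P = 0" using pCons.prems by (cases "P = 0") auto
      then show ?thesis using le 0 berk_chartD(2)[OF x] by simp
    next
      case (Suc k)
      have "degree P \<le> k" using pCons.prems Suc by (cases "P = 0") auto
      then have "x [:0, 1:] * x P \<le> M * (\<Sum>i\<le>k. na_abs (coeff P i) * M ^ i)"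
        using assms berk_chartD(4)[OF x] by (intro mult_mono pCons.IH) auto
      also have "\<dots> = (\<Sum>i\<le>k. na_abs (coeff P i) * M ^ Suc i)" by (simp add: sum_distrib_left mult_ac)
      finally show ?thesis using le unfolding Suc by (simp add: sum.atMost_Suc_shift del: sum.atMost_Suc)
    qed
  qed
  then show ?thesis by blast
qed

text \<open>Division by \<open>Z - a\<close> writes \<open>P\<close> as its value at
  \<open>a\<close> plus a multiple \<open>(Z - a) * Q\<close>, and \<open>x Q\<close> is bounded as
  soon as \<open>x [:0, 1:]\<close> is. Smallness on the single polynomial \<open>Z - a\<close> thus
  controls any finite set of polynomials.\<close>

lemma berk_near:
  assumes "finite F" "0 < \<delta>"
  shows "\<exists>s>0. \<forall>x\<in>berk_chart. x [:- a, 1:] < s \<longrightarrow> (\<forall>P\<in>F. \<bar>x P - eval_pt a P\<bar> < \<delta>)"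
proof -
  define M where "M = na_abs a + 1"
  define b where "b P = (\<Sum>i\<le>degree (synthetic_div P a). na_abs (coeff (synthetic_div P a) i) * M ^ i)" for P
  have M: "1 \<le> M" by (simp add: M_def)
  have b0: "0 \<le> b P" for P unfolding b_def using M by (intro sum_nonneg mult_nonneg_nonneg) auto
  define bb where "bb = (\<Sum>P\<in>F. b P) + 1"
  have bb: "b P < bb" "0 < bb" if "P \<in> F" for P
    using member_le_sum[of P F b] b0 assms(1) that by (auto simp: bb_def sum_nonneg add_nonneg_pos)
  define s where "s = min 1 (\<delta> / bb)"
  have bb0: "0 < bb" using b0 by (simp add: bb_def sum_nonneg add_nonneg_pos)
  have s: "0 < s" using assms(2) bb0 by (simp add: s_def)
  have "\<bar>x P - eval_pt a P\<bar> < \<delta>" if x: "x \<in> berk_chart" "x [:- a, 1:] < s" "P \<in> F" for x P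
  proof -
    have eq: "P - [:poly P a:] = [:- a, 1:] * synthetic_div P a"
      using synthetic_div_correct'[of a P] by (simp add: algebra_simps)
    have "[:0, 1:] = [:- a, 1:] + [:a:]" by simp
    then have "x [:0, 1:] \<le> x [:- a, 1:] + na_abs a"
      using berk_chartD(6)[OF x(1), of "[:- a, 1:]" "[:a:]"] berk_chartD(7)[OF x(1), of a] by metis
    then have "x [:0, 1:] \<le> M" using x(2) by (simp add: M_def s_def)
    then have Q: "x (synthetic_div P a) \<le> b P" unfolding b_def using M by (intro berk_poly_bound x) auto
    have "\<bar>x P - eval_pt a P\<bar> = \<bar>x P - x [:poly P a:]\<bar>" using berk_chartD(7)[OF x(1)] by (simp add: eval_pt_def)
    also have "\<dots> \<le> x (P - [:poly P a:])" by (rule berk_chart_diff[OF x(1)])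
    also have "\<dots> = x [:- a, 1:] * x (synthetic_div P a)" unfolding eq by (rule berk_chartD(5)[OF x(1)])
    also have "\<dots> \<le> (\<delta> / bb) * b P" using x(2) Q berk_chartD(4)[OF x(1)] s by (intro mult_mono) (auto simp: s_def)
    also have "\<dots> < (\<delta> / bb) * bb" using bb(1)[OF x(3)] assms(2) bb0 by (intro mult_strict_left_mono) auto
    finally show ?thesis using bb0 by simp
  qed
  then show ?thesis using s by blast
qed

text \<open>The estimate of \<open>cdist_Some_ball\<close> with a Berkovich point in the role of
  \<open>w\<close>.\<close>

lemma berk_D_chart1_Some:
  assumes x: "x \<in> berk_chart" and D: "berk_D (x, True) (Some a) < r" and r: "r * max (na_abs a) 1 \<le> 1/2"
  shows "x [:- a, 1:] < 2 * (max (na_abs a) 1)\<^sup>2 * r"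
proof -
  define M where "M = max (na_abs a) 1"
  define W where "W = max (x [:0, 1:]) 1"
  have M: "1 \<le> M" "na_abs a \<le> M" and W: "1 \<le> W" by (auto simp: M_def W_def)
  have "x [:1:] = 1" using berk_chartD(7)[OF x, of 1] by simp
  then have DD: "berk_D (x, True) (Some a) = x [:- a, 1:] / (W * M)"
    by (simp add: berk_D_def na.hdist_def berk_H_def row_size_def axis_def na.nrm_def M_def W_def)
  have less: "x [:- a, 1:] < r * (W * M)"
    using D M(1) W unfolding DD by (simp add: pos_divide_less_eq)
  have rM: "r * M \<le> 1/2" using r by (simp add: M_def)
  have r0: "0 < r"
  proof -
    have "0 \<le> x [:- a, 1:] / (W * M)" using berk_chartD(4)[OF x] M W by simp
    then show ?thesis using D DD by linarith
  qed
  have "r * (W * M) = W * (r * M)" by simp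
  also have "\<dots> \<le> W * (1/2)" using rM W by (intro mult_left_mono) auto
  finally have "x [:- a, 1:] < W / 2" using less by simp
  moreover have "x [:0, 1:] \<le> x [:- a, 1:] + na_abs a"
    using berk_chartD(6)[OF x, of "[:- a, 1:]" "[:a:]"] berk_chartD(7)[OF x, of a] by simp
  ultimately have W2: "W \<le> 2 * M" using M W_def by (auto simp: max_def split: if_splits)
  have "r * (W * M) \<le> r * ((2 * M) * M)" using r0 M W2 by (intro mult_left_mono mult_right_mono) auto
  then show ?thesis using less by (simp add: M_def[symmetric] power2_eq_square algebra_simps)
qed

text \<open>\<open>berk_D\<close> measures distances to classical points, and balls form
  neighbourhood bases there. Infinity is treated as the point 0 of the second chart.\<close>

lemma berk_ball_basis:
  assumes U: "openin P1berk_top U" and z: "berk_\<iota> z \<in> U"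
  shows "\<exists>r>0. {p \<in> topspace P1berk_top. berk_D p z < r} \<subseteq> U"
proof -
  have U': "U \<subseteq> glue_pts berk_chart" "openin (chart_top berk_chart) {x \<in> berk_chart. (x, True) \<in> U}"
    "openin (chart_top berk_chart) {y \<in> berk_chart. glue_chart2 y \<in> U}"
    using openin_glue_top[of berk_chart U] U by (auto simp: P1berk_top_def)
  show ?thesis unfolding topspace_P1berk
  proof (cases z)
    case (Some a)
    then have "eval_pt a \<in> {x \<in> berk_chart. (x, True) \<in> U}" using z eval_pt_in by (simp add: berk_\<iota>_def)
    from openin_chart_top_nbhd[OF U'(2) this] obtain F \<delta> where F: "finite F" "0 < \<delta>"
      "\<And>x. x \<in> berk_chart \<Longrightarrow> (\<forall>P\<in>F. \<bar>x P - eval_pt a P\<bar> < \<delta>) \<Longrightarrow> (x, True) \<in> U" by blast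
    obtain s where s: "0 < s" "\<And>x. x \<in> berk_chart \<Longrightarrow> x [:- a, 1:] < s \<Longrightarrow> (\<forall>P\<in>F. \<bar>x P - eval_pt a P\<bar> < \<delta>)"
      using berk_near[OF F(1,2), of a] by blast
    define M where "M = max (na_abs a) 1"
    have M: "1 \<le> M" by (simp add: M_def)
    define r where "r = min (1 / (2 * M)) (s / (2 * M\<^sup>2))"
    have r: "0 < r" using M s by (simp add: r_def)
    have "r * M \<le> 1 / (2 * M) * M" unfolding r_def using M by (intro mult_right_mono) auto
    then have rM: "r * M \<le> 1/2" using M by simp
    have "2 * M\<^sup>2 * r \<le> 2 * M\<^sup>2 * (s / (2 * M\<^sup>2))" unfolding r_def using M by (intro mult_left_mono) auto
    then have rs: "2 * M\<^sup>2 * r \<le> s" using M by simp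
    have "p \<in> U" if p: "p \<in> glue_pts berk_chart" "berk_D p z < r" for p
      using p(1)
    proof (cases rule: glue_pts_berk_cases)
      case (1 x)
      have "x [:- a, 1:] < 2 * M\<^sup>2 * r" unfolding M_def
        by (rule berk_D_chart1_Some[OF 1(2)]) (use p(2) rM in \<open>simp_all add: 1(1) Some M_def\<close>)
      then have "x [:- a, 1:] < s" using rs by linarith
      then show ?thesis unfolding 1(1) by (intro F(3) 1(2) s(2))
    next
      case 2
      have "berk_infty = berk_\<iota> None" by (simp add: berk_\<iota>_def)
      from berk_D_\<iota>[of None "Some a", folded this] have "berk_D p z = 1 / M"
        by (simp add: 2 Some na.cdist_sym[of None] na.cdist_Some_None M_def)
      then have "1 < r * M" using p(2) M by (simp add: pos_divide_less_eq)
      then show ?thesis using rM by simp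
    qed
    then show "\<exists>r>0. {p \<in> glue_pts berk_chart. berk_D p z < r} \<subseteq> U" using r by blast
  next
    case None
    have e0: "eval_pt 0 [:0, 1:] = 0" by (simp add: eval_pt_def)
    then have "glue_chart2 (eval_pt 0) = berk_\<iota> z" using None by (simp add: glue_chart2_def berk_\<iota>_def berk_infty_eq)
    then have "eval_pt 0 \<in> {y \<in> berk_chart. glue_chart2 y \<in> U}" using z eval_pt_in by simp
    from openin_chart_top_nbhd[OF U'(3) this] obtain F \<delta> where F: "finite F" "0 < \<delta>"
      "\<And>x. x \<in> berk_chart \<Longrightarrow> (\<forall>P\<in>F. \<bar>x P - eval_pt 0 P\<bar> < \<delta>) \<Longrightarrow> glue_chart2 x \<in> U" by blast
    obtain s where s: "0 < s" "\<And>x. x \<in> berk_chart \<Longrightarrow> x [:- 0, 1:] < s \<Longrightarrow> (\<forall>P\<in>F. \<bar>x P - eval_pt 0 P\<bar> < \<delta>)"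
      using berk_near[OF F(1,2), of 0] by blast
    define r where "r = min (1/2) s"
    have r: "0 < r" using s by (simp add: r_def)
    have "p \<in> U" if p: "p \<in> glue_pts berk_chart" "berk_D p z < r" for p
      using p(1)
    proof (cases rule: glue_pts_berk_cases)
      case (1 x)
      define W where "W = max (x [:0, 1:]) 1"
      have "x [:1:] = 1" "x [:-1:] = 1" using berk_chartD(7)[OF 1(2), of 1] berk_chartD(7)[OF 1(2), of "-1"] by simp_all
      then have "berk_D p z = 1 / W"
        by (simp add: 1(1) None berk_D_def na.hdist_def berk_H_def row_size_def axis_def na.nrm_def W_def)
      then have W: "1 / W < r" using p(2) by simp
      have W1: "1 \<le> W" by (simp add: W_def)
      have "W \<noteq> 1" using W by (auto simp: r_def)
      then have Wx: "W = x [:0, 1:]" by (auto simp: W_def max_def split: if_splits)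
      then have nz: "x [:0, 1:] \<noteq> 0" using W1 by simp
      have g: "glue_trans x \<in> berk_chart" "glue_trans (glue_trans x) = x" using gluable_berk 1(2) nz by (auto simp: gluable_def)
      have gZ: "glue_trans x [:0, 1:] = 1 / W" unfolding Wx by (rule glue_trans_Z[of x, OF berk_chartD(3)[OF 1(2)]])
      then have "glue_chart2 (glue_trans x) = p" using g W1 by (simp add: glue_chart2_def 1(1))
      moreover have "glue_trans x [:- 0, 1:] < s" using gZ W by (simp add: r_def)
      ultimately show ?thesis using F(3)[OF g(1) s(2)[OF g(1)]] by simp
    next
      case 2
      then show ?thesis using z None by (simp add: berk_\<iota>_def)
    qed
    then show "\<exists>r>0. {p \<in> glue_pts berk_chart. berk_D p z < r} \<subseteq> U" using r by blast
  qed
qed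

section \<open>The action of matrices on the Berkovich line\<close>

lemma poly_subst_mob_hom: "poly_subst_mob g P = hom_subst (degree P) [:g$1$2, g$1$1:] [:g$2$2, g$2$1:] P"
  by (simp add: poly_subst_mob_def hom_subst_def)

lemma berk_act_True:
  "berk_act g (x, True) = (if x [:g$2$2, g$2$1:] = 0 then berk_infty
     else (subst_seminorm [:g$1$2, g$1$1:] [:g$2$2, g$2$1:] x, True))"
  by (simp add: berk_act_def subst_seminorm_def[abs_def] poly_subst_mob_hom)

lemma berk_act_infty: "berk_act g berk_infty = berk_\<iota> (if g$2$1 = 0 then None else Some (g$1$1 / g$2$1))"
  by (simp add: berk_act_def berk_infty_def berk_\<iota>_def eval_pt_def[abs_def])

lemma berk_act_in:
  assumes "p \<in> glue_pts berk_chart" shows "berk_act g p \<in> glue_pts berk_chart"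
  using assms
proof (cases rule: glue_pts_berk_cases)
  case (1 x)
  have "berk_infty = berk_\<iota> None" by (simp add: berk_\<iota>_def)
  then show ?thesis using 1 berk_subst[OF 1(2)] berk_\<iota>_in[of None] by (auto simp: berk_act_True glue_pts_def)
next
  case 2
  then show ?thesis by (simp only: berk_act_infty berk_\<iota>_in)
qed

lemma berk_act_\<iota>:
  "berk_\<iota> (mobius g z) = berk_act g (berk_\<iota> z)"
proof (cases z)
  case None
  have "berk_\<iota> z = berk_infty" using None by (simp add: berk_\<iota>_def)
  then show ?thesis using None by (simp add: berk_act_infty mobius_def Let_def)
next
  case (Some w)
  let ?A = "[:g$1$2, g$1$1:]" and ?B = "[:g$2$2, g$2$1:]"
  have B: "eval_pt w ?B = na_abs (g$2$1 * w + g$2$2)" by (simp add: eval_pt_def algebra_simps)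
  show ?thesis
  proof (cases "g$2$1 * w + g$2$2 = 0")
    case True
    then show ?thesis using Some B by (simp add: berk_\<iota>_def mobius_def Let_def berk_act_True)
  next
    case False
    have pB: "poly ?B w = g$2$1 * w + g$2$2" "poly ?A w = g$1$1 * w + g$1$2" by (simp_all add: algebra_simps)
    have "subst_seminorm ?A ?B (eval_pt w) P = eval_pt ((g$1$1 * w + g$1$2) / (g$2$1 * w + g$2$2)) P" for P
    proof -
      have "poly (hom_subst (degree P) ?A ?B P) w = poly ?B w ^ degree P * poly P (poly ?A w / poly ?B w)"
        by (rule poly_hom_subst[OF _ order_refl]) (use False in \<open>simp only: pB not_False_eq_True\<close>)
      then show ?thesis using False unfolding subst_seminorm_def eval_pt_def
        by (simp only: pB na.N_mult na.N_power) simp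
    qed
    then have "subst_seminorm ?A ?B (eval_pt w) = eval_pt ((g$1$1 * w + g$1$2) / (g$2$1 * w + g$2$2))" by (rule ext)
    then show ?thesis using Some False B by (simp add: berk_\<iota>_def mobius_def Let_def berk_act_True)
  qed
qed

text \<open>The action is pullback of rows up to scale. If the denominator \<open>?B\<close> has
  seminorm 0, the image is infinity; then \<open>det g = 1\<close> writes 1 as \<open>g$1$1\<close>
  times \<open>?B\<close> minus \<open>g$2$1\<close> times \<open>?A\<close>, so \<open>x ?A\<close>
  is positive and provides the scale.\<close>

lemma berk_H_act:
  assumes p: "p \<in> glue_pts berk_chart" and det: "det g = 1"
  shows "\<exists>c>0. berk_H (berk_act g p) = (\<lambda>u. c * berk_H p (u v* g))"
  using p
proof (cases rule: glue_pts_berk_cases)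
  case (1 x)
  let ?A = "[:g$1$2, g$1$1:]" and ?B = "[:g$2$2, g$2$1:]"
  have lin: "berk_H p (u v* g) = x (smult (u$1) ?A + smult (u$2) ?B)" for u
    using 1 by (simp add: berk_H_def algebra_simps)
  show ?thesis
  proof (cases "x ?B = 0")
    case True
    have "smult (g$1$1) ?B + smult (- g$2$1) ?A = 1"
      using det by (simp add: det_2 algebra_simps one_pCons)
    then have "1 \<le> na_abs (g$1$1) * x ?B + na_abs (g$2$1) * x ?A"
      using berk_chartD(6)[OF 1(2), of "smult (g$1$1) ?B" "smult (- g$2$1) ?A"] berk_chartD(3)[OF 1(2)]
      by (simp only: berk_chart_smult[OF 1(2)] na.N_minus)
    then have xA: "0 < x ?A" using True berk_chartD(4)[OF 1(2), of ?A] by (cases "x ?A = 0") auto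
    have "x (smult a ?A + smult b ?B) = na_abs a * x ?A" for a b
    proof -
      have "x (smult b ?B) = 0" by (simp only: berk_chart_smult[OF 1(2)] True mult_zero_right)
      then have "\<bar>x (smult a ?A + smult b ?B) - x (smult a ?A)\<bar> \<le> 0"
        using berk_chart_diff[OF 1(2), of "smult a ?A + smult b ?B" "smult a ?A"] by (simp only: add_diff_cancel_left')
      then show ?thesis using berk_chart_smult[OF 1(2), of a ?A] by simp
    qed
    then show ?thesis using xA True 1
      by (intro exI[of _ "1 / x ?A"]) (simp add: lin fun_eq_iff berk_act_True, simp add: berk_H_def berk_infty_def)
  next
    case False
    then have xB: "0 < x ?B" using berk_chartD(4)[OF 1(2), of ?B] by simp
    have "subst_seminorm ?A ?B x [:b, a:] = (1 / x ?B) * x (smult a ?A + smult b ?B)" for a b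
    proof (cases "a = 0")
      case True
      then show ?thesis using xB by (simp add: subst_seminorm_const berk_chart_smult[OF 1(2)] berk_chartD(7)[OF 1(2)] del: smult_pCons)
    next
      case False
      then show ?thesis by (simp add: subst_seminorm_def hom_subst_def algebra_simps)
    qed
    then show ?thesis using xB False 1
      by (intro exI[of _ "1 / x ?B"]) (simp add: lin fun_eq_iff berk_act_True, simp add: berk_H_def)
  qed
next
  case 2
  have *: "berk_H berk_infty (u v* g) = na_abs (u$1 * g$1$1 + u$2 * g$2$1)" for u by (simp add: berk_H_def berk_infty_def)
  show ?thesis
  proof (cases "g$2$1 = 0")
    case True
    then have "g$1$1 \<noteq> 0" using det by (auto simp: det_2)
    then show ?thesis using True
      by (intro exI[of _ "1 / na_abs (g$1$1)"])
         (simp add: 2 * berk_act_infty fun_eq_iff na.N_mult, simp add: berk_\<iota>_def berk_H_def berk_infty_def)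
  next
    case False
    have "na_abs (b + a * (g$1$1 / g$2$1)) = (1 / na_abs (g$2$1)) * na_abs (a * g$1$1 + b * g$2$1)" for a b
    proof -
      have "b + a * (g$1$1 / g$2$1) = (a * g$1$1 + b * g$2$1) / g$2$1" using False by (simp add: field_simps)
      then show ?thesis by (simp add: na.N_divide)
    qed
    then show ?thesis using False
      by (intro exI[of _ "1 / na_abs (g$2$1)"])
         (simp add: 2 * berk_act_infty fun_eq_iff, simp add: berk_\<iota>_def berk_H_def eval_pt_def algebra_simps)
  qed
qed

text \<open>The line is cut along the pole of \<open>g\<close> and along infinity. On each of these
  two pieces the action is constant; on the rest it is continuous in the first chart.\<close>

lemma berk_act_measurable:
  shows "berk_act g \<in> measurable (borel_of P1berk_top) (borel_of P1berk_top)"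
proof (rule measurable_borel_ofI)
  let ?B = "[:g$2$2, g$2$1:]" and ?A = "[:g$1$2, g$1$1:]"
  let ?T = "P1berk_top" and ?C = "berk_chart"
  show "berk_act g x \<in> topspace P1berk_top" if "x \<in> space (borel_of P1berk_top)" for x
    using berk_act_in that by (simp add: topspace_P1berk)
  fix U assume U: "openin P1berk_top U"
  have op: "{(x, True) | x. x \<in> S} \<in> sets (borel_of ?T)" if "openin (chart_top ?C) S" for S
    using chart1_open[OF gluable_berk that] by (simp add: P1berk_top_def borel_of_open)
  define V where "V = {(x, True) | x. x \<in> {x \<in> ?C. x ?B \<noteq> 0 \<and> subst_seminorm ?A ?B x \<in> {x \<in> ?C. (x, True) \<in> U}}}"
  have V: "V \<in> sets (borel_of ?T)" unfolding V_def
    using openin_glue_top[of ?C U] U by (intro op subst_seminorm_open berk_subst) (auto simp: P1berk_top_def)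
  define C1 where "C1 = {(x, True) | x. x \<in> ?C}"
  have C1: "C1 \<in> sets (borel_of ?T)" unfolding C1_def by (rule op) (use openin_topspace[of "chart_top ?C"] in simp)
  define C2 where "C2 = {(x, True) | x. x \<in> {x \<in> ?C. x ?B \<noteq> 0}}"
  have C2: "C2 \<in> sets (borel_of ?T)" unfolding C2_def
  proof (rule op)
    have "{x \<in> ?C. x ?B \<noteq> 0} = {x \<in> topspace (chart_top ?C). x ?B \<in> - {0}}" by auto
    then show "openin (chart_top ?C) {x \<in> ?C. x ?B \<noteq> 0}"
      using openin_continuous_map_preimage[OF continuous_map_chart_coord[of ?C ?B], of "- {0}"] by (simp add: open_openin[symmetric] open_Compl)
  qed
  have sp: "topspace ?T \<in> sets (borel_of ?T)" using sets.top[of "borel_of ?T"] by simp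
  have C1sub: "x \<in> ?C" if "(x, True) \<in> topspace ?T" for x using that by (auto simp: topspace_P1berk glue_pts_def)
  have "berk_act g -` U \<inter> space (borel_of ?T) =
      V \<union> (if berk_infty \<in> U then C1 - C2 else {}) \<union> (if berk_act g berk_infty \<in> U then topspace ?T - C1 else {})" (is "?L = ?R")
  proof (rule Set.set_eqI)
    fix p
    show "p \<in> ?L \<longleftrightarrow> p \<in> ?R"
    proof (cases "p \<in> topspace ?T")
      case False
      have "V \<subseteq> topspace ?T" "C1 \<subseteq> topspace ?T" by (auto simp: V_def C1_def topspace_P1berk glue_pts_def)
      then show ?thesis using False by auto
    next
      case True
      then have "p \<in> glue_pts ?C" by (simp add: topspace_P1berk)
      then show ?thesis
      proof (cases rule: glue_pts_berk_cases)
        case (1 x)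
        then show ?thesis using True berk_subst[OF 1(2)] by (auto simp: V_def C1_def C2_def berk_act_True)
      next
        case 2
        then show ?thesis using True by (auto simp: V_def C1_def C2_def berk_infty_def)
      qed
    qed
  qed
  also have "\<dots> \<in> sets (borel_of ?T)" using V C1 C2 sp by (intro sets.Un) auto
  finally show "berk_act g -` U \<inter> space (borel_of ?T) \<in> sets (borel_of ?T)" .
qed

lemma berk_D_word_act:
  assumes det: "\<And>g. det (\<rho> g) = 1" and y: "y \<in> glue_pts berk_chart"
  shows "berk_D (word_act (\<lambda>g. berk_act (\<rho> g)) w y) q = na.hdist (\<lambda>u. berk_H y (u v* word_mat \<rho> w)) q"
proof -
  have "word_act (\<lambda>g. berk_act (\<rho> g)) w y \<in> glue_pts berk_chart \<and>
     (\<exists>c>0. berk_H (word_act (\<lambda>g. berk_act (\<rho> g)) w y) = (\<lambda>u. c * berk_H y (u v* word_mat \<rho> w)))"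
  proof (induction w)
    case Nil
    have "berk_H y = (\<lambda>u. 1 * berk_H y (u v* mat 1))" by (rule ext) simp
    then show ?case using y by (auto intro!: exI[of _ 1])
  next
    case (Cons g w)
    let ?y = "word_act (\<lambda>g. berk_act (\<rho> g)) w y"
    obtain c where c: "0 < c" "berk_H ?y = (\<lambda>u. c * berk_H y (u v* word_mat \<rho> w))" using Cons by blast
    obtain k where k: "0 < k" "berk_H (berk_act (\<rho> g) ?y) = (\<lambda>u. k * berk_H ?y (u v* \<rho> g))" using berk_H_act[OF _ det] Cons by blast
    have "u v* \<rho> g v* word_mat \<rho> w = u v* word_mat \<rho> (g # w)" for u by (simp add: vec_eq_iff algebra_simps)
    then have "berk_H (berk_act (\<rho> g) ?y) = (\<lambda>u. (k * c) * berk_H y (u v* word_mat \<rho> (g # w)))" unfolding k(2) c(2) by (simp add: mult.assoc)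
    moreover have "0 < k * c" using k c by simp
    ultimately have "\<exists>c>0. berk_H (berk_act (\<rho> g) ?y) = (\<lambda>u. c * berk_H y (u v* word_mat \<rho> (g # w)))" by blast
    then show ?case using berk_act_in Cons by (simp only: word_act_simps)
  qed
  then obtain c where c: "0 < c" "berk_H (word_act (\<lambda>g. berk_act (\<rho> g)) w y) = (\<lambda>u. c * berk_H y (u v* word_mat \<rho> w))"
    by blast
  show ?thesis unfolding berk_D_def c(2) by (rule na.hdist_scale[OF c(1)])
qed

lemma berk_boundary_walk:
  fixes m :: "'a::countable pmf"
  assumes "e \<in> set_pmf m" "set f \<subseteq> set_pmf m" "set h \<subseteq> set_pmf m" "0 < c"
    and data: "sl2_data m B c e f h na_abs \<rho>"
    and det: "\<And>g. det (\<rho> g) = 1"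
  shows "boundary_walk m (\<lambda>g. mobius (\<rho> g)) na.cdist None P1berk_top (\<lambda>g. berk_act (\<rho> g)) berk_\<iota> berk_D"
proof
  note H = row_seminorm_berk_H
  show "\<exists>L. \<forall>x y. na.cdist (mobius (\<rho> g) x) (mobius (\<rho> g) y) \<le> L * na.cdist x y" for g
    using na.cdist_mobius_Lipschitz[OF det] by blast
  show "\<exists>l. (\<lambda>n. na.cdist (s n) l) \<longlonglongrightarrow> 0" if "\<And>r::real. 0 < r \<Longrightarrow> \<exists>K. \<forall>i\<ge>K. \<forall>j\<ge>K. na.cdist (s i) (s j) < r" for s
    using na.cdist_complete[OF na_abs_complete that] by simp
  show "berk_act (\<rho> g) \<in> measurable (borel_of P1berk_top) (borel_of P1berk_top)" for g by (rule berk_act_measurable)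
  show "openin P1berk_top {y \<in> topspace P1berk_top. berk_D y z < r}" for z r by (rule berk_ball_open)
  show "\<exists>r>0. {y \<in> topspace P1berk_top. berk_D y z < r} \<subseteq> U" if "openin P1berk_top U" "berk_\<iota> z \<in> U" for U z
    by (rule berk_ball_basis[OF that])
  show "\<exists>n0. \<forall>n\<ge>n0. \<forall>y\<in>topspace P1berk_top.
       measure_pmf.prob (replicate_pmf n m) {w. \<eta> < berk_D (word_act (\<lambda>g. berk_act (\<rho> g)) w y) (word_act (\<lambda>g. mobius (\<rho> g)) w None)} \<le> \<eta>"
    if \<eta>: "0 < \<eta>" for \<eta>
  proof -
    obtain n0 where n0: "\<And>n H. n0 \<le> n \<Longrightarrow> row_seminorm na_abs H \<Longrightarrow>
      measure_pmf.prob (replicate_pmf n m) {w. \<eta> < na.hdist (\<lambda>y. H (y v* word_mat \<rho> w)) (word_act (\<lambda>g. mobius (\<rho> g)) w None)} \<le> \<eta>"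
      using contraction_uniform[OF assms(1-4) \<eta> \<eta>, of B, where 'k="complex fls"] data by blast
    have eq: "berk_D (word_act (\<lambda>g. berk_act (\<rho> g)) w y) q = na.hdist (\<lambda>u. berk_H y (u v* word_mat \<rho> w)) q"
      if y: "y \<in> glue_pts berk_chart" for w y q
      by (rule berk_D_word_act[OF det y])
    show ?thesis
    proof (intro exI[of _ n0] allI impI ballI)
      fix n y assume "n0 \<le> n" "y \<in> topspace P1berk_top"
      then show "measure_pmf.prob (replicate_pmf n m) {w. \<eta> < berk_D (word_act (\<lambda>g. berk_act (\<rho> g)) w y) (word_act (\<lambda>g. mobius (\<rho> g)) w None)} \<le> \<eta>"
        using n0[OF _ H, of n y] by (simp add: eq topspace_P1berk)
    qed
  qed
  show "na.cdist x z \<le> na.cdist x u + na.cdist u z" for x z u by (rule na.cdist_triangle)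
  show "na.cdist x z = na.cdist z x" for x z by (rule na.cdist_sym)
  show "berk_D y z \<le> berk_D y x + na.cdist x z" if "y \<in> topspace P1berk_top" for x y z
    unfolding berk_D_def using that by (intro na.hdist_triangle H) (simp add: topspace_P1berk)
  show "na.cdist x z \<le> berk_D y x + berk_D y z" if "y \<in> topspace P1berk_top" for x y z
    unfolding berk_D_def using that by (intro na.hdist_triangle2 H) (simp add: topspace_P1berk)
  show "0 \<le> berk_D y z" if "y \<in> topspace P1berk_top" for y z
    unfolding berk_D_def using that by (intro na.hdist_nonneg H) (simp add: topspace_P1berk)
  show "y = berk_\<iota> z" if "y \<in> topspace P1berk_top" "berk_D y z = 0" for y z
    using berk_D_eq_0 that by (simp add: topspace_P1berk)
  show "berk_\<iota> x \<in> topspace P1berk_top" for x by (simp add: topspace_P1berk berk_\<iota>_in)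
  show "berk_\<iota> (mobius (\<rho> g) x) = berk_act (\<rho> g) (berk_\<iota> x)" for g x by (rule berk_act_\<iota>)
  show "berk_D (berk_\<iota> x) z = na.cdist x z" for x z by (rule berk_D_\<iota>)
  show "0 \<le> na.cdist x z" "na.cdist x x = 0" for x z by simp_all
qed

section \<open>Independent hyperbolic words\<close>

lemma na_abs_add_le_1: "na_abs x \<le> 1 \<Longrightarrow> na_abs y \<le> 1 \<Longrightarrow> na_abs (x + y) \<le> 1"
  using na_abs_le_iff[of _ 0] by auto

text \<open>The nonzero values are integral powers of e, so a value above 1 is at least e. The
  strict inequality is what persists under perturbation to small t.\<close>

lemma na_abs_gt_1_imp: "1 < na_abs x \<Longrightarrow> 5/2 < na_abs x"
proof -
  assume a: "1 < na_abs x"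
  then have "x \<noteq> 0" by (auto simp: na_abs_def)
  with a have "1 \<le> - real_of_int (fls_subdegree x)" by (simp add: na_abs_def)
  then have "exp 1 \<le> na_abs x" using \<open>x \<noteq> 0\<close> by (simp add: na_abs_def)
  \<comment> \<open>Four terms of the exponential series give 8/3, which is above 5/2.\<close>
  moreover have "1 + 1 + 1\<^sup>2 / 2 + 1 ^ 3 / 6 \<le> exp (1::real)"
  proof -
    have "(\<Sum>k<4. 1 ^ k / fact k) \<le> exp (1::real)"
      using sum_le_suminf[OF summable_exp[of "1::real"], of "{..<4}"]
      by (simp add: exp_def divide_inverse mult.commute)
    then show ?thesis by (simp add: eval_nat_numeral)
  qed
  ultimately show ?thesis by (simp add: power2_eq_square)
qed

definition smat2 :: "'k::comm_ring_1 \<Rightarrow> 'k^2^2 \<Rightarrow> 'k^2^2" where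
  "smat2 c A = (\<chi> i j. c * A$i$j)"

lemma smat2_nth [simp]: "smat2 c A $ i $ j = c * A$i$j"
  by (simp add: smat2_def)

text \<open>The module spanned by \<open>W\<close> over the valuation ring, that is, over the series
  without pole.\<close>

inductive_set int_span :: "(complex fls^2^2) set \<Rightarrow> (complex fls^2^2) set" for W where
  base: "A \<in> W \<Longrightarrow> A \<in> int_span W"
| add: "A \<in> int_span W \<Longrightarrow> B \<in> int_span W \<Longrightarrow> A + B \<in> int_span W"
| scale: "na_abs c \<le> 1 \<Longrightarrow> A \<in> int_span W \<Longrightarrow> smat2 c A \<in> int_span W"

lemma int_span_mult:
  assumes W: "\<And>A B. A \<in> W \<Longrightarrow> B \<in> W \<Longrightarrow> A ** B \<in> W"
    and "A \<in> int_span W" "B \<in> int_span W"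
  shows "A ** B \<in> int_span W"
  using assms(3)
proof induction
  case (base B)
  from assms(2) show ?case
  proof induction
    case (base A)
    then show ?case using W \<open>B \<in> W\<close> by (intro int_span.base)
  next
    case (add A A')
    have "(A + A') ** B = A ** B + A' ** B" by (rule mat2_eqI) (simp_all add: algebra_simps)
    then show ?case using add by (simp add: int_span.add)
  next
    case (scale c A)
    have "smat2 c A ** B = smat2 c (A ** B)" by (rule mat2_eqI) (simp_all add: algebra_simps)
    then show ?case using scale by (simp add: int_span.scale)
  qed
next
  case (add B B')
  have "A ** (B + B') = A ** B + A ** B'" by (rule mat2_eqI) (simp_all add: algebra_simps)
  then show ?case using add by (simp add: int_span.add)
next
  case (scale c B)
  have "A ** smat2 c B = smat2 c (A ** B)" by (rule mat2_eqI) (simp_all add: algebra_simps)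
  then show ?case using scale by (simp add: int_span.scale)
qed

lemma int_span_trace:
  assumes "\<And>A. A \<in> W \<Longrightarrow> na_abs (tr2 A) \<le> 1" "A \<in> int_span W"
  shows "na_abs (tr2 A) \<le> 1"
  using assms(2)
proof induction
  case (add A B)
  have "tr2 (A + B) = tr2 A + tr2 B" by (simp add: tr2_def)
  then show ?case using add by (simp add: na_abs_add_le_1)
next
  case (scale c A)
  have "tr2 (smat2 c A) = c * tr2 A" by (simp add: tr2_def algebra_simps)
  then show ?case using scale by (simp add: na.N_mult mult_le_one)
qed (use assms in auto)

lemma mobius_mult:
  fixes A B :: "'k::field^2^2"
  assumes "det A \<noteq> 0" "det B \<noteq> 0"
  shows "mobius (A ** B) p = mobius A (mobius B p)"
proof -
  obtain c where c: "c \<noteq> 0" "B *v pv p = c *s pv (mobius B p)" using pv_mobius[OF assms(2)] by blast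
  obtain e where e: "e \<noteq> 0" "A *v pv (mobius B p) = e *s pv (mobius A (mobius B p))" using pv_mobius[OF assms(1)] by blast
  have "det (A ** B) \<noteq> 0" using assms by (simp add: det_mul)
  then obtain k where k: "k \<noteq> 0" "(A ** B) *v pv p = k *s pv (mobius (A ** B) p)" using pv_mobius by blast
  have "k *s pv (mobius (A ** B) p) = A *v (B *v pv p)" by (simp add: k(2)[symmetric] matrix_vector_mul_assoc)
  also have "\<dots> = c *s (A *v pv (mobius B p))" unfolding c(2) by (simp add: vec_eq_iff algebra_simps)
  also have "\<dots> = (c * e) *s pv (mobius A (mobius B p))" unfolding e(2) by simp
  finally have "(k / (c * e)) *s pv (mobius (A ** B) p) = pv (mobius A (mobius B p))"
    using c(1) e(1) k(1) by (simp add: vec_eq_iff field_simps)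
  then show ?thesis by (rule pv_proportional)
qed

lemma mobius_id [simp]: "mobius (mat 1 :: 'k::field^2^2) p = p"
  by (cases p) (simp_all add: mobius_def)

text \<open>Multiplicativity makes the image of the neutral element idempotent; an invertible
  idempotent is the identity.\<close>

lemma idempotent_sl2:
  fixes A :: "'k::field^2^2"
  assumes "A ** A = A" "det A = 1" shows "A = mat 1"
proof -
  have "adj2 A ** (A ** A) = adj2 A ** A" using assms(1) by simp
  then show ?thesis using mult_adj2(2)[OF assms(2)] by (simp add: matrix_mul_assoc)
qed

locale sl2_rep = group G for G (structure) +
  fixes X :: "'g set" and r :: "'g \<Rightarrow> complex fls^2^2"
  assumes X: "X \<subseteq> carrier G" "generate G X = carrier G"
    and r_mult: "x \<in> carrier G \<Longrightarrow> y \<in> carrier G \<Longrightarrow> r (x \<otimes> y) = r x ** r y"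
    and r_det: "x \<in> carrier G \<Longrightarrow> det (r x) = 1"
    and hyp: "\<exists>g\<in>carrier G. 1 < na_abs (tr2 (r g))"
    and orb: "\<And>p. infinite {mobius (r g) p | g. g \<in> carrier G}"
begin

lemma r_one: "r \<one> = mat 1"
  using r_mult[of \<one> \<one>] r_det[of \<one>] by (intro idempotent_sl2) simp_all

lemma r_inv: "x \<in> carrier G \<Longrightarrow> r (inv x) = adj2 (r x)"
proof -
  assume x: "x \<in> carrier G"
  have e: "r x ** r (inv x) = mat 1" using r_mult[of x "inv x"] x by (simp add: r_one)
  have "adj2 (r x) = adj2 (r x) ** (r x ** r (inv x))" by (simp only: e matrix_mul_rid)
  also have "\<dots> = r (inv x)" using mult_adj2(2)[OF r_det[OF x]] by (simp add: matrix_mul_assoc)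
  finally show ?thesis by simp
qed

text \<open>If all words had integral traces, the span of their matrices over the valuation ring would be a
  ring of matrices with integral traces. It contains the inverses \<open>tr s - s\<close> of the generators, hence
  all of the image of \<open>G\<close>.\<close>
lemma hyperbolic_word:
  obtains f where "set f \<subseteq> X" "5/2 < na_abs (tr2 (word_mat r f))"
proof -
  have "\<exists>f. set f \<subseteq> X \<and> 1 < na_abs (tr2 (word_mat r f))"
  proof (rule ccontr)
    assume no: "\<not> (\<exists>f. set f \<subseteq> X \<and> 1 < na_abs (tr2 (word_mat r f)))"
    define W where "W = {word_mat r w | w. set w \<subseteq> X}"
    have Wm: "A ** B \<in> W" if AB: "A \<in> W" "B \<in> W" for A B
    proof -
      obtain u w where "A = word_mat r u" "B = word_mat r w" "set u \<subseteq> X" "set w \<subseteq> X" using AB by (auto simp: W_def)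
      then show ?thesis unfolding W_def by (auto simp: word_mat_append intro!: exI[of _ "u @ w"])
    qed
    have tr: "na_abs (tr2 A) \<le> 1" if "A \<in> W" for A
      using that no by (auto simp: W_def not_less)
    have w1: "mat 1 \<in> W" unfolding W_def by (auto intro!: exI[of _ "[]"])
    have wX: "r x \<in> W" if "x \<in> X" for x using that unfolding W_def by (auto intro!: exI[of _ "[x]"])
    have "r g \<in> int_span W" if "g \<in> generate G X" for g
      using that
    proof induction
      case one
      then show ?case using w1 by (simp add: r_one int_span.base)
    next
      case (incl x)
      then show ?case using wX by (simp add: int_span.base)
    next
      case (inv x)
      then have x: "x \<in> carrier G" using X by blast
      have "r (inv x) = smat2 (tr2 (r x)) (mat 1) + smat2 (-1) (r x)"
        unfolding r_inv[OF x] by (rule mat2_eqI) (simp_all add: tr2_def)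
      moreover have "na_abs (-1) \<le> 1" by (simp add: na.N_1)
      ultimately show ?case
        using int_span.add[OF int_span.scale[OF tr[OF wX[OF inv]] int_span.base[OF w1]]
            int_span.scale[OF _ int_span.base[OF wX[OF inv]], of "-1"]] by simp
    next
      case (eng x y)
      then have "x \<in> carrier G" "y \<in> carrier G" using X by auto
      then show ?case using eng int_span_mult[OF Wm] by (simp add: r_mult)
    qed
    then have "na_abs (tr2 (r g)) \<le> 1" if "g \<in> carrier G" for g
      using int_span_trace[OF tr] that X by auto
    then show False using hyp by force
  qed
  then show ?thesis using that na_abs_gt_1_imp by blast
qed

abbreviation wact :: "'g list \<Rightarrow> complex fls option \<Rightarrow> complex fls option" where
  "wact w p \<equiv> word_act (\<lambda>g. mobius (r g)) w p"

lemma det_X: "x \<in> X \<Longrightarrow> det (r x) = 1"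
  using r_det X by blast

lemma det_word: "set w \<subseteq> X \<Longrightarrow> det (word_mat r w) = 1"
  by (rule det_word_mat) (use det_X in auto)

lemma pv_wact: "set w \<subseteq> X \<Longrightarrow> \<exists>c. c \<noteq> 0 \<and> word_mat r w *v pv p = c *s pv (wact w p)"
  by (rule na.pv_word_act) (use det_X in auto)

lemma mobius_inj: "x \<in> carrier G \<Longrightarrow> inj (mobius (r x))"
proof (rule inj_on_inverseI)
  fix p assume x: "x \<in> carrier G"
  have "mobius (adj2 (r x)) (mobius (r x) p) = mobius (adj2 (r x) ** r x) p"
    using r_det[OF x] r_det[of "inv x"] x by (intro mobius_mult[symmetric]) (auto simp: r_inv[symmetric])
  then show "mobius (adj2 (r x)) (mobius (r x) p) = p" using mult_adj2(2)[OF r_det[OF x]] by simp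
qed

text \<open>A finite set mapped into itself by the generators is permuted by them, since they act
  injectively. It is then stable under inverses and under the whole group, so infinite group orbits
  force infinite word orbits.\<close>

lemma infinite_word_orbit: "infinite {wact w p | w. set w \<subseteq> X}"
proof
  assume fin: "finite {wact w p | w. set w \<subseteq> X}" (is "finite ?F")
  have stab: "mobius (r x) ` ?F = ?F" if x: "x \<in> X" for x
  proof (rule card_subset_eq[OF fin])
    show "mobius (r x) ` ?F \<subseteq> ?F"
    proof
      fix q assume "q \<in> mobius (r x) ` ?F"
      then obtain w where "q = mobius (r x) (wact w p)" "set w \<subseteq> X" by blast
      then show "q \<in> ?F" using x by (auto intro!: exI[of _ "x # w"])
    qed
    show "card (mobius (r x) ` ?F) = card ?F"
      using mobius_inj[of x] x X by (intro card_image) (auto intro: inj_on_subset)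
  qed
  have "mobius (r g) ` ?F \<subseteq> ?F" if "g \<in> generate G X" for g
    using that
  proof induction
    case one
    then show ?case by (simp add: r_one)
  next
    case (incl x)
    then show ?case using stab by simp
  next
    case (inv x)
    then have x: "x \<in> carrier G" using X by blast
    show ?case
    proof
      fix q assume "q \<in> mobius (r (inv x)) ` ?F"
      then obtain s where s: "s \<in> ?F" "q = mobius (r (inv x)) s" by blast
      then obtain u where u: "u \<in> ?F" "s = mobius (r x) u" using stab[OF inv] by blast
      have "q = mobius (r (inv x) ** r x) u"
        using s u r_det[OF x] r_det[of "inv x"] x by (subst mobius_mult) auto
      then have "q = u" using mult_adj2(2)[OF r_det[OF x]] by (simp add: r_inv[OF x])
      then show "q \<in> ?F" using u by simp
    qed
  next
    case (eng x y)
    then have xy: "x \<in> carrier G" "y \<in> carrier G" using X by auto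
    then have "mobius (r (x \<otimes> y)) = mobius (r x) \<circ> mobius (r y)"
      using r_det by (auto simp: fun_eq_iff r_mult mobius_mult)
    then have "mobius (r (x \<otimes> y)) ` ?F = mobius (r x) ` (mobius (r y) ` ?F)" by (simp only: image_comp)
    also have "\<dots> \<subseteq> mobius (r x) ` ?F" by (rule image_mono[OF eng.IH(2)])
    also have "\<dots> \<subseteq> ?F" by (rule eng.IH(1))
    finally show ?case .
  qed
  note sub = this
  have p: "p \<in> ?F" by (auto intro!: exI[of _ "[]"])
  have "{mobius (r g) p | g. g \<in> carrier G} \<subseteq> ?F"
  proof clarify
    fix g assume "g \<in> carrier G"
    then have "mobius (r g) ` ?F \<subseteq> ?F" using sub X by simp
    from subsetD[OF this imageI[OF p]] show "\<exists>w. mobius (r g) p = wact w p \<and> set w \<subseteq> X" by simp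
  qed
  then show False using orb[of p] fin finite_subset by blast
qed

end

text \<open>\<open>1 - d\<close> is a power series with constant term 1 and has a power series root.
  Hence the eigenvalues of a hyperbolic matrix lie in the Laurent field itself, without a quadratic
  extension.\<close>

lemma na_sqrt:
  assumes "na_abs d < 1"
  shows "\<exists>s. s\<^sup>2 = 1 - d \<and> s \<noteq> 0"
proof -
  have "na_abs d \<le> exp (- real_of_int 1)"
  proof (cases "d = 0")
    case False
    with assms have "- real_of_int (fls_subdegree d) < 0" by (simp add: na_abs_def)
    then show ?thesis using False by (simp add: na_abs_def)
  qed (simp add: na_abs_def)
  then have d0: "fls_nth d k = 0" if "k < 1" for k using na_abs_le_iff[of d 1] that by blast
  define E where "E = fls_regpart (1 - d)"
  have "0 \<le> fls_subdegree (1 - d)" by (rule fls_subdegree_ge0I) (simp add: d0)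
  then have E: "fps_to_fls E = 1 - d" unfolding E_def by (rule fls_regpart_to_fls_trivial)
  have E0: "fps_nth E 0 = 1" by (simp add: E_def d0)
  define s where "s = fps_radical (\<lambda>_ _. 1) (Suc 1) E"
  have "s ^ Suc 1 = E" unfolding s_def using E0 by (subst power_radical[symmetric]) auto
  then have "fps_to_fls s ^ 2 = 1 - d" using E by (simp add: numeral_2_eq_2 fps_to_fls_power[symmetric] del: power_Suc)
  moreover have "1 - d \<noteq> 0" using E0 E by (metis fps_to_fls_eq_0_iff fps_zero_nth zero_neq_one)
  ultimately show ?thesis by (intro exI[of _ "fps_to_fls s"]) auto
qed

text \<open>By Cayley-Hamilton the columns of \<open>A\<close> minus \<mu> times the identity are
  eigenvectors for \<open>l\<close>. If both vanished, the trace would give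
  \<open>l = \<mu>\<close>.\<close>

lemma eigenvector_exists:
  fixes A :: "'k::field^2^2"
  assumes "l + \<mu> = tr2 A" "l * \<mu> = det A" "l \<noteq> \<mu>"
  shows "\<exists>p. A *v pv p = l *s pv p"
proof -
  have ex: "\<exists>p. A *v pv p = l *s pv p" if v: "v \<noteq> 0" "A *v v = l *s v" for v
  proof (cases "v$2 = 0")
    case True
    then have v1: "v$1 \<noteq> 0" using v(1) by (auto simp: vec_eq_iff forall_2)
    have "A$1$1 * v$1 = l * v$1" "A$2$1 * v$1 = 0" using v(2) True by (auto simp: vec_eq_iff forall_2)
    then show ?thesis using v1 by (intro exI[of _ None]) (simp add: vec_eq_iff forall_2)
  next
    case False
    have "A$1$1 * v$1 + A$1$2 * v$2 = l * v$1" "A$2$1 * v$1 + A$2$2 * v$2 = l * v$2" using v(2) by (auto simp: vec_eq_iff forall_2)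
    then show ?thesis using False by (intro exI[of _ "Some (v$1 / v$2)"]) (simp add: vec_eq_iff forall_2 field_simps)
  qed
  have t: "l = A$1$1 + A$2$2 - \<mu>" using assms(1) by (simp add: tr2_def algebra_simps)
  have d: "(A$1$1 + A$2$2 - \<mu>) * \<mu> = A$1$1 * A$2$2 - A$1$2 * A$2$1" using assms(2) by (simp add: t det_2)
  define v :: "'k^2" where "v = vector [A$1$1 - \<mu>, A$2$1]"
  define w :: "'k^2" where "w = vector [A$1$2, A$2$2 - \<mu>]"
  have "A *v v = l *s v" "A *v w = l *s w"
    using d by (simp_all add: v_def w_def vec_eq_iff forall_2 t algebra_simps)
  moreover have "v \<noteq> 0 \<or> w \<noteq> 0"
  proof (rule ccontr)
    assume "\<not> (v \<noteq> 0 \<or> w \<noteq> 0)"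
    then have "A$1$1 = \<mu>" "A$2$2 = \<mu>" by (auto simp: v_def w_def vec_eq_iff forall_2)
    then show False using t assms(3) by simp
  qed
  ultimately show ?thesis using ex by blast
qed

context sl2_rep
begin

text \<open>The hyperbolic word \<open>f\<close> has two fixed points \<open>p\<close>, \<open>q\<close>, and it shares none with its conjugate by
  \<open>h\<close> as soon as \<open>h\<close> moves both out of \<open>{p, q}\<close>. Such an \<open>h\<close> exists because word orbits are infinite and
  the powers of \<open>f\<close> move every other point out of any finite set.\<close>
lemma independent_hyperbolic_words:
  obtains f h where "set f \<subseteq> X" "set h \<subseteq> X" "5/2 < na_abs (tr2 (word_mat r f))"
    "det (word_mat r f ** conj2 (word_mat r h) (word_mat r f) - conj2 (word_mat r h) (word_mat r f) ** word_mat r f) \<noteq> 0"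
proof -
  obtain f where f: "set f \<subseteq> X" "5/2 < na_abs (tr2 (word_mat r f))" by (rule hyperbolic_word)
  define F where "F = word_mat r f"
  define \<tau> where "\<tau> = tr2 F"
  have dF: "det F = 1" using det_word[OF f(1)] by (simp add: F_def)
  have \<tau>: "5/2 < na_abs \<tau>" using f by (simp add: \<tau>_def F_def)
  then have \<tau>0: "\<tau> \<noteq> 0" by auto
  have four: "na_abs 4 \<le> 1" using na_abs_add_le_1[of 2 2] na_abs_add_le_1[of 1 1] by simp
  have "na_abs (4 / \<tau>\<^sup>2) < 1"
  proof -
    have "1 < na_abs \<tau> * na_abs \<tau>" using \<tau> by (intro less_1_mult) auto
    then show ?thesis using four \<tau>0 by (simp add: na.N_divide na.N_mult power2_eq_square divide_less_eq)
  qed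
  then obtain s where s: "s\<^sup>2 = 1 - 4 / \<tau>\<^sup>2" "s \<noteq> 0" using na_sqrt by blast
  \<comment> \<open>The roots of \<open>x^2 - \<tau> * x + 1\<close>; \<open>s\<close> is a square
    root of the discriminant divided by \<open>\<tau>^2\<close>.\<close>
  define l where "l = \<tau> * (1 + s) / 2"
  define \<mu> where "\<mu> = \<tau> * (1 - s) / 2"
  have sum: "l + \<mu> = tr2 F" by (simp add: l_def \<mu>_def \<tau>_def[symmetric] field_simps)
  have "l * \<mu> = \<tau>\<^sup>2 * (1 - s\<^sup>2) / 4" by (simp add: l_def \<mu>_def power2_eq_square field_simps)
  also have "\<dots> = 1" using \<tau>0 by (simp add: s(1))
  finally have prod: "l * \<mu> = det F" "\<mu> * l = det F" by (simp_all add: dF mult.commute)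
  have "l - \<mu> = \<tau> * s" by (simp add: l_def \<mu>_def field_simps)
  then have neq: "l \<noteq> \<mu>" using \<tau>0 s(2) by auto
  obtain p where p: "F *v pv p = l *s pv p" using eigenvector_exists[OF sum prod(1) neq] by blast
  have sum': "\<mu> + l = tr2 F" using sum by (simp add: add.commute)
  obtain q where q: "F *v pv q = \<mu> *s pv q" using eigenvector_exists[OF sum' prod(2) neq[symmetric]] by blast
  let ?a = "pv p" and ?b = "pv q"
  define w where "w = wedge ?a ?b"
  have w: "w \<noteq> 0"
  proof
    assume "w = 0"
    then have "p = q" by (intro wedge_pv_eq_0) (simp add: w_def)
    then have "l *s ?b = \<mu> *s ?b" using p q by simp
    then have "l * ?b$i = \<mu> * ?b$i" for i by (metis vector_smult_component)
    then have "?b = 0" using neq by (simp add: vec_eq_iff)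
    then show False by simp
  qed
  have decomp: "w *s v = wedge v ?b *s ?a + wedge ?a v *s ?b" for v
    by (simp add: w_def wedge_def vec_eq_iff forall_2 algebra_simps)
  have Fdec: "w *s (F *v v) = (wedge v ?b * l) *s ?a + (wedge ?a v * \<mu>) *s ?b" for v
  proof -
    have "w *s (F *v v) = F *v (w *s v)" by (simp add: vec_eq_iff algebra_simps)
    also have "\<dots> = wedge v ?b *s (F *v ?a) + wedge ?a v *s (F *v ?b)"
      unfolding decomp by (simp add: vec_eq_iff algebra_simps)
    finally show ?thesis unfolding p q by (simp add: vec_eq_iff algebra_simps)
  qed
  \<comment> \<open>In the eigenbasis this quadratic form is a product of two linear forms, so its
    only zeros on the line are \<open>p\<close> and \<open>q\<close>.\<close>
  have qform: "w * wedge v (F *v v) = (\<mu> - l) * (wedge v ?b * wedge ?a v)" for v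
  proof -
    have "w * wedge v (F *v v) = wedge v (w *s (F *v v))" by (simp add: wedge_def algebra_simps)
    also have "\<dots> = wedge v ?b * l * wedge v ?a + wedge ?a v * \<mu> * wedge v ?b"
      unfolding Fdec by (simp add: wedge_def algebra_simps)
    also have "wedge v ?a = - wedge ?a v" by (simp add: wedge_def algebra_simps)
    finally show ?thesis by (simp add: algebra_simps)
  qed
  have q0: "x \<in> {p, q}" if x: "wedge (pv x) (F *v pv x) = 0" for x
  proof -
    have "wedge (pv x) ?b * wedge ?a (pv x) = 0" using qform[of "pv x"] x neq by simp
    then show ?thesis using wedge_pv_eq_0[of x q] wedge_pv_eq_0[of p x] by auto
  qed
  \<comment> \<open>The Chebyshev values at a hyperbolic trace never vanish, so the iterates of a
    point not fixed by \<open>f\<close> are pairwise distinct.\<close>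
  have escape: "\<exists>k. wact (wpow f k) x \<notin> B" if x: "x \<notin> {p, q}" and B: "finite B" for x B
  proof -
    have "inj (\<lambda>k. wact (wpow f k) x)"
    proof (rule linorder_injI, rule notI)
      fix i j :: nat assume ij: "i < j" and eq: "wact (wpow f i) x = wact (wpow f j) x"
      have ex: "\<exists>c. c \<noteq> 0 \<and> mat_pow F k *v pv x = c *s pv (wact (wpow f k) x)" for k
        using pv_wact[OF set_wpow[OF f(1)], of k x] by (simp only: word_mat_concat_replicate F_def)
      obtain c e where c: "c \<noteq> 0" "mat_pow F i *v pv x = c *s pv (wact (wpow f i) x)"
        and e: "e \<noteq> 0" "mat_pow F j *v pv x = e *s pv (wact (wpow f j) x)" using ex[of i] ex[of j] by blast
      have "wedge (mat_pow F i *v pv x) (mat_pow F j *v pv x) = 0"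
        unfolding c(2) e(2) eq by (simp add: wedge_def algebra_simps)
      then have "chebU (tr2 F) (j - i) * wedge (pv x) (F *v pv x) = 0"
        using wedge_mat_pow2[OF dF less_imp_le[OF ij]] by simp
      moreover obtain n where n: "j - i = Suc n" using ij by (cases "j - i") auto
      have "chebU (tr2 F) (j - i) \<noteq> 0"
      proof
        assume "chebU (tr2 F) (j - i) = 0"
        then have "na_abs (chebU (tr2 F) (Suc n)) = 0" by (simp only: n na.N_0)
        then show False using na.N_chebU[of "tr2 F" n] \<tau> by (simp add: \<tau>_def)
      qed
      ultimately show False using q0 x by auto
    qed
    then have "infinite (range (\<lambda>k. wact (wpow f k) x))" by (rule range_inj_infinite)
    then have "\<not> range (\<lambda>k. wact (wpow f k) x) \<subseteq> B" using B finite_subset by blast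
    then show ?thesis by blast
  qed
  have winj: "inj (wact u)" if u: "set u \<subseteq> X" for u
    using u
  proof (induction u)
    case Nil
    show ?case by (simp add: inj_def)
  next
    case (Cons g u)
    then have "g \<in> carrier G" "inj (wact u)" using X by auto
    then have "inj (mobius (r g) \<circ> wact u)" by (intro inj_compose mobius_inj)
    moreover have "mobius (r g) \<circ> wact u = wact (g # u)" by (simp add: fun_eq_iff)
    ultimately show ?case by simp
  qed
  have ex: "\<exists>u. set u \<subseteq> X \<and> wact u x \<notin> {p, q}" for x
  proof (rule ccontr)
    assume "\<not> (\<exists>u. set u \<subseteq> X \<and> wact u x \<notin> {p, q})"
    then have "{wact w x |w. set w \<subseteq> X} \<subseteq> {p, q}" by blast
    then show False using infinite_word_orbit[of x] finite_subset by blast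
  qed
  have fp: "wact (wpow f k) p = p" "wact (wpow f k) q = q" for k
  proof -
    have fix1: "wact f x = x" if x: "F *v pv x = c *s pv x" "c \<noteq> 0" for x c
    proof -
      obtain e where e: "e \<noteq> 0" "F *v pv x = e *s pv (wact f x)"
        using pv_wact[OF f(1), of x, folded F_def] by blast
      then have "(c / e) *s pv x = pv (wact f x)" using x by (simp add: vec_eq_iff field_simps)
      from pv_proportional[OF this] show ?thesis by simp
    qed
    have "l \<noteq> 0" "\<mu> \<noteq> 0" using prod dF by auto
    then have "wact f p = p" "wact f q = q" using fix1[OF p] fix1[OF q] by auto
    then show "wact (wpow f k) p = p" "wact (wpow f k) q = q" by (induction k) simp_all
  qed
  obtain u where u: "set u \<subseteq> X" "wact u p \<notin> {p, q}" using ex by blast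
  obtain v where v: "set v \<subseteq> X" "wact v q \<notin> {p, q}" using ex by blast
  \<comment> \<open>\<open>u\<close> moves \<open>p\<close> away; suppose it sends \<open>q\<close>
    to \<open>q\<close> or \<open>p\<close>. Powers of \<open>f\<close> fix both of these points and
    move \<open>wact u p\<close> past any finite set. Then \<open>v @ wpow f k @ u\<close> works if
    \<open>q\<close> was fixed, and \<open>u @ wpow f k @ u\<close> works if it went to
    \<open>p\<close>.\<close>
  have "\<exists>h. set h \<subseteq> X \<and> wact h p \<notin> {p, q} \<and> wact h q \<notin> {p, q}"
  proof (cases "wact u q \<in> {p, q}")
    case False
    then show ?thesis using u by blast
  next
    case True
    show ?thesis
    proof (cases "wact u q = q")
      case uq: True
      have "finite (wact v -` {p, q})" using winj[OF v(1)] by (intro finite_vimageI) auto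
      then obtain k where k: "wact (wpow f k) (wact u p) \<notin> wact v -` {p, q}" using escape[OF u(2)] by blast
      show ?thesis
        using k v u uq fp set_wpow[OF f(1), of k] by (intro exI[of _ "v @ wpow f k @ u"]) auto
    next
      case False
      then have uq: "wact u q = p" using True by blast
      have "finite (wact u -` {p, q})" using winj[OF u(1)] by (intro finite_vimageI) auto
      then obtain k where k: "wact (wpow f k) (wact u p) \<notin> wact u -` {p, q}" using escape[OF u(2)] by blast
      show ?thesis
        using k u uq fp set_wpow[OF f(1), of k] by (intro exI[of _ "u @ wpow f k @ u"]) auto
    qed
  qed
  then obtain h where h: "set h \<subseteq> X" "wact h p \<notin> {p, q}" "wact h q \<notin> {p, q}" by blast
  define H where "H = word_mat r h"
  have dH: "det H = 1" using det_word[OF h(1)] by (simp add: H_def)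
  define F' where "F' = conj2 H F"
  have nz: "wedge (pv x) (F' *v pv x) \<noteq> 0" if x: "wact h x \<notin> {p, q}" for x
  proof
    assume 0: "wedge (pv x) (F' *v pv x) = 0"
    have "wedge (pv x) (F' *v pv x) = wedge (H *v pv x) (H *v (F' *v pv x))"
      using dH by (simp only: wedge_mat mult_1_left)
    also have "H *v (F' *v pv x) = F *v (H *v pv x)"
      using mult_adj2(1)[OF dH] by (simp add: F'_def conj2_def matrix_vector_mul_assoc matrix_mul_assoc)
    finally have e: "wedge (H *v pv x) (F *v (H *v pv x)) = 0" using 0 by simp
    obtain c where c: "c \<noteq> 0" "H *v pv x = c *s pv (wact h x)"
      using pv_wact[OF h(1), of x, folded H_def] by blast
    have "wedge (H *v pv x) (F *v (H *v pv x)) = c * c * wedge (pv (wact h x)) (F *v pv (wact h x))"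
      unfolding c(2) by (simp add: wedge_def algebra_simps)
    then have "wedge (pv (wact h x)) (F *v pv (wact h x)) = 0" using e c(1) by simp
    then show False using q0 x by blast
  qed
  define K where "K = F ** F' - F' ** F"
  \<comment> \<open>In the eigenbasis of \<open>F\<close> a commutator with \<open>F\<close> has
    zero diagonal. So \<open>det K\<close> vanishes only if an off-diagonal entry does, that is, if
    \<open>F'\<close> fixes \<open>p\<close> or \<open>q\<close>.\<close>
  have Ka: "w *s (K *v ?a) = (wedge ?a (F' *v ?a) * (\<mu> - l)) *s ?b"
  proof -
    have "K *v ?a = F *v (F' *v ?a) - F' *v (F *v ?a)" by (simp add: K_def vec_eq_iff algebra_simps)
    also have "F' *v (F *v ?a) = l *s (F' *v ?a)" unfolding p by (simp add: vec_eq_iff algebra_simps)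
    finally have Kv: "K *v ?a = F *v (F' *v ?a) - l *s (F' *v ?a)" .
    have "w *s (K *v ?a) = w *s (F *v (F' *v ?a)) - l *s (w *s (F' *v ?a))"
      unfolding Kv by (simp add: vec_eq_iff algebra_simps)
    then show ?thesis unfolding Fdec decomp[of "F' *v ?a"] by (simp add: vec_eq_iff algebra_simps)
  qed
  have Kb: "w *s (K *v ?b) = (wedge (F' *v ?b) ?b * (l - \<mu>)) *s ?a"
  proof -
    have "K *v ?b = F *v (F' *v ?b) - F' *v (F *v ?b)" by (simp add: K_def vec_eq_iff algebra_simps)
    also have "F' *v (F *v ?b) = \<mu> *s (F' *v ?b)" unfolding q by (simp add: vec_eq_iff algebra_simps)
    finally have Kv: "K *v ?b = F *v (F' *v ?b) - \<mu> *s (F' *v ?b)" .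
    have "w *s (K *v ?b) = w *s (F *v (F' *v ?b)) - \<mu> *s (w *s (F' *v ?b))"
      unfolding Kv by (simp add: vec_eq_iff algebra_simps)
    then show ?thesis unfolding Fdec decomp[of "F' *v ?b"] by (simp add: vec_eq_iff algebra_simps)
  qed
  have "w * w * (det K * w) = wedge (w *s (K *v ?a)) (w *s (K *v ?b))"
    unfolding w_def wedge_mat[symmetric] by (simp add: wedge_def algebra_simps)
  also have "\<dots> = - (wedge ?a (F' *v ?a) * (\<mu> - l) * (wedge (F' *v ?b) ?b * (l - \<mu>)) * w)"
    unfolding Ka Kb by (simp add: w_def wedge_def algebra_simps)
  finally have "det K = 0 \<Longrightarrow> wedge ?a (F' *v ?a) = 0 \<or> wedge (F' *v ?b) ?b = 0" using w neq by auto
  moreover have "wedge (F' *v ?b) ?b = - wedge ?b (F' *v ?b)" by (simp add: wedge_def algebra_simps)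
  ultimately have "det K \<noteq> 0" using nz[OF h(2)] nz[OF h(3)] by auto
  then show ?thesis using that[of f h] f h by (simp add: K_def F'_def H_def F_def)
qed

end

section \<open>The hybrid projective line\<close>

lemma hyb_abs_nonneg [simp]: "0 \<le> hyb_abs a"
  by (auto simp: hyb_abs_def le_max_iff_disj)

lemma hyb_abs_zero [simp]: "hyb_abs 0 = 0"
  by (simp add: hyb_abs_def)

lemma hyb_abs_bounds: "cmod a \<le> hyb_abs a" "hyb_abs a \<le> cmod a + 1"
  by (auto simp: hyb_abs_def)

lemma summable_exp_minus: "summable (\<lambda>k. exp (- real k))"
proof -
  have "exp (- real k) = exp (-1) ^ k" for k by (simp add: exp_of_nat_mult[symmetric] mult.commute)
  moreover have "summable (\<lambda>k. exp (-1::real) ^ k)" by (rule summable_geometric) simp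
  ultimately show ?thesis by simp
qed

lemma summable_on_int_lower:
  fixes F :: "int \<Rightarrow> real"
  assumes "\<And>n. n < d \<Longrightarrow> F n = 0" "\<And>n. 0 \<le> F n"
  shows "F summable_on UNIV \<longleftrightarrow> summable (\<lambda>k. F (d + int k))"
proof -
  have inj: "inj_on (\<lambda>k. d + int k) UNIV" by (auto simp: inj_on_def)
  have "F summable_on UNIV \<longleftrightarrow> F summable_on range (\<lambda>k. d + int k)"
  proof (rule summable_on_cong_neutral)
    fix n assume "n \<in> UNIV - range (\<lambda>k. d + int k)"
    then have "n \<noteq> d + int (nat (n - d))" by blast
    then have "n < d" by linarith
    then show "F n = 0" by (rule assms(1))
  qed auto
  also have "\<dots> \<longleftrightarrow> (F \<circ> (\<lambda>k. d + int k)) summable_on UNIV" by (rule summable_on_reindex[OF inj])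
  also have "\<dots> \<longleftrightarrow> summable (\<lambda>k. F (d + int k))"
    using summable_on_UNIV_nonneg_real_iff[of "F \<circ> (\<lambda>k. d + int k)"] assms(2) by (simp add: o_def)
  finally show ?thesis .
qed

text \<open>\<open>hyb_abs\<close> exceeds \<open>cmod\<close> by at most 1, and the series of
  \<open>exp (- k)\<close> converges; membership is absolute convergence at radius 1/e. Any lower
  bound \<open>d\<close> for the support will do, so two series can share one.\<close>

lemma hybA_iff:
  assumes d: "\<And>n. n < d \<Longrightarrow> fls_nth f n = 0"
  shows "f \<in> hybA \<longleftrightarrow> summable (\<lambda>k. cmod (fls_nth f (d + int k)) * exp (- real k))"
proof -
  have "f \<in> hybA \<longleftrightarrow> summable (\<lambda>k. hyb_abs (fls_nth f (d + int k)) * exp (- real_of_int (d + int k)))"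
    unfolding hybA_def mem_Collect_eq by (rule summable_on_int_lower) (use d in auto)
  also have "(\<lambda>k. hyb_abs (fls_nth f (d + int k)) * exp (- real_of_int (d + int k)))
      = (\<lambda>k. exp (- real_of_int d) * (hyb_abs (fls_nth f (d + int k)) * exp (- real k)))"
    by (rule ext) (simp add: exp_diff exp_minus field_simps exp_add)
  also have "summable \<dots> \<longleftrightarrow> summable (\<lambda>k. hyb_abs (fls_nth f (d + int k)) * exp (- real k))"
    by (rule summable_cmult_iff[THEN trans]) simp
  also have "\<dots> \<longleftrightarrow> summable (\<lambda>k. cmod (fls_nth f (d + int k)) * exp (- real k))"
  proof
    assume "summable (\<lambda>k. hyb_abs (fls_nth f (d + int k)) * exp (- real k))"
    then show "summable (\<lambda>k. cmod (fls_nth f (d + int k)) * exp (- real k))"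
      by (rule summable_comparison_test'[where N=0]) (auto simp: abs_mult intro!: mult_right_mono hyb_abs_bounds)
  next
    assume "summable (\<lambda>k. cmod (fls_nth f (d + int k)) * exp (- real k))"
    then have "summable (\<lambda>k. cmod (fls_nth f (d + int k)) * exp (- real k) + exp (- real k))"
      by (intro summable_add summable_exp_minus)
    then show "summable (\<lambda>k. hyb_abs (fls_nth f (d + int k)) * exp (- real k))"
    proof (rule summable_comparison_test'[where N=0])
      fix k :: nat
      have "hyb_abs (fls_nth f (d + int k)) * exp (- real k) \<le> (cmod (fls_nth f (d + int k)) + 1) * exp (- real k)"
        by (intro mult_right_mono hyb_abs_bounds) auto
      then show "norm (hyb_abs (fls_nth f (d + int k)) * exp (- real k)) \<le> cmod (fls_nth f (d + int k)) * exp (- real k) + exp (- real k)"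
        by (simp add: algebra_simps)
    qed
  qed
  finally show ?thesis .
qed

lemma hybA_zero: "0 \<in> hybA"
  using hybA_iff[of 0 0] by simp

lemma hybA_one: "1 \<in> hybA"
proof -
  have "summable (\<lambda>k. cmod (fls_nth (1::complex fls) (0 + int k)) * exp (- real k))"
    by (rule summable_finite[of "{0}"]) auto
  then show ?thesis using hybA_iff[of 0 1] by simp
qed

lemma hybA_add: "a \<in> hybA \<Longrightarrow> b \<in> hybA \<Longrightarrow> a + b \<in> hybA"
proof -
  assume ab: "a \<in> hybA" "b \<in> hybA"
  define d where "d = min (fls_subdegree a) (fls_subdegree b)"
  have "summable (\<lambda>k. cmod (fls_nth a (d + int k)) * exp (- real k) + cmod (fls_nth b (d + int k)) * exp (- real k))"
    using ab hybA_iff[of d a] hybA_iff[of d b] by (intro summable_add) (auto simp: d_def)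
  then have "summable (\<lambda>k. cmod (fls_nth (a + b) (d + int k)) * exp (- real k))"
  proof (rule summable_comparison_test'[where N=0])
    fix k :: nat
    have "cmod (fls_nth (a + b) (d + int k)) * exp (- real k) \<le> (cmod (fls_nth a (d + int k)) + cmod (fls_nth b (d + int k))) * exp (- real k)"
      by (intro mult_right_mono) (auto simp: norm_triangle_ineq)
    then show "norm (cmod (fls_nth (a + b) (d + int k)) * exp (- real k)) \<le>
       cmod (fls_nth a (d + int k)) * exp (- real k) + cmod (fls_nth b (d + int k)) * exp (- real k)"
      by (simp add: algebra_simps)
  qed
  then show ?thesis using hybA_iff[of d "a + b"] by (simp add: d_def)
qed

lemma hybA_mult: "a \<in> hybA \<Longrightarrow> b \<in> hybA \<Longrightarrow> a * b \<in> hybA"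
proof -
  assume ab: "a \<in> hybA" "b \<in> hybA"
  define A where "A = fls_base_factor_to_fps a"
  define B where "B = fls_base_factor_to_fps b"
  define d where "d = fls_subdegree a + fls_subdegree b"
  have nth: "fls_nth (a * b) n = fls_nth (fps_to_fls (A * B)) (n - d)" for n
    by (simp add: fls_times_def A_def B_def d_def algebra_simps)
  have An: "fps_nth A k = fls_nth a (fls_subdegree a + int k)" "fps_nth B k = fls_nth b (fls_subdegree b + int k)" for k
    unfolding A_def B_def by (rule fls_base_factor_to_fps_nth)+
  have sA: "summable (\<lambda>k. norm (cmod (fps_nth A k) * exp (- real k)))" "summable (\<lambda>k. norm (cmod (fps_nth B k) * exp (- real k)))"
    using ab hybA_iff[of "fls_subdegree a" a] hybA_iff[of "fls_subdegree b" b] by (simp_all add: An)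
  have "summable (\<lambda>k. \<Sum>i\<le>k. (cmod (fps_nth A i) * exp (- real i)) * (cmod (fps_nth B (k - i)) * exp (- real (k - i))))"
    by (rule summable_Cauchy_product[OF sA])
  then have "summable (\<lambda>k. cmod (fps_nth (A * B) k) * exp (- real k))"
  proof (rule summable_comparison_test'[where N=0])
    fix k :: nat
    have "cmod (fps_nth (A * B) k) * exp (- real k) \<le> (\<Sum>i\<le>k. cmod (fps_nth A i) * cmod (fps_nth B (k - i))) * exp (- real k)"
      by (intro mult_right_mono) (auto simp: fps_mult_nth atLeast0AtMost norm_mult[symmetric] intro: norm_sum)
    also have "\<dots> = (\<Sum>i\<le>k. (cmod (fps_nth A i) * exp (- real i)) * (cmod (fps_nth B (k - i)) * exp (- real (k - i))))"
      unfolding sum_distrib_right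
    proof (rule sum.cong)
      fix i assume "i \<in> {..k}"
      then have "exp (- real k) = exp (- real i) * exp (- real (k - i))" by (simp add: exp_add[symmetric] of_nat_diff)
      then show "cmod (fps_nth A i) * cmod (fps_nth B (k - i)) * exp (- real k) = (cmod (fps_nth A i) * exp (- real i)) * (cmod (fps_nth B (k - i)) * exp (- real (k - i)))"
        by simp
    qed simp
    finally show "norm (cmod (fps_nth (A * B) k) * exp (- real k)) \<le> (\<Sum>i\<le>k. (cmod (fps_nth A i) * exp (- real i)) * (cmod (fps_nth B (k - i)) * exp (- real (k - i))))"
      by simp
  qed
  then show ?thesis using hybA_iff[of d "a * b"] by (simp add: nth)
qed

lemma hybA_conv_radius:
  assumes "a \<in> hybA" shows "ereal (exp (-1)) \<le> fls_conv_radius a"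
proof -
  define f where "f k = fls_nth a (fls_subdegree a + int k)" for k
  have "summable (\<lambda>k. cmod (f k) * exp (- real k))"
    using assms hybA_iff[of "fls_subdegree a" a] by (simp add: f_def)
  moreover have "cmod (f k) * exp (- real k) = norm (f k * complex_of_real (exp (-1)) ^ k)" for k
    by (simp add: norm_mult norm_power exp_of_nat_mult[symmetric] mult.commute)
  ultimately have "summable (\<lambda>k. norm (f k * complex_of_real (exp (-1)) ^ k))"
    by (simp only:)
  then have "summable (\<lambda>k. f k * complex_of_real (exp (-1)) ^ k)"
    by (rule summable_norm_cancel)
  from conv_radius_geI[OF this] have "ereal (exp (-1)) \<le> conv_radius f" by simp
  moreover have "f = fps_nth (fls_base_factor_to_fps a)" unfolding f_def fls_base_factor_to_fps_nth ..
  ultimately show ?thesis unfolding fls_conv_radius_altdef fps_conv_radius_def by simp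
qed

text \<open>Absolute convergence identifies the unordered sum with \<open>eval_fls\<close>, which is
  known to be additive, multiplicative and expanded by its own series.\<close>

lemma fls_eval_has_sum:
  assumes a: "a \<in> hybA" and t: "t \<noteq> 0" "cmod t < exp (-1)"
  shows "((\<lambda>n. fls_nth a n * t powi n) has_sum eval_fls a t) UNIV"
proof -
  let ?F = "fls_base_factor_to_fps a" and ?d = "fls_subdegree a"
  have inj: "inj_on (\<lambda>k. ?d + int k) UNIV" by (auto simp: inj_on_def)
  have "ereal (cmod t) < ereal (exp (-1))" using t by simp
  also have "\<dots> \<le> fps_conv_radius ?F" using hybA_conv_radius[OF a] unfolding fls_conv_radius_altdef .
  finally have "ereal (cmod t) < fps_conv_radius ?F" .
  then have sm: "summable (\<lambda>k. norm (fps_nth ?F k * t ^ k))"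
    unfolding fps_conv_radius_def by (rule abs_summable_in_conv_radius)
  have "((\<lambda>k. fps_nth ?F k * t ^ k) has_sum eval_fps ?F t) UNIV"
    unfolding eval_fps_def
    by (rule norm_summable_imp_has_sum[OF sm summable_sums[OF summable_norm_cancel[OF sm]]])
  then have "((\<lambda>k. fps_nth ?F k * t ^ k * t powi ?d) has_sum (eval_fps ?F t * t powi ?d)) UNIV"
    by (rule has_sum_cmult_left)
  moreover have "fps_nth ?F k * t ^ k * t powi ?d = fls_nth a (?d + int k) * t powi (?d + int k)" for k
    using t(1) unfolding fls_base_factor_to_fps_nth by (simp add: power_int_add)
  ultimately have "((\<lambda>n. fls_nth a n * t powi n) \<circ> (\<lambda>k. ?d + int k) has_sum eval_fls a t) UNIV"
    by (simp add: o_def eval_fls_def)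
  then have "((\<lambda>n. fls_nth a n * t powi n) has_sum eval_fls a t) (range (\<lambda>k. ?d + int k))"
    by (subst has_sum_reindex[OF inj])
  then show ?thesis
  proof (subst (asm) has_sum_cong_neutral[where T=UNIV and g="\<lambda>n. fls_nth a n * t powi n"])
    fix n assume "n \<in> UNIV - range (\<lambda>k. ?d + int k)"
    then have "n \<noteq> ?d + int (nat (n - ?d))" by blast
    then have "n < ?d" by linarith
    then show "fls_nth a n * t powi n = 0" by simp
  qed auto
qed

lemma fls_eval_eq:
  assumes "a \<in> hybA" "t \<noteq> 0" "cmod t < exp (-1)"
  shows "fls_eval a t = eval_fls a t"
  unfolding fls_eval_def by (rule infsumI[OF fls_eval_has_sum[OF assms]])

lemma fls_eval_ring:
  assumes t: "t \<noteq> 0" "cmod t < exp (-1)" and ab: "a \<in> hybA" "b \<in> hybA"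
  shows "fls_eval (a + b) t = fls_eval a t + fls_eval b t" "fls_eval (a * b) t = fls_eval a t * fls_eval b t"
proof -
  have "ereal (cmod t) < fls_conv_radius c" if "c \<in> hybA" for c
    using less_le_trans[OF _ hybA_conv_radius[OF that], of "ereal (cmod t)"] t(2) by simp
  then show "fls_eval (a + b) t = fls_eval a t + fls_eval b t" "fls_eval (a * b) t = fls_eval a t * fls_eval b t"
    using ab t hybA_add[OF ab] hybA_mult[OF ab] by (simp_all add: fls_eval_eq eval_fls_add eval_fls_mult)
qed

lemma fls_eval_0_1: "fls_eval 0 t = 0" "fls_eval 1 t = 1"
proof -
  show "fls_eval 0 t = 0" by (simp add: fls_eval_def)
  have "infsum (\<lambda>n::int. fls_nth 1 n * t powi n) UNIV = infsum (\<lambda>n::int. 1) {0::int}"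
    by (rule infsum_cong_neutral) auto
  then show "fls_eval 1 t = 1" by (simp add: fls_eval_def)
qed

lemma fls_eval_has_laurent_expansion:
  assumes "a \<in> hybA" shows "(\<lambda>t. fls_eval a t) has_laurent_expansion a"
proof -
  have "0 < fls_conv_radius a" using less_le_trans[OF _ hybA_conv_radius[OF assms], of 0] by simp
  then have "eval_fls a has_laurent_expansion a" by (rule eval_fls_has_laurent_expansion)
  moreover have "eventually (\<lambda>t. eval_fls a t = fls_eval a t) (at 0)"
    unfolding eventually_at using fls_eval_eq[OF assms]
    by (intro exI[of _ "exp (-1)"]) auto
  ultimately show ?thesis by (subst has_laurent_expansion_cong[symmetric]) auto
qed

text \<open>An exponent in (0, 1] turns \<open>cmod\<close> into an absolute value; the last
  equation is the normalisation that matches the value \<open>exp (-1)\<close> of the variable t in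
  the Laurent field.\<close>

lemma hyb_eps_bounds:
  assumes "t \<noteq> 0" "cmod t < exp (-1)"
  shows "0 < hyb_eps t" "hyb_eps t \<le> 1" "cmod t powr hyb_eps t = exp (-1)"
proof -
  have "ln (cmod t) < ln (exp (-1))" using assms by (subst ln_less_cancel_iff) auto
  then have l: "ln (cmod t) < -1" by simp
  show "0 < hyb_eps t" using l by (simp add: hyb_eps_def divide_neg_neg)
  have "- 1 / L \<le> 1" if "L < -1" for L :: real using that by (simp add: divide_simps)
  from this[OF l] show "hyb_eps t \<le> 1" by (simp add: hyb_eps_def)
  have "ln (cmod t) \<noteq> 0" using l by linarith
  then show "cmod t powr hyb_eps t = exp (-1)" using assms(1) by (simp add: powr_def hyb_eps_def del: ln_eq_zero_iff)
qed

text \<open>Termwise, the power of t contributes exactly \<open>exp (- n)\<close>. A coefficient of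
  modulus below 1 grows under an exponent at most 1, but only up to 1, and the maximum with 1 in
  \<open>hyb_abs\<close> covers this.\<close>

lemma fls_eval_bound:
  assumes a: "a \<in> hybA" and t: "t \<noteq> 0" "cmod t < exp (-1)"
  shows "cmod (fls_eval a t) powr hyb_eps t \<le> hyb_norm a"
proof -
  let ?e = "hyb_eps t"
  note e = hyb_eps_bounds[OF t]
  interpret absval "\<lambda>z::complex. cmod z powr ?e" by (rule absval_cmod_powr[OF e(1,2)])
  let ?h = "\<lambda>n::int. hyb_abs (fls_nth a n) * exp (- real_of_int n)"
  have sh: "?h summable_on UNIV" using a by (simp add: hybA_def)
  have tm_le: "cmod (fls_nth a n * t powi n) powr ?e \<le> ?h n" for n
  proof -
    have "cmod (t powi n) powr ?e = exp (- real_of_int n)"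
    proof -
      have "cmod (t powi n) = cmod t powr real_of_int n" using t by (simp add: norm_power_int powr_real_of_int')
      then have "cmod (t powi n) powr ?e = (cmod t powr ?e) powr real_of_int n" by (simp add: powr_powr mult.commute)
      then show ?thesis unfolding e(3) by (simp add: powr_def)
    qed
    moreover have "cmod (fls_nth a n) powr ?e \<le> hyb_abs (fls_nth a n)"
    proof (cases "fls_nth a n = 0")
      case False
      show ?thesis
      proof (cases "cmod (fls_nth a n) \<le> 1")
        case True
        then have "cmod (fls_nth a n) powr ?e \<le> 1" using e by (intro powr_le1) auto
        then show ?thesis using False by (simp add: hyb_abs_def)
      next
        case c: False
        then have "cmod (fls_nth a n) powr ?e \<le> cmod (fls_nth a n) powr 1" using e by (intro powr_mono) auto
        then show ?thesis using False by (simp add: hyb_abs_def)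
      qed
    qed simp
    ultimately show ?thesis by (simp add: norm_mult powr_mult mult_right_mono)
  qed
  have fin: "cmod (\<Sum>n\<in>I. fls_nth a n * t powi n) powr ?e \<le> hyb_norm a" if I: "finite I" for I
  proof -
    have "cmod (\<Sum>n\<in>I. fls_nth a n * t powi n) powr ?e \<le> (\<Sum>n\<in>I. cmod (fls_nth a n * t powi n) powr ?e)" by (rule N_sum)
    also have "\<dots> \<le> (\<Sum>n\<in>I. ?h n)" by (intro sum_mono tm_le)
    also have "\<dots> \<le> hyb_norm a" unfolding hyb_norm_def by (rule finite_sum_le_infsum[OF sh I]) auto
    finally show ?thesis .
  qed
  have "((\<lambda>n. fls_nth a n * t powi n) has_sum fls_eval a t) UNIV"
    using fls_eval_has_sum[OF a t] by (simp add: fls_eval_eq[OF a t])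
  then have "((\<lambda>I. \<Sum>n\<in>I. fls_nth a n * t powi n) \<longlongrightarrow> fls_eval a t) (finite_subsets_at_top UNIV)"
    by (simp add: has_sum_def)
  then have "((\<lambda>I. cmod (\<Sum>n\<in>I. fls_nth a n * t powi n) powr ?e) \<longlongrightarrow> cmod (fls_eval a t) powr ?e) (finite_subsets_at_top UNIV)"
    using e(1) by (intro tendsto_powr' tendsto_norm tendsto_const) auto
  then show ?thesis
  proof (rule tendsto_upperbound)
    show "\<forall>\<^sub>F I in finite_subsets_at_top UNIV. cmod (\<Sum>n\<in>I. fls_nth a n * t powi n) powr ?e \<le> hyb_norm a"
      unfolding eventually_finite_subsets_at_top using fin by (intro exI[of _ "{}"]) auto
  qed simp
qed

lemma na_abs_le_hyb_norm:
  assumes a: "a \<in> hybA" shows "na_abs a \<le> hyb_norm a"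
proof (cases "a = 0")
  case True
  then show ?thesis by (simp add: na_abs_def hyb_norm_def)
next
  case False
  let ?h = "\<lambda>n::int. hyb_abs (fls_nth a n) * exp (- real_of_int n)"
  have sh: "?h summable_on UNIV" using a by (simp add: hybA_def)
  have "1 \<le> hyb_abs (fls_nth a (fls_subdegree a))" using False by (simp add: hyb_abs_def)
  then have "na_abs a \<le> ?h (fls_subdegree a)" using False by (simp add: na_abs_def)
  also have "\<dots> \<le> hyb_norm a"
    unfolding hyb_norm_def using finite_sum_le_infsum[OF sh, of "{fls_subdegree a}"] by simp
  finally show ?thesis .
qed

lemma hyb_norm_nonneg: "0 \<le> hyb_norm a"
  unfolding hyb_norm_def by (rule infsum_nonneg) auto

lemma coeff_subring_hybAZ: "coeff_subring hybAZ"
proof -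
  have sum: "(\<Sum>i\<in>I. f i) \<in> hybA" if "\<And>i. i \<in> I \<Longrightarrow> f i \<in> hybA" for I :: "nat set" and f
    using that by (induction I rule: infinite_finite_induct) (auto intro: hybA_zero hybA_add)
  have "P * Q \<in> hybAZ" if "P \<in> hybAZ" "Q \<in> hybAZ" for P Q
    using that by (auto simp: hybAZ_def coeff_mult intro!: sum hybA_mult)
  moreover have "[:0, 1:] \<in> hybAZ" "[:a:] \<in> hybAZ" if "a \<in> hybA" for a
    using that by (auto simp: hybAZ_def coeff_pCons hybA_zero hybA_one split: nat.split)
  moreover have "(1 :: complex fls poly) \<in> hybAZ" by (auto simp: hybAZ_def coeff_1 hybA_zero hybA_one)
  ultimately show ?thesis using hybA_zero by (auto simp: coeff_subring_def hybAZ_def hybA_add)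
qed

lemma reflect_hybAZ: "reflect_poly P \<in> hybAZ \<longleftrightarrow> P \<in> hybAZ"
proof
  assume a: "reflect_poly P \<in> hybAZ"
  show "P \<in> hybAZ"
    unfolding hybAZ_def
  proof (intro CollectI allI)
    fix i
    show "coeff P i \<in> hybA"
    proof (cases "i \<le> degree P")
      case True
      then have "coeff (reflect_poly P) (degree P - i) = coeff P i" by (simp add: coeff_reflect_poly)
      then show ?thesis using a unfolding hybAZ_def by (metis (mono_tags) mem_Collect_eq)
    qed (simp add: coeff_eq_0 hybA_zero)
  qed
qed (auto simp: hybAZ_def coeff_reflect_poly hybA_zero)

lemma hyb_chartD:
  assumes "x \<in> hyb_chart"
  shows "mult_seminorm_on hybAZ x" "P \<notin> hybAZ \<Longrightarrow> x P = 0" "a \<in> hybA \<Longrightarrow> x [:a:] \<le> hyb_norm a"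
  using assms by (auto simp: hyb_chart_def)

lemma gluable_hyb: "gluable hyb_chart"
  unfolding gluable_def
proof (intro ballI impI conjI)
  fix y assume y: "y \<in> hyb_chart" "y [:0, 1:] \<noteq> 0"
  have Z: "1 \<in> hybAZ" "[:0, 1:] \<in> hybAZ" using coeff_subring_hybAZ by (auto simp: coeff_subring_def)
  show g: "glue_trans y \<in> hyb_chart"
    using mult_seminorm_subst[OF hyb_chartD(1)[OF y(1)] coeff_subring_hybAZ Z y(2)] hyb_chartD[OF y(1)]
    by (auto simp: hyb_chart_def glue_trans_subst subst_seminorm_const)
       (simp add: subst_seminorm_def reflect_poly_hom_subst[symmetric] reflect_hybAZ hyb_chartD(2)[OF y(1)])
  show "glue_trans (glue_trans y) = y"
  proof (rule ext)
    fix P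
    show "glue_trans (glue_trans y) P = y P"
    proof (cases "P \<in> hybAZ")
      case True
      then show ?thesis by (rule glue_trans_glue_trans[OF hyb_chartD(1)[OF y(1)] coeff_subring_hybAZ y(2)])
    next
      case False
      then show ?thesis using hyb_chartD(2)[OF y(1)] by (simp add: glue_trans_def reflect_hybAZ)
    qed
  qed
qed

text \<open>Both the evaluation at \<open>t\<close>, with \<open>N_t\<close>, and the inclusion of \<open>A\<close> into the Laurent series are of
  this kind, so estimates that are uniform in \<open>N\<close> and \<open>evl\<close> treat all fibres of the hybrid space alike.\<close>
locale hyb_eval = absval N for N :: "'k::field \<Rightarrow> real" +
  fixes evl :: "complex fls \<Rightarrow> 'k"
  assumes ev_0: "evl 0 = 0" and ev_1: "evl 1 = 1"
    and ev_add: "a \<in> hybA \<Longrightarrow> b \<in> hybA \<Longrightarrow> evl (a + b) = evl a + evl b"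
    and ev_mult: "a \<in> hybA \<Longrightarrow> b \<in> hybA \<Longrightarrow> evl (a * b) = evl a * evl b"
    and ev_le: "a \<in> hybA \<Longrightarrow> N (evl a) \<le> hyb_norm a"

definition hyb_pt :: "('k::field \<Rightarrow> real) \<Rightarrow> (complex fls \<Rightarrow> 'k) \<Rightarrow> 'k \<Rightarrow> complex fls poly \<Rightarrow> real" where
  "hyb_pt N evl z P = (if P \<in> hybAZ then N (poly (map_poly evl P) z) else 0)"

text \<open>Becomes \<open>psi t\<close> for the complex fibres (\<open>psi_eq\<close>) and
  \<open>psi_na\<close> on the classical points of the central one
  (\<open>psi_na_\<iota>\<close>).\<close>

definition hyb_Psi :: "('k::field \<Rightarrow> real) \<Rightarrow> (complex fls \<Rightarrow> 'k) \<Rightarrow> 'k option \<Rightarrow> (complex fls poly \<Rightarrow> real) \<times> bool" where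
  "hyb_Psi N evl p = (case p of None \<Rightarrow> (hyb_pt N evl 0, False) | Some z \<Rightarrow> (hyb_pt N evl z, True))"

lemma hybAZ_pCons: "pCons a P \<in> hybAZ \<longleftrightarrow> a \<in> hybA \<and> P \<in> hybAZ"
proof
  assume p: "pCons a P \<in> hybAZ"
  then have "coeff (pCons a P) 0 \<in> hybA" "\<And>i. coeff (pCons a P) (Suc i) \<in> hybA"
    unfolding hybAZ_def by blast+
  then show "a \<in> hybA \<and> P \<in> hybAZ" by (simp add: hybAZ_def)
qed (auto simp: hybAZ_def coeff_pCons split: nat.split)

lemma Z_in_hybAZ: "[:0, 1:] \<in> hybAZ"
  using coeff_subring_hybAZ by (simp add: coeff_subring_def)

context hyb_eval
begin

lemma coeff_ev [simp]: "coeff (map_poly evl P) i = evl (coeff P i)"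
  by (simp add: coeff_map_poly ev_0)

lemma ev_sum: "(\<And>i. i \<in> I \<Longrightarrow> g i \<in> hybA) \<Longrightarrow> evl (\<Sum>i\<in>I. g i) = (\<Sum>i\<in>I. evl (g i)) \<and> (\<Sum>i\<in>I. g i) \<in> hybA" for I :: "nat set"
  by (induction I rule: infinite_finite_induct) (auto simp: ev_0 ev_add hybA_zero hybA_add)

lemma map_ev_add: "P \<in> hybAZ \<Longrightarrow> Q \<in> hybAZ \<Longrightarrow> map_poly evl (P + Q) = map_poly evl P + map_poly evl Q"
  by (rule poly_eqI) (simp add: ev_add hybAZ_def)

lemma map_ev_mult:
  assumes "P \<in> hybAZ" "Q \<in> hybAZ"
  shows "map_poly evl (P * Q) = map_poly evl P * map_poly evl Q"
proof (rule poly_eqI)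
  fix n
  have PQ: "coeff P i \<in> hybA" "coeff Q i \<in> hybA" for i using assms by (auto simp: hybAZ_def)
  have "evl (\<Sum>i\<le>n. coeff P i * coeff Q (n - i)) = (\<Sum>i\<le>n. evl (coeff P i * coeff Q (n - i)))"
    using ev_sum[of "{..n}" "\<lambda>i. coeff P i * coeff Q (n - i)"] PQ hybA_mult by blast
  then show "coeff (map_poly evl (P * Q)) n = coeff (map_poly evl P * map_poly evl Q) n"
    by (simp add: coeff_mult ev_mult PQ)
qed

lemma map_ev_pCons: "map_poly evl (pCons a P) = pCons (evl a) (map_poly evl P)"
  by (rule poly_eqI) (simp add: coeff_pCons split: nat.split)

lemma hyb_pt_const: "a \<in> hybA \<Longrightarrow> hyb_pt N evl z [:a:] = N (evl a)"
  using hybA_zero by (simp add: hyb_pt_def hybAZ_pCons map_ev_pCons) (simp add: hybAZ_def)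

lemma hyb_pt_Z: "hyb_pt N evl z [:0, 1:] = N z"
  using Z_in_hybAZ by (simp add: hyb_pt_def map_ev_pCons ev_0 ev_1)

lemma hyb_pt_in: "hyb_pt N evl z \<in> hyb_chart"
proof -
  have S: "0 \<in> hybAZ" "1 \<in> hybAZ" "P + Q \<in> hybAZ" "P * Q \<in> hybAZ" if "P \<in> hybAZ" "Q \<in> hybAZ" for P Q
    using coeff_subring_hybAZ that by (auto simp: coeff_subring_def)
  note S' = S[OF Z_in_hybAZ Z_in_hybAZ]
  have "map_poly evl 1 = 1" by (simp add: one_pCons map_ev_pCons ev_1)
  then have "mult_seminorm_on hybAZ (hyb_pt N evl z)"
    unfolding mult_seminorm_on_def using S'(1,2)
    by (auto simp: hyb_pt_def S(3,4) map_ev_add map_ev_mult N_mult N_add)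
  then show ?thesis
    unfolding hyb_chart_def using hyb_pt_const ev_le by (auto simp: hyb_pt_def)
qed

text \<open>The gluing is inversion of the coordinate, so each point can be examined in whichever
  chart has its coordinate small.\<close>

lemma glue_chart2_hyb_pt: "glue_chart2 (hyb_pt N evl u) = hyb_Psi N evl (inv_pt (Some u))"
proof (cases "u = 0")
  case True
  then show ?thesis by (simp add: glue_chart2_def hyb_pt_Z hyb_Psi_def inv_pt_def)
next
  case False
  have "glue_trans (hyb_pt N evl u) P = hyb_pt N evl (1 / u) P" for P
  proof (cases "P \<in> hybAZ")
    case True
    have "map_poly evl (reflect_poly P) = hom_subst (degree P) 1 [:0, 1:] (map_poly evl P)"
      by (rule poly_eqI) (simp add: reflect_poly_hom_subst coeff_hom_subst_reflect ev_0)
    moreover have "degree (map_poly evl P) \<le> degree P" by (rule degree_le) (simp add: coeff_eq_0 ev_0)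
    ultimately have "poly (map_poly evl (reflect_poly P)) u = u ^ degree P * poly (map_poly evl P) (1 / u)"
      using poly_hom_subst[of "[:0, 1:]" u "map_poly evl P" "degree P" 1] False by simp
    then show ?thesis
      using True False by (simp add: glue_trans_def hyb_pt_Z) (simp add: hyb_pt_def reflect_hybAZ N_mult N_power)
  next
    case F: False
    then show ?thesis by (simp add: glue_trans_def hyb_pt_def reflect_hybAZ)
  qed
  then have "glue_trans (hyb_pt N evl u) = hyb_pt N evl (1 / u)" by (rule ext)
  then show ?thesis using False by (simp add: glue_chart2_def hyb_pt_Z hyb_Psi_def inv_pt_def)
qed

lemma charts_cover: "(\<exists>z. p = Some z \<and> N z \<le> 2) \<or> (\<exists>u. inv_pt p = Some u \<and> N u \<le> 2)"
proof (cases p)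
  case None
  then show ?thesis by (auto simp: inv_pt_def)
next
  case (Some z)
  show ?thesis
  proof (cases "N z \<le> 2")
    case False
    then have "z \<noteq> 0" by auto
    moreover have "1 / N z \<le> 2" using False by (intro order_trans[OF divide_left_mono[of 1 "N z" 1]]) auto
    ultimately show ?thesis using Some by (auto simp: inv_pt_def N_divide)
  qed (use Some in auto)
qed

text \<open>Radius 2 instead of 1 makes the two discs overlap. A point outside the first disc has
  inverse coordinate at most 1/2, and a point within 1/4 of it still has inverse coordinate at most
  2.\<close>

lemma charts_cover_pair:
  assumes "cdist p q < 1/4"
  shows "(\<exists>z w. p = Some z \<and> q = Some w \<and> N z \<le> 2 \<and> N w \<le> 2)
    \<or> (\<exists>z w. inv_pt p = Some z \<and> inv_pt q = Some w \<and> N z \<le> 2 \<and> N w \<le> 2)"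
proof -
  have far: "\<exists>z w. inv_pt p = Some z \<and> inv_pt q = Some w \<and> N z \<le> 2 \<and> N w \<le> 2"
    if no: "\<nexists>z. p = Some z \<and> N z \<le> 2" and d: "cdist p q < 1/4" for p q
  proof -
    obtain u where u: "inv_pt p = Some u" "N u \<le> 1/2"
    proof (cases p)
      case None
      then show ?thesis using that[of 0] by (simp add: inv_pt_def)
    next
      case (Some z)
      then have z: "2 < N z" using no by auto
      then have "z \<noteq> 0" by auto
      have half: "1 / x \<le> 1/2" if "2 < x" for x :: real using that by (simp add: divide_simps)
      have "N (1 / z) \<le> 1/2" using half[OF z] unfolding N_divide N_1 .
      with \<open>z \<noteq> 0\<close> show ?thesis using that[of "1 / z"] Some by (simp add: inv_pt_def)
    qed
    have d': "cdist (Some u) (inv_pt q) < 1/4" using d u cdist_inv_pt[of p q] by simp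
    then obtain w where w: "inv_pt q = Some w"
      using u(2) by (cases "inv_pt q") (auto simp: cdist_Some_None max_def)
    have "N w \<le> 2"
    proof (rule ccontr)
      assume "\<not> N w \<le> 2"
      then have w2: "2 < N w" by simp
      have "cdist (Some u) (Some w) = N (u - w) / N w" using u(2) w2 by (simp add: cdist_Some max_def)
      then have "N (u - w) / N w < 1/4" using d' w by simp
      then have "N (u - w) < 1/4 * N w" using w2 by (subst (asm) pos_divide_less_eq) auto
      moreover have "N w - N u \<le> N (u - w)" using N_diff_ge[of w u] by (simp add: N_diff_commute)
      ultimately show False using u(2) w2 by linarith
    qed
    then show ?thesis using u w by auto
  qed
  show ?thesis
  proof (cases "(\<exists>z. p = Some z \<and> N z \<le> 2) \<and> (\<exists>z. q = Some z \<and> N z \<le> 2)")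
    case True
    then show ?thesis by blast
  next
    case False
    then consider "\<nexists>z. p = Some z \<and> N z \<le> 2" | "\<nexists>z. q = Some z \<and> N z \<le> 2" by blast
    then show ?thesis
    proof cases
      case 1
      from far[OF 1 assms] show ?thesis by blast
    next
      case 2
      have "cdist q p < 1/4" using assms by (simp add: cdist_sym)
      from far[OF 2 this] show ?thesis by blast
    qed
  qed
qed

lemma N_diff_le_cdist: "N z \<le> 2 \<Longrightarrow> N w \<le> 2 \<Longrightarrow> N (z - w) \<le> 4 * cdist (Some z) (Some w)"
proof -
  assume "N z \<le> 2" "N w \<le> 2"
  then have "max (N z) 1 * max (N w) 1 \<le> 2 * 2" by (intro mult_mono) auto
  then have "N (z - w) / 4 \<le> N (z - w) / (max (N z) 1 * max (N w) 1)"
    by (intro divide_left_mono) auto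
  then show ?thesis by (simp add: cdist_Some mult.commute)
qed

end

section \<open>Compactness of the disc of radius 2 and uniform continuity across fibres\<close>

definition hyb_disk :: "(complex fls poly \<Rightarrow> real) set" where
  "hyb_disk = {x \<in> hyb_chart. x [:0, 1:] \<le> 2}"

text \<open>Horner's scheme: on the disc each further coefficient \<open>a\<close> replaces the
  bound \<open>b\<close> by \<open>hyb_norm a + 2 * b\<close>.\<close>

lemma hyb_disk_bound: "\<exists>b\<ge>0. \<forall>x\<in>hyb_disk. x P \<in> {0..b}"
proof (cases "P \<in> hybAZ")
  case True
  then show ?thesis
  proof (induction P)
    case 0
    then show ?case by (intro exI[of _ 0]) (auto simp: hyb_disk_def hyb_chart_def mult_seminorm_on_def)
  next
    case (pCons a P)
    have "0 \<in> hybAZ" by (simp add: hybAZ_def hybA_zero)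
    then have aP: "a \<in> hybA" "P \<in> hybAZ" "[:a:] \<in> hybAZ" using pCons.prems by (simp_all add: hybAZ_pCons)
    then obtain b where b: "0 \<le> b" "\<And>x. x \<in> hyb_disk \<Longrightarrow> x P \<in> {0..b}" using pCons.IH by blast
    have eq: "pCons a P = [:a:] + [:0, 1:] * P" by simp
    show ?case
    proof (intro exI[of _ "hyb_norm a + 2 * b"] conjI ballI)
      show "0 \<le> hyb_norm a + 2 * b" using b(1) hyb_norm_nonneg[of a] by simp
      fix x assume x: "x \<in> hyb_disk"
      then have xc: "mult_seminorm_on hybAZ x" "x [:a:] \<le> hyb_norm a" "x [:0, 1:] \<le> 2"
        using aP hyb_chartD by (auto simp: hyb_disk_def)
      have m: "[:0, 1:] * P \<in> hybAZ" using coeff_subring_hybAZ aP(2) unfolding coeff_subring_def by blast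
      have "x (pCons a P) \<le> x [:a:] + x ([:0, 1:] * P)"
        unfolding eq using xc(1) aP(3) m unfolding mult_seminorm_on_def by blast
      also have "x ([:0, 1:] * P) = x [:0, 1:] * x P"
        using xc(1) aP(2) Z_in_hybAZ unfolding mult_seminorm_on_def by blast
      also have "\<dots> \<le> 2 * b" using b(2)[OF x] xc(3) b(1) by (intro mult_mono) auto
      finally have "x (pCons a P) \<le> hyb_norm a + 2 * b" using xc(2) by linarith
      moreover have "0 \<le> x (pCons a P)" using xc(1) pCons.prems unfolding mult_seminorm_on_def by blast
      ultimately show "x (pCons a P) \<in> {0..hyb_norm a + 2 * b}" by simp
    qed
  qed
next
  case False
  then show ?thesis by (intro exI[of _ 0]) (auto simp: hyb_disk_def hyb_chart_def)
qed

text \<open>Tychonoff's theorem: all defining conditions are closed under pointwise convergence, and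
  the values lie in a product of bounded intervals.\<close>

lemma compact_hyb_disk: "compactin (chart_top hyb_chart) hyb_disk"
proof -
  obtain b where b: "\<And>P x. x \<in> hyb_disk \<Longrightarrow> x P \<in> {0..b P}" using hyb_disk_bound by metis
  have c: "continuous_on UNIV (\<lambda>x :: complex fls poly \<Rightarrow> real. x P)" for P by (rule continuous_on_product_coordinates)
  have "hyb_disk = {x. x 0 = 0} \<inter> {x. x 1 = 1} \<inter> (\<Inter>p\<in>hybAZ. {x. 0 \<le> x p}) \<inter>
     (\<Inter>p\<in>hybAZ. \<Inter>q\<in>hybAZ. {x. x (p * q) = x p * x q} \<inter> {x. x (p + q) \<le> x p + x q}) \<inter>
     (\<Inter>p\<in>-hybAZ. {x. x p = 0}) \<inter> (\<Inter>a\<in>hybA. {x. x [:a:] \<le> hyb_norm a}) \<inter> {x. x [:0, 1:] \<le> 2}"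
    unfolding hyb_disk_def hyb_chart_def mult_seminorm_on_def by auto
  also have "closed \<dots>"
    by (intro closed_Int closed_INT ballI closed_Collect_eq closed_Collect_le continuous_intros c)
  finally have cl: "closed hyb_disk" .
  have "compactin (powertop_real UNIV) (PiE UNIV (\<lambda>P. {0..b P}))"
    by (subst compactin_PiE) auto
  then have "compact (PiE UNIV (\<lambda>P. {0..b P}))" by (simp add: euclidean_product_topology)
  then have "compact (PiE UNIV (\<lambda>P. {0..b P}) \<inter> hyb_disk)" using cl by (rule compact_Int_closed)
  moreover have "PiE UNIV (\<lambda>P. {0..b P}) \<inter> hyb_disk = hyb_disk" using b by (auto simp: PiE_def Pi_def extensional_def)
  ultimately have "compact hyb_disk" by simp
  then show ?thesis
    by (simp add: chart_top_def compactin_subtopology euclidean_product_topology hyb_disk_def)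
qed

text \<open>A Lebesgue number argument without a metric: closeness is measured by finitely many
  polynomials and one tolerance.\<close>

lemma hyb_disk_uniformly_continuous:
  assumes F: "continuous_map (chart_top hyb_chart) euclideanreal F" and "0 < \<epsilon>"
  obtains FP \<delta> where "finite FP" "0 < \<delta>"
    "\<And>x y. x \<in> hyb_disk \<Longrightarrow> y \<in> hyb_disk \<Longrightarrow> (\<And>P. P \<in> FP \<Longrightarrow> \<bar>x P - y P\<bar> < \<delta>) \<Longrightarrow> \<bar>F x - F y\<bar> < \<epsilon>"
proof -
  let ?C = "hyb_chart"
  have "\<exists>FP \<delta>. finite FP \<and> 0 < \<delta> \<and> (\<forall>y\<in>?C. (\<forall>P\<in>FP. \<bar>y P - x P\<bar> < \<delta>) \<longrightarrow> \<bar>F y - F x\<bar> < \<epsilon> / 2)" if "x \<in> ?C" for x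
  proof -
    have "openin (chart_top ?C) {y \<in> topspace (chart_top ?C). F y \<in> ball (F x) (\<epsilon> / 2)}"
      by (rule openin_continuous_map_preimage[OF F]) simp
    then obtain FP \<delta> where *: "finite FP" "0 < \<delta>"
        "\<And>y. y \<in> ?C \<Longrightarrow> (\<forall>P\<in>FP. \<bar>y P - x P\<bar> < \<delta>) \<Longrightarrow> y \<in> {y \<in> topspace (chart_top ?C). F y \<in> ball (F x) (\<epsilon> / 2)}"
      using openin_chart_top_nbhd[of ?C _ x] \<open>x \<in> ?C\<close> \<open>0 < \<epsilon>\<close> by (metis (no_types, lifting) centre_in_ball half_gt_zero mem_Collect_eq topspace_chart_top)
    have "\<bar>F y - F x\<bar> < \<epsilon> / 2" if "y \<in> ?C" "\<forall>P\<in>FP. \<bar>y P - x P\<bar> < \<delta>" for y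
      using *(3)[OF that] by (simp add: dist_real_def abs_minus_commute)
    then show ?thesis using *(1,2) by blast
  qed
  then obtain FP \<delta> where FP: "\<And>x. x \<in> ?C \<Longrightarrow> finite (FP x)" "\<And>x. x \<in> ?C \<Longrightarrow> (0::real) < \<delta> x"
     "\<And>x y. x \<in> ?C \<Longrightarrow> y \<in> ?C \<Longrightarrow> (\<forall>P\<in>FP x. \<bar>y P - x P\<bar> < \<delta> x) \<Longrightarrow> \<bar>F y - F x\<bar> < \<epsilon> / 2"
    by metis
  \<comment> \<open>Half the tolerance, so that a point close to a member of \<open>V x\<close> is
    still within the full tolerance of \<open>x\<close>.\<close>
  define V where "V x = {y \<in> ?C. \<forall>P\<in>FP x. \<bar>y P - x P\<bar> < \<delta> x / 2}" for x
  have V: "openin (chart_top ?C) (V x)" if x: "x \<in> ?C" for x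
  proof -
    have "V x = topspace (chart_top ?C) \<inter> (\<Inter>P\<in>FP x. {y \<in> topspace (chart_top ?C). y P \<in> ball (x P) (\<delta> x / 2)})"
      by (auto simp: V_def dist_real_def abs_minus_commute)
    also have "openin (chart_top ?C) \<dots>"
    proof (subst Int_commute, rule openin_INT[OF FP(1)[OF x]])
      fix P
      show "openin (chart_top ?C) {y \<in> topspace (chart_top ?C). y P \<in> ball (x P) (\<delta> x / 2)}"
        by (rule openin_continuous_map_preimage[OF continuous_map_chart_coord]) simp
    qed
    finally show ?thesis .
  qed
  have sub: "hyb_disk \<subseteq> ?C" by (auto simp: hyb_disk_def)
  have "hyb_disk \<subseteq> \<Union>(V ` hyb_disk)"
  proof
    fix x assume x: "x \<in> hyb_disk"
    then have "x \<in> V x" using FP(2)[of x] sub by (auto simp: V_def)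
    then show "x \<in> \<Union>(V ` hyb_disk)" using x by blast
  qed
  moreover have "\<And>U. U \<in> V ` hyb_disk \<Longrightarrow> openin (chart_top ?C) U" using V sub by blast
  ultimately obtain \<F> where "finite \<F>" "\<F> \<subseteq> V ` hyb_disk" "hyb_disk \<subseteq> \<Union>\<F>"
    using compactinD[OF compact_hyb_disk, of "V ` hyb_disk"] by blast
  then obtain X where X: "finite X" "X \<subseteq> hyb_disk" "hyb_disk \<subseteq> \<Union>(V ` X)"
    by (metis finite_subset_image)
  define d where "d = Min (insert 1 ((\<lambda>x. \<delta> x / 2) ` X))"
  have d: "0 < d" using X(1,2) FP(2) sub by (auto simp: d_def subset_iff)
  have d2: "d \<le> \<delta> x / 2" if "x \<in> X" for x unfolding d_def by (rule Min_le) (use X(1) that in auto)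
  show ?thesis
  proof (rule that[of "\<Union>(FP ` X)" d])
    show "finite (\<Union>(FP ` X))" using X(1,2) FP(1) sub by blast
    show "0 < d" by (rule d)
    fix x y assume xy: "x \<in> hyb_disk" "y \<in> hyb_disk" and close: "\<And>P. P \<in> \<Union>(FP ` X) \<Longrightarrow> \<bar>x P - y P\<bar> < d"
    obtain z where z: "z \<in> X" "x \<in> V z" using X(3) xy(1) by blast
    have zC: "z \<in> ?C" using z(1) X(2) sub by blast
    have "\<bar>x P - z P\<bar> < \<delta> z" "\<bar>y P - z P\<bar> < \<delta> z" if P: "P \<in> FP z" for P
    proof -
      have "\<bar>x P - z P\<bar> < \<delta> z / 2" using z(2) P by (simp add: V_def)
      moreover have "\<bar>x P - y P\<bar> < \<delta> z / 2" using close[of P] P z(1) d2[OF z(1)] by fastforce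
      ultimately show "\<bar>x P - z P\<bar> < \<delta> z" "\<bar>y P - z P\<bar> < \<delta> z" using FP(2)[OF zC] by linarith+
    qed
    then have "\<bar>F x - F z\<bar> < \<epsilon> / 2" "\<bar>F y - F z\<bar> < \<epsilon> / 2" using FP(3)[OF zC] xy sub by blast+
    then show "\<bar>F x - F y\<bar> < \<epsilon>" by linarith
  qed
qed

lemma hyb_disk_bounded:
  assumes F: "continuous_map (chart_top hyb_chart) euclideanreal F"
  obtains C where "\<And>x. x \<in> hyb_disk \<Longrightarrow> \<bar>F x\<bar> \<le> C"
proof -
  have "compact (F ` hyb_disk)" using image_compactin[OF compact_hyb_disk F] by simp
  then have "bounded (F ` hyb_disk)" by (rule compact_imp_bounded)
  then show ?thesis using that by (auto simp: bounded_iff)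
qed

text \<open>The constants arise from \<open>hyb_norm\<close> of the coefficients and from the radius
  2 alone, hence serve all fibres. The bound \<open>b\<close> on the values is carried along because
  the product rule needs it.\<close>

lemma hyb_pt_Lipschitz:
  assumes "P \<in> hybAZ"
  shows "\<exists>L\<ge>0. \<exists>b\<ge>0. \<forall>(N :: 'k::field \<Rightarrow> real) evl z w. hyb_eval N evl \<longrightarrow> N z \<le> 2 \<longrightarrow> N w \<le> 2 \<longrightarrow>
     N (poly (map_poly evl P) z) \<le> b \<and> N (poly (map_poly evl P) z - poly (map_poly evl P) w) \<le> L * N (z - w)"
  using assms
proof (induction P)
  case 0
  have "N 0 \<le> 0" if "hyb_eval N evl" for N :: "'k \<Rightarrow> real" and evl
    using that by (simp add: hyb_eval_def absval.N_0)
  then show ?case by (intro exI[of _ "0::real"] conjI allI impI) simp_all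
next
  case (pCons a P)
  then have aP: "a \<in> hybA" "P \<in> hybAZ" by (auto simp: hybAZ_pCons)
  obtain L b where L: "0 \<le> L" "0 \<le> b" "\<And>(N :: 'k \<Rightarrow> real) evl z w. hyb_eval N evl \<Longrightarrow> N z \<le> 2 \<Longrightarrow> N w \<le> 2 \<Longrightarrow>
     N (poly (map_poly evl P) z) \<le> b \<and> N (poly (map_poly evl P) z - poly (map_poly evl P) w) \<le> L * N (z - w)"
    using pCons.IH[OF aP(2)] by blast
  show ?case
  proof (rule exI[of _ "b + 2 * L"], rule conjI, goal_cases)
    case 1
    show ?case using L(1,2) by simp
  next
    case 2
    show ?case
    proof (rule exI[of _ "hyb_norm a + 2 * b"], intro conjI allI impI)
    show "0 \<le> hyb_norm a + 2 * b" using L(1,2) hyb_norm_nonneg[of a] by auto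
    fix N :: "'k \<Rightarrow> real" and evl z w assume h: "hyb_eval N evl" and z: "N z \<le> 2" and w: "N w \<le> 2"
    interpret hyb_eval N evl by (rule h)
    let ?P = "poly (map_poly evl P)"
    note I = L(3)[OF h z w]
    have "N (evl a + z * ?P z) \<le> N (evl a) + N z * N (?P z)" using N_add[of "evl a" "z * ?P z"] by (simp add: N_mult)
    also have "\<dots> \<le> hyb_norm a + 2 * b" using I z L(2) aP(1) by (intro add_mono mult_mono ev_le) auto
    finally show "N (poly (map_poly evl (pCons a P)) z) \<le> hyb_norm a + 2 * b" by (simp add: map_ev_pCons)
    have "N ((z - w) * ?P z + w * (?P z - ?P w)) \<le> N (z - w) * N (?P z) + N w * N (?P z - ?P w)"
      using N_add[of "(z - w) * ?P z" "w * (?P z - ?P w)"] by (simp add: N_mult)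
    also have "\<dots> \<le> N (z - w) * b + 2 * (L * N (z - w))" using I w L by (intro add_mono mult_mono) auto
    finally show "N (poly (map_poly evl (pCons a P)) z - poly (map_poly evl (pCons a P)) w) \<le> (b + 2 * L) * N (z - w)"
      by (simp add: map_ev_pCons algebra_simps)
    qed
  qed
qed

lemma hyb_pt_disk: "hyb_eval N evl \<Longrightarrow> N z \<le> 2 \<Longrightarrow> hyb_pt N evl z \<in> hyb_disk"
  by (simp add: hyb_disk_def hyb_eval.hyb_pt_in hyb_eval.hyb_pt_Z)

lemma hyb_pt_uniformly_continuous:
  assumes F: "continuous_map (chart_top hyb_chart) euclideanreal F" and "0 < \<epsilon>"
  shows "\<exists>\<delta>>0. \<forall>(N :: 'k::field \<Rightarrow> real) evl z w. hyb_eval N evl \<longrightarrow> N z \<le> 2 \<longrightarrow> N w \<le> 2 \<longrightarrow> N (z - w) \<le> \<delta> \<longrightarrow>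
     \<bar>F (hyb_pt N evl z) - F (hyb_pt N evl w)\<bar> < \<epsilon>"
proof -
  obtain FP \<delta> where FP: "finite FP" "0 < \<delta>"
    "\<And>x y. x \<in> hyb_disk \<Longrightarrow> y \<in> hyb_disk \<Longrightarrow> (\<And>P. P \<in> FP \<Longrightarrow> \<bar>x P - y P\<bar> < \<delta>) \<Longrightarrow> \<bar>F x - F y\<bar> < \<epsilon>"
    using hyb_disk_uniformly_continuous[OF assms] by blast
  have "\<exists>L\<ge>0. \<forall>(N :: 'k \<Rightarrow> real) evl z w. hyb_eval N evl \<longrightarrow> N z \<le> 2 \<longrightarrow> N w \<le> 2 \<longrightarrow>
     \<bar>hyb_pt N evl z P - hyb_pt N evl w P\<bar> \<le> L * N (z - w)" for P
  proof (cases "P \<in> hybAZ")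
    case True
    then obtain L b where L: "0 \<le> L" "\<And>(N :: 'k \<Rightarrow> real) evl z w. hyb_eval N evl \<Longrightarrow> N z \<le> 2 \<Longrightarrow> N w \<le> 2 \<Longrightarrow>
     N (poly (map_poly evl P) z) \<le> b \<and> N (poly (map_poly evl P) z - poly (map_poly evl P) w) \<le> L * N (z - w)"
      using hyb_pt_Lipschitz[OF True, where 'k='k] by blast
    show ?thesis
    proof (intro exI[of _ L] conjI allI impI L(1))
      fix N :: "'k \<Rightarrow> real" and evl z w assume h: "hyb_eval N evl" and z: "N z \<le> 2" and w: "N w \<le> 2"
      interpret hyb_eval N evl by (rule h)
      let ?P = "poly (map_poly evl P)"
      have "N (?P z) - N (?P w) \<le> N (?P z - ?P w)" by (rule N_diff_ge)
      moreover have "N (?P w) - N (?P z) \<le> N (?P z - ?P w)" using N_diff_ge[of "?P w" "?P z"] N_diff_commute by simp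
      ultimately show "\<bar>hyb_pt N evl z P - hyb_pt N evl w P\<bar> \<le> L * N (z - w)"
        using L(2)[OF h z w] True unfolding hyb_pt_def by (simp add: abs_le_iff)
    qed
  next
    case False
    then show ?thesis by (intro exI[of _ 0]) (auto simp: hyb_pt_def)
  qed
  then obtain L where L: "\<And>P. 0 \<le> L P" "\<And>P (N :: 'k \<Rightarrow> real) evl z w. hyb_eval N evl \<Longrightarrow> N z \<le> 2 \<Longrightarrow> N w \<le> 2 \<Longrightarrow>
     \<bar>hyb_pt N evl z P - hyb_pt N evl w P\<bar> \<le> L P * N (z - w)"
    by metis
  define d where "d = \<delta> / (2 * (1 + (\<Sum>P\<in>FP. L P)))"
  have s: "0 \<le> (\<Sum>P\<in>FP. L P)" by (intro sum_nonneg L)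
  have d: "0 < d" using FP(2) s by (simp add: d_def)
  show ?thesis
  proof (intro exI[of _ d] conjI allI impI d)
    fix N :: "'k \<Rightarrow> real" and evl z w
    assume h: "hyb_eval N evl" and z: "N z \<le> 2" and w: "N w \<le> 2" and zw: "N (z - w) \<le> d"
    interpret hyb_eval N evl by (rule h)
    show "\<bar>F (hyb_pt N evl z) - F (hyb_pt N evl w)\<bar> < \<epsilon>"
    proof (rule FP(3))
      fix P assume P: "P \<in> FP"
      have "L P \<le> (\<Sum>P\<in>FP. L P)" by (rule member_le_sum[OF P L(1) FP(1)])
      then have "L P * N (z - w) \<le> (\<Sum>P\<in>FP. L P) * d" using zw L(1) s by (intro mult_mono) auto
      also have "\<dots> \<le> (1 + (\<Sum>P\<in>FP. L P)) * d" using d by simp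
      also have "\<dots> = \<delta> / 2" using s by (simp add: d_def field_simps)
      also have "\<dots> < \<delta>" using FP(2) by simp
      finally show "\<bar>hyb_pt N evl z P - hyb_pt N evl w P\<bar> < \<delta>" using L(2)[OF h z w, of P] by linarith
    qed (auto intro: hyb_pt_disk h z w)
  qed
qed

lemma topspace_P1hyb: "topspace P1hyb_top = glue_pts hyb_chart"
  unfolding P1hyb_top_def by (rule topspace_glue_top[OF gluable_hyb])

lemma hyb_chart_maps_continuous:
  assumes f: "continuous_map P1hyb_top euclideanreal f"
  shows "continuous_map (chart_top hyb_chart) euclideanreal (\<lambda>x. f (x, True))"
    "continuous_map (chart_top hyb_chart) euclideanreal (\<lambda>y. f (glue_chart2 y))"
  using continuous_map_compose[OF continuous_map_chart1[OF gluable_hyb] f[unfolded P1hyb_top_def]]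
    continuous_map_compose[OF continuous_map_chart2[OF gluable_hyb] f[unfolded P1hyb_top_def]]
  by (simp_all add: o_def)

lemma (in hyb_eval) hyb_Psi_inv: "inv_pt p = Some u \<Longrightarrow> hyb_Psi N evl p = glue_chart2 (hyb_pt N evl u)"
  using glue_chart2_hyb_pt[of u] inv_pt_inv_pt[of p] by simp

text \<open>One modulus for all fibres over a given field: \<delta> can be fixed before t.\<close>

lemma hyb_Psi_uniformly_continuous:
  assumes f: "continuous_map P1hyb_top euclideanreal f" and "0 < \<epsilon>"
  shows "\<exists>\<delta>>0. \<forall>(N :: 'k::field \<Rightarrow> real) evl p q. hyb_eval N evl \<longrightarrow> absval.cdist N p q \<le> \<delta> \<longrightarrow>
     \<bar>f (hyb_Psi N evl p) - f (hyb_Psi N evl q)\<bar> \<le> \<epsilon>"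
proof -
  note c = hyb_chart_maps_continuous[OF f]
  obtain d1 where d1: "0 < d1" "\<And>(N :: 'k \<Rightarrow> real) evl z w. hyb_eval N evl \<Longrightarrow> N z \<le> 2 \<Longrightarrow> N w \<le> 2 \<Longrightarrow> N (z - w) \<le> d1 \<Longrightarrow>
     \<bar>f (hyb_pt N evl z, True) - f (hyb_pt N evl w, True)\<bar> < \<epsilon>"
    using hyb_pt_uniformly_continuous[OF c(1) \<open>0 < \<epsilon>\<close>, where 'k='k] by blast
  obtain d2 where d2: "0 < d2" "\<And>(N :: 'k \<Rightarrow> real) evl z w. hyb_eval N evl \<Longrightarrow> N z \<le> 2 \<Longrightarrow> N w \<le> 2 \<Longrightarrow> N (z - w) \<le> d2 \<Longrightarrow>
     \<bar>f (glue_chart2 (hyb_pt N evl z)) - f (glue_chart2 (hyb_pt N evl w))\<bar> < \<epsilon>"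
    using hyb_pt_uniformly_continuous[OF c(2) \<open>0 < \<epsilon>\<close>, where 'k='k] by blast
  \<comment> \<open>1/8 is below the 1/4 that puts both points into one chart; the factor 4 compares
    \<open>N (z - w)\<close> with the chordal distance on the disc.\<close>
  define d where "d = min (1/8) (min d1 d2 / 4)"
  have d: "0 < d" "d < 1/4" "4 * d \<le> d1" "4 * d \<le> d2" using d1(1) d2(1) by (auto simp: d_def)
  show ?thesis
  proof (intro exI[of _ d] conjI allI impI d(1))
    fix N :: "'k \<Rightarrow> real" and evl p q
    assume h: "hyb_eval N evl" and pq: "absval.cdist N p q \<le> d"
    interpret hyb_eval N evl by (rule h)
    have "cdist p q < 1/4" using pq d(2) by linarith
    from charts_cover_pair[OF this] show "\<bar>f (hyb_Psi N evl p) - f (hyb_Psi N evl q)\<bar> \<le> \<epsilon>"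
    proof (elim disjE exE conjE)
      fix z w assume s: "p = Some z" "q = Some w" "N z \<le> 2" "N w \<le> 2"
      have "N (z - w) \<le> d1" using N_diff_le_cdist[OF s(3,4)] pq d(3) s(1,2) by simp
      from d1(2)[OF h s(3,4) this] show ?thesis using s by (simp add: hyb_Psi_def)
    next
      fix z w assume s: "inv_pt p = Some z" "inv_pt q = Some w" "N z \<le> 2" "N w \<le> 2"
      have "N (z - w) \<le> d2" using N_diff_le_cdist[OF s(3,4)] pq d(4) s(1,2) cdist_inv_pt[of p q] by simp
      from d2(2)[OF h s(3,4) this] show ?thesis
        using hyb_Psi_inv[OF s(1)] hyb_Psi_inv[OF s(2)] by simp
    qed
  qed
qed

lemma hyb_Psi_bounded:
  assumes f: "continuous_map P1hyb_top euclideanreal f"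
  shows "\<exists>C\<ge>0. \<forall>(N :: 'k::field \<Rightarrow> real) evl p. hyb_eval N evl \<longrightarrow> \<bar>f (hyb_Psi N evl p)\<bar> \<le> C"
proof -
  note c = hyb_chart_maps_continuous[OF f]
  obtain C1 where C1: "\<And>x. x \<in> hyb_disk \<Longrightarrow> \<bar>f (x, True)\<bar> \<le> C1" using hyb_disk_bounded[OF c(1)] by blast
  obtain C2 where C2: "\<And>x. x \<in> hyb_disk \<Longrightarrow> \<bar>f (glue_chart2 x)\<bar> \<le> C2" using hyb_disk_bounded[OF c(2)] by blast
  define C where "C = max 0 (max C1 C2)"
  have "\<bar>f (hyb_Psi N evl p)\<bar> \<le> C" if h: "hyb_eval N evl" for N :: "'k \<Rightarrow> real" and evl p
  proof -
    interpret hyb_eval N evl by (rule h)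
    from charts_cover[of p] show ?thesis
    proof (elim disjE exE conjE)
      fix z assume "p = Some z" "N z \<le> 2"
      then show ?thesis using C1[OF hyb_pt_disk[OF h]] by (simp add: hyb_Psi_def C_def le_max_iff_disj)
    next
      fix u assume "inv_pt p = Some u" "N u \<le> 2"
      then show ?thesis using C2[OF hyb_pt_disk[OF h]] hyb_Psi_inv[of p u] by (simp add: C_def le_max_iff_disj)
    qed
  qed
  moreover have "0 \<le> C" by (simp add: C_def)
  ultimately show ?thesis by blast
qed

section \<open>The complex fibres and the central fibre in the hybrid space\<close>

lemma hyb_eval_complex:
  assumes t: "t \<noteq> 0" "cmod t < exp (-1)"
  shows "hyb_eval (\<lambda>z. cmod z powr hyb_eps t) (\<lambda>a. fls_eval a t)"
proof -
  interpret absval "\<lambda>z::complex. cmod z powr hyb_eps t" by (rule absval_cmod_powr[OF hyb_eps_bounds(1,2)[OF t]])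
  show ?thesis
    by unfold_locales (simp_all add: fls_eval_0_1 fls_eval_ring[OF t] fls_eval_bound t)
qed

lemma hyb_eval_na: "hyb_eval na_abs (\<lambda>a. a)"
  by (intro hyb_eval.intro absval_na_abs hyb_eval_axioms.intro) (auto simp: na_abs_le_hyb_norm)

lemma psi_eq: "psi t = hyb_Psi (\<lambda>z. cmod z powr hyb_eps t) (\<lambda>a. fls_eval a t)"
proof (rule ext)
  fix p
  have "poly (map_poly (\<lambda>a. fls_eval a t) P) 0 = fls_eval (coeff P 0) t" for P
    by (simp add: poly_0_coeff_0 coeff_map_poly fls_eval_0_1)
  then show "psi t p = hyb_Psi (\<lambda>z. cmod z powr hyb_eps t) (\<lambda>a. fls_eval a t) p"
    by (auto simp: psi_def hyb_Psi_def hyb_pt_def fun_eq_iff split: option.split)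
qed

lemma psi_na_\<iota>: "psi_na (berk_\<iota> p) = hyb_Psi na_abs (\<lambda>a. a) p"
  by (auto simp: psi_na_def berk_\<iota>_def hyb_Psi_def hyb_pt_def fun_eq_iff berk_infty_eq eval_pt_def map_poly_id' split: option.split)

lemma (in hyb_eval) hyb_Psi_in: "hyb_Psi N evl p \<in> glue_pts hyb_chart"
  by (auto simp: hyb_Psi_def glue_pts_def hyb_pt_in hyb_pt_Z split: option.split)

text \<open>Infinity is split off as a single point, and the map into the first chart is
  continuous.\<close>

lemma psi_measurable:
  assumes t: "t \<noteq> 0" "cmod t < exp (-1)"
  shows "psi t \<in> measurable (borel_of P1C_top) (borel_of P1hyb_top)"
proof (rule measurable_borel_ofI)
  interpret hyb_eval "\<lambda>z. cmod z powr hyb_eps t" "\<lambda>a. fls_eval a t" by (rule hyb_eval_complex[OF t])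
  let ?pt = "hyb_pt (\<lambda>z. cmod z powr hyb_eps t) (\<lambda>a. fls_eval a t)"
  show "psi t p \<in> topspace P1hyb_top" for p by (simp add: psi_eq topspace_P1hyb hyb_Psi_in)
  fix U assume U: "openin P1hyb_top U"
  have "continuous_map euclidean euclideanreal (\<lambda>z. ?pt z P)" for P
  proof -
    have "continuous_on UNIV (\<lambda>z. ?pt z P)"
      using hyb_eps_bounds(1)[OF t] by (cases "P \<in> hybAZ") (auto simp: hyb_pt_def intro!: continuous_intros continuous_on_powr')
    then show ?thesis by simp
  qed
  then have "continuous_map euclidean (chart_top hyb_chart) ?pt"
    by (rule continuous_map_into_chart) (rule hyb_pt_in)
  from continuous_map_compose[OF this continuous_map_chart1[OF gluable_hyb]]
  have "openin euclidean {z \<in> topspace euclidean. ((\<lambda>x. (x, True)) \<circ> ?pt) z \<in> U}"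
    using U unfolding P1hyb_top_def by (rule openin_continuous_map_preimage)
  then have o: "open {z. (?pt z, True) \<in> U}" by simp
  have O: "openin P1C_top (Some ` V)" if "open V" for V :: "complex set"
    using that by (simp add: openin_P1C_top image_iff)
  have "psi t -` U = Some ` {z. (?pt z, True) \<in> U} \<union> (if psi t None \<in> U then UNIV - Some ` UNIV else {})"
  proof (rule Set.set_eqI)
    fix p show "p \<in> psi t -` U \<longleftrightarrow> p \<in> Some ` {z. (?pt z, True) \<in> U} \<union> (if psi t None \<in> U then UNIV - Some ` UNIV else {})"
      by (cases p) (auto simp: psi_eq hyb_Psi_def image_iff)
  qed
  also have "\<dots> \<in> sets (borel_of P1C_top)"
    using borel_of_open[OF O[OF o]] borel_of_open[OF O[OF open_UNIV]] sets.top[of "borel_of P1C_top"]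
    by auto
  finally show "psi t -` U \<inter> space (borel_of P1C_top) \<in> sets (borel_of P1C_top)" by simp
qed

lemma psi_na_chart: "x \<in> berk_chart \<Longrightarrow> (\<lambda>P. if P \<in> hybAZ then x P else 0) \<in> hyb_chart"
proof -
  assume x: "x \<in> berk_chart"
  have S: "0 \<in> hybAZ" "1 \<in> hybAZ" "\<And>P Q. P \<in> hybAZ \<Longrightarrow> Q \<in> hybAZ \<Longrightarrow> P + Q \<in> hybAZ" "\<And>P Q. P \<in> hybAZ \<Longrightarrow> Q \<in> hybAZ \<Longrightarrow> P * Q \<in> hybAZ"
    using coeff_subring_hybAZ by (auto simp: coeff_subring_def)
  show ?thesis
    unfolding hyb_chart_def mult_seminorm_on_def
    using berk_chartD[OF x] S na_abs_le_hyb_norm hyb_norm_nonneg by auto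
qed

lemma psi_na_measurable: "psi_na \<in> measurable (borel_of P1berk_top) (borel_of P1hyb_top)"
proof (rule measurable_borel_ofI)
  let ?r = "\<lambda>x :: complex fls poly \<Rightarrow> real. (\<lambda>P. if P \<in> hybAZ then x P else 0)"
  show in_hyb: "psi_na p \<in> topspace P1hyb_top" if "p \<in> space (borel_of P1berk_top)" for p
  proof -
    have "p \<in> glue_pts berk_chart" using that by (simp add: topspace_P1berk)
    then show ?thesis
    proof (cases rule: glue_pts_berk_cases)
      case (1 x)
      then show ?thesis using psi_na_chart by (simp add: psi_na_def topspace_P1hyb glue_pts_def)
    next
      case 2
      have "psi_na berk_infty = hyb_Psi na_abs (\<lambda>a. a) None" using psi_na_\<iota>[of None] by (simp add: berk_\<iota>_def)
      then show ?thesis using 2 hyb_eval.hyb_Psi_in[OF hyb_eval_na] by (simp add: topspace_P1hyb)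
    qed
  qed
  fix U assume U: "openin P1hyb_top U"
  have "continuous_map (chart_top berk_chart) euclideanreal (\<lambda>x. ?r x P)" for P
    by (cases "P \<in> hybAZ") (auto simp: continuous_map_chart_coord)
  then have "continuous_map (chart_top berk_chart) (chart_top hyb_chart) ?r"
    by (rule continuous_map_into_chart) (simp add: psi_na_chart)
  from continuous_map_compose[OF this continuous_map_chart1[OF gluable_hyb]]
  have "openin (chart_top berk_chart) {x \<in> topspace (chart_top berk_chart). ((\<lambda>x. (x, True)) \<circ> ?r) x \<in> U}"
    using U unfolding P1hyb_top_def by (rule openin_continuous_map_preimage)
  then have o: "openin (chart_top berk_chart) {x \<in> berk_chart. (?r x, True) \<in> U}" by simp
  have O: "{(x, True) | x. x \<in> V} \<in> sets (borel_of P1berk_top)" if "openin (chart_top berk_chart) V" for V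
    unfolding P1berk_top_def by (rule borel_of_open[OF chart1_open[OF gluable_berk that]])
  have top: "openin (chart_top berk_chart) berk_chart" using openin_topspace[of "chart_top berk_chart"] by simp
  have "psi_na -` U \<inter> space (borel_of P1berk_top) = {(x, True) | x. x \<in> {x \<in> berk_chart. (?r x, True) \<in> U}}
      \<union> (if psi_na berk_infty \<in> U then space (borel_of P1berk_top) - {(x, True) | x. x \<in> berk_chart} else {})"
    (is "?L = ?R")
  proof (rule Set.set_eqI)
    fix p
    have inf: "berk_infty \<in> glue_pts berk_chart" using berk_\<iota>_in[of None] by (simp add: berk_\<iota>_def)
    show "p \<in> ?L \<longleftrightarrow> p \<in> ?R"
    proof (cases "p \<in> glue_pts berk_chart")
      case True
      then show ?thesis
      proof (cases rule: glue_pts_berk_cases)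
        case (1 x)
        then show ?thesis using True by (auto simp: psi_na_def topspace_P1berk cong: if_cong)
      next
        case 2
        then show ?thesis using inf by (auto simp: topspace_P1berk berk_infty_eq)
      qed
    next
      case False
      then show ?thesis by (auto simp: topspace_P1berk glue_pts_def)
    qed
  qed
  also have "\<dots> \<in> sets (borel_of P1berk_top)"
    using O[OF o] O[OF top] sets.top[of "borel_of P1berk_top"] by (auto simp del: space_borel_of)
  finally show "psi_na -` U \<inter> space (borel_of P1berk_top) \<in> sets (borel_of P1berk_top)" .
qed

section \<open>Degeneration of the absolute values\<close>

text \<open>The integral over the image of the stationary measure is an expectation at the limit
  point, to which \<open>expectation_\<xi>_approx\<close> applies.\<close>

lemma (in boundary_walk) distr_\<nu>_approx:
  fixes F :: "'z \<Rightarrow> real"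
  assumes \<psi>: "\<psi> \<in> measurable (borel_of T) (borel_of S)" and f: "continuous_map S euclideanreal F"
    and Fc: "\<And>\<epsilon>. 0 < \<epsilon> \<Longrightarrow> \<exists>\<delta>>0. \<forall>x z. d x z \<le> \<delta> \<longrightarrow> \<bar>F (\<psi> (\<iota> x)) - F (\<psi> (\<iota> z))\<bar> \<le> \<epsilon>"
    and C: "\<And>x. \<bar>F (\<psi> (\<iota> x))\<bar> \<le> C" and \<epsilon>pos: "0 \<le> \<epsilon>"
    and \<delta>: "\<And>x z. d x z \<le> \<delta> \<Longrightarrow> \<bar>F (\<psi> (\<iota> x)) - F (\<psi> (\<iota> z))\<bar> \<le> \<epsilon>"
    and small: "\<And>y. y \<in> topspace T \<Longrightarrow>
        measure_pmf.prob (replicate_pmf n m) {w. \<delta> < D (word_act act' w y) (word_act act w x0)} \<le> \<eta>"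
  shows "\<bar>(\<integral>x. F x \<partial>distr (stationary_measure T m act') (borel_of S) \<psi>)
     - measure_pmf.expectation (replicate_pmf n m) (\<lambda>w. F (\<psi> (\<iota> (word_act act w x0))))\<bar> \<le> \<epsilon> + 2 * C * \<eta>"
proof -
  have Fm: "F \<in> borel_measurable (borel_of S)"
    using continuous_map_measurable[OF f] unfolding measurable_cong_sets[OF refl borel_of_euclidean] .
  note \<psi>\<xi> = measurable_compose[OF \<iota>_\<xi>_measurable \<psi>]
  have "\<psi> \<in> measurable \<nu> (borel_of S)" using \<psi> by (simp add: \<nu>_def)
  then have "(\<integral>x. F x \<partial>distr (stationary_measure T m act') (borel_of S) \<psi>) = (\<integral>x. F (\<psi> x) \<partial>\<nu>)"
    unfolding stationary_measure_eq using Fm by (rule integral_distr)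
  also have "\<dots> = (\<integral>\<omega>. F (\<psi> (\<iota> (\<xi> \<omega>))) \<partial>\<Omega>)"
    unfolding \<nu>_def by (rule integral_distr[OF \<iota>_\<xi>_measurable measurable_compose[OF \<psi> Fm]])
  finally have eq: "(\<integral>x. F x \<partial>distr (stationary_measure T m act') (borel_of S) \<psi>) = (\<integral>\<omega>. F (\<psi> (\<iota> (\<xi> \<omega>))) \<partial>\<Omega>)" .
  show ?thesis
    unfolding eq
  proof (rule expectation_\<xi>_approx)
    show "(\<lambda>\<omega>. F (\<psi> (\<iota> (\<xi> \<omega>)))) \<in> borel_measurable \<Omega>" by (rule measurable_compose[OF \<psi>\<xi> Fm])
  qed (fact Fc C \<epsilon>pos \<delta> small)+
qed

lemma filterlim_ln_cmod: "filterlim (\<lambda>t. ln (cmod t)) at_infinity (at 0)"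
proof -
  have "filterlim cmod (at_right 0) (at 0)"
    unfolding filterlim_at by (auto simp: eventually_at_filter intro!: tendsto_norm_zero)
  from filterlim_compose[OF ln_at_0 this] have "filterlim (\<lambda>t. ln (cmod t)) at_bot (at 0)" .
  then show ?thesis by (rule filterlim_mono[OF _ at_bot_le_at_infinity order_refl])
qed

lemma eventually_small: "eventually (\<lambda>t::complex. t \<noteq> 0 \<and> cmod t < exp (-1)) (at 0)"
  unfolding eventually_at by (intro exI[of _ "exp (-1)"]) auto

text \<open>Write \<open>f\<close> as \<open>t^n\<close> times \<open>g\<close> with
  \<open>g\<close> nonzero at 0. The logarithm of the left side is \<open>- n\<close> minus
  \<open>ln (cmod (g t)) / ln (cmod t)\<close>, and the quotient tends to 0.\<close>

lemma has_laurent_expansion_na_abs: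
  assumes f: "f has_laurent_expansion F"
  shows "((\<lambda>t. cmod (f t) powr hyb_eps t) \<longlongrightarrow> na_abs F) (at 0)"
proof (cases "F = 0")
  case True
  then have "eventually (\<lambda>t. f t = 0) (at 0)"
    using f unfolding has_laurent_expansion_def by (auto elim: eventually_mono)
  then have "eventually (\<lambda>t. cmod (f t) powr hyb_eps t = 0) (at 0)" by eventually_elim simp
  then show ?thesis using True by (simp add: na_abs_def tendsto_eventually)
next
  case False
  define n where "n = fls_subdegree F"
  define g where "g t = f t * t powi (-n)" for t
  have "g has_laurent_expansion F * fls_X_intpow (-n)"
    unfolding g_def by (intro laurent_expansion_intros f)
  then have g: "g has_laurent_expansion fls_shift n F"
    unfolding fls_X_intpow_times_conv_shift(2) by simp
  have "(g \<longlongrightarrow> fls_nth (fls_shift n F) 0) (at 0)"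
    by (rule has_laurent_expansion_imp_tendsto_0[OF g]) (use False in \<open>simp add: n_def\<close>)
  moreover have c: "fls_nth (fls_shift n F) 0 \<noteq> 0" using False by (simp add: n_def)
  ultimately have "((\<lambda>t. ln (cmod (g t))) \<longlongrightarrow> ln (cmod (fls_nth (fls_shift n F) 0))) (at 0)"
    by (intro tendsto_intros) auto
  then have "((\<lambda>t. ln (cmod (g t)) / ln (cmod t)) \<longlongrightarrow> 0) (at 0)"
    by (rule tendsto_divide_0[OF _ filterlim_ln_cmod])
  then have "((\<lambda>t. exp (- real_of_int n - ln (cmod (g t)) / ln (cmod t))) \<longlongrightarrow> exp (- real_of_int n - 0)) (at 0)"
    by (intro tendsto_intros)
  moreover have "eventually (\<lambda>t. exp (- real_of_int n - ln (cmod (g t)) / ln (cmod t)) = cmod (f t) powr hyb_eps t) (at 0)"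
    using has_laurent_expansion_nonzero_imp_eventually_nonzero[OF f False] eventually_small
  proof eventually_elim
    case (elim t)
    then have t: "t \<noteq> 0" "f t \<noteq> 0" and t1: "cmod t < exp (-1)" by auto
    have "cmod t < 1" by (rule less_trans[OF t1]) simp
    then have l: "ln (cmod t) < 0" using t by simp
    have "cmod (g t) = cmod (f t) * cmod t powr (- real_of_int n)"
      using t powr_real_of_int'[of "cmod t" "- n"] by (simp add: g_def norm_mult norm_power_int)
    then have "ln (cmod (g t)) = ln (cmod (f t)) - real_of_int n * ln (cmod t)"
      using t by (simp add: ln_mult ln_powr)
    then have "- real_of_int n - ln (cmod (g t)) / ln (cmod t) = hyb_eps t * ln (cmod (f t))"
      using l by (simp add: hyb_eps_def diff_divide_distrib)
    then show ?case using t by (simp add: powr_def)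
  qed
  ultimately have "((\<lambda>t. cmod (f t) powr hyb_eps t) \<longlongrightarrow> exp (- real_of_int n - 0)) (at 0)"
    by (rule Lim_transform_eventually)
  then show ?thesis using False by (simp add: na_abs_def n_def)
qed

text \<open>Near 0 the limit gives the bound, elsewhere compactness of an annulus. The bound holds
  on one punctured disc for every \<open>f\<close>; a merely eventual one would leave no common
  range of t for infinitely many letters.\<close>

lemma hyb_eps_powr_bounded:
  assumes hol: "f holomorphic_on ball 0 1 - {0}" and f: "f has_laurent_expansion F"
  obtains B where "\<And>t. t \<noteq> 0 \<Longrightarrow> cmod t < exp (-1) \<Longrightarrow> cmod (f t) powr hyb_eps t \<le> B"
proof -
  have "eventually (\<lambda>t. cmod (f t) powr hyb_eps t < na_abs F + 1) (at 0)"
    by (rule order_tendstoD(2)[OF has_laurent_expansion_na_abs[OF f]]) simp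
  then obtain d where d: "0 < d" "\<And>t. t \<noteq> 0 \<Longrightarrow> cmod t < d \<Longrightarrow> cmod (f t) powr hyb_eps t < na_abs F + 1"
    unfolding eventually_at by auto
  have e1: "exp (-1) < (1::real)" by simp
  have "compact (cball 0 (exp (-1)) - ball (0::complex) d)" by (intro compact_diff) auto
  moreover have "continuous_on (cball 0 (exp (-1)) - ball (0::complex) d) f"
    by (rule continuous_on_subset[OF holomorphic_on_imp_continuous_on[OF hol]]) (use d(1) in \<open>auto intro: le_less_trans[OF _ e1]\<close>)
  ultimately have "bounded (f ` (cball 0 (exp (-1)) - ball 0 d))"
    by (intro compact_imp_bounded compact_continuous_image)
  then obtain C where C': "\<And>t. t \<in> cball 0 (exp (-1)) - ball 0 d \<Longrightarrow> cmod (f t) \<le> C"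
    unfolding bounded_iff by blast
  have C: "cmod (f t) \<le> C" if "cmod t \<le> exp (-1)" "d \<le> cmod t" for t
    by (rule C') (use that in auto)
  show ?thesis
  proof (rule that)
    fix t :: complex assume t: "t \<noteq> 0" "cmod t < exp (-1)"
    show "cmod (f t) powr hyb_eps t \<le> max (na_abs F + 1) (max C 1)"
    proof (cases "cmod t < d")
      case True
      then show ?thesis using d(2)[OF t(1)] by (simp add: le_max_iff_disj)
    next
      case False
      then have "cmod (f t) \<le> max C 1" using C[of t] t by (simp add: le_max_iff_disj)
      then have "cmod (f t) powr hyb_eps t \<le> max C 1 powr hyb_eps t"
        using hyb_eps_bounds(1)[OF t] by (intro powr_mono2) auto
      also have "\<dots> \<le> max C 1 powr 1" using hyb_eps_bounds(2)[OF t] by (intro powr_mono) auto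
      finally show ?thesis by (simp add: le_max_iff_disj)
    qed
  qed
qed

section \<open>Laurent expansions of words and convergence at a fixed time\<close>

definition mat_expansion :: "(complex \<Rightarrow> complex^2^2) \<Rightarrow> complex fls^2^2 \<Rightarrow> bool" where
  "mat_expansion M A \<longleftrightarrow> (\<forall>i j. (\<lambda>t. M t $ i $ j) has_laurent_expansion A $ i $ j)"

lemma mat_expansion_mult: "mat_expansion M A \<Longrightarrow> mat_expansion M' A' \<Longrightarrow> mat_expansion (\<lambda>t. M t ** M' t) (A ** A')"
  unfolding mat_expansion_def by (auto intro!: laurent_expansion_intros)

lemma mat_expansion_minus: "mat_expansion M A \<Longrightarrow> mat_expansion M' A' \<Longrightarrow> mat_expansion (\<lambda>t. M t - M' t) (A - A')"
  unfolding mat_expansion_def by (auto intro!: laurent_expansion_intros)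

lemma mat_expansion_one: "mat_expansion (\<lambda>t. mat 1) (mat 1)"
  unfolding mat_expansion_def by (auto simp: mat_def)

lemma mat_expansion_adj2: "mat_expansion M A \<Longrightarrow> mat_expansion (\<lambda>t. adj2 (M t)) (adj2 A)"
  unfolding mat_expansion_def forall_2 by (auto intro!: laurent_expansion_intros)

lemma mat_expansion_tr2: "mat_expansion M A \<Longrightarrow> (\<lambda>t. tr2 (M t)) has_laurent_expansion tr2 A"
  unfolding mat_expansion_def tr2_def by (auto intro!: laurent_expansion_intros)

lemma mat_expansion_det: "mat_expansion M A \<Longrightarrow> (\<lambda>t. det (M t)) has_laurent_expansion det A"
  unfolding mat_expansion_def det_2 by (auto intro!: laurent_expansion_intros)

lemma mat_expansion_word:
  "(\<And>g. g \<in> set w \<Longrightarrow> mat_expansion (\<rho> g) (r g)) \<Longrightarrow> mat_expansion (\<lambda>t. word_mat (\<lambda>g. \<rho> g t) w) (word_mat r w)"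
  by (induction w) (auto intro: mat_expansion_one mat_expansion_mult)

lemma mat_expansion_cong:
  assumes "mat_expansion M A" "mat_expansion M' A'" "eventually (\<lambda>t. M t = M' t) (at 0)"
  shows "A = A'"
proof -
  have "A $ i $ j = A' $ i $ j" for i j
  proof (rule has_laurent_expansion_unique)
    show "(\<lambda>t. M t $ i $ j) has_laurent_expansion A $ i $ j" using assms(1) by (simp add: mat_expansion_def)
    have "(\<lambda>t. M' t $ i $ j) has_laurent_expansion A' $ i $ j" using assms(2) by (simp add: mat_expansion_def)
    moreover have "eventually (\<lambda>t. M t $ i $ j = M' t $ i $ j) (at 0)" using assms(3) by eventually_elim simp
    ultimately show "(\<lambda>t. M t $ i $ j) has_laurent_expansion A' $ i $ j" by (subst has_laurent_expansion_cong) auto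
  qed
  then show ?thesis by (simp add: vec_eq_iff)
qed

text \<open>Charts carry pointwise convergence, and for each polynomial \<open>P\<close> the value
  at \<open>z t\<close> has Laurent expansion \<open>poly P Z\<close>; the degeneration of the
  absolute values gives the limit.\<close>

lemma hyb_pt_tendsto:
  assumes z: "z has_laurent_expansion Z" and F: "continuous_map (chart_top hyb_chart) euclideanreal F"
  shows "((\<lambda>t. F (hyb_pt (\<lambda>z. cmod z powr hyb_eps t) (\<lambda>a. fls_eval a t) (z t))) \<longlongrightarrow> F (hyb_pt na_abs (\<lambda>a. a) Z)) (at 0)"
proof -
  let ?pt = "\<lambda>t. hyb_pt (\<lambda>z. cmod z powr hyb_eps t) (\<lambda>a. fls_eval a t) (z t)"
  have ex: "(\<lambda>t. poly (map_poly (\<lambda>a. fls_eval a t) P) (z t)) has_laurent_expansion poly P Z" if "P \<in> hybAZ" for P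
    using that
  proof (induction P)
    case (pCons a P)
    then have aP: "a \<in> hybA" "P \<in> hybAZ" by (auto simp: hybAZ_pCons)
    have "map_poly (\<lambda>a. fls_eval a t) (pCons a P) = pCons (fls_eval a t) (map_poly (\<lambda>a. fls_eval a t) P)" for t
      by (rule poly_eqI) (simp add: coeff_map_poly fls_eval_0_1 coeff_pCons split: nat.split)
    then show ?case
      using pCons.IH[OF aP(2)] fls_eval_has_laurent_expansion[OF aP(1)] z by (auto intro!: laurent_expansion_intros)
  qed simp
  have "limitin (chart_top hyb_chart) ?pt (hyb_pt na_abs (\<lambda>a. a) Z) (at 0)"
    unfolding chart_top_def limitin_subtopology limitin_componentwise limitin_canonical_iff
  proof (intro conjI ballI)
    show "hyb_pt na_abs (\<lambda>a. a) Z \<in> hyb_chart" by (rule hyb_eval.hyb_pt_in[OF hyb_eval_na])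
    show "eventually (\<lambda>t. ?pt t \<in> hyb_chart) (at 0)"
      using eventually_small by eventually_elim (auto intro: hyb_eval.hyb_pt_in[OF hyb_eval_complex])
    fix P
    show "((\<lambda>t. ?pt t P) \<longlongrightarrow> hyb_pt na_abs (\<lambda>a. a) Z P) (at 0)"
    proof (cases "P \<in> hybAZ")
      case True
      then show ?thesis using has_laurent_expansion_na_abs[OF ex[OF True]] by (simp add: hyb_pt_def map_poly_id')
    qed (simp add: hyb_pt_def)
  qed auto
  from continuous_map_limit[OF F this] show ?thesis by (simp add: o_def)
qed

text \<open>The lower left entry is meromorphic, so near 0 it vanishes identically or nowhere. In
  the first case the point is constantly infinity, in the second it is a quotient of meromorphic
  functions in the first chart.\<close>

lemma psi_mobius_tendsto:
  assumes M: "mat_expansion M A" and f: "continuous_map P1hyb_top euclideanreal f"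
  shows "((\<lambda>t. f (psi t (mobius (M t) None))) \<longlongrightarrow> f (hyb_Psi na_abs (\<lambda>a. a) (mobius A None))) (at 0)"
proof -
  note c = hyb_chart_maps_continuous[OF f]
  have M': "(\<lambda>t. M t $ i $ j) has_laurent_expansion A $ i $ j" for i j using M by (simp add: mat_expansion_def)
  show ?thesis
  proof (cases "A $ 2 $ 1 = 0")
    case True
    have z: "eventually (\<lambda>t. M t $ 2 $ 1 = 0) (at 0)"
      using M'[of 2 1] True unfolding has_laurent_expansion_def by (auto elim: eventually_mono)
    have lim: "((\<lambda>t. f (glue_chart2 (hyb_pt (\<lambda>z. cmod z powr hyb_eps t) (\<lambda>a. fls_eval a t) 0))) \<longlongrightarrow> f (glue_chart2 (hyb_pt na_abs (\<lambda>a. a) 0))) (at 0)"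
      by (rule hyb_pt_tendsto[OF has_laurent_expansion_0 c(2)])
    have eq: "f (glue_chart2 (hyb_pt na_abs (\<lambda>a. a) 0)) = f (hyb_Psi na_abs (\<lambda>a. a) (mobius A None))"
      using True by (simp add: hyb_eval.glue_chart2_hyb_pt[OF hyb_eval_na] na.inv_pt_def mobius_def)
    have "eventually (\<lambda>t. f (glue_chart2 (hyb_pt (\<lambda>z. cmod z powr hyb_eps t) (\<lambda>a. fls_eval a t) 0)) = f (psi t (mobius (M t) None))) (at 0)"
      using eventually_small z
    proof eventually_elim
      case (elim t)
      then interpret hyb_eval "\<lambda>z. cmod z powr hyb_eps t" "\<lambda>a. fls_eval a t" by (intro hyb_eval_complex) auto
      show ?case using elim by (simp add: glue_chart2_hyb_pt inv_pt_def mobius_def psi_eq)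
    qed
    from Lim_transform_eventually[OF lim this] show ?thesis unfolding eq .
  next
    case False
    have "eventually (\<lambda>t. M t $ 2 $ 1 \<noteq> 0) (at 0)"
      by (rule has_laurent_expansion_nonzero_imp_eventually_nonzero[OF M' False])
    then have ev: "eventually (\<lambda>t. f (hyb_pt (\<lambda>z. cmod z powr hyb_eps t) (\<lambda>a. fls_eval a t) (M t $ 1 $ 1 / M t $ 2 $ 1), True) = f (psi t (mobius (M t) None))) (at 0)"
      by eventually_elim (simp add: mobius_def psi_eq hyb_Psi_def)
    have "((\<lambda>t. f (hyb_pt (\<lambda>z. cmod z powr hyb_eps t) (\<lambda>a. fls_eval a t) (M t $ 1 $ 1 / M t $ 2 $ 1), True)) \<longlongrightarrow> f (hyb_pt na_abs (\<lambda>a. a) (A $ 1 $ 1 / A $ 2 $ 1), True)) (at 0)"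
      by (rule hyb_pt_tendsto[OF _ c(1)]) (intro laurent_expansion_intros M')
    from Lim_transform_eventually[OF this ev] show ?thesis using False by (simp add: mobius_def hyb_Psi_def)
  qed
qed

section \<open>Convergence of the stationary measures\<close>

text \<open>The walk is made lazy, so that the identity is a letter, and its letters are coded by natural
  numbers, since \<open>boundary_walk\<close> needs a countable type of letters. Neither changes the stationary
  measures.\<close>
definition letter_code :: "'g pmf \<Rightarrow> 'g \<Rightarrow> nat" where
  "letter_code m g = Suc (to_nat_on (set_pmf m) g)"

definition letter :: "'g pmf \<Rightarrow> 'g \<Rightarrow> nat \<Rightarrow> 'g" where
  "letter m e n = (case n of 0 \<Rightarrow> e | Suc k \<Rightarrow> from_nat_into (set_pmf m) k)"

text \<open>Code 0 is reserved for the identity, which is why \<open>letter_code\<close> starts at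
  1.\<close>

definition lazy_letters :: "'g pmf \<Rightarrow> nat pmf" where
  "lazy_letters m = bind_pmf (bernoulli_pmf (1/2)) (\<lambda>b. if b then return_pmf 0 else map_pmf (letter_code m) m)"

lemma letter_0 [simp]: "letter m e 0 = e"
  by (simp add: letter_def)

lemma letter_code [simp]: "g \<in> set_pmf m \<Longrightarrow> letter m e (letter_code m g) = g"
  by (simp add: letter_def letter_code_def from_nat_into_to_nat_on)

lemma letter_in: "letter m e n \<in> insert e (set_pmf m)"
  by (cases n) (auto simp: letter_def from_nat_into set_pmf_not_empty)

lemma set_lazy_letters: "set_pmf (lazy_letters m) = insert 0 (letter_code m ` set_pmf m)"
  by (auto simp: lazy_letters_def set_pmf_bernoulli split: if_splits)

lemma nn_integral_lazy_letters:
  "(\<integral>\<^sup>+n. \<phi> (letter m e n) \<partial>lazy_letters m) = \<phi> e * ennreal (1/2) + (\<integral>\<^sup>+g. \<phi> g \<partial>m) * ennreal (1/2)"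
proof -
  have "(\<integral>\<^sup>+g. \<phi> (letter m e (letter_code m g)) \<partial>m) = (\<integral>\<^sup>+g. \<phi> g \<partial>m)"
    by (rule nn_integral_cong_AE) (auto intro!: AE_pmfI)
  then show ?thesis unfolding lazy_letters_def by simp
qed

text \<open>The lazy equation reads \<open>x = x/2 + y/2\<close>, and since \<open>x\<close> is
  finite it is equivalent to \<open>x = y\<close>.\<close>

lemma stationary_on_lazy_letters:
  assumes id: "\<And>x. x \<in> topspace T \<Longrightarrow> act e x = x"
  shows "stationary_on T (lazy_letters m) (\<lambda>n. act (letter m e n)) \<mu> \<longleftrightarrow> stationary_on T m act \<mu>"
proof (cases "prob_on T \<mu>")
  case True
  then interpret prob_space \<mu> by (simp add: prob_on_def)
  have "emeasure \<mu> A = (\<integral>\<^sup>+n. emeasure \<mu> (act (letter m e n) -` A \<inter> space \<mu>) \<partial>lazy_letters m)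
     \<longleftrightarrow> emeasure \<mu> A = (\<integral>\<^sup>+g. emeasure \<mu> (act g -` A \<inter> space \<mu>) \<partial>m)" (is "?x = ?l \<longleftrightarrow> ?x = ?y") if A: "A \<in> sets \<mu>" for A
  proof -
    have "act e -` A \<inter> space \<mu> = A" using id True sets.sets_into_space[OF A] by (auto simp: prob_on_def)
    then have l: "?l = ?x * ennreal (1/2) + ?y * ennreal (1/2)"
      using nn_integral_lazy_letters[where \<phi>="\<lambda>g. emeasure \<mu> (act g -` A \<inter> space \<mu>)" and m=m and e=e] by simp
    have "ennreal (1/2) + ennreal (1/2) = ennreal (1/2 + 1/2)" by (rule ennreal_plus[symmetric]) auto
    also have "\<dots> = 1" by simp
    finally have x: "?x = ?x * ennreal (1/2) + ?x * ennreal (1/2)"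
      by (simp only: distrib_left[symmetric] mult_1_right)
    have fin: "?x * ennreal (1/2) \<noteq> \<infinity>" by (simp add: ennreal_mult_eq_top_iff)
    have h: "ennreal (1/2) \<noteq> 0" "ennreal (1/2) \<noteq> Orderings.top" by auto
    have "?x = ?l \<longleftrightarrow> ?x * ennreal (1/2) + ?x * ennreal (1/2) = ?x * ennreal (1/2) + ?y * ennreal (1/2)"
      using x l by metis
    also have "\<dots> \<longleftrightarrow> ?x * ennreal (1/2) = ?y * ennreal (1/2)"
      using fin ennreal_add_left_cancel[of "?x * ennreal (1/2)"] by blast
    also have "\<dots> \<longleftrightarrow> ?x = ?y" using ennreal_mult_cancel_left[of "ennreal (1/2)" ?x ?y] h by (metis mult.commute)
    finally show ?thesis .
  qed
  then show ?thesis unfolding stationary_on_def by blast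
qed (simp add: stationary_on_def)

lemma stationary_measure_lazy_letters:
  assumes "\<And>x. x \<in> topspace T \<Longrightarrow> act e x = x"
  shows "stationary_measure T m act = stationary_measure T (lazy_letters m) (\<lambda>n. act (letter m e n))"
proof -
  have "stationary_on T (lazy_letters m) (\<lambda>n. act (letter m e n)) = stationary_on T m act"
    by (rule ext) (rule stationary_on_lazy_letters[of T act e m], rule assms)
  then show ?thesis by (simp add: stationary_measure_def)
qed

lemma berk_act_one: "p \<in> glue_pts berk_chart \<Longrightarrow> berk_act (mat 1) p = p"
proof (erule glue_pts_berk_cases)
  fix x assume x: "p = (x, True)" "x \<in> berk_chart"
  have "poly_subst_mob (mat 1) P = P" for P
    using poly_as_sum_of_monoms[of P] by (simp add: poly_subst_mob_def monom_altdef one_pCons[symmetric])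
  then show ?thesis using x berk_chartD(3)[OF x(2)] by (simp add: berk_act_def one_pCons[symmetric])
next
  assume "p = berk_infty"
  then show ?thesis using berk_act_infty[of "mat 1"] by (simp add: berk_\<iota>_def)
qed

lemma word_act_mobius:
  assumes "\<And>g. det (\<rho> g) = 1"
  shows "word_act (\<lambda>g. mobius (\<rho> g)) w p = mobius (word_mat \<rho> w) p"
  by (induction w) (simp_all add: mobius_mult assms det_word_mat)

locale meromorphic_rep = group G for G (structure) +
  fixes \<rho> :: "'a \<Rightarrow> complex \<Rightarrow> complex^2^2"
  assumes rep: "rep_M G \<rho>"
begin

lemma rep_det: "g \<in> carrier G \<Longrightarrow> t \<noteq> 0 \<Longrightarrow> cmod t < 1 \<Longrightarrow> det (\<rho> g t) = 1"
  using rep by (simp add: rep_M_def)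

lemma rep_mult: "g \<in> carrier G \<Longrightarrow> h \<in> carrier G \<Longrightarrow> t \<noteq> 0 \<Longrightarrow> cmod t < 1 \<Longrightarrow> \<rho> (g \<otimes> h) t = \<rho> g t ** \<rho> h t"
  using rep by (simp add: rep_M_def)

lemma rep_one: "t \<noteq> 0 \<Longrightarrow> cmod t < 1 \<Longrightarrow> \<rho> \<one> t = mat 1"
  using rep_mult[of \<one> \<one> t] rep_det[of \<one> t] by (intro idempotent_sl2) auto

lemma rep_holomorphic: "g \<in> carrier G \<Longrightarrow> (\<lambda>t. \<rho> g t $ i $ j) holomorphic_on ball 0 1 - {0}"
  using rep by (simp add: rep_M_def)

lemma rep_expansion:
  assumes "g \<in> carrier G" shows "mat_expansion (\<rho> g) (rho_na \<rho> g)"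
  unfolding mat_expansion_def
proof (intro allI)
  fix i j
  have "isolated_singularity_at (\<lambda>t. \<rho> g t $ i $ j) 0"
    by (rule isolated_singularity_at_holomorphic[OF rep_holomorphic[OF assms]]) auto
  moreover have "not_essential (\<lambda>t. \<rho> g t $ i $ j) 0" using rep assms by (simp add: rep_M_def)
  ultimately show "(\<lambda>t. \<rho> g t $ i $ j) has_laurent_expansion rho_na \<rho> g $ i $ j"
    by (simp add: rho_na_def not_essential_has_laurent_expansion_0)
qed

lemma eventually_unit: "eventually (\<lambda>t::complex. t \<noteq> 0 \<and> cmod t < 1) (at 0)"
  unfolding eventually_at by (intro exI[of _ 1]) auto

lemma rho_na_mult: "g \<in> carrier G \<Longrightarrow> h \<in> carrier G \<Longrightarrow> rho_na \<rho> (g \<otimes> h) = rho_na \<rho> g ** rho_na \<rho> h"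
proof -
  assume gh: "g \<in> carrier G" "h \<in> carrier G"
  have "eventually (\<lambda>t. \<rho> (g \<otimes> h) t = \<rho> g t ** \<rho> h t) (at 0)"
    using eventually_unit by eventually_elim (simp add: rep_mult gh)
  then show ?thesis
    using gh by (intro mat_expansion_cong[OF rep_expansion mat_expansion_mult[OF rep_expansion rep_expansion]]) auto
qed

lemma rho_na_det: "g \<in> carrier G \<Longrightarrow> det (rho_na \<rho> g) = 1"
proof (rule has_laurent_expansion_unique)
  assume g: "g \<in> carrier G"
  show "(\<lambda>t. det (\<rho> g t)) has_laurent_expansion det (rho_na \<rho> g)" by (rule mat_expansion_det[OF rep_expansion[OF g]])
  have "eventually (\<lambda>t. det (\<rho> g t) = 1) (at 0)"
    using eventually_unit by eventually_elim (simp add: rep_det g)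
  then show "(\<lambda>t. det (\<rho> g t)) has_laurent_expansion 1" by (subst has_laurent_expansion_cong[where g="\<lambda>_. 1"]) auto
qed

lemma rho_na_one: "rho_na \<rho> \<one> = mat 1"
  using rho_na_mult[of \<one> \<one>] rho_na_det[of \<one>] by (intro idempotent_sl2) auto

lemma rep_bounded:
  assumes g: "g \<in> carrier G"
  shows "\<exists>B. (\<forall>t. t \<noteq> 0 \<longrightarrow> cmod t < exp (-1) \<longrightarrow> absval.mnrm (\<lambda>z. cmod z powr hyb_eps t) (\<rho> g t) \<le> B) \<and>
     na.mnrm (rho_na \<rho> g) \<le> B"
proof -
  have "\<exists>B. \<forall>t. t \<noteq> 0 \<longrightarrow> cmod t < exp (-1) \<longrightarrow> cmod (\<rho> g t $ i $ j) powr hyb_eps t \<le> B" for i j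
    using hyb_eps_powr_bounded[OF rep_holomorphic[OF g] rep_expansion[OF g, unfolded mat_expansion_def, rule_format]] by metis
  then obtain B where B: "\<And>i j t. t \<noteq> 0 \<Longrightarrow> cmod t < exp (-1) \<Longrightarrow> cmod (\<rho> g t $ i $ j) powr hyb_eps t \<le> B i j"
    by metis
  define b where "b = max (max (max (B 1 1) (B 1 2)) (max (B 2 1) (B 2 2))) (na.mnrm (rho_na \<rho> g))"
  have "absval.mnrm (\<lambda>z. cmod z powr hyb_eps t) (\<rho> g t) \<le> b" if t: "t \<noteq> 0" "cmod t < exp (-1)" for t
  proof -
    interpret absval "\<lambda>z::complex. cmod z powr hyb_eps t" by (rule absval_cmod_powr[OF hyb_eps_bounds(1,2)[OF t]])
    have "B 1 1 \<le> b" "B 1 2 \<le> b" "B 2 1 \<le> b" "B 2 2 \<le> b" by (simp_all add: b_def le_max_iff_disj)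
    then show ?thesis unfolding mnrm_def nrm_def
      by (intro max.boundedI order_trans[OF B[OF t]])
  qed
  then show ?thesis by (intro exI[of _ b]) (simp add: b_def)
qed

end

locale non_elementary_walk = meromorphic_rep G \<rho> for G (structure) and \<rho> :: "'a \<Rightarrow> complex \<Rightarrow> complex^2^2" +
  fixes m :: "'a pmf"
  assumes supp: "set_pmf m \<subseteq> carrier G" and gen: "generate G (set_pmf m) = carrier G"
    and non_el: "non_elementary G (rho_na \<rho>)"
begin

abbreviation "lt \<equiv> letter m \<one>"
abbreviation "lm \<equiv> lazy_letters m"

lemma lt_in: "lt n \<in> carrier G"
  using letter_in[of m \<one> n] supp by auto

lemma word_mat_code:
  "set w \<subseteq> set_pmf m \<Longrightarrow> word_mat (\<lambda>n. r (lt n)) (map (letter_code m) w) = word_mat r w"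
  by (induction w) auto

text \<open>The conditions of \<open>sl2_data\<close> are identities in t, bounds on a whole
  punctured disc, or two strict inequalities between a constant and a limit as t tends to 0. Only
  the last two shrink the range of t, so one neighbourhood of 0 suffices for all letters.\<close>

lemma uniform_data:
  obtains B c f h where "0 < c" "set f \<subseteq> set_pmf lm" "set h \<subseteq> set_pmf lm"
    "sl2_data lm B c 0 f h na_abs (\<lambda>n. rho_na \<rho> (lt n))"
    "eventually (\<lambda>t. sl2_data lm B c 0 f h (\<lambda>z. cmod z powr hyb_eps t) (\<lambda>n. \<rho> (lt n) t)) (at 0)"
proof -
  interpret sl2_rep G "set_pmf m" "rho_na \<rho>"
    using non_el by unfold_locales (auto simp: supp gen rho_na_mult rho_na_det non_elementary_def tr2_def)
  obtain f h where fh: "set f \<subseteq> set_pmf m" "set h \<subseteq> set_pmf m" "5/2 < na_abs (tr2 (word_mat (rho_na \<rho>) f))"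
    "det (word_mat (rho_na \<rho>) f ** conj2 (word_mat (rho_na \<rho>) h) (word_mat (rho_na \<rho>) f)
       - conj2 (word_mat (rho_na \<rho>) h) (word_mat (rho_na \<rho>) f) ** word_mat (rho_na \<rho>) f) \<noteq> 0" (is "?k \<noteq> 0")
    using independent_hyperbolic_words by blast
  \<comment> \<open>Half of the limit value, so that it is exceeded for all small t.\<close>
  define c where "c = na_abs ?k / 2"
  have c: "0 < c" "c < na_abs ?k" using fh(4) by (simp_all add: c_def)
  obtain B where B: "\<And>g t. g \<in> carrier G \<Longrightarrow> t \<noteq> 0 \<Longrightarrow> cmod t < exp (-1) \<Longrightarrow> absval.mnrm (\<lambda>z. cmod z powr hyb_eps t) (\<rho> g t) \<le> B g"
     "\<And>g. g \<in> carrier G \<Longrightarrow> na.mnrm (rho_na \<rho> g) \<le> B g"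
    using rep_bounded by metis
  let ?F = "\<lambda>t. word_mat (\<lambda>g. \<rho> g t) f" and ?H = "\<lambda>t. word_mat (\<lambda>g. \<rho> g t) h"
  have F: "mat_expansion ?F (word_mat (rho_na \<rho>) f)" and H: "mat_expansion ?H (word_mat (rho_na \<rho>) h)"
    using fh(1,2) supp by (auto intro!: mat_expansion_word rep_expansion)
  have ev1: "eventually (\<lambda>t. 5/2 < cmod (tr2 (?F t)) powr hyb_eps t) (at 0)"
    by (rule order_tendstoD(1)[OF has_laurent_expansion_na_abs[OF mat_expansion_tr2[OF F]] fh(3)])
  have "mat_expansion (\<lambda>t. ?F t ** conj2 (?H t) (?F t) - conj2 (?H t) (?F t) ** ?F t)
     (word_mat (rho_na \<rho>) f ** conj2 (word_mat (rho_na \<rho>) h) (word_mat (rho_na \<rho>) f)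
       - conj2 (word_mat (rho_na \<rho>) h) (word_mat (rho_na \<rho>) f) ** word_mat (rho_na \<rho>) f)"
    unfolding conj2_def by (intro mat_expansion_minus mat_expansion_mult mat_expansion_adj2 F H)
  from order_tendstoD(1)[OF has_laurent_expansion_na_abs[OF mat_expansion_det[OF this]] c(2)]
  have ev2: "eventually (\<lambda>t. c < cmod (det (?F t ** conj2 (?H t) (?F t) - conj2 (?H t) (?F t) ** ?F t)) powr hyb_eps t) (at 0)" .
  show ?thesis
  proof (rule that[of c "map (letter_code m) f" "map (letter_code m) h" "\<lambda>n. B (lt n)"])
    show "0 < c" by (rule c(1))
    show "set (map (letter_code m) f) \<subseteq> set_pmf lm" "set (map (letter_code m) h) \<subseteq> set_pmf lm"
      using fh(1,2) by (auto simp: set_lazy_letters)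
    show "sl2_data lm (\<lambda>n. B (lt n)) c 0 (map (letter_code m) f) (map (letter_code m) h) na_abs (\<lambda>n. rho_na \<rho> (lt n))"
      unfolding sl2_data_def lettersdet_def word_mat_code[OF fh(1)] word_mat_code[OF fh(2)]
      using fh(3) c(2) B(2) by (auto simp: absval_na_abs rho_na_det lt_in rho_na_one)
    show "eventually (\<lambda>t. sl2_data lm (\<lambda>n. B (lt n)) c 0 (map (letter_code m) f) (map (letter_code m) h)
       (\<lambda>z. cmod z powr hyb_eps t) (\<lambda>n. \<rho> (lt n) t)) (at 0)"
      using ev1 ev2 eventually_small eventually_unit
    proof eventually_elim
      case (elim t)
      then have t: "t \<noteq> 0" "cmod t < exp (-1)" "cmod t < 1" by auto
      have wm: "word_mat (\<lambda>n. \<rho> (lt n) t) (map (letter_code m) f) = ?F t" "word_mat (\<lambda>n. \<rho> (lt n) t) (map (letter_code m) h) = ?H t"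
        using word_mat_code[OF fh(1), of "\<lambda>g. \<rho> g t"] word_mat_code[OF fh(2), of "\<lambda>g. \<rho> g t"] by simp_all
      show ?case
        unfolding sl2_data_def lettersdet_def wm
        using elim(1,2) t B(1)[OF lt_in t(1,2)] absval_cmod_powr[OF hyb_eps_bounds(1,2)[OF t(1,2)]]
        by (auto simp: rep_det lt_in rep_one)
    qed
  qed
qed

text \<open>Every single word converges, and the values are bounded by one constant on all fibres;
  dominated convergence sums over the words.\<close>

lemma expectation_tendsto:
  assumes f: "continuous_map P1hyb_top euclideanreal f"
  shows "((\<lambda>t. measure_pmf.expectation (replicate_pmf n lm) (\<lambda>w. f (psi t (word_act (\<lambda>n. mobius (\<rho> (lt n) t)) w None))))
     \<longlongrightarrow> measure_pmf.expectation (replicate_pmf n lm) (\<lambda>w. f (hyb_Psi na_abs (\<lambda>a. a) (word_act (\<lambda>n. mobius (rho_na \<rho> (lt n))) w None)))) (at 0)"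
proof -
  let ?E = "measure_pmf.expectation (replicate_pmf n lm)"
  let ?\<phi> = "\<lambda>t w. f (psi t (word_act (\<lambda>n. mobius (\<rho> (lt n) t)) w None))"
  let ?\<phi>na = "\<lambda>w. f (hyb_Psi na_abs (\<lambda>a. a) (word_act (\<lambda>n. mobius (rho_na \<rho> (lt n))) w None))"
  obtain C where C: "0 \<le> C" "\<And>(N :: complex \<Rightarrow> real) evl p. hyb_eval N evl \<Longrightarrow> \<bar>f (hyb_Psi N evl p)\<bar> \<le> C"
    using hyb_Psi_bounded[OF f, where 'k=complex] by blast
  \<comment> \<open>The cutoff makes the bound \<open>C\<close> valid for all t, as dominated
    convergence along an arbitrary sequence requires.\<close>
  define g where "g t w = (if t \<noteq> 0 \<and> cmod t < exp (-1) then ?\<phi> t w else 0)" for t w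
  have bd: "\<bar>g t w\<bar> \<le> C" for t w
    using C(1) C(2)[OF hyb_eval_complex] by (simp add: g_def psi_eq)
  have ev: "eventually (\<lambda>t. g t w = ?\<phi> t w) (at 0)" for w
    using eventually_small by eventually_elim (simp add: g_def)
  have lim: "((\<lambda>t. g t w) \<longlongrightarrow> ?\<phi>na w) (at 0)" for w
  proof -
    have "((\<lambda>t. f (psi t (mobius (word_mat (\<lambda>n. \<rho> (lt n) t) w) None))) \<longlongrightarrow> f (hyb_Psi na_abs (\<lambda>a. a) (mobius (word_mat (\<lambda>n. rho_na \<rho> (lt n)) w) None))) (at 0)"
      by (rule psi_mobius_tendsto[OF mat_expansion_word[OF rep_expansion[OF lt_in]] f])
    moreover have "eventually (\<lambda>t. f (psi t (mobius (word_mat (\<lambda>n. \<rho> (lt n) t) w) None)) = g t w) (at 0)"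
      using eventually_small eventually_unit
      by eventually_elim (simp add: g_def word_act_mobius[of "\<lambda>n. \<rho> (lt n) _"] rep_det lt_in)
    ultimately have "((\<lambda>t. g t w) \<longlongrightarrow> f (hyb_Psi na_abs (\<lambda>a. a) (mobius (word_mat (\<lambda>n. rho_na \<rho> (lt n)) w) None))) (at 0)"
      by (rule Lim_transform_eventually)
    then show ?thesis by (simp add: word_act_mobius[of "\<lambda>n. rho_na \<rho> (lt n)"] rho_na_det lt_in)
  qed
  have "((\<lambda>t. ?E (g t)) \<longlongrightarrow> ?E ?\<phi>na) (at 0)"
    unfolding tendsto_at_iff_sequentially
  proof (intro allI impI)
    fix X :: "nat \<Rightarrow> complex" assume X: "\<forall>i. X i \<in> UNIV - {0}" "X \<longlonglongrightarrow> 0"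
    have "(\<lambda>i. ?E (g (X i))) \<longlonglongrightarrow> ?E ?\<phi>na"
    proof (rule integral_dominated_convergence[where w="\<lambda>_. C"])
      show "AE w in replicate_pmf n lm. (\<lambda>i. g (X i) w) \<longlonglongrightarrow> ?\<phi>na w"
        using lim X unfolding tendsto_at_iff_sequentially by (auto simp: o_def)
    qed (use bd in auto)
    then show "((\<lambda>t. ?E (g t)) \<circ> X) \<longlonglongrightarrow> ?E ?\<phi>na" by (simp add: o_def)
  qed
  moreover have "eventually (\<lambda>t. ?E (g t) = ?E (?\<phi> t)) (at 0)"
    using eventually_small
  proof eventually_elim
    case (elim t)
    then have "g t = ?\<phi> t" by (simp add: g_def fun_eq_iff)
    then show ?case by (simp only:)
  qed
  ultimately show ?thesis by (rule Lim_transform_eventually)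
qed

text \<open>The order of choices decides: the function \<open>f\<close> gives the tolerances
  \<open>d1\<close> and \<open>d2\<close>, these give the time \<open>n\<close>, and only then is t
  taken small. Both stationary integrals are compared with expectations at time \<open>n\<close>,
  which converge.\<close>

lemma weak_convergence:
  assumes f: "continuous_map P1hyb_top euclideanreal f"
  shows "((\<lambda>t. \<integral>x. f x \<partial>distr (nu_t m \<rho> t) (borel_of P1hyb_top) (psi t))
     \<longlongrightarrow> (\<integral>x. f x \<partial>distr (nu_na m \<rho>) (borel_of P1hyb_top) psi_na)) (at 0)"
proof -
  obtain B c v h where data: "0 < c" "set v \<subseteq> set_pmf lm" "set h \<subseteq> set_pmf lm"
    "sl2_data lm B c 0 v h na_abs (\<lambda>n. rho_na \<rho> (lt n))"
    "eventually (\<lambda>t. sl2_data lm B c 0 v h (\<lambda>z. cmod z powr hyb_eps t) (\<lambda>n. \<rho> (lt n) t)) (at 0)"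
    by (rule uniform_data)
  have 0: "0 \<in> set_pmf lm" by (simp add: set_lazy_letters)
  obtain C1 where C1: "0 \<le> C1" "\<And>(N :: complex \<Rightarrow> real) evl p. hyb_eval N evl \<Longrightarrow> \<bar>f (hyb_Psi N evl p)\<bar> \<le> C1"
    using hyb_Psi_bounded[OF f, where 'k=complex] by blast
  obtain C2 where C2: "0 \<le> C2" "\<And>(N :: complex fls \<Rightarrow> real) evl p. hyb_eval N evl \<Longrightarrow> \<bar>f (hyb_Psi N evl p)\<bar> \<le> C2"
    using hyb_Psi_bounded[OF f, where 'k="complex fls"] by blast
  define C where "C = max C1 C2"
  have C: "0 \<le> C" "C1 \<le> C" "C2 \<le> C" using C1(1) by (auto simp: C_def)
  have det_na: "\<And>n. det (rho_na \<rho> (lt n)) = 1" by (simp add: rho_na_det lt_in)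
  let ?\<nu>na = "\<integral>x. f x \<partial>distr (nu_na m \<rho>) (borel_of P1hyb_top) psi_na"
  let ?\<nu> = "\<lambda>t. \<integral>x. f x \<partial>distr (nu_t m \<rho> t) (borel_of P1hyb_top) (psi t)"
  show ?thesis
  proof (rule tendstoI)
    fix \<epsilon> :: real assume \<epsilon>: "0 < \<epsilon>"
    \<comment> \<open>Makes \<open>2 * C * \<eta> \<le> \<epsilon> / 8\<close>, where the summand 1
      covers \<open>C = 0\<close>. With the modulus \<open>\<epsilon> / 8\<close> each comparison
      costs at most \<open>\<epsilon> / 4\<close>, and there are three.\<close>
    define \<eta> where "\<eta> = \<epsilon> / (16 * (C + 1))"
    have \<eta>: "0 < \<eta>" using \<epsilon> C(1) by (simp add: \<eta>_def)
    have "2 * C * \<eta> \<le> 2 * (C + 1) * \<eta>" using \<eta> by simp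
    also have "\<dots> = \<epsilon> / 8" using C(1) by (simp add: \<eta>_def field_simps)
    finally have C\<eta>: "2 * C * \<eta> \<le> \<epsilon> / 8" .
    have e8: "0 < \<epsilon> / 8" using \<epsilon> by simp
    note UCc = hyb_Psi_uniformly_continuous[OF f, where 'k=complex] and UCn = hyb_Psi_uniformly_continuous[OF f, where 'k="complex fls"]
    obtain d1 where d1: "0 < d1" "\<And>(N :: complex \<Rightarrow> real) evl p q. hyb_eval N evl \<Longrightarrow> absval.cdist N p q \<le> d1 \<Longrightarrow>
       \<bar>f (hyb_Psi N evl p) - f (hyb_Psi N evl q)\<bar> \<le> \<epsilon> / 8"
      using UCc[OF e8] by blast
    obtain d2 where d2: "0 < d2" "\<And>(N :: complex fls \<Rightarrow> real) evl p q. hyb_eval N evl \<Longrightarrow> absval.cdist N p q \<le> d2 \<Longrightarrow>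
       \<bar>f (hyb_Psi N evl p) - f (hyb_Psi N evl q)\<bar> \<le> \<epsilon> / 8"
      using UCn[OF e8] by blast
    obtain n1 where n1: "\<And>n (N :: complex \<Rightarrow> real) \<rho> H. n1 \<le> n \<Longrightarrow> sl2_data lm B c 0 v h N \<rho> \<Longrightarrow> row_seminorm N H \<Longrightarrow>
       measure_pmf.prob (replicate_pmf n lm) {w. d1 < absval.hdist N (\<lambda>y. H (y v* word_mat \<rho> w)) (word_act (\<lambda>g. mobius (\<rho> g)) w None)} \<le> \<eta>"
      using contraction_uniform[OF 0 data(2,3,1) \<eta> d1(1), where 'k=complex] by blast
    obtain n2 where n2: "\<And>n (N :: complex fls \<Rightarrow> real) \<rho> H. n2 \<le> n \<Longrightarrow> sl2_data lm B c 0 v h N \<rho> \<Longrightarrow> row_seminorm N H \<Longrightarrow>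
       measure_pmf.prob (replicate_pmf n lm) {w. d2 < absval.hdist N (\<lambda>y. H (y v* word_mat \<rho> w)) (word_act (\<lambda>g. mobius (\<rho> g)) w None)} \<le> \<eta>"
      using contraction_uniform[OF 0 data(2,3,1) \<eta> d2(1), where 'k="complex fls"] by blast
    define n where "n = max n1 n2"
    let ?E = "measure_pmf.expectation (replicate_pmf n lm)"
    let ?\<phi> = "\<lambda>t w. f (psi t (word_act (\<lambda>n. mobius (\<rho> (lt n) t)) w None))"
    let ?\<phi>na = "\<lambda>w. f (hyb_Psi na_abs (\<lambda>a. a) (word_act (\<lambda>n. mobius (rho_na \<rho> (lt n))) w None))"
    have "\<bar>?\<nu>na - ?E ?\<phi>na\<bar> \<le> \<epsilon> / 8 + 2 * C * \<eta>"
    proof -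
      interpret bw: boundary_walk lm "\<lambda>n. mobius (rho_na \<rho> (lt n))" na.cdist None P1berk_top "\<lambda>n. berk_act (rho_na \<rho> (lt n))" berk_\<iota> berk_D
        by (rule berk_boundary_walk[OF 0 data(2,3,1,4) det_na])
      have \<nu>: "nu_na m \<rho> = stationary_measure P1berk_top lm (\<lambda>n. berk_act (rho_na \<rho> (lt n)))"
        unfolding nu_na_def
        by (rule stationary_measure_lazy_letters) (simp add: rho_na_one berk_act_one topspace_P1berk)
      have "\<bar>?\<nu>na - ?E (\<lambda>w. f (psi_na (berk_\<iota> (word_act (\<lambda>n. mobius (rho_na \<rho> (lt n))) w None))))\<bar> \<le> \<epsilon> / 8 + 2 * C * \<eta>"
        unfolding \<nu>
      proof (rule bw.distr_\<nu>_approx[OF psi_na_measurable f, where \<delta>=d2])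
        show "\<exists>\<delta>>0. \<forall>x z. na.cdist x z \<le> \<delta> \<longrightarrow> \<bar>f (psi_na (berk_\<iota> x)) - f (psi_na (berk_\<iota> z))\<bar> \<le> \<epsilon>'" if "0 < \<epsilon>'" for \<epsilon>'
          using UCn[OF that] hyb_eval_na unfolding psi_na_\<iota> by blast
        show "\<bar>f (psi_na (berk_\<iota> x))\<bar> \<le> C" for x unfolding psi_na_\<iota> by (rule order_trans[OF C2(2)[OF hyb_eval_na] C(3)])
        show "0 \<le> \<epsilon> / 8" using \<epsilon> by simp
        show "\<bar>f (psi_na (berk_\<iota> x)) - f (psi_na (berk_\<iota> z))\<bar> \<le> \<epsilon> / 8" if "na.cdist x z \<le> d2" for x z
          unfolding psi_na_\<iota> by (rule d2(2)[OF hyb_eval_na that])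
        show "measure_pmf.prob (replicate_pmf n lm) {w. d2 < berk_D (word_act (\<lambda>n. berk_act (rho_na \<rho> (lt n))) w y) (word_act (\<lambda>n. mobius (rho_na \<rho> (lt n))) w None)} \<le> \<eta>"
          if "y \<in> topspace P1berk_top" for y
        proof -
          have y: "y \<in> glue_pts berk_chart" using that by (simp add: topspace_P1berk)
          show ?thesis unfolding berk_D_word_act[of "\<lambda>n. rho_na \<rho> (lt n)", OF det_na y]
            by (rule n2[OF _ data(4) row_seminorm_berk_H[OF y]]) (simp add: n_def)
        qed
      qed
      then show ?thesis unfolding psi_na_\<iota> .
    qed
    then have na: "\<bar>?\<nu>na - ?E ?\<phi>na\<bar> \<le> \<epsilon> / 4" using C\<eta> by linarith
    have cx: "eventually (\<lambda>t. \<bar>?\<nu> t - ?E (?\<phi> t)\<bar> \<le> \<epsilon> / 4) (at 0)"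
      using data(5) eventually_small eventually_unit
    proof eventually_elim
      case (elim t)
      then have t: "t \<noteq> 0" "cmod t < exp (-1)" "cmod t < 1" by auto
      interpret absval "\<lambda>z::complex. cmod z powr hyb_eps t" by (rule absval_cmod_powr[OF hyb_eps_bounds(1,2)[OF t(1,2)]])
      note he = hyb_eval_complex[OF t(1,2)]
      have det: "\<And>n. det (\<rho> (lt n) t) = 1" by (simp add: rep_det lt_in t)
      interpret bw: boundary_walk lm "\<lambda>n. mobius (\<rho> (lt n) t)" cdist None P1C_top "\<lambda>n. mobius (\<rho> (lt n) t)" "\<lambda>x. x" cdist
        by (rule complex_boundary_walk[OF hyb_eps_bounds(1,2)[OF t(1,2)] 0 data(2,3,1) elim(1) det])
      have \<nu>: "nu_t m \<rho> t = stationary_measure P1C_top lm (\<lambda>n. mobius (\<rho> (lt n) t))"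
        unfolding nu_t_def
        by (rule stationary_measure_lazy_letters) (simp add: rep_one t)
      have "\<bar>?\<nu> t - ?E (?\<phi> t)\<bar> \<le> \<epsilon> / 8 + 2 * C * \<eta>"
        unfolding \<nu>
      proof (rule bw.distr_\<nu>_approx[OF psi_measurable[OF t(1,2)] f, where \<delta>=d1])
        show "\<exists>\<delta>>0. \<forall>x z. cdist x z \<le> \<delta> \<longrightarrow> \<bar>f (psi t x) - f (psi t z)\<bar> \<le> \<epsilon>'" if "0 < \<epsilon>'" for \<epsilon>'
          using UCc[OF that] he unfolding psi_eq by blast
        show "\<bar>f (psi t x)\<bar> \<le> C" for x unfolding psi_eq by (rule order_trans[OF C1(2)[OF he] C(2)])
        show "0 \<le> \<epsilon> / 8" using \<epsilon> by simp
        show "\<bar>f (psi t x) - f (psi t z)\<bar> \<le> \<epsilon> / 8" if "cdist x z \<le> d1" for x z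
          unfolding psi_eq by (rule d1(2)[OF he that])
        show "measure_pmf.prob (replicate_pmf n lm) {w. d1 < cdist (word_act (\<lambda>n. mobius (\<rho> (lt n) t)) w y) (word_act (\<lambda>n. mobius (\<rho> (lt n) t)) w None)} \<le> \<eta>" for y
          unfolding cdist_word_act[of _ "\<lambda>n. \<rho> (lt n) t", OF det]
          by (rule n1[OF _ elim(1) row_seminorm_ptH]) (simp add: n_def)
      qed
      then show ?case using C\<eta> by linarith
    qed
    have "eventually (\<lambda>t. dist (?E (?\<phi> t)) (?E ?\<phi>na) < \<epsilon> / 4) (at 0)"
      by (rule tendstoD[OF expectation_tendsto[OF f]]) (use \<epsilon> in simp)
    with cx show "eventually (\<lambda>t. dist (?\<nu> t) ?\<nu>na < \<epsilon>) (at 0)"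
    proof eventually_elim
      case (elim t)
      have "\<bar>?\<nu> t - ?\<nu>na\<bar> \<le> \<bar>?\<nu> t - ?E (?\<phi> t)\<bar> + \<bar>?E (?\<phi> t) - ?E ?\<phi>na\<bar> + \<bar>?\<nu>na - ?E ?\<phi>na\<bar>" by linarith
      then show ?case using elim na \<epsilon> unfolding dist_real_def by linarith
    qed
  qed
qed

end

theorem theoremC:
  fixes G :: "('g, 'b) monoid_scheme"
    and m :: "'g pmf"
    and \<rho> :: "'g \<Rightarrow> complex \<Rightarrow> complex ^2^2"
  assumes "group G"
    and "\<exists>S. finite S \<and> S \<subseteq> carrier G \<and> generate G S = carrier G"
    and "set_pmf m \<subseteq> carrier G"
    and "generate G (set_pmf m) = carrier G"
    and "rep_M G \<rho>"
    and "non_elementary G (rho_na \<rho>)"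
  shows "weak_conv_on P1hyb_top
           (\<lambda>t. distr (nu_t m \<rho> t) (borel_of P1hyb_top) (psi t))
           (distr (nu_na m \<rho>) (borel_of P1hyb_top) psi_na)
           (at 0)"
proof -
  interpret non_elementary_walk G \<rho> m
    using assms by (intro non_elementary_walk.intro meromorphic_rep.intro meromorphic_rep_axioms.intro non_elementary_walk_axioms.intro)
  show ?thesis unfolding weak_conv_on_def using weak_convergence by blast
qed

end
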